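(* Let $r\ge 1$ and $n\ge 2$ be integers. Let $S=\mathbb{R}[z_1,\dots,z_r]/\big(\sum_{i=1}^r z_i^2-1\big)$, equipped with the action of the cyclic group $C_2$ of order $2$ given by $z_i\mapsto -z_i$, and let $R=S^{C_2}$. Then $S\times R^{n-2}$ is a degree-$n$ étale algebra over $R$ which cannot be generated, as an $R$-algebra, by fewer than $r$ elements.
   Context: Here $\mathbb{R}$ is the field of real numbers; $\operatorname{Spec}R$ is a smooth affine $\mathbb{R}$-variety of dimension $r-1$. A degree-$n$ étale algebra over a ring $R$ is a commutative $R$-algebra that is étale (flat, separable, finitely presented) and of rank $n$ as a projective $R$-module. $S\times R^{n-2}$ carries the componentwise algebra structure. *)

theory Defs
  imports
    "HOL-Algebra.Algebra"
    "HOL-Algebra.Elementary_Groups"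
    "HOL-Algebra.Algebraic_Closure_Type"
    "HOL-Library.Multiset"
begin

section \<open>Modules and algebras\<close>

text \<open>
  Rings, modules and algebras are the records and locales of HOL-Algebra; in particular
  \<open>algebra R A\<close> says that \<open>A\<close> is a commutative \<open>R\<close>-algebra. A type argument \<open>TYPE('c)\<close> bounds the
  modules a notion quantifies over: they live on the type \<open>'c\<close>. A statement in which \<open>'c\<close>
  is a free type variable makes the unrestricted assertion.
\<close>

definition module_hom ::
    "('r, 'x) ring_scheme \<Rightarrow> ('r, 'm, 'y) module_scheme \<Rightarrow> ('r, 'n, 'z) module_scheme \<Rightarrow> ('m \<Rightarrow> 'n) set"
  where "module_hom R M N =
    {h \<in> hom (add_monoid M) (add_monoid N).
       \<forall>a\<in>carrier R. \<forall>x\<in>carrier M. h (a \<odot>\<^bsub>M\<^esub> x) = a \<odot>\<^bsub>N\<^esub> h x}"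

definition algebra_hom ::
    "('r, 'x) ring_scheme \<Rightarrow> ('r, 'm, 'y) module_scheme \<Rightarrow> ('r, 'n, 'z) module_scheme \<Rightarrow> ('m \<Rightarrow> 'n) set"
  where "algebra_hom R A B =
    {h \<in> ring_hom A B. \<forall>a\<in>carrier R. \<forall>x\<in>carrier A. h (a \<odot>\<^bsub>A\<^esub> x) = a \<odot>\<^bsub>B\<^esub> h x}"

definition submodule_generated ::
    "('r, 'x) ring_scheme \<Rightarrow> ('r, 'm, 'y) module_scheme \<Rightarrow> 'm set \<Rightarrow> 'm set"
  where "submodule_generated R M B = \<Inter>{H. submodule H R M \<and> B \<subseteq> H}"

definition subalgebra_generated ::
    "('r, 'x) ring_scheme \<Rightarrow> ('r, 'm, 'y) module_scheme \<Rightarrow> 'm set \<Rightarrow> 'm set"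
  where "subalgebra_generated R A B =
    \<Inter>{H. subring H A \<and> (\<forall>a\<in>carrier R. \<forall>x\<in>H. a \<odot>\<^bsub>A\<^esub> x \<in> H) \<and> B \<subseteq> H}"

text \<open>\<open>S\<close> as an algebra over itself, or over any of its subrings.\<close>

definition ring_as_algebra :: "('a, 'x) ring_scheme \<Rightarrow> ('a, 'a) module"
  where "ring_as_algebra S =
    ring.extend (ring.truncate S) \<lparr>module.smult = (\<lambda>a x. a \<otimes>\<^bsub>S\<^esub> x)\<rparr>"

definition product_algebra ::
    "('r, 'm, 'x) module_scheme \<Rightarrow> ('r, 'n, 'y) module_scheme \<Rightarrow> ('r, 'm \<times> 'n) module"
  where "product_algebra A B =
    ring.extend (RDirProd A B) \<lparr>module.smult = (\<lambda>a (x, y). (a \<odot>\<^bsub>A\<^esub> x, a \<odot>\<^bsub>B\<^esub> y))\<rparr>"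

definition power_algebra :: "('r, 'm, 'x) module_scheme \<Rightarrow> nat \<Rightarrow> ('r, nat \<Rightarrow> 'm) module"
  where "power_algebra A m =
    \<lparr>carrier = {..<m} \<rightarrow>\<^sub>E carrier A,
     monoid.mult = (\<lambda>x y. \<lambda>i\<in>{..<m}. x i \<otimes>\<^bsub>A\<^esub> y i),
     one = (\<lambda>i\<in>{..<m}. \<one>\<^bsub>A\<^esub>),
     ring.zero = (\<lambda>i\<in>{..<m}. \<zero>\<^bsub>A\<^esub>),
     add = (\<lambda>x y. \<lambda>i\<in>{..<m}. x i \<oplus>\<^bsub>A\<^esub> y i),
     module.smult = (\<lambda>a x. \<lambda>i\<in>{..<m}. a \<odot>\<^bsub>A\<^esub> x i)\<rparr>"

definition quotient_algebra :: "('r, 'm, 'x) module_scheme \<Rightarrow> 'm set \<Rightarrow> ('r, 'm set) module"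
  where "quotient_algebra A K =
    ring.extend (A Quot K) \<lparr>module.smult = (\<lambda>a U. \<Union>x\<in>U. K +>\<^bsub>A\<^esub> (a \<odot>\<^bsub>A\<^esub> x))\<rparr>"


section \<open>Monoid algebras and polynomial rings\<close>

text \<open>
  \<open>monoid_algebra R G\<close> is \<open>R[G]\<close>, on the finitely supported functions \<open>G \<rightarrow> R\<close> with convolution as
  product. Disregarding the product, it is the free \<open>R\<close>-module on the set \<open>carrier G\<close>.
\<close>

definition support :: "('r, 'x) ring_scheme \<Rightarrow> ('g \<Rightarrow> 'r) \<Rightarrow> 'g set"
  where "support R f = {x. f x \<noteq> \<zero>\<^bsub>R\<^esub>}"

definition basis_elem :: "('r, 'x) ring_scheme \<Rightarrow> 'g \<Rightarrow> 'g \<Rightarrow> 'r"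
  where "basis_elem R x = (\<lambda>y. if y = x then \<one>\<^bsub>R\<^esub> else \<zero>\<^bsub>R\<^esub>)"

definition monoid_algebra ::
    "('r, 'x) ring_scheme \<Rightarrow> ('g, 'y) monoid_scheme \<Rightarrow> ('r, 'g \<Rightarrow> 'r) module"
  where "monoid_algebra R G =
    \<lparr>carrier = {f. range f \<subseteq> carrier R \<and> support R f \<subseteq> carrier G \<and> finite (support R f)},
     monoid.mult = (\<lambda>f g z.
       \<Oplus>\<^bsub>R\<^esub>p \<in> {p \<in> support R f \<times> support R g. fst p \<otimes>\<^bsub>G\<^esub> snd p = z}. f (fst p) \<otimes>\<^bsub>R\<^esub> g (snd p)),
     one = basis_elem R \<one>\<^bsub>G\<^esub>,
     ring.zero = (\<lambda>_. \<zero>\<^bsub>R\<^esub>),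
     add = (\<lambda>f g x. f x \<oplus>\<^bsub>R\<^esub> g x),
     module.smult = (\<lambda>a f x. a \<otimes>\<^bsub>R\<^esub> f x)\<rparr>"

text \<open>
  As in \<open>HOL-Algebra.Indexed_Polynomials\<close>, a monomial is the multiset of its variables.
\<close>

definition poly_algebra :: "('r, 'x) ring_scheme \<Rightarrow> 'v set \<Rightarrow> ('r, 'v multiset \<Rightarrow> 'r) module"
  where "poly_algebra R V =
    monoid_algebra R \<lparr>carrier = {w. set_mset w \<subseteq> V}, monoid.mult = (+), one = {#}\<rparr>"

definition poly_var :: "('r, 'x) ring_scheme \<Rightarrow> 'v \<Rightarrow> 'v multiset \<Rightarrow> 'r"
  where "poly_var R i = basis_elem R {#i#}"

definition poly_subst ::
    "('r, 'x) ring_scheme \<Rightarrow> ('r, 'm, 'y) module_scheme \<Rightarrow> ('v \<Rightarrow> 'm) \<Rightarrow> ('v multiset \<Rightarrow> 'r) \<Rightarrow> 'm"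
  where "poly_subst R A a f =
    (\<Oplus>\<^bsub>A\<^esub>w \<in> support R f. f w \<odot>\<^bsub>A\<^esub> (\<Otimes>\<^bsub>A\<^esub>i \<in> set_mset w. a i [^]\<^bsub>A\<^esub> count w i))"


section \<open>Tensor products\<close>

text \<open>
  \<open>M \<otimes>\<^sub>R N\<close> is the free \<open>R\<close>-module on \<open>M \<times> N\<close> modulo the bilinearity relations. The monoid algebra of
  the product of the multiplicative monoids is used as the free module, so that for algebras
  the quotient carries the product \<open>(a \<otimes> b)(a' \<otimes> b') = aa' \<otimes> bb'\<close>. If \<open>M\<close> or \<open>N\<close> is a mere module,
  the fields \<open>mult\<close> and \<open>one\<close> of the result are meaningless and play no role.
\<close>

definition tensor_free ::
    "('r, 'x) ring_scheme \<Rightarrow> ('r, 'm, 'y) module_scheme \<Rightarrow> ('r, 'n, 'z) module_scheme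
      \<Rightarrow> ('r, 'm \<times> 'n \<Rightarrow> 'r) module"
  where "tensor_free R M N = monoid_algebra R (M \<times>\<times> N)"

definition tensor_relations ::
    "('r, 'x) ring_scheme \<Rightarrow> ('r, 'm, 'y) module_scheme \<Rightarrow> ('r, 'n, 'z) module_scheme
      \<Rightarrow> ('m \<times> 'n \<Rightarrow> 'r) set"
  where "tensor_relations R M N =
    (let F = tensor_free R M N; b = (\<lambda>m n. basis_elem R (m, n)) in
      {b (m \<oplus>\<^bsub>M\<^esub> m') n \<ominus>\<^bsub>F\<^esub> (b m n \<oplus>\<^bsub>F\<^esub> b m' n) | m m' n.
         m \<in> carrier M \<and> m' \<in> carrier M \<and> n \<in> carrier N}
    \<union> {b m (n \<oplus>\<^bsub>N\<^esub> n') \<ominus>\<^bsub>F\<^esub> (b m n \<oplus>\<^bsub>F\<^esub> b m n') | m n n'.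
         m \<in> carrier M \<and> n \<in> carrier N \<and> n' \<in> carrier N}
    \<union> {b (a \<odot>\<^bsub>M\<^esub> m) n \<ominus>\<^bsub>F\<^esub> (a \<odot>\<^bsub>F\<^esub> b m n) | a m n.
         a \<in> carrier R \<and> m \<in> carrier M \<and> n \<in> carrier N}
    \<union> {b m (a \<odot>\<^bsub>N\<^esub> n) \<ominus>\<^bsub>F\<^esub> (a \<odot>\<^bsub>F\<^esub> b m n) | a m n.
         a \<in> carrier R \<and> m \<in> carrier M \<and> n \<in> carrier N})"

definition tensor_kernel ::
    "('r, 'x) ring_scheme \<Rightarrow> ('r, 'm, 'y) module_scheme \<Rightarrow> ('r, 'n, 'z) module_scheme
      \<Rightarrow> ('m \<times> 'n \<Rightarrow> 'r) set"
  where "tensor_kernel R M N =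
    submodule_generated R (tensor_free R M N) (tensor_relations R M N)"

definition tensor_product ::
    "('r, 'x) ring_scheme \<Rightarrow> ('r, 'm, 'y) module_scheme \<Rightarrow> ('r, 'n, 'z) module_scheme
      \<Rightarrow> ('r, ('m \<times> 'n \<Rightarrow> 'r) set) module"
  where "tensor_product R M N = quotient_algebra (tensor_free R M N) (tensor_kernel R M N)"

definition pure_tensor ::
    "('r, 'x) ring_scheme \<Rightarrow> ('r, 'm, 'y) module_scheme \<Rightarrow> ('r, 'n, 'z) module_scheme
      \<Rightarrow> 'm \<Rightarrow> 'n \<Rightarrow> ('m \<times> 'n \<Rightarrow> 'r) set"
  where "pure_tensor R M N m n =
    tensor_kernel R M N +>\<^bsub>tensor_free R M N\<^esub> basis_elem R (m, n)"


section \<open>Localization\<close>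

text \<open>
  \<open>localization R T M\<close> is \<open>T\<^sup>-\<^sup>1M\<close> for a multiplicative subset \<open>T\<close> of \<open>R\<close>, made of the classes
  \<open>m/s\<close> of pairs \<open>(m, s)\<close>. Its scalars are the elements of \<open>T\<^sup>-\<^sup>1R\<close>, which is the
  localization of \<open>R\<close> as an algebra over itself.
\<close>

definition fraction_rel ::
    "'r set \<Rightarrow> ('r, 'm, 'y) module_scheme \<Rightarrow> (('m \<times> 'r) \<times> ('m \<times> 'r)) set"
  where "fraction_rel T M =
    {((m, s), (m', s')). m \<in> carrier M \<and> s \<in> T \<and> m' \<in> carrier M \<and> s' \<in> T \<and>
       (\<exists>u\<in>T. u \<odot>\<^bsub>M\<^esub> (s' \<odot>\<^bsub>M\<^esub> m) = u \<odot>\<^bsub>M\<^esub> (s \<odot>\<^bsub>M\<^esub> m'))}"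

definition fraction :: "'r set \<Rightarrow> ('r, 'm, 'y) module_scheme \<Rightarrow> 'm \<Rightarrow> 'r \<Rightarrow> ('m \<times> 'r) set"
  where "fraction T M m s = fraction_rel T M `` {(m, s)}"

definition localization ::
    "('r, 'x) ring_scheme \<Rightarrow> 'r set \<Rightarrow> ('r, 'm, 'y) module_scheme
      \<Rightarrow> (('r \<times> 'r) set, ('m \<times> 'r) set) module"
  where "localization R T M =
    \<lparr>carrier = (carrier M \<times> T) // fraction_rel T M,
     monoid.mult = (\<lambda>U V. \<Union>(m, s)\<in>U. \<Union>(m', s')\<in>V. fraction T M (m \<otimes>\<^bsub>M\<^esub> m') (s \<otimes>\<^bsub>R\<^esub> s')),
     one = fraction T M \<one>\<^bsub>M\<^esub> \<one>\<^bsub>R\<^esub>,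
     ring.zero = fraction T M \<zero>\<^bsub>M\<^esub> \<one>\<^bsub>R\<^esub>,
     add = (\<lambda>U V. \<Union>(m, s)\<in>U. \<Union>(m', s')\<in>V.
              fraction T M (s' \<odot>\<^bsub>M\<^esub> m \<oplus>\<^bsub>M\<^esub> s \<odot>\<^bsub>M\<^esub> m') (s \<otimes>\<^bsub>R\<^esub> s')),
     module.smult = (\<lambda>A U. \<Union>(a, t)\<in>A. \<Union>(m, s)\<in>U. fraction T M (a \<odot>\<^bsub>M\<^esub> m) (t \<otimes>\<^bsub>R\<^esub> s))\<rparr>"


section \<open>Etale algebras\<close>

text \<open>
  Flatness: tensoring preserves injectivity. In the definition \<open>t\<close> is \<open>f \<otimes> id\<^sub>M\<close>, a linear map on
  \<open>N \<otimes> M\<close> being determined by its values on pure tensors.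
\<close>

definition flat_module ::
    "'c itself \<Rightarrow> ('r, 'x) ring_scheme \<Rightarrow> ('r, 'm, 'y) module_scheme \<Rightarrow> bool"
  where "flat_module (_ :: 'c itself) R M \<longleftrightarrow> module R M \<and>
    (\<forall>(N :: ('r, 'c) module) (N' :: ('r, 'c) module) f.
       module R N \<and> module R N' \<and> f \<in> module_hom R N N' \<and> inj_on f (carrier N) \<longrightarrow>
       (\<exists>t \<in> module_hom R (tensor_product R N M) (tensor_product R N' M).
          (\<forall>x\<in>carrier N. \<forall>m\<in>carrier M. t (pure_tensor R N M x m) = pure_tensor R N' M (f x) m) \<and>
          inj_on t (carrier (tensor_product R N M))))"

definition projective_module ::
    "'c itself \<Rightarrow> ('r, 'x) ring_scheme \<Rightarrow> ('r, 'm, 'y) module_scheme \<Rightarrow> bool"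
  where "projective_module (_ :: 'c itself) R P \<longleftrightarrow> module R P \<and>
    (\<forall>(M :: ('r, 'c) module) (N :: ('r, 'c) module) g f.
       module R M \<and> module R N \<and> g \<in> module_hom R M N \<and> g ` carrier M = carrier N \<and>
       f \<in> module_hom R P N \<longrightarrow>
       (\<exists>h \<in> module_hom R P M. \<forall>x\<in>carrier P. g (h x) = f x))"

text \<open>
  \<open>A\<close> is separable if it is projective as a module over \<open>A \<otimes>\<^sub>R A\<close>, which acts on \<open>A\<close> by
  \<open>(a \<otimes> b) \<cdot> x = abx\<close>, that is, through the multiplication map \<open>\<mu>\<close>.
\<close>

definition separable_algebra ::
    "'c itself \<Rightarrow> ('r, 'x) ring_scheme \<Rightarrow> ('r, 'a, 'y) module_scheme \<Rightarrow> bool"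
  where "separable_algebra (C :: 'c itself) R A \<longleftrightarrow> algebra R A \<and>
    (\<exists>\<mu> \<in> algebra_hom R (tensor_product R A A) A.
       (\<forall>a\<in>carrier A. \<forall>b\<in>carrier A. \<mu> (pure_tensor R A A a b) = a \<otimes>\<^bsub>A\<^esub> b) \<and>
       projective_module C (tensor_product R A A)
         (ring.extend (ring.truncate A) \<lparr>module.smult = (\<lambda>t x. \<mu> t \<otimes>\<^bsub>A\<^esub> x)\<rparr>))"

definition finitely_presented_algebra ::
    "('r, 'x) ring_scheme \<Rightarrow> ('r, 'a, 'y) module_scheme \<Rightarrow> bool"
  where "finitely_presented_algebra R A \<longleftrightarrow> algebra R A \<and>
    (\<exists>(m :: nat) F. let P = poly_algebra R {..<m} in
       finite F \<and> F \<subseteq> carrier P \<and>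
       (\<exists>h \<in> algebra_hom R P A. h ` carrier P = carrier A \<and> a_kernel P A h = Idl\<^bsub>P\<^esub> F))"

definition etale_algebra ::
    "'c itself \<Rightarrow> ('r, 'x) ring_scheme \<Rightarrow> ('r, 'a, 'y) module_scheme \<Rightarrow> bool"
  where "etale_algebra (C :: 'c itself) R A \<longleftrightarrow>
    algebra R A \<and> flat_module C R A \<and> separable_algebra C R A \<and> finitely_presented_algebra R A"

definition free_module_of_rank ::
    "nat \<Rightarrow> ('r, 'x) ring_scheme \<Rightarrow> ('r, 'm, 'y) module_scheme \<Rightarrow> bool"
  where "free_module_of_rank n R M \<longleftrightarrow> module R M \<and>
    (\<exists>b \<in> {..<n} \<rightarrow> carrier M. \<forall>x\<in>carrier M.
       \<exists>!c. c \<in> {..<n} \<rightarrow>\<^sub>E carrier R \<and> x = (\<Oplus>\<^bsub>M\<^esub>i \<in> {..<n}. c i \<odot>\<^bsub>M\<^esub> b i))"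

text \<open>
  The rank is that of the localizations at the prime ideals, as for any finitely generated
  projective module.
\<close>

definition projective_module_of_rank ::
    "'c itself \<Rightarrow> nat \<Rightarrow> ('r, 'x) ring_scheme \<Rightarrow> ('r, 'm, 'y) module_scheme \<Rightarrow> bool"
  where "projective_module_of_rank (C :: 'c itself) n R M \<longleftrightarrow>
    projective_module C R M \<and>
    (\<exists>B. finite B \<and> B \<subseteq> carrier M \<and> submodule_generated R M B = carrier M) \<and>
    (\<forall>I. primeideal I R \<longrightarrow>
       free_module_of_rank n (localization R (carrier R - I) (ring_as_algebra R))
         (localization R (carrier R - I) M))"

definition etale_algebra_of_degree ::
    "'c itself \<Rightarrow> nat \<Rightarrow> ('r, 'x) ring_scheme \<Rightarrow> ('r, 'a, 'y) module_scheme \<Rightarrow> bool"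
  where "etale_algebra_of_degree (C :: 'c itself) n R A \<longleftrightarrow>
    etale_algebra C R A \<and> projective_module_of_rank C n R A"


section \<open>The ring of the sphere and its antipodal quotient\<close>

abbreviation real_ring :: "real ring"
  where "real_ring \<equiv> ring_of_type_algebra"

text \<open>The variables \<open>z\<^sub>1, \<dots>, z\<^sub>r\<close> are indexed by \<open>{1..r}\<close>.\<close>

definition real_poly :: "nat \<Rightarrow> (real, nat multiset \<Rightarrow> real) module"
  where "real_poly r = poly_algebra real_ring {1..r}"

definition sphere_equation :: "nat \<Rightarrow> nat multiset \<Rightarrow> real"
  where "sphere_equation r =
    (\<Oplus>\<^bsub>real_poly r\<^esub>i \<in> {1..r}. poly_var real_ring i [^]\<^bsub>real_poly r\<^esub> (2 :: nat))
      \<ominus>\<^bsub>real_poly r\<^esub> \<one>\<^bsub>real_poly r\<^esub>"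

definition sphere_ring :: "nat \<Rightarrow> (nat multiset \<Rightarrow> real) set ring"
  where "sphere_ring r = real_poly r Quot (Idl\<^bsub>real_poly r\<^esub> {sphere_equation r})"

definition antipode :: "nat \<Rightarrow> (nat multiset \<Rightarrow> real) \<Rightarrow> nat multiset \<Rightarrow> real"
  where "antipode r =
    poly_subst real_ring (real_poly r) (\<lambda>i. \<ominus>\<^bsub>real_poly r\<^esub> poly_var real_ring i)"

text \<open>
  The substitution \<open>z\<^sub>i \<mapsto> -z\<^sub>i\<close> is an involution fixing the equation of the sphere, so it maps each
  residue class onto a residue class. The nontrivial element of the group of order 2 acts by it.
\<close>

definition antipodal_action ::
    "nat \<Rightarrow> int \<Rightarrow> (nat multiset \<Rightarrow> real) set \<Rightarrow> (nat multiset \<Rightarrow> real) set"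
  where "antipodal_action r g =
    (\<lambda>U\<in>carrier (sphere_ring r). if g = \<one>\<^bsub>integer_mod_group 2\<^esub> then U else antipode r ` U)"

definition invariant_ring :: "nat \<Rightarrow> (nat multiset \<Rightarrow> real) set ring"
  where "invariant_ring r =
    (sphere_ring r)\<lparr>carrier :=
       (\<Inter>g\<in>carrier (integer_mod_group 2). invariants (carrier (sphere_ring r)) (antipodal_action r) g)\<rparr>"

text \<open>The \<open>R\<close>-algebra \<open>S \<times> R\<^sup>n\<^sup>-\<^sup>2\<close>.\<close>

definition sphere_etale_algebra ::
    "nat \<Rightarrow> nat \<Rightarrow> ((nat multiset \<Rightarrow> real) set,
       (nat multiset \<Rightarrow> real) set \<times> (nat \<Rightarrow> (nat multiset \<Rightarrow> real) set)) module"
  where "sphere_etale_algebra r n =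
    product_algebra (ring_as_algebra (sphere_ring r))
      (power_algebra (ring_as_algebra (invariant_ring r)) (n - 2))"

end

theory Submission
  imports Defs "Jordan_Normal_Form.Char_Poly" "HOL-Library.Poly_Mapping"
    "HOL-Analysis.Continuum_Not_Denumerable"
begin

text \<open>
  The involution of \<open>S\<close> is free because \<open>\<Sum>\<^sub>i z\<^sub>i\<^sup>2 = 1\<close> with the \<open>z\<^sub>i\<close> odd. Put
  \<open>Tr u = u + \<sigma> u\<close>. Then \<open>1, z\<^sub>1, \<dots>, z\<^sub>r\<close> and their halves are dual generating families of the
  \<open>R\<close>-module \<open>S\<close> for the form \<open>Tr (u v)\<close>. Dual families with \<open>\<Sum>\<^sub>i x\<^sub>i y\<^sub>i = 1\<close> yield projectivity,
  flatness, the separability idempotent \<open>\<Sum>\<^sub>i x\<^sub>i \<otimes> y\<^sub>i\<close> and a finite presentation by the structure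
  constants. At a prime \<open>\<pp>\<close> of \<open>R\<close> some \<open>z\<^sub>i\<^sup>2\<close> is invertible, and \<open>1, z\<^sub>i\<close> is a basis of \<open>S\<^sub>\<pp>\<close>.

  Fewer than \<open>r\<close> elements do not generate: by the Borsuk-Ulam theorem their \<open>S\<close>-components agree at
  some pair of antipodal points of the sphere, and the elements whose \<open>S\<close>-component agrees there form a
  proper subalgebra.

  The Borsuk-Ulam theorem for polynomials is proved algebraically. It suffices to solve
  \<open>y\<^sub>j\<^sup>D + s g\<^sub>j(y) = 0\<close> over the reals for \<open>j = 1, \<dots>, n\<close>, where \<open>D\<close> is odd, \<open>g\<^sub>j\<close> has degree at most
  \<open>D\<close>, and \<open>s\<close> is arbitrarily large. For all but countably many \<open>s\<close> the monomials with exponents below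
  \<open>D\<close> form a basis of the quotient of the polynomial ring by these equations. Its dimension \<open>D\<^sup>n\<close> is odd,
  so the commuting multiplications by the variables have a common real eigenvector, and the eigenvalues
  form a solution.
\<close>

section \<open>Finite sums and linear maps\<close>

text \<open>The dual families are redundant on purpose: \<open>r + 1\<close> elements describe a
  module of rank 2 without any choice of local basis, so one trace identity serves every clause of
  the etale condition, and a basis is chosen only for the rank. The obstacle is Borsuk-Ulam, where
  parity of a dimension takes the place of a topological degree. Nonreal characters of a
  finite-dimensional real algebra come in conjugate pairs, so odd dimension forces a real one. The
  odd parts alone need not have a finite-dimensional quotient of known dimension: they may have
  zeros at infinity or infinitely many zeros. The terms \<open>y_j^D\<close> repair this, having no
  common zero at infinity; at \<open>s = 0\<close> the monomials with small exponents are visibly a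
  basis, and being a basis is an open enough condition to fail for few \<open>s\<close>. The price
  is an error: a solution only satisfies \<open>g_j(y) = - y_j^D / s\<close>. This is why
  \<open>s\<close> must be unbounded, why the solutions are scaled back to the unit sphere, where
  \<open>y_j^D\<close> becomes bounded, and why compactness is needed at the end.\<close>

lemma (in abelian_monoid) finsum_mono_neutral:
  assumes "finite B" "A \<subseteq> B" "f \<in> B \<rightarrow> carrier G" "\<And>x. x \<in> B - A \<Longrightarrow> f x = \<zero>"
  shows "finsum G f A = finsum G f B"
  by (rule add.finprod_mono_neutral_cong_left) (use assms in auto)

lemma (in abelian_monoid) finsum_swap:
  assumes "finite A" "finite B" "\<And>x y. x \<in> A \<Longrightarrow> y \<in> B \<Longrightarrow> f x y \<in> carrier G"
  shows "(\<Oplus>x\<in>A. \<Oplus>y\<in>B. f x y) = (\<Oplus>y\<in>B. \<Oplus>x\<in>A. f x y)"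
  using assms(1,3)
proof (induction A)
  case empty
  then show ?case by simp
next
  case (insert a A)
  have "(\<Oplus>x\<in>insert a A. \<Oplus>y\<in>B. f x y) = (\<Oplus>y\<in>B. f a y) \<oplus> (\<Oplus>x\<in>A. \<Oplus>y\<in>B. f x y)"
    using insert by (intro finsum_insert) (auto intro!: finsum_closed)
  also have "(\<Oplus>x\<in>A. \<Oplus>y\<in>B. f x y) = (\<Oplus>y\<in>B. \<Oplus>x\<in>A. f x y)"
    using insert by simp
  also have "(\<Oplus>y\<in>B. f a y) \<oplus> \<dots> = (\<Oplus>y\<in>B. f a y \<oplus> (\<Oplus>x\<in>A. f x y))"
    using insert by (intro finsum_addf[symmetric]) (auto intro!: finsum_closed)
  also have "\<dots> = (\<Oplus>y\<in>B. \<Oplus>x\<in>insert a A. f x y)"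
    using insert by (intro finsum_cong') (auto intro!: finsum_closed finsum_insert[symmetric])
  finally show ?case .
qed

lemma (in abelian_monoid) finsum_Times:
  assumes "finite A" "finite B" "\<And>x y. x \<in> A \<Longrightarrow> y \<in> B \<Longrightarrow> f (x, y) \<in> carrier G"
  shows "(\<Oplus>p\<in>A \<times> B. f p) = (\<Oplus>x\<in>A. \<Oplus>y\<in>B. f (x, y))"
  using assms(1,3)
proof (induction A)
  case empty
  then show ?case by simp
next
  case (insert a A)
  have "insert a A \<times> B = Pair a ` B \<union> A \<times> B" by auto
  then have "(\<Oplus>p\<in>insert a A \<times> B. f p) = (\<Oplus>p\<in>Pair a ` B. f p) \<oplus> (\<Oplus>p\<in>A \<times> B. f p)"
    using insert assms(2) by (simp only:) (intro finsum_Un_disjoint, auto)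
  also have "(\<Oplus>p\<in>Pair a ` B. f p) = (\<Oplus>y\<in>B. f (a, y))"
    using insert by (intro finsum_reindex) (auto simp: inj_on_def)
  also have "(\<Oplus>p\<in>A \<times> B. f p) = (\<Oplus>x\<in>A. \<Oplus>y\<in>B. f (x, y))" using insert by simp
  also have "(\<Oplus>y\<in>B. f (a, y)) \<oplus> \<dots> = (\<Oplus>x\<in>insert a A. \<Oplus>y\<in>B. f (x, y))"
    using insert by (intro finsum_insert[symmetric]) (auto intro!: finsum_closed)
  finally show ?case .
qed

lemma module_homI:
  assumes "\<And>x. x \<in> carrier M \<Longrightarrow> h x \<in> carrier N"
    and "\<And>x y. x \<in> carrier M \<Longrightarrow> y \<in> carrier M \<Longrightarrow> h (x \<oplus>\<^bsub>M\<^esub> y) = h x \<oplus>\<^bsub>N\<^esub> h y"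
    and "\<And>a x. a \<in> carrier R \<Longrightarrow> x \<in> carrier M \<Longrightarrow> h (a \<odot>\<^bsub>M\<^esub> x) = a \<odot>\<^bsub>N\<^esub> h x"
  shows "h \<in> module_hom R M N"
  using assms by (auto simp: module_hom_def hom_def)

lemma module_homD:
  assumes "h \<in> module_hom R M N"
  shows "x \<in> carrier M \<Longrightarrow> h x \<in> carrier N"
    and "x \<in> carrier M \<Longrightarrow> y \<in> carrier M \<Longrightarrow> h (x \<oplus>\<^bsub>M\<^esub> y) = h x \<oplus>\<^bsub>N\<^esub> h y"
    and "a \<in> carrier R \<Longrightarrow> x \<in> carrier M \<Longrightarrow> h (a \<odot>\<^bsub>M\<^esub> x) = a \<odot>\<^bsub>N\<^esub> h x"
  using assms by (auto simp: module_hom_def hom_def)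

lemma algebra_homD:
  assumes "h \<in> algebra_hom R M N"
  shows "x \<in> carrier M \<Longrightarrow> h x \<in> carrier N"
    and "x \<in> carrier M \<Longrightarrow> y \<in> carrier M \<Longrightarrow> h (x \<oplus>\<^bsub>M\<^esub> y) = h x \<oplus>\<^bsub>N\<^esub> h y"
    and "x \<in> carrier M \<Longrightarrow> y \<in> carrier M \<Longrightarrow> h (x \<otimes>\<^bsub>M\<^esub> y) = h x \<otimes>\<^bsub>N\<^esub> h y"
    and "h \<one>\<^bsub>M\<^esub> = \<one>\<^bsub>N\<^esub>"
    and "a \<in> carrier R \<Longrightarrow> x \<in> carrier M \<Longrightarrow> h (a \<odot>\<^bsub>M\<^esub> x) = a \<odot>\<^bsub>N\<^esub> h x"
  using assms by (auto simp: algebra_hom_def Ring.ring_hom_def)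

lemma module_abelian_group: "module R M \<Longrightarrow> abelian_group M"
  by (rule module.axioms)

text \<open>This and the following three lemmas are stated for bare additive maps and not for
  \<open>module_hom\<close>: the maps to come include coefficient extraction and
  \<open>m \<mapsto> m / t\<close>, whose source and target are not always modules over the same
  ring.\<close>

lemma additive_zero:
  assumes "abelian_group M" "abelian_group N" "h \<in> carrier M \<rightarrow> carrier N"
    "\<And>x y. x \<in> carrier M \<Longrightarrow> y \<in> carrier M \<Longrightarrow> h (x \<oplus>\<^bsub>M\<^esub> y) = h x \<oplus>\<^bsub>N\<^esub> h y"
  shows "h \<zero>\<^bsub>M\<^esub> = \<zero>\<^bsub>N\<^esub>"
proof -
  interpret M: abelian_group M by fact
  interpret N: abelian_group N by fact
  have c: "h \<zero>\<^bsub>M\<^esub> \<in> carrier N" using assms(3) by auto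
  have "h \<zero>\<^bsub>M\<^esub> \<oplus>\<^bsub>N\<^esub> h \<zero>\<^bsub>M\<^esub> = h \<zero>\<^bsub>M\<^esub>" using assms(4)[of "\<zero>\<^bsub>M\<^esub>" "\<zero>\<^bsub>M\<^esub>"] by simp
  then show ?thesis using c by (metis N.add.r_cancel_one')
qed

lemma additive_uminus:
  assumes "abelian_group M" "abelian_group N" "h \<in> carrier M \<rightarrow> carrier N"
    "\<And>x y. x \<in> carrier M \<Longrightarrow> y \<in> carrier M \<Longrightarrow> h (x \<oplus>\<^bsub>M\<^esub> y) = h x \<oplus>\<^bsub>N\<^esub> h y"
    "x \<in> carrier M"
  shows "h (\<ominus>\<^bsub>M\<^esub> x) = \<ominus>\<^bsub>N\<^esub> h x"
proof -
  interpret M: abelian_group M by fact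
  interpret N: abelian_group N by fact
  have c: "h x \<in> carrier N" "h (\<ominus>\<^bsub>M\<^esub> x) \<in> carrier N" using assms(3,5) by auto
  have "h (\<ominus>\<^bsub>M\<^esub> x) \<oplus>\<^bsub>N\<^esub> h x = \<zero>\<^bsub>N\<^esub>"
    using assms(4)[of "\<ominus>\<^bsub>M\<^esub> x" x] assms(5) additive_zero[OF assms(1-4)] by (simp add: M.l_neg)
  then show ?thesis using c by (intro N.minus_equality[symmetric])
qed

lemma additive_minus:
  assumes "abelian_group M" "abelian_group N" "h \<in> carrier M \<rightarrow> carrier N"
    "\<And>x y. x \<in> carrier M \<Longrightarrow> y \<in> carrier M \<Longrightarrow> h (x \<oplus>\<^bsub>M\<^esub> y) = h x \<oplus>\<^bsub>N\<^esub> h y"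
    "x \<in> carrier M" "y \<in> carrier M"
  shows "h (x \<ominus>\<^bsub>M\<^esub> y) = h x \<ominus>\<^bsub>N\<^esub> h y"
proof -
  interpret M: abelian_group M by fact
  interpret N: abelian_group N by fact
  show ?thesis
    using assms(4)[of x "\<ominus>\<^bsub>M\<^esub> y"] assms(5,6) additive_uminus[OF assms(1-4,6)] by (simp add: M.minus_eq N.minus_eq)
qed

lemma additive_finsum:
  assumes "abelian_group M" "abelian_group N" "h \<in> carrier M \<rightarrow> carrier N"
    "\<And>x y. x \<in> carrier M \<Longrightarrow> y \<in> carrier M \<Longrightarrow> h (x \<oplus>\<^bsub>M\<^esub> y) = h x \<oplus>\<^bsub>N\<^esub> h y"
    "finite A" "f \<in> A \<rightarrow> carrier M"
  shows "h (\<Oplus>\<^bsub>M\<^esub>i\<in>A. f i) = (\<Oplus>\<^bsub>N\<^esub>i\<in>A. h (f i))"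
proof -
  interpret M: abelian_group M by fact
  interpret N: abelian_group N by fact
  show ?thesis using assms(5,6)
  proof (induction A)
    case empty
    then show ?case using additive_zero[OF assms(1-4)] by simp
  next
    case (insert a A)
    then have f: "f a \<in> carrier M" "f \<in> A \<rightarrow> carrier M" by auto
    then have "h \<circ> f \<in> A \<rightarrow> carrier N" "h (f a) \<in> carrier N" using assms(3) by auto
    moreover have "(\<Oplus>\<^bsub>M\<^esub>i\<in>A. f i) \<in> carrier M" using f by (intro M.finsum_closed)
    ultimately show ?case
      using insert f by (simp add: assms(4) o_def Pi_def)
  qed
qed

section \<open>Monoid algebras\<close>

text \<open>The map given by the universal property of the free module on \<open>carrier G\<close>.
  The product of \<open>G\<close> enters only through the choice of \<open>\<phi>\<close>.\<close>

definition lin_map ::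
    "('r, 'x) ring_scheme \<Rightarrow> ('r, 'm, 'y) module_scheme \<Rightarrow> ('g \<Rightarrow> 'm) \<Rightarrow> ('g \<Rightarrow> 'r) \<Rightarrow> 'm"
  where "lin_map R M \<phi> f = (\<Oplus>\<^bsub>M\<^esub>x \<in> support R f. f x \<odot>\<^bsub>M\<^esub> \<phi> x)"

lemma monoid_algebra_simps:
  "carrier (monoid_algebra R G) = {f. range f \<subseteq> carrier R \<and> support R f \<subseteq> carrier G \<and> finite (support R f)}"
  "\<one>\<^bsub>monoid_algebra R G\<^esub> = basis_elem R \<one>\<^bsub>G\<^esub>"
  "\<zero>\<^bsub>monoid_algebra R G\<^esub> = (\<lambda>_. \<zero>\<^bsub>R\<^esub>)"
  "f \<oplus>\<^bsub>monoid_algebra R G\<^esub> g = (\<lambda>x. f x \<oplus>\<^bsub>R\<^esub> g x)"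
  "a \<odot>\<^bsub>monoid_algebra R G\<^esub> f = (\<lambda>x. a \<otimes>\<^bsub>R\<^esub> f x)"
  by (simp_all add: monoid_algebra_def)

context cring
begin

lemma monoid_algebra_closed:
  "range f \<subseteq> carrier R \<Longrightarrow> support R f \<subseteq> A \<Longrightarrow> finite A \<Longrightarrow> A \<subseteq> carrier G \<Longrightarrow> f \<in> carrier (monoid_algebra R G)"
  by (auto simp: monoid_algebra_simps intro: finite_subset)

lemma monoid_algebraD:
  assumes "f \<in> carrier (monoid_algebra R G)"
  shows "f x \<in> carrier R" "finite (support R f)" "support R f \<subseteq> carrier G"
  using assms by (auto simp: monoid_algebra_simps)

lemma module_monoid_algebra: "module R (monoid_algebra R G)"
proof (rule moduleI)
  let ?A = "monoid_algebra R G"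
  have add: "f \<oplus>\<^bsub>?A\<^esub> g \<in> carrier ?A" if "f \<in> carrier ?A" "g \<in> carrier ?A" for f g
    by (rule monoid_algebra_closed[of _ "support R f \<union> support R g"])
      (use that monoid_algebraD[OF that(1)] monoid_algebraD[OF that(2)] in
        \<open>auto simp: monoid_algebra_simps(4) support_def\<close>)
  have zero: "\<zero>\<^bsub>?A\<^esub> \<in> carrier ?A"
    by (rule monoid_algebra_closed[of _ "{}"]) (auto simp: monoid_algebra_simps(3) support_def)
  show "abelian_group ?A"
  proof (rule abelian_groupI)
    fix f assume f: "f \<in> carrier ?A"
    show "\<exists>g\<in>carrier ?A. g \<oplus>\<^bsub>?A\<^esub> f = \<zero>\<^bsub>?A\<^esub>"
    proof
      show "(\<lambda>x. \<ominus> f x) \<in> carrier ?A"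
        by (rule monoid_algebra_closed[of _ "support R f"])
          (use monoid_algebraD[OF f] in \<open>auto simp: support_def\<close>)
      show "(\<lambda>x. \<ominus> f x) \<oplus>\<^bsub>?A\<^esub> f = \<zero>\<^bsub>?A\<^esub>"
        using monoid_algebraD(1)[OF f] by (simp add: monoid_algebra_simps(3,4) l_neg)
    qed
  qed (use add zero monoid_algebraD(1)[where G = G] in \<open>auto simp: monoid_algebra_simps(3,4) a_ac intro!: ext\<close>)
  fix a f assume a: "a \<in> carrier R" and f: "f \<in> carrier ?A"
  show "a \<odot>\<^bsub>?A\<^esub> f \<in> carrier ?A"
    by (rule monoid_algebra_closed[of _ "support R f"])
      (use a monoid_algebraD[OF f] in \<open>auto simp: monoid_algebra_simps(5) support_def\<close>)
qed (use monoid_algebraD(1)[where G = G] is_cring in \<open>auto simp: monoid_algebra_simps(4,5) l_distr r_distr m_assoc intro!: ext\<close>)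

lemma basis_elem_closed: "x \<in> carrier G \<Longrightarrow> basis_elem R x \<in> carrier (monoid_algebra R G)"
  by (rule monoid_algebra_closed[of _ "{x}"]) (auto simp: basis_elem_def support_def)

text \<open>A finite support is exhausted one point at a time. The induction runs over a finite set
  containing the support, not over the support itself, so that points where the function vanishes
  may be dropped without a case of their own.\<close>

lemma monoid_algebra_induct [consumes 1, case_names zero step]:
  assumes "f \<in> carrier (monoid_algebra R G)" "P \<zero>\<^bsub>monoid_algebra R G\<^esub>"
    and step: "\<And>a x g. a \<in> carrier R \<Longrightarrow> x \<in> carrier G \<Longrightarrow> g \<in> carrier (monoid_algebra R G) \<Longrightarrow> P g \<Longrightarrow>
      P (a \<odot>\<^bsub>monoid_algebra R G\<^esub> basis_elem R x \<oplus>\<^bsub>monoid_algebra R G\<^esub> g)"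
  shows "P f"
proof -
  let ?A = "monoid_algebra R G"
  have "P f" if "finite S" "f \<in> carrier ?A" "support R f \<subseteq> S" for S
    using that
  proof (induction S arbitrary: f)
    case empty
    then have "f = \<zero>\<^bsub>?A\<^esub>" by (auto simp: support_def monoid_algebra_simps(3))
    then show ?case using assms(2) by simp
  next
    case (insert x S)
    show ?case
    proof (cases "f x = \<zero>")
      case True
      then show ?thesis using insert by (auto simp: support_def)
    next
      case False
      note f = monoid_algebraD[OF insert.prems(1)]
      have x: "x \<in> carrier G" using False f(3) by (auto simp: support_def)
      have "support R (f(x := \<zero>)) \<subseteq> support R f" by (auto simp: support_def)
      then have g: "f(x := \<zero>) \<in> carrier ?A"
        using f by (intro monoid_algebra_closed[of _ "support R f"]) auto
      moreover have "support R (f(x := \<zero>)) \<subseteq> S" using insert.prems(2) by (auto simp: support_def)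
      ultimately have "P (f x \<odot>\<^bsub>?A\<^esub> basis_elem R x \<oplus>\<^bsub>?A\<^esub> f(x := \<zero>))"
        using insert.IH f(1) x by (intro step) auto
      also have "f x \<odot>\<^bsub>?A\<^esub> basis_elem R x \<oplus>\<^bsub>?A\<^esub> f(x := \<zero>) = f"
        using f(1) by (auto simp: monoid_algebra_simps(4,5) basis_elem_def)
      finally show ?thesis .
    qed
  qed
  then show ?thesis using assms(1) monoid_algebraD(2) by blast
qed

context
  fixes M :: "('a, 'm, 'y) module_scheme" and G :: "('g, 'z) monoid_scheme" and \<phi> :: "'g \<Rightarrow> 'm"
  assumes M: "module R M" and \<phi>: "\<And>x. x \<in> carrier G \<Longrightarrow> \<phi> x \<in> carrier M"
begin

interpretation M: module R M by (rule M)

text \<open>The support changes under addition and scaling, so the sums defining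
  \<open>lin_map\<close> can be compared only after they have been extended to a common finite index
  set.\<close>

lemma lin_map_superset:
  assumes "f \<in> carrier (monoid_algebra R G)" "finite A" "support R f \<subseteq> A" "A \<subseteq> carrier G"
  shows "lin_map R M \<phi> f = (\<Oplus>\<^bsub>M\<^esub>x \<in> A. f x \<odot>\<^bsub>M\<^esub> \<phi> x)"
  unfolding lin_map_def
  by (rule M.finsum_mono_neutral)
    (use assms monoid_algebraD[OF assms(1)] \<phi> in \<open>auto simp: support_def subset_iff\<close>)

lemma lin_map_closed:
  assumes "f \<in> carrier (monoid_algebra R G)"
  shows "lin_map R M \<phi> f \<in> carrier M"
  unfolding lin_map_def using monoid_algebraD[OF assms] \<phi> by (intro M.finsum_closed) auto

lemma lin_map_add:
  assumes f: "f \<in> carrier (monoid_algebra R G)" and g: "g \<in> carrier (monoid_algebra R G)"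
  shows "lin_map R M \<phi> (f \<oplus>\<^bsub>monoid_algebra R G\<^esub> g) = lin_map R M \<phi> f \<oplus>\<^bsub>M\<^esub> lin_map R M \<phi> g"
proof -
  interpret A: module R "monoid_algebra R G" by (rule module_monoid_algebra)
  let ?S = "support R f \<union> support R g"
  have S: "finite ?S" "?S \<subseteq> carrier G" using monoid_algebraD[OF f] monoid_algebraD[OF g] by auto
  have "support R (f \<oplus>\<^bsub>monoid_algebra R G\<^esub> g) \<subseteq> ?S"
    by (auto simp: monoid_algebra_simps(4) support_def)
  then have "lin_map R M \<phi> (f \<oplus>\<^bsub>monoid_algebra R G\<^esub> g)
    = (\<Oplus>\<^bsub>M\<^esub>x \<in> ?S. (f \<oplus>\<^bsub>monoid_algebra R G\<^esub> g) x \<odot>\<^bsub>M\<^esub> \<phi> x)"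
    using f g S by (intro lin_map_superset) auto
  also have "\<dots> = (\<Oplus>\<^bsub>M\<^esub>x \<in> ?S. f x \<odot>\<^bsub>M\<^esub> \<phi> x \<oplus>\<^bsub>M\<^esub> g x \<odot>\<^bsub>M\<^esub> \<phi> x)"
    using monoid_algebraD(1)[OF f] monoid_algebraD(1)[OF g] \<phi> S(2)
    by (intro M.finsum_cong') (auto simp: monoid_algebra_simps(4) M.smult_l_distr subset_iff)
  also have "\<dots> = (\<Oplus>\<^bsub>M\<^esub>x \<in> ?S. f x \<odot>\<^bsub>M\<^esub> \<phi> x) \<oplus>\<^bsub>M\<^esub> (\<Oplus>\<^bsub>M\<^esub>x \<in> ?S. g x \<odot>\<^bsub>M\<^esub> \<phi> x)"
    using monoid_algebraD(1)[OF f] monoid_algebraD(1)[OF g] \<phi> S(2)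
    by (intro M.finsum_addf) auto
  also have "\<dots> = lin_map R M \<phi> f \<oplus>\<^bsub>M\<^esub> lin_map R M \<phi> g"
    using f g S by (simp add: lin_map_superset[of _ ?S])
  finally show ?thesis .
qed

lemma lin_map_smult:
  assumes a: "a \<in> carrier R" and f: "f \<in> carrier (monoid_algebra R G)"
  shows "lin_map R M \<phi> (a \<odot>\<^bsub>monoid_algebra R G\<^esub> f) = a \<odot>\<^bsub>M\<^esub> lin_map R M \<phi> f"
proof -
  interpret A: module R "monoid_algebra R G" by (rule module_monoid_algebra)
  have "support R (a \<odot>\<^bsub>monoid_algebra R G\<^esub> f) \<subseteq> support R f"
    using a by (auto simp: monoid_algebra_simps(5) support_def)
  then have "lin_map R M \<phi> (a \<odot>\<^bsub>monoid_algebra R G\<^esub> f)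
    = (\<Oplus>\<^bsub>M\<^esub>x \<in> support R f. (a \<odot>\<^bsub>monoid_algebra R G\<^esub> f) x \<odot>\<^bsub>M\<^esub> \<phi> x)"
    using a f monoid_algebraD[OF f] by (intro lin_map_superset) auto
  also have "\<dots> = (\<Oplus>\<^bsub>M\<^esub>x \<in> support R f. a \<odot>\<^bsub>M\<^esub> (f x \<odot>\<^bsub>M\<^esub> \<phi> x))"
    using a monoid_algebraD[OF f] \<phi>
    by (intro M.finsum_cong') (auto simp: monoid_algebra_simps(5) M.smult_assoc1 subset_iff)
  also have "\<dots> = a \<odot>\<^bsub>M\<^esub> lin_map R M \<phi> f"
    unfolding lin_map_def using a monoid_algebraD[OF f] \<phi>
    by (intro M.finsum_smult_ldistr[symmetric]) auto
  finally show ?thesis .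
qed

lemma lin_map_basis:
  assumes "x \<in> carrier G"
  shows "lin_map R M \<phi> (basis_elem R x) = \<phi> x"
proof -
  have "lin_map R M \<phi> (basis_elem R x) = (\<Oplus>\<^bsub>M\<^esub>y \<in> {x}. basis_elem R x y \<odot>\<^bsub>M\<^esub> \<phi> y)"
    using assms by (intro lin_map_superset basis_elem_closed) (auto simp: support_def basis_elem_def)
  also have "\<dots> = \<phi> x" using assms \<phi> by (simp add: basis_elem_def)
  finally show ?thesis .
qed

lemma lin_map_module_hom: "lin_map R M \<phi> \<in> module_hom R (monoid_algebra R G) M"
  by (intro module_homI lin_map_closed lin_map_add lin_map_smult)

end

text \<open>The basis elements span. Every multilinear identity about the product is reduced to
  basis elements by this lemma, one argument at a time.\<close>

lemma monoid_algebra_hom_eqI: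
  assumes M: "module R M"
    and h: "h \<in> module_hom R (monoid_algebra R G) M" and k: "k \<in> module_hom R (monoid_algebra R G) M"
    and eq: "\<And>x. x \<in> carrier G \<Longrightarrow> h (basis_elem R x) = k (basis_elem R x)"
    and f: "f \<in> carrier (monoid_algebra R G)"
  shows "h f = k f"
proof -
  interpret A: module R "monoid_algebra R G" by (rule module_monoid_algebra)
  interpret M: module R M by (rule M)
  show ?thesis using f
  proof (induction rule: monoid_algebra_induct)
    case zero
    then show ?case
      using additive_zero[OF module_abelian_group[OF A.module_axioms] module_abelian_group[OF M], of h]
        additive_zero[OF module_abelian_group[OF A.module_axioms] module_abelian_group[OF M], of k] module_homD[OF h] module_homD[OF k]
      by auto
  next
    case (step a x g)
    then show ?case
      using module_homD[OF h] module_homD[OF k] eq basis_elem_closed[of x G] by simp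
  qed
qed

lemma monoid_algebra_finsum_apply:
  assumes "finite A" "\<And>i. i \<in> A \<Longrightarrow> F i \<in> carrier (monoid_algebra R G)"
  shows "(\<Oplus>\<^bsub>monoid_algebra R G\<^esub>i\<in>A. F i) z = (\<Oplus>i\<in>A. F i z)"
proof -
  interpret A: module R "monoid_algebra R G" by (rule module_monoid_algebra)
  show ?thesis
    using assms monoid_algebraD(1)[where G = G] additive_finsum[OF module_abelian_group[OF A.module_axioms] is_abelian_group, of "\<lambda>f. f z" A F]
    by (auto simp: monoid_algebra_simps(4))
qed

lemma lin_map_apply:
  assumes "\<And>x. x \<in> carrier G \<Longrightarrow> \<phi> x \<in> carrier (monoid_algebra R H)" "f \<in> carrier (monoid_algebra R G)"
  shows "lin_map R (monoid_algebra R H) \<phi> f z = (\<Oplus>x\<in>support R f. f x \<otimes> \<phi> x z)"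
proof -
  interpret A: module R "monoid_algebra R H" by (rule module_monoid_algebra)
  have "lin_map R (monoid_algebra R H) \<phi> f z = (\<Oplus>x\<in>support R f. (f x \<odot>\<^bsub>monoid_algebra R H\<^esub> \<phi> x) z)"
    unfolding lin_map_def
  proof (rule monoid_algebra_finsum_apply)
    fix x assume "x \<in> support R f"
    then show "f x \<odot>\<^bsub>monoid_algebra R H\<^esub> \<phi> x \<in> carrier (monoid_algebra R H)"
      using assms monoid_algebraD[OF assms(2)] by (intro A.smult_closed) auto
  qed (use monoid_algebraD[OF assms(2)] in simp)
  then show ?thesis by (simp only: monoid_algebra_simps(5))
qed

text \<open>This form of the convolution product makes its bilinearity visible.\<close>

lemma monoid_algebra_mult_eq:
  assumes G: "monoid G" and f: "f \<in> carrier (monoid_algebra R G)" and g: "g \<in> carrier (monoid_algebra R G)"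
  shows "f \<otimes>\<^bsub>monoid_algebra R G\<^esub> g = lin_map R (monoid_algebra R G)
    (\<lambda>x. lin_map R (monoid_algebra R G) (\<lambda>y. basis_elem R (x \<otimes>\<^bsub>G\<^esub> y)) g) f" (is "_ = ?r")
proof
  fix z
  interpret A: module R "monoid_algebra R G" by (rule module_monoid_algebra)
  interpret G: monoid G by (rule G)
  let ?A = "monoid_algebra R G"
  note f' = monoid_algebraD[OF f] and g' = monoid_algebraD[OF g]
  have b: "basis_elem R (x \<otimes>\<^bsub>G\<^esub> y) \<in> carrier ?A" if "x \<in> carrier G" "y \<in> carrier G" for x y
    using that by (intro basis_elem_closed) simp
  have inner: "lin_map R ?A (\<lambda>y. basis_elem R (x \<otimes>\<^bsub>G\<^esub> y)) g \<in> carrier ?A" if "x \<in> carrier G" for x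
    using that b g by (intro lin_map_closed A.module_axioms) auto
  have inner_z: "lin_map R ?A (\<lambda>y. basis_elem R (x \<otimes>\<^bsub>G\<^esub> y)) g z
    = (\<Oplus>y\<in>support R g. g y \<otimes> basis_elem R (x \<otimes>\<^bsub>G\<^esub> y) z)" if "x \<in> carrier G" for x
    using that b by (intro lin_map_apply[OF _ g]) simp
  have "?r z = (\<Oplus>x\<in>support R f. f x \<otimes> lin_map R ?A (\<lambda>y. basis_elem R (x \<otimes>\<^bsub>G\<^esub> y)) g z)"
    using inner by (rule lin_map_apply[OF _ f])
  also have "\<dots> = (\<Oplus>x\<in>support R f. \<Oplus>y\<in>support R g.
      if x \<otimes>\<^bsub>G\<^esub> y = z then f x \<otimes> g y else \<zero>)"
  proof (intro finsum_cong' refl)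
    fix x assume x: "x \<in> support R f"
    then have xG: "x \<in> carrier G" using f' by auto
    have "f x \<otimes> lin_map R ?A (\<lambda>y. basis_elem R (x \<otimes>\<^bsub>G\<^esub> y)) g z
      = (\<Oplus>y\<in>support R g. f x \<otimes> (g y \<otimes> basis_elem R (x \<otimes>\<^bsub>G\<^esub> y) z))"
      unfolding inner_z[OF xG] using f' g' by (intro finsum_rdistr) (auto simp: basis_elem_def)
    also have "\<dots> = (\<Oplus>y\<in>support R g. if x \<otimes>\<^bsub>G\<^esub> y = z then f x \<otimes> g y else \<zero>)"
      using f' g' by (intro finsum_cong') (auto simp: basis_elem_def)
    finally show "f x \<otimes> lin_map R ?A (\<lambda>y. basis_elem R (x \<otimes>\<^bsub>G\<^esub> y)) g z
      = (\<Oplus>y\<in>support R g. if x \<otimes>\<^bsub>G\<^esub> y = z then f x \<otimes> g y else \<zero>)" .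
  qed (use f' g' in \<open>auto intro!: finsum_closed\<close>)
  also have "\<dots> = (\<Oplus>p\<in>support R f \<times> support R g.
      if fst p \<otimes>\<^bsub>G\<^esub> snd p = z then f (fst p) \<otimes> g (snd p) else \<zero>)"
  proof -
    have "(\<Oplus>p\<in>support R f \<times> support R g.
        if fst p \<otimes>\<^bsub>G\<^esub> snd p = z then f (fst p) \<otimes> g (snd p) else \<zero>)
      = (\<Oplus>x\<in>support R f. \<Oplus>y\<in>support R g.
        if fst (x, y) \<otimes>\<^bsub>G\<^esub> snd (x, y) = z then f (fst (x, y)) \<otimes> g (snd (x, y)) else \<zero>)"
      using f' g' by (intro finsum_Times) auto
    then show ?thesis by (simp only: fst_conv snd_conv)
  qed
  \<comment> \<open>Pairs whose product is not \<open>z\<close> contribute zero; dropping them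
    leaves exactly the index set of the convolution.\<close>
  also have "\<dots> = (\<Oplus>p\<in>{p \<in> support R f \<times> support R g. fst p \<otimes>\<^bsub>G\<^esub> snd p = z}. f (fst p) \<otimes> g (snd p))"
    using f' g' by (intro add.finprod_mono_neutral_cong_right) auto
  finally show "(f \<otimes>\<^bsub>?A\<^esub> g) z = ?r z" by (simp add: monoid_algebra_def)
qed

lemma monoid_algebra_mult_closed:
  assumes G: "monoid G" and f: "f \<in> carrier (monoid_algebra R G)" and g: "g \<in> carrier (monoid_algebra R G)"
  shows "f \<otimes>\<^bsub>monoid_algebra R G\<^esub> g \<in> carrier (monoid_algebra R G)"
proof -
  interpret G: monoid G by (rule G)
  show ?thesis
    unfolding monoid_algebra_mult_eq[OF assms]
    by (intro lin_map_closed[where G = G] module_monoid_algebra basis_elem_closed G.m_closed f g)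
qed

lemma monoid_algebra_mult_hom_left:
  assumes G: "monoid G" and g: "g \<in> carrier (monoid_algebra R G)"
  shows "(\<lambda>f. f \<otimes>\<^bsub>monoid_algebra R G\<^esub> g) \<in> module_hom R (monoid_algebra R G) (monoid_algebra R G)"
proof -
  let ?A = "monoid_algebra R G"
  interpret G: monoid G by (rule G)
  interpret A: module R ?A by (rule module_monoid_algebra)
  define \<phi> where "\<phi> x = lin_map R ?A (\<lambda>y. basis_elem R (x \<otimes>\<^bsub>G\<^esub> y)) g" for x
  have \<phi>: "\<phi> x \<in> carrier ?A" if "x \<in> carrier G" for x
    unfolding \<phi>_def
    by (intro lin_map_closed[where G = G] module_monoid_algebra basis_elem_closed G.m_closed g that)
  have hom: "lin_map R ?A \<phi> \<in> module_hom R ?A ?A"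
    by (rule lin_map_module_hom[OF module_monoid_algebra \<phi>])
  have eq: "f \<otimes>\<^bsub>?A\<^esub> g = lin_map R ?A \<phi> f" if "f \<in> carrier ?A" for f
    unfolding \<phi>_def[abs_def] by (rule monoid_algebra_mult_eq[OF G that g])
  show ?thesis
    using module_homD[OF hom] by (intro module_homI) (simp_all add: eq)
qed

text \<open>The right factor sits in the inner \<open>lin_map\<close>, under the sum over the
  support of \<open>f\<close>. Linearity holds there term by term and is then carried through the
  sum.\<close>

lemma monoid_algebra_mult_hom_right:
  assumes G: "monoid G" and f: "f \<in> carrier (monoid_algebra R G)"
  shows "(\<lambda>g. f \<otimes>\<^bsub>monoid_algebra R G\<^esub> g) \<in> module_hom R (monoid_algebra R G) (monoid_algebra R G)"
proof -
  let ?A = "monoid_algebra R G"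
  interpret G: monoid G by (rule G)
  interpret A: module R ?A by (rule module_monoid_algebra)
  define \<phi> where "\<phi> g x = lin_map R ?A (\<lambda>y. basis_elem R (x \<otimes>\<^bsub>G\<^esub> y)) g" for x g
  note f' = monoid_algebraD[OF f]
  have hom: "(\<lambda>g. \<phi> g x) \<in> module_hom R ?A ?A" if "x \<in> carrier G" for x
    unfolding \<phi>_def
    by (rule lin_map_module_hom[OF module_monoid_algebra]) (use that in \<open>simp add: basis_elem_closed\<close>)
  have eq: "f \<otimes>\<^bsub>?A\<^esub> g = (\<Oplus>\<^bsub>?A\<^esub>x\<in>support R f. f x \<odot>\<^bsub>?A\<^esub> \<phi> g x)" if "g \<in> carrier ?A" for g
    unfolding \<phi>_def using monoid_algebra_mult_eq[OF G f that] by (simp only: lin_map_def[of R ?A _ f])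
  show ?thesis
  proof (rule module_homI)
    fix g h assume g: "g \<in> carrier ?A" and h: "h \<in> carrier ?A"
    show "f \<otimes>\<^bsub>?A\<^esub> g \<in> carrier ?A" by (rule monoid_algebra_mult_closed[OF G f g])
    have "f \<otimes>\<^bsub>?A\<^esub> (g \<oplus>\<^bsub>?A\<^esub> h) = (\<Oplus>\<^bsub>?A\<^esub>x\<in>support R f. f x \<odot>\<^bsub>?A\<^esub> \<phi> g x \<oplus>\<^bsub>?A\<^esub> f x \<odot>\<^bsub>?A\<^esub> \<phi> h x)"
      unfolding eq[OF A.add.m_closed[OF g h]]
      using f' module_homD[OF hom] g h by (intro A.finsum_cong') (auto simp: A.smult_r_distr subset_iff)
    also have "\<dots> = f \<otimes>\<^bsub>?A\<^esub> g \<oplus>\<^bsub>?A\<^esub> f \<otimes>\<^bsub>?A\<^esub> h"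
      unfolding eq[OF g] eq[OF h]
      using f' module_homD[OF hom] g h by (intro A.finsum_addf) auto
    finally show "f \<otimes>\<^bsub>?A\<^esub> (g \<oplus>\<^bsub>?A\<^esub> h) = f \<otimes>\<^bsub>?A\<^esub> g \<oplus>\<^bsub>?A\<^esub> f \<otimes>\<^bsub>?A\<^esub> h" .
    fix a assume a: "a \<in> carrier R"
    have "f \<otimes>\<^bsub>?A\<^esub> (a \<odot>\<^bsub>?A\<^esub> g) = (\<Oplus>\<^bsub>?A\<^esub>x\<in>support R f. a \<odot>\<^bsub>?A\<^esub> (f x \<odot>\<^bsub>?A\<^esub> \<phi> g x))"
      unfolding eq[OF A.smult_closed[OF a g]]
      using f' module_homD[OF hom] g a
      by (intro A.finsum_cong') (auto simp: A.smult_assoc1[symmetric] m_comm subset_iff)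
    also have "\<dots> = a \<odot>\<^bsub>?A\<^esub> (f \<otimes>\<^bsub>?A\<^esub> g)"
      unfolding eq[OF g]
      using f' module_homD[OF hom] g a by (intro A.finsum_smult_ldistr[symmetric]) auto
    finally show "f \<otimes>\<^bsub>?A\<^esub> (a \<odot>\<^bsub>?A\<^esub> g) = a \<odot>\<^bsub>?A\<^esub> (f \<otimes>\<^bsub>?A\<^esub> g)" .
  qed
qed

lemma monoid_algebra_basis_mult:
  assumes G: "monoid G" and x: "x \<in> carrier G" and y: "y \<in> carrier G"
  shows "basis_elem R x \<otimes>\<^bsub>monoid_algebra R G\<^esub> basis_elem R y = basis_elem R (x \<otimes>\<^bsub>G\<^esub> y)"
proof -
  interpret G: monoid G by (rule G)
  let ?A = "monoid_algebra R G"
  have 1: "lin_map R ?A (\<lambda>y. basis_elem R (x \<otimes>\<^bsub>G\<^esub> y)) (basis_elem R y) = basis_elem R (x \<otimes>\<^bsub>G\<^esub> y)"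
    if "x \<in> carrier G" for x
    using that y by (intro lin_map_basis[where G = G] module_monoid_algebra basis_elem_closed) auto
  have "basis_elem R x \<otimes>\<^bsub>?A\<^esub> basis_elem R y =
    lin_map R ?A (\<lambda>x. lin_map R ?A (\<lambda>y. basis_elem R (x \<otimes>\<^bsub>G\<^esub> y)) (basis_elem R y)) (basis_elem R x)"
    by (intro monoid_algebra_mult_eq[OF G] basis_elem_closed x y)
  also have "\<dots> = lin_map R ?A (\<lambda>y. basis_elem R (x \<otimes>\<^bsub>G\<^esub> y)) (basis_elem R y)"
    using 1 y x by (intro lin_map_basis[where G = G] module_monoid_algebra) (auto simp: basis_elem_closed)
  also have "\<dots> = basis_elem R (x \<otimes>\<^bsub>G\<^esub> y)" by (rule 1[OF x])
  finally show ?thesis .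
qed

text \<open>Commutativity, associativity and the unit law are equalities of maps linear in each
  argument, so nested uses of \<open>monoid_algebra_hom_eqI\<close> reduce them to the corresponding
  laws of \<open>G\<close>.\<close>

lemma algebra_monoid_algebra:
  assumes "comm_monoid G"
  shows "algebra R (monoid_algebra R G)"
proof -
  interpret G: comm_monoid G by fact
  let ?A = "monoid_algebra R G"
  interpret A: module R ?A by (rule module_monoid_algebra)
  note G = G.monoid_axioms
  note cl = monoid_algebra_mult_closed[OF G]
  note l = module_homD[OF monoid_algebra_mult_hom_left[OF G]]
  note r = module_homD[OF monoid_algebra_mult_hom_right[OF G]]
  note bc = basis_elem_closed[where G = G]
  have comp: "(\<lambda>f. k (h f)) \<in> module_hom R ?A ?A"
    if "h \<in> module_hom R ?A ?A" "k \<in> module_hom R ?A ?A" for h k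
    using module_homD[OF that(1)] module_homD[OF that(2)] by (intro module_homI) auto
  have eqI: "h f = k f" if "h \<in> module_hom R ?A ?A" "k \<in> module_hom R ?A ?A"
    "\<And>x. x \<in> carrier G \<Longrightarrow> h (basis_elem R x) = k (basis_elem R x)" "f \<in> carrier ?A" for h k f
    by (rule monoid_algebra_hom_eqI[OF module_monoid_algebra that])
  have idh: "(\<lambda>f. f) \<in> module_hom R ?A ?A" by (rule module_homI) simp_all
  have bm: "basis_elem R x \<otimes>\<^bsub>?A\<^esub> basis_elem R y = basis_elem R (x \<otimes>\<^bsub>G\<^esub> y)"
    if "x \<in> carrier G" "y \<in> carrier G" for x y
    using monoid_algebra_basis_mult[OF G that] .
  note hl = monoid_algebra_mult_hom_left[OF G] and hr = monoid_algebra_mult_hom_right[OF G]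
  have comm: "f \<otimes>\<^bsub>?A\<^esub> g = g \<otimes>\<^bsub>?A\<^esub> f" if f: "f \<in> carrier ?A" and g: "g \<in> carrier ?A" for f g
  proof (rule eqI[OF hl[OF g] hr[OF g] _ f])
    fix x assume x: "x \<in> carrier G"
    show "basis_elem R x \<otimes>\<^bsub>?A\<^esub> g = g \<otimes>\<^bsub>?A\<^esub> basis_elem R x"
      by (rule eqI[OF hr[OF bc[OF x]] hl[OF bc[OF x]] _ g]) (simp add: bm x G.m_comm)
  qed
  have assoc: "f \<otimes>\<^bsub>?A\<^esub> g \<otimes>\<^bsub>?A\<^esub> h = f \<otimes>\<^bsub>?A\<^esub> (g \<otimes>\<^bsub>?A\<^esub> h)"
    if f: "f \<in> carrier ?A" and g: "g \<in> carrier ?A" and h: "h \<in> carrier ?A" for f g h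
  proof (rule eqI[OF comp[OF hl[OF g] hl[OF h]] hl[OF cl[OF g h]] _ f])
    fix x assume x: "x \<in> carrier G"
    show "basis_elem R x \<otimes>\<^bsub>?A\<^esub> g \<otimes>\<^bsub>?A\<^esub> h = basis_elem R x \<otimes>\<^bsub>?A\<^esub> (g \<otimes>\<^bsub>?A\<^esub> h)"
    proof (rule eqI[OF comp[OF hr[OF bc[OF x]] hl[OF h]] comp[OF hl[OF h] hr[OF bc[OF x]]] _ g])
      fix y assume y: "y \<in> carrier G"
      show "basis_elem R x \<otimes>\<^bsub>?A\<^esub> basis_elem R y \<otimes>\<^bsub>?A\<^esub> h = basis_elem R x \<otimes>\<^bsub>?A\<^esub> (basis_elem R y \<otimes>\<^bsub>?A\<^esub> h)"
        by (rule eqI[OF hr[OF cl[OF bc[OF x] bc[OF y]]] comp[OF hr[OF bc[OF y]] hr[OF bc[OF x]]] _ h])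
          (simp add: bm x y G.m_assoc)
    qed
  qed
  have one: "\<one>\<^bsub>?A\<^esub> \<otimes>\<^bsub>?A\<^esub> f = f" if f: "f \<in> carrier ?A" for f
    unfolding monoid_algebra_simps(2)
    by (rule eqI[OF hr[OF bc[OF G.one_closed]] idh _ f]) (simp add: bm)
  have "comm_monoid ?A"
    by (rule comm_monoidI) (use cl assoc one comm bc[OF G.one_closed] in \<open>simp_all add: monoid_algebra_simps(2)\<close>)
  then have "cring ?A"
    by (intro cringI module_abelian_group[OF module_monoid_algebra] l(2))
  then show ?thesis
    using l(3) A.smult_l_distr A.smult_r_distr A.smult_assoc1 by (intro algebraI is_cring) auto
qed

text \<open>Both sides of the product rule are linear in each factor, so it suffices that
  \<open>\<phi>\<close> is multiplicative on \<open>G\<close>.\<close>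

lemma lin_map_algebra_hom:
  assumes "comm_monoid G" "algebra R A"
    and \<phi>: "\<And>x. x \<in> carrier G \<Longrightarrow> \<phi> x \<in> carrier A"
    and one: "\<phi> \<one>\<^bsub>G\<^esub> = \<one>\<^bsub>A\<^esub>"
    and mult: "\<And>x y. x \<in> carrier G \<Longrightarrow> y \<in> carrier G \<Longrightarrow> \<phi> (x \<otimes>\<^bsub>G\<^esub> y) = \<phi> x \<otimes>\<^bsub>A\<^esub> \<phi> y"
  shows "lin_map R A \<phi> \<in> algebra_hom R (monoid_algebra R G) A"
proof -
  interpret G: comm_monoid G by fact
  interpret A: algebra R A by fact
  let ?P = "monoid_algebra R G"
  let ?h = "lin_map R A \<phi>"
  have A: "module R A" by (rule A.module_axioms)
  interpret P: algebra R ?P by (rule algebra_monoid_algebra[OF assms(1)])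
  have hom: "?h \<in> module_hom R ?P A" by (rule lin_map_module_hom[OF A \<phi>])
  note h = module_homD[OF hom]
  note hl = monoid_algebra_mult_hom_left[OF G.monoid_axioms] and hr = monoid_algebra_mult_hom_right[OF G.monoid_axioms]
  have comp: "(\<lambda>f. ?h (k f)) \<in> module_hom R ?P A" if "k \<in> module_hom R ?P ?P" for k
    using module_homD[OF that] h by (intro module_homI) auto
  have ml: "(\<lambda>f. ?h f \<otimes>\<^bsub>A\<^esub> a) \<in> module_hom R ?P A" if "a \<in> carrier A" for a
    using h that by (intro module_homI) (auto simp: A.l_distr A.smult_assoc2)
  \<comment> \<open>The algebra axioms move scalars out of the left factor only; commutativity
    supplies the right one.\<close>
  have mr: "(\<lambda>f. a \<otimes>\<^bsub>A\<^esub> ?h f) \<in> module_hom R ?P A" if a: "a \<in> carrier A" for a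
  proof (rule module_homI)
    fix c f assume c: "c \<in> carrier R" and f: "f \<in> carrier ?P"
    have "a \<otimes>\<^bsub>A\<^esub> (c \<odot>\<^bsub>A\<^esub> ?h f) = (c \<odot>\<^bsub>A\<^esub> ?h f) \<otimes>\<^bsub>A\<^esub> a" using a c h(1)[OF f] by (intro A.m_comm) auto
    also have "\<dots> = c \<odot>\<^bsub>A\<^esub> (?h f \<otimes>\<^bsub>A\<^esub> a)" using a c h(1)[OF f] by (rule_tac A.smult_assoc2)
    also have "?h f \<otimes>\<^bsub>A\<^esub> a = a \<otimes>\<^bsub>A\<^esub> ?h f" using a h(1)[OF f] by (intro A.m_comm) auto
    finally show "a \<otimes>\<^bsub>A\<^esub> ?h (c \<odot>\<^bsub>?P\<^esub> f) = c \<odot>\<^bsub>A\<^esub> (a \<otimes>\<^bsub>A\<^esub> ?h f)" using h(3)[OF c f] by simp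
  qed (use h a in \<open>auto simp: A.r_distr\<close>)
  note bc = basis_elem_closed[where G = G]
  have b: "?h (basis_elem R x) = \<phi> x" if "x \<in> carrier G" for x
    by (rule lin_map_basis[OF A \<phi> that])
  have "?h (f \<otimes>\<^bsub>?P\<^esub> g) = ?h f \<otimes>\<^bsub>A\<^esub> ?h g" if f: "f \<in> carrier ?P" and g: "g \<in> carrier ?P" for f g
  proof (rule monoid_algebra_hom_eqI[OF A comp[OF hl[OF g]] ml[OF h(1)[OF g]] _ f])
    fix x assume x: "x \<in> carrier G"
    show "?h (basis_elem R x \<otimes>\<^bsub>?P\<^esub> g) = ?h (basis_elem R x) \<otimes>\<^bsub>A\<^esub> ?h g"
    proof (rule monoid_algebra_hom_eqI[OF A comp[OF hr[OF bc[OF x]]] mr[OF h(1)[OF bc[OF x]]] _ g])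
      fix y assume y: "y \<in> carrier G"
      show "?h (basis_elem R x \<otimes>\<^bsub>?P\<^esub> basis_elem R y) = ?h (basis_elem R x) \<otimes>\<^bsub>A\<^esub> ?h (basis_elem R y)"
        using x y by (simp add: monoid_algebra_basis_mult[OF G.monoid_axioms] b mult)
    qed
  qed
  moreover have "?h \<one>\<^bsub>?P\<^esub> = \<one>\<^bsub>A\<^esub>" using b[OF G.one_closed] one by (simp add: monoid_algebra_simps(2))
  ultimately show ?thesis
    using h by (auto simp: algebra_hom_def Ring.ring_hom_def)
qed

end

section \<open>Quotient modules\<close>

lemma (in abelian_group) minus_zero_iff:
  assumes "a \<in> carrier G" "b \<in> carrier G"
  shows "a \<ominus> b = \<zero> \<longleftrightarrow> a = b"
proof
  assume "a \<ominus> b = \<zero>"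
  then have "\<ominus> (\<ominus> b) = a" using assms by (intro minus_equality) (auto simp: minus_eq)
  then show "a = b" using assms by simp
qed (use assms in \<open>simp add: minus_eq r_neg\<close>)

text \<open>Adding a scalar multiplication to a ring record gives a different term with the same
  operations. The ring axioms are carried over to such terms by this lemma.\<close>

lemma cring_cong:
  assumes "cring R" "carrier S = carrier R"
    "\<And>x y. x \<in> carrier R \<Longrightarrow> y \<in> carrier R \<Longrightarrow> x \<oplus>\<^bsub>S\<^esub> y = x \<oplus>\<^bsub>R\<^esub> y"
    "\<And>x y. x \<in> carrier R \<Longrightarrow> y \<in> carrier R \<Longrightarrow> x \<otimes>\<^bsub>S\<^esub> y = x \<otimes>\<^bsub>R\<^esub> y"
    "\<zero>\<^bsub>S\<^esub> = \<zero>\<^bsub>R\<^esub>" "\<one>\<^bsub>S\<^esub> = \<one>\<^bsub>R\<^esub>"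
  shows "cring S"
proof -
  interpret R: cring R by fact
  have "abelian_group S"
    by (rule abelian_groupI) (auto simp: assms R.a_ac intro: R.l_neg)
  moreover have "comm_monoid S"
    by (rule comm_monoidI) (auto simp: assms R.m_ac)
  ultimately show ?thesis
    by (rule cringI) (auto simp: assms R.l_distr)
qed

lemma quotient_algebra_simps:
  "carrier (quotient_algebra A K) = a_rcosets\<^bsub>A\<^esub> K"
  "\<one>\<^bsub>quotient_algebra A K\<^esub> = K +>\<^bsub>A\<^esub> \<one>\<^bsub>A\<^esub>"
  "\<zero>\<^bsub>quotient_algebra A K\<^esub> = K"
  "U \<oplus>\<^bsub>quotient_algebra A K\<^esub> V = U <+>\<^bsub>A\<^esub> V"
  "U \<otimes>\<^bsub>quotient_algebra A K\<^esub> V = rcoset_mult A K U V"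
  "a \<odot>\<^bsub>quotient_algebra A K\<^esub> U = (\<Union>x\<in>U. K +>\<^bsub>A\<^esub> (a \<odot>\<^bsub>A\<^esub> x))"
  by (simp_all add: quotient_algebra_def FactRing_def ring.defs)

locale quotient_module = module R M for R and M :: "('r, 'm, 'y) module_scheme" (structure) +
  fixes K assumes K: "submodule K R M"
begin

abbreviation "Q \<equiv> quotient_algebra M K"
abbreviation "proj x \<equiv> K +>\<^bsub>M\<^esub> x"

lemma K_closed: "x \<in> K \<Longrightarrow> x \<in> carrier M"
  using submoduleE(1)[OF K] by auto

lemma K_abelian_subgroup: "abelian_subgroup K M"
proof (rule abelian_subgroupI3)
  show "additive_subgroup K M" using K by (intro additive_subgroup.intro) (rule submodule.axioms)
  show "abelian_group M" by (rule module_abelian_group[OF module_axioms])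
qed

lemma carrier_quotient: "carrier Q = (\<lambda>x. proj x) ` carrier M"
  by (auto simp: quotient_algebra_simps A_RCOSETS_def')

lemma proj_closed: "x \<in> carrier M \<Longrightarrow> proj x \<in> carrier Q"
  by (auto simp: carrier_quotient)

lemma proj_add: "x \<in> carrier M \<Longrightarrow> y \<in> carrier M \<Longrightarrow> proj (x \<oplus>\<^bsub>M\<^esub> y) = proj x \<oplus>\<^bsub>Q\<^esub> proj y"
  by (simp add: quotient_algebra_simps abelian_subgroup.a_rcos_sum[OF K_abelian_subgroup])

lemma mem_proj_iff: "x \<in> carrier M \<Longrightarrow> y \<in> carrier M \<Longrightarrow> y \<in> proj x \<longleftrightarrow> y \<ominus>\<^bsub>M\<^esub> x \<in> K"
  by (simp add: abelian_subgroup.a_rcos_module[OF K_abelian_subgroup] M.minus_eq)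

lemma mem_projD: "y \<in> proj x \<Longrightarrow> x \<in> carrier M \<Longrightarrow> y \<in> carrier M"
  using K_closed by (auto simp: a_r_coset_def')

lemma proj_self: "x \<in> carrier M \<Longrightarrow> x \<in> proj x"
  using abelian_subgroup.a_rcos_self[OF K_abelian_subgroup] .

lemma proj_eqI:
  assumes "x \<in> carrier M" "y \<in> carrier M" "x \<ominus>\<^bsub>M\<^esub> y \<in> K"
  shows "proj x = proj y"
  using abelian_subgroup.a_repr_independence'[OF K_abelian_subgroup, of x y] assms mem_proj_iff[of y x] by simp

lemma proj_K: "x \<in> K \<Longrightarrow> proj x = \<zero>\<^bsub>Q\<^esub>"
  using abelian_subgroup.a_rcos_const[OF K_abelian_subgroup] by (simp add: quotient_algebra_simps)

text \<open>The scalar product of the quotient is a union of cosets over all representatives. These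
  cosets coincide, and the coset \<open>proj x\<close> that indexes them is nonempty, so the union
  is one of them.\<close>

lemma proj_smult:
  assumes a: "a \<in> carrier R" and x: "x \<in> carrier M"
  shows "proj (a \<odot>\<^bsub>M\<^esub> x) = a \<odot>\<^bsub>Q\<^esub> proj x"
proof -
  have "proj (a \<odot>\<^bsub>M\<^esub> y) = proj (a \<odot>\<^bsub>M\<^esub> x)" if y: "y \<in> proj x" for y
  proof (rule proj_eqI)
    have yM: "y \<in> carrier M" using mem_projD y x .
    then show "a \<odot>\<^bsub>M\<^esub> y \<in> carrier M" "a \<odot>\<^bsub>M\<^esub> x \<in> carrier M" using a x by auto
    have "a \<odot>\<^bsub>M\<^esub> y \<ominus>\<^bsub>M\<^esub> a \<odot>\<^bsub>M\<^esub> x = a \<odot>\<^bsub>M\<^esub> (y \<ominus>\<^bsub>M\<^esub> x)"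
      using a x yM by (simp add: M.minus_eq smult_r_distr smult_r_minus)
    then show "a \<odot>\<^bsub>M\<^esub> y \<ominus>\<^bsub>M\<^esub> a \<odot>\<^bsub>M\<^esub> x \<in> K"
      using y x yM mem_proj_iff submoduleE(4)[OF K a] by simp
  qed
  moreover have "proj x \<noteq> {}" using proj_self[OF x] by blast
  ultimately have "(\<Union>y\<in>proj x. proj (a \<odot>\<^bsub>M\<^esub> y)) = proj (a \<odot>\<^bsub>M\<^esub> x)" by (rule SUP_eq_const[rotated])
  then show ?thesis unfolding quotient_algebra_simps(6) by (rule sym)
qed

lemma quotient_elim:
  assumes "U \<in> carrier Q"
  obtains x where "x \<in> carrier M" "U = proj x"
  using assms by (auto simp: carrier_quotient)

lemma module_quotient: "module R Q"
proof (rule moduleI)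
  have zero: "\<zero>\<^bsub>Q\<^esub> = proj \<zero>\<^bsub>M\<^esub>"
    using proj_K[of "\<zero>\<^bsub>M\<^esub>"] additive_subgroup.zero_closed[OF abelian_subgroup.axioms(1)[OF K_abelian_subgroup]] by simp
  show "abelian_group Q"
  proof (rule abelian_groupI)
    fix U assume "U \<in> carrier Q"
    then obtain x where x: "x \<in> carrier M" "U = proj x" by (rule quotient_elim)
    have "proj (\<ominus>\<^bsub>M\<^esub> x) \<oplus>\<^bsub>Q\<^esub> U = \<zero>\<^bsub>Q\<^esub>"
      using x by (simp add: zero proj_add[symmetric] M.l_neg)
    then show "\<exists>V\<in>carrier Q. V \<oplus>\<^bsub>Q\<^esub> U = \<zero>\<^bsub>Q\<^esub>" using x proj_closed by blast
  qed (auto elim!: quotient_elim simp: zero proj_add[symmetric] proj_closed M.a_ac)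
qed (auto elim!: quotient_elim simp: proj_add[symmetric] proj_smult[symmetric] proj_closed
    smult_l_distr smult_r_distr smult_assoc1 R.is_cring)

lemma proj_hom: "(\<lambda>x. proj x) \<in> module_hom R M Q"
  by (intro module_homI proj_closed proj_add proj_smult)

text \<open>A map that vanishes on \<open>K\<close> is constant on cosets, so the lift can be read
  off at a representative picked by \<open>SOME\<close>.\<close>

lemma quotient_lift:
  assumes N: "module R N" and h: "h \<in> module_hom R M N" and zero: "\<And>x. x \<in> K \<Longrightarrow> h x = \<zero>\<^bsub>N\<^esub>"
  shows "\<exists>t\<in>module_hom R Q N. \<forall>x\<in>carrier M. t (proj x) = h x"
proof -
  interpret N: module R N by (rule N)
  note h' = module_homD[OF h]
  have const: "h y = h x" if x: "x \<in> carrier M" and y: "y \<in> proj x" for x y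
  proof -
    have yM: "y \<in> carrier M" using mem_projD y x .
    have "h (y \<ominus>\<^bsub>M\<^esub> x) = h y \<ominus>\<^bsub>N\<^esub> h x"
      using h' x yM by (intro additive_minus module_abelian_group[OF module_axioms] module_abelian_group[OF N]) auto
    moreover have "h (y \<ominus>\<^bsub>M\<^esub> x) = \<zero>\<^bsub>N\<^esub>" using zero mem_proj_iff[OF x yM] y by simp
    ultimately have "h y \<ominus>\<^bsub>N\<^esub> h x = \<zero>\<^bsub>N\<^esub>" by simp
    then show ?thesis by (rule iffD1[OF N.minus_zero_iff[OF h'(1)[OF yM] h'(1)[OF x]]])
  qed
  define t where "t U = h (SOME y. y \<in> U)" for U
  have t: "t (proj x) = h x" if "x \<in> carrier M" for x
    unfolding t_def using const[OF that someI[of "\<lambda>y. y \<in> proj x", OF proj_self[OF that]]] .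
  have "t \<in> module_hom R Q N"
    by (rule module_homI) (auto elim!: quotient_elim simp: proj_add[symmetric] proj_smult[symmetric] t h')
  then show ?thesis using t by blast
qed

end

context module
begin

text \<open>Together with \<open>submodule_generated_least\<close> this extends a property from
  generators to the submodule they generate: that a linear map kills the tensor relations, or sends
  them into the kernel, need only be checked on the relations.\<close>

lemma submodule_hom_preimage:
  assumes "module R N" "h \<in> module_hom R M N" "submodule H R N"
  shows "submodule {x \<in> carrier M. h x \<in> H} R M"
proof -
  interpret N: module R N by fact
  note h = module_homD[OF assms(2)] and H = N.submoduleE[OF assms(3)]
  have ag: "abelian_group M" "abelian_group N"
    by (rule module_abelian_group[OF module_axioms], rule module_abelian_group[OF N.module_axioms])
  have z: "h \<zero>\<^bsub>M\<^esub> = \<zero>\<^bsub>N\<^esub>" using h by (intro additive_zero[OF ag]) auto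
  have zH: "\<zero>\<^bsub>N\<^esub> \<in> H"
    using additive_subgroup.zero_closed[OF additive_subgroup.intro[OF submodule.axioms(1)[OF assms(3)]]] .
  have m: "h (\<ominus>\<^bsub>M\<^esub> x) = \<ominus>\<^bsub>N\<^esub> h x" if "x \<in> carrier M" for x
    using h that by (intro additive_uminus[OF ag]) auto
  show ?thesis by (rule submoduleI) (auto simp: z zH m h H)
qed

lemma submodule_zero: "submodule {\<zero>\<^bsub>M\<^esub>} R M"
  by (rule submoduleI) auto

lemma submodule_generated_submodule:
  assumes "B \<subseteq> carrier M"
  shows "submodule (submodule_generated R M B) R M"
proof (rule submoduleI)
  have C: "submodule (carrier M) R M" by (rule carrier_is_submodule)
  show "submodule_generated R M B \<subseteq> carrier M"
    using C assms by (auto simp: submodule_generated_def)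
  show "\<zero>\<^bsub>M\<^esub> \<in> submodule_generated R M B"
    unfolding submodule_generated_def
    using additive_subgroup.zero_closed[OF additive_subgroup.intro[OF submodule.axioms(1)]] by auto
qed (use submoduleE in \<open>auto simp: submodule_generated_def\<close>)

lemma submodule_generated_superset: "B \<subseteq> submodule_generated R M B"
  by (auto simp: submodule_generated_def)

lemma submodule_generated_least: "submodule H R M \<Longrightarrow> B \<subseteq> H \<Longrightarrow> submodule_generated R M B \<subseteq> H"
  by (auto simp: submodule_generated_def)

end

text \<open>A scalar \<open>a\<close> acts as multiplication by the element
  \<open>a \<odot> \<one>\<close> of the algebra.\<close>

lemma (in algebra) ideal_submodule:
  assumes "ideal J M"
  shows "submodule J R M"
proof (rule submoduleI)
  interpret J: ideal J M by fact
  fix a p assume a: "a \<in> carrier R" and p: "p \<in> J"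
  have pM: "p \<in> carrier M" using p J.a_subset by auto
  have "a \<odot>\<^bsub>M\<^esub> p = (a \<odot>\<^bsub>M\<^esub> \<one>\<^bsub>M\<^esub>) \<otimes>\<^bsub>M\<^esub> p" using a pM smult_assoc2[of a "\<one>\<^bsub>M\<^esub>" p] by simp
  also have "\<dots> \<in> J" using a p by (intro J.I_l_closed) auto
  finally show "a \<odot>\<^bsub>M\<^esub> p \<in> J" .
qed (use ideal.axioms(1)[OF assms] additive_subgroup.a_subset additive_subgroup.zero_closed
    additive_subgroup.a_inv_closed additive_subgroup.a_closed in \<open>auto intro: abelian_group_axioms\<close>)

section \<open>Tensor products\<close>

locale tensor = M: module R M + N: module R N
  for R :: "('r, 'x) ring_scheme" (structure)
    and M :: "('r, 'm, 'y) module_scheme" and N :: "('r, 'n, 'z) module_scheme"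
begin

abbreviation "F \<equiv> tensor_free R M N"
abbreviation "ker \<equiv> tensor_kernel R M N"
abbreviation "T \<equiv> tensor_product R M N"
abbreviation "pure m n \<equiv> pure_tensor R M N m n"

sublocale F: module R F
  unfolding tensor_free_def by (rule M.R.module_monoid_algebra)

lemma basis_closed: "m \<in> carrier M \<Longrightarrow> n \<in> carrier N \<Longrightarrow> basis_elem R (m, n) \<in> carrier F"
  unfolding tensor_free_def by (rule M.R.basis_elem_closed) simp

lemma relations_closed: "tensor_relations R M N \<subseteq> carrier F"
  unfolding tensor_relations_def Let_def by (auto intro!: F.minus_closed F.add.m_closed basis_closed)

sublocale Q: quotient_module R F ker
  unfolding tensor_kernel_def
  by (intro quotient_module.intro quotient_module_axioms.intro F.module_axioms
      F.submodule_generated_submodule relations_closed)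

lemma T_eq: "T = quotient_algebra F ker"
  by (simp add: tensor_product_def)

lemma pure_eq: "pure m n = Q.proj (basis_elem R (m, n))"
  by (simp add: pure_tensor_def)

sublocale T: module R T
  unfolding T_eq by (rule Q.module_quotient)

lemma pure_closed: "m \<in> carrier M \<Longrightarrow> n \<in> carrier N \<Longrightarrow> pure m n \<in> carrier T"
  by (simp add: pure_eq T_eq Q.proj_closed basis_closed)

lemma relation_in_kernel: "x \<in> tensor_relations R M N \<Longrightarrow> x \<in> ker"
  using F.submodule_generated_superset by (auto simp: tensor_kernel_def)

lemma pure_add_left:
  assumes "m \<in> carrier M" "m' \<in> carrier M" "n \<in> carrier N"
  shows "pure (m \<oplus>\<^bsub>M\<^esub> m') n = pure m n \<oplus>\<^bsub>T\<^esub> pure m' n"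
proof -
  have "Q.proj (basis_elem R (m \<oplus>\<^bsub>M\<^esub> m', n)) = Q.proj (basis_elem R (m, n) \<oplus>\<^bsub>F\<^esub> basis_elem R (m', n))"
    using assms
    by (intro Q.proj_eqI relation_in_kernel F.add.m_closed basis_closed M.add.m_closed)
      (auto simp: tensor_relations_def Let_def)
  then show ?thesis using assms by (simp add: pure_eq T_eq Q.proj_add basis_closed)
qed

lemma pure_add_right:
  assumes "m \<in> carrier M" "n \<in> carrier N" "n' \<in> carrier N"
  shows "pure m (n \<oplus>\<^bsub>N\<^esub> n') = pure m n \<oplus>\<^bsub>T\<^esub> pure m n'"
proof -
  have "Q.proj (basis_elem R (m, n \<oplus>\<^bsub>N\<^esub> n')) = Q.proj (basis_elem R (m, n) \<oplus>\<^bsub>F\<^esub> basis_elem R (m, n'))"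
    using assms
    by (intro Q.proj_eqI relation_in_kernel F.add.m_closed basis_closed N.add.m_closed)
      (auto simp: tensor_relations_def Let_def)
  then show ?thesis using assms by (simp add: pure_eq T_eq Q.proj_add basis_closed)
qed

lemma pure_smult_left:
  assumes "a \<in> carrier R" "m \<in> carrier M" "n \<in> carrier N"
  shows "pure (a \<odot>\<^bsub>M\<^esub> m) n = a \<odot>\<^bsub>T\<^esub> pure m n"
proof -
  have "Q.proj (basis_elem R (a \<odot>\<^bsub>M\<^esub> m, n)) = Q.proj (a \<odot>\<^bsub>F\<^esub> basis_elem R (m, n))"
    using assms
    by (intro Q.proj_eqI relation_in_kernel F.smult_closed basis_closed M.smult_closed)
      (auto simp: tensor_relations_def Let_def)
  then show ?thesis using assms by (simp add: pure_eq T_eq Q.proj_smult basis_closed)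
qed

lemma pure_smult_right:
  assumes "a \<in> carrier R" "m \<in> carrier M" "n \<in> carrier N"
  shows "pure m (a \<odot>\<^bsub>N\<^esub> n) = a \<odot>\<^bsub>T\<^esub> pure m n"
proof -
  have "Q.proj (basis_elem R (m, a \<odot>\<^bsub>N\<^esub> n)) = Q.proj (a \<odot>\<^bsub>F\<^esub> basis_elem R (m, n))"
    using assms
    by (intro Q.proj_eqI relation_in_kernel F.smult_closed basis_closed N.smult_closed)
      (auto simp: tensor_relations_def Let_def)
  then show ?thesis using assms by (simp add: pure_eq T_eq Q.proj_smult basis_closed)
qed

lemma pure_zero_left: "n \<in> carrier N \<Longrightarrow> pure \<zero>\<^bsub>M\<^esub> n = \<zero>\<^bsub>T\<^esub>"
  using pure_smult_left[of "\<zero>\<^bsub>R\<^esub>" "\<zero>\<^bsub>M\<^esub>" n] by (simp add: pure_closed)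

text \<open>Scalars are absorbed into the left factor, and zero is the pure tensor of zeros, so sums
  of pure tensors already give everything.\<close>

lemma tensor_induct [consumes 1, case_names pure add]:
  assumes "u \<in> carrier T"
    and pure: "\<And>m n. m \<in> carrier M \<Longrightarrow> n \<in> carrier N \<Longrightarrow> P (pure m n)"
    and add: "\<And>u v. u \<in> carrier T \<Longrightarrow> v \<in> carrier T \<Longrightarrow> P u \<Longrightarrow> P v \<Longrightarrow> P (u \<oplus>\<^bsub>T\<^esub> v)"
  shows "P u"
proof -
  obtain f where f: "f \<in> carrier F" "u = Q.proj f" using assms(1) by (auto simp: T_eq Q.carrier_quotient)
  have "P (Q.proj f)" using f(1)[unfolded tensor_free_def]
  proof (induction rule: M.R.monoid_algebra_induct)
    case zero
    have "Q.proj \<zero>\<^bsub>F\<^esub> = pure \<zero>\<^bsub>M\<^esub> \<zero>\<^bsub>N\<^esub>"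
      using Q.proj_K[OF additive_subgroup.zero_closed[OF abelian_subgroup.axioms(1)[OF Q.K_abelian_subgroup]]]
      by (simp add: pure_zero_left T_eq)
    then show ?case using pure by (simp add: tensor_free_def)
  next
    case (step a x g)
    obtain m n where x: "x = (m, n)" "m \<in> carrier M" "n \<in> carrier N" using step(2) by auto
    have g: "g \<in> carrier F" using step(3) by (simp add: tensor_free_def)
    have "Q.proj (a \<odot>\<^bsub>F\<^esub> basis_elem R x \<oplus>\<^bsub>F\<^esub> g) = pure (a \<odot>\<^bsub>M\<^esub> m) n \<oplus>\<^bsub>T\<^esub> Q.proj g"
      using x step(1) g
      by (simp add: pure_smult_left Q.proj_add Q.proj_smult basis_closed) (simp add: T_eq pure_eq)
    moreover have "P (pure (a \<odot>\<^bsub>M\<^esub> m) n \<oplus>\<^bsub>T\<^esub> Q.proj g)"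
      using x step(1,4) g by (intro add pure pure_closed) (auto simp: T_eq Q.proj_closed)
    ultimately show ?case by (simp add: tensor_free_def)
  qed
  then show ?thesis using f by simp
qed

text \<open>The linear extension of \<open>\<beta>\<close> to the free module kills each of the four
  kinds of relations exactly because \<open>\<beta>\<close> is bilinear, hence it kills the kernel
  and descends to the quotient.\<close>

lemma tensor_lift:
  assumes L: "module R L"
    and cl: "\<And>m n. m \<in> carrier M \<Longrightarrow> n \<in> carrier N \<Longrightarrow> \<beta> m n \<in> carrier L"
    and al: "\<And>m m' n. m \<in> carrier M \<Longrightarrow> m' \<in> carrier M \<Longrightarrow> n \<in> carrier N \<Longrightarrow>
      \<beta> (m \<oplus>\<^bsub>M\<^esub> m') n = \<beta> m n \<oplus>\<^bsub>L\<^esub> \<beta> m' n"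
    and ar: "\<And>m n n'. m \<in> carrier M \<Longrightarrow> n \<in> carrier N \<Longrightarrow> n' \<in> carrier N \<Longrightarrow>
      \<beta> m (n \<oplus>\<^bsub>N\<^esub> n') = \<beta> m n \<oplus>\<^bsub>L\<^esub> \<beta> m n'"
    and sl: "\<And>a m n. a \<in> carrier R \<Longrightarrow> m \<in> carrier M \<Longrightarrow> n \<in> carrier N \<Longrightarrow>
      \<beta> (a \<odot>\<^bsub>M\<^esub> m) n = a \<odot>\<^bsub>L\<^esub> \<beta> m n"
    and sr: "\<And>a m n. a \<in> carrier R \<Longrightarrow> m \<in> carrier M \<Longrightarrow> n \<in> carrier N \<Longrightarrow>
      \<beta> m (a \<odot>\<^bsub>N\<^esub> n) = a \<odot>\<^bsub>L\<^esub> \<beta> m n"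
  shows "\<exists>t\<in>module_hom R T L. \<forall>m\<in>carrier M. \<forall>n\<in>carrier N. t (pure m n) = \<beta> m n"
proof -
  interpret L: module R L by (rule L)
  define h where "h = lin_map R L (\<lambda>p. \<beta> (fst p) (snd p))"
  have hom: "h \<in> module_hom R F L"
    unfolding h_def tensor_free_def by (rule M.R.lin_map_module_hom[OF L]) (use cl in auto)
  note h' = module_homD[OF hom]
  have b: "h (basis_elem R (m, n)) = \<beta> m n" if "m \<in> carrier M" "n \<in> carrier N" for m n
    unfolding h_def using cl that by (subst M.R.lin_map_basis[OF L, where G = "M \<times>\<times> N"]) auto
  have mn: "h (x \<ominus>\<^bsub>F\<^esub> y) = h x \<ominus>\<^bsub>L\<^esub> h y" if "x \<in> carrier F" "y \<in> carrier F" for x y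
    by (rule additive_minus[OF module_abelian_group[OF F.module_axioms] module_abelian_group[OF L] _ _ that])
      (use h' in auto)
  have "tensor_relations R M N \<subseteq> {x \<in> carrier F. h x \<in> {\<zero>\<^bsub>L\<^esub>}}"
  proof
    fix x assume x: "x \<in> tensor_relations R M N"
    have "h x = \<zero>\<^bsub>L\<^esub>"
      using x unfolding tensor_relations_def Let_def
      by (auto simp: mn h' b basis_closed al ar sl sr cl L.minus_zero_iff)
    then show "x \<in> {x \<in> carrier F. h x \<in> {\<zero>\<^bsub>L\<^esub>}}" using x relations_closed by auto
  qed
  then have "ker \<subseteq> {x \<in> carrier F. h x \<in> {\<zero>\<^bsub>L\<^esub>}}"
    unfolding tensor_kernel_def
    by (intro F.submodule_generated_least F.submodule_hom_preimage[OF L hom] L.submodule_zero)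
  then obtain t where t: "t \<in> module_hom R T L" "\<forall>x\<in>carrier F. t (Q.proj x) = h x"
    using Q.quotient_lift[OF L hom] unfolding T_eq by blast
  have "t (pure m n) = \<beta> m n" if "m \<in> carrier M" "n \<in> carrier N" for m n
    using t(2) that by (simp add: pure_eq basis_closed b)
  then show ?thesis using t(1) by blast
qed

end

section \<open>Tensor products of algebras\<close>

locale algebra_tensor = A: algebra R A + B: algebra R B
  for R :: "('r, 'x) ring_scheme" (structure)
    and A :: "('r, 'm, 'y) module_scheme" and B :: "('r, 'n, 'z) module_scheme"
begin

sublocale tensor R A B ..

lemma comm_monoid_AB: "comm_monoid (A \<times>\<times> B)"
  by (rule comm_monoidI) (auto simp: A.m_ac B.m_ac)

sublocale FA: algebra R F
  unfolding tensor_free_def by (rule A.R.algebra_monoid_algebra[OF comm_monoid_AB])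

lemma basis_mult:
  assumes "a \<in> carrier A" "b \<in> carrier B" "a' \<in> carrier A" "b' \<in> carrier B"
  shows "basis_elem R (a, b) \<otimes>\<^bsub>F\<^esub> basis_elem R (a', b') = basis_elem R (a \<otimes>\<^bsub>A\<^esub> a', b \<otimes>\<^bsub>B\<^esub> b')"
  unfolding tensor_free_def
  using A.R.monoid_algebra_basis_mult[OF comm_monoid.axioms(1)[OF comm_monoid_AB], of "(a, b)" "(a', b')"] assms by simp

lemma mult_hom: "f \<in> carrier F \<Longrightarrow> (\<lambda>g. f \<otimes>\<^bsub>F\<^esub> g) \<in> module_hom R F F"
  unfolding tensor_free_def
  by (rule A.R.monoid_algebra_mult_hom_right[OF comm_monoid.axioms(1)[OF comm_monoid_AB]])

text \<open>Multiplication by a basis element carries each relation to a relation of the same kind,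
  hence preserves the submodule that the relations generate.\<close>

lemma kernel_mult_basis:
  assumes ab: "a \<in> carrier A" "b \<in> carrier B" and x: "x \<in> ker"
  shows "basis_elem R (a, b) \<otimes>\<^bsub>F\<^esub> x \<in> ker"
proof -
  let ?e = "basis_elem R (a, b)"
  note hom = mult_hom[OF basis_closed[OF ab]]
  note h = module_homD[OF hom]
  have mn: "?e \<otimes>\<^bsub>F\<^esub> (x \<ominus>\<^bsub>F\<^esub> y) = ?e \<otimes>\<^bsub>F\<^esub> x \<ominus>\<^bsub>F\<^esub> ?e \<otimes>\<^bsub>F\<^esub> y" if "x \<in> carrier F" "y \<in> carrier F" for x y
    using h that by (intro additive_minus[where h = "\<lambda>g. ?e \<otimes>\<^bsub>F\<^esub> g"] module_abelian_group[OF F.module_axioms]) auto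
  have Asm: "a \<otimes>\<^bsub>A\<^esub> (c \<odot>\<^bsub>A\<^esub> m) = c \<odot>\<^bsub>A\<^esub> (a \<otimes>\<^bsub>A\<^esub> m)" if "c \<in> carrier R" "m \<in> carrier A" for c m
    using that ab A.smult_assoc2[of c m a] by (simp add: A.m_comm)
  have Bsm: "b \<otimes>\<^bsub>B\<^esub> (c \<odot>\<^bsub>B\<^esub> m) = c \<odot>\<^bsub>B\<^esub> (b \<otimes>\<^bsub>B\<^esub> m)" if "c \<in> carrier R" "m \<in> carrier B" for c m
    using that ab B.smult_assoc2[of c m b] by (simp add: B.m_comm)
  have "tensor_relations R A B \<subseteq> {x \<in> carrier F. ?e \<otimes>\<^bsub>F\<^esub> x \<in> ker}"
  proof
    fix x assume x: "x \<in> tensor_relations R A B"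
    then consider
      (1) m m' n where "x = basis_elem R (m \<oplus>\<^bsub>A\<^esub> m', n) \<ominus>\<^bsub>F\<^esub> (basis_elem R (m, n) \<oplus>\<^bsub>F\<^esub> basis_elem R (m', n))"
        "m \<in> carrier A" "m' \<in> carrier A" "n \<in> carrier B"
    | (2) m n n' where "x = basis_elem R (m, n \<oplus>\<^bsub>B\<^esub> n') \<ominus>\<^bsub>F\<^esub> (basis_elem R (m, n) \<oplus>\<^bsub>F\<^esub> basis_elem R (m, n'))"
        "m \<in> carrier A" "n \<in> carrier B" "n' \<in> carrier B"
    | (3) c m n where "x = basis_elem R (c \<odot>\<^bsub>A\<^esub> m, n) \<ominus>\<^bsub>F\<^esub> (c \<odot>\<^bsub>F\<^esub> basis_elem R (m, n))"
        "c \<in> carrier R" "m \<in> carrier A" "n \<in> carrier B"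
    | (4) c m n where "x = basis_elem R (m, c \<odot>\<^bsub>B\<^esub> n) \<ominus>\<^bsub>F\<^esub> (c \<odot>\<^bsub>F\<^esub> basis_elem R (m, n))"
        "c \<in> carrier R" "m \<in> carrier A" "n \<in> carrier B"
      unfolding tensor_relations_def Let_def by blast
    then have "?e \<otimes>\<^bsub>F\<^esub> x \<in> tensor_relations R A B"
    proof cases
      case 1
      then have "?e \<otimes>\<^bsub>F\<^esub> x = basis_elem R (a \<otimes>\<^bsub>A\<^esub> m \<oplus>\<^bsub>A\<^esub> a \<otimes>\<^bsub>A\<^esub> m', b \<otimes>\<^bsub>B\<^esub> n) \<ominus>\<^bsub>F\<^esub>
          (basis_elem R (a \<otimes>\<^bsub>A\<^esub> m, b \<otimes>\<^bsub>B\<^esub> n) \<oplus>\<^bsub>F\<^esub> basis_elem R (a \<otimes>\<^bsub>A\<^esub> m', b \<otimes>\<^bsub>B\<^esub> n))"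
        using ab by (simp add: mn h(2) basis_closed basis_mult A.r_distr)
      then show ?thesis unfolding tensor_relations_def Let_def using 1 ab by blast
    next
      case 2
      then have "?e \<otimes>\<^bsub>F\<^esub> x = basis_elem R (a \<otimes>\<^bsub>A\<^esub> m, b \<otimes>\<^bsub>B\<^esub> n \<oplus>\<^bsub>B\<^esub> b \<otimes>\<^bsub>B\<^esub> n') \<ominus>\<^bsub>F\<^esub>
          (basis_elem R (a \<otimes>\<^bsub>A\<^esub> m, b \<otimes>\<^bsub>B\<^esub> n) \<oplus>\<^bsub>F\<^esub> basis_elem R (a \<otimes>\<^bsub>A\<^esub> m, b \<otimes>\<^bsub>B\<^esub> n'))"
        using ab by (simp add: mn h(2) basis_closed basis_mult B.r_distr)
      then show ?thesis unfolding tensor_relations_def Let_def using 2 ab by blast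
    next
      case 3
      then have "?e \<otimes>\<^bsub>F\<^esub> x = basis_elem R (c \<odot>\<^bsub>A\<^esub> (a \<otimes>\<^bsub>A\<^esub> m), b \<otimes>\<^bsub>B\<^esub> n) \<ominus>\<^bsub>F\<^esub>
          (c \<odot>\<^bsub>F\<^esub> basis_elem R (a \<otimes>\<^bsub>A\<^esub> m, b \<otimes>\<^bsub>B\<^esub> n))"
        using ab by (simp add: mn h(3) basis_closed basis_mult Asm)
      then show ?thesis unfolding tensor_relations_def Let_def using 3 ab by blast
    next
      case 4
      then have "?e \<otimes>\<^bsub>F\<^esub> x = basis_elem R (a \<otimes>\<^bsub>A\<^esub> m, c \<odot>\<^bsub>B\<^esub> (b \<otimes>\<^bsub>B\<^esub> n)) \<ominus>\<^bsub>F\<^esub>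
          (c \<odot>\<^bsub>F\<^esub> basis_elem R (a \<otimes>\<^bsub>A\<^esub> m, b \<otimes>\<^bsub>B\<^esub> n))"
        using ab by (simp add: mn h(3) basis_closed basis_mult Bsm)
      then show ?thesis unfolding tensor_relations_def Let_def using 4 ab by blast
    qed
    then show "x \<in> {x \<in> carrier F. ?e \<otimes>\<^bsub>F\<^esub> x \<in> ker}"
      using x relations_closed relation_in_kernel by blast
  qed
  then have "ker \<subseteq> {x \<in> carrier F. ?e \<otimes>\<^bsub>F\<^esub> x \<in> ker}"
    unfolding tensor_kernel_def[of R A B]
    by (intro F.submodule_generated_least F.submodule_hom_preimage[OF F.module_axioms hom]
        F.submodule_generated_submodule[OF relations_closed])
  then show ?thesis using x by blast
qed

text \<open>\<open>tensor_kernel\<close> is generated as a submodule only. The product of cosets is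
  well behaved because it is also an ideal: multiplication by general elements is built from
  multiplication by basis elements.\<close>

lemma ideal_kernel: "ideal ker F"
proof (rule idealI)
  note K = F.submoduleE[OF Q.K]
  show "ring F" by (rule cring.axioms(1)[OF FA.M_cring])
  show "subgroup ker (add_monoid F)" using Q.K by (rule submodule.axioms)
  have l: "f \<otimes>\<^bsub>F\<^esub> x \<in> ker" if f: "f \<in> carrier F" and x: "x \<in> ker" for f x
    using f[unfolded tensor_free_def]
  proof (induction rule: A.R.monoid_algebra_induct)
    case zero
    have "\<zero>\<^bsub>F\<^esub> \<otimes>\<^bsub>F\<^esub> x \<in> ker"
      using Q.K_closed[OF x] additive_subgroup.zero_closed[OF abelian_subgroup.axioms(1)[OF Q.K_abelian_subgroup]] by simp
    then show ?case by (simp add: tensor_free_def)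
  next
    case (step c p g)
    obtain a b where p: "p = (a, b)" "a \<in> carrier A" "b \<in> carrier B" using step(2) by auto
    have g: "g \<in> carrier F" "g \<otimes>\<^bsub>F\<^esub> x \<in> ker" using step(3,4) by (simp_all add: tensor_free_def)
    have "(c \<odot>\<^bsub>F\<^esub> basis_elem R p \<oplus>\<^bsub>F\<^esub> g) \<otimes>\<^bsub>F\<^esub> x = c \<odot>\<^bsub>F\<^esub> (basis_elem R p \<otimes>\<^bsub>F\<^esub> x) \<oplus>\<^bsub>F\<^esub> g \<otimes>\<^bsub>F\<^esub> x"
      using p g step(1) Q.K_closed[OF x] by (simp add: FA.l_distr FA.smult_assoc2 basis_closed)
    also have "\<dots> \<in> ker" using K(4,5) kernel_mult_basis[OF p(2,3) x] p(1) step(1) g by simp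
    finally show ?case by (simp add: tensor_free_def)
  qed
  then show "f \<otimes>\<^bsub>F\<^esub> x \<in> ker" if "x \<in> ker" "f \<in> carrier F" for x f using that by blast
  then show "x \<otimes>\<^bsub>F\<^esub> f \<in> ker" if "x \<in> ker" "f \<in> carrier F" for x f
    using l[OF that(2,1)] FA.m_comm[OF Q.K_closed[OF that(1)] that(2)] by simp
qed

lemma proj_mult:
  assumes "f \<in> carrier F" "g \<in> carrier F"
  shows "Q.proj f \<otimes>\<^bsub>T\<^esub> Q.proj g = Q.proj (f \<otimes>\<^bsub>F\<^esub> g)"
  using ideal.rcoset_mult_add[OF ideal_kernel assms] by (simp add: T_eq quotient_algebra_simps)

sublocale TA: algebra R T
proof (rule algebraI)
  show "cring R" by (rule A.R.is_cring)
  show "cring T"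
  proof (rule cring_cong[OF ideal.quotient_is_cring[OF ideal_kernel FA.M_cring]])
  qed (simp_all add: T_eq quotient_algebra_simps FactRing_def)
  fix a x y assume a: "a \<in> carrier R" and "x \<in> carrier T" "y \<in> carrier T"
  then obtain f g where fg: "f \<in> carrier F" "x = Q.proj f" "g \<in> carrier F" "y = Q.proj g"
    by (auto simp: T_eq Q.carrier_quotient)
  have sm: "a \<odot>\<^bsub>T\<^esub> Q.proj f = Q.proj (a \<odot>\<^bsub>F\<^esub> f)" if "f \<in> carrier F" for f
    using Q.proj_smult[OF a that] by (simp add: T_eq)
  show "(a \<odot>\<^bsub>T\<^esub> x) \<otimes>\<^bsub>T\<^esub> y = a \<odot>\<^bsub>T\<^esub> (x \<otimes>\<^bsub>T\<^esub> y)"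
    using fg a by (simp add: sm proj_mult FA.smult_assoc2)
qed (use T.smult_l_distr T.smult_r_distr T.smult_assoc1 in auto)

lemma pure_mult:
  assumes "a \<in> carrier A" "b \<in> carrier B" "a' \<in> carrier A" "b' \<in> carrier B"
  shows "pure a b \<otimes>\<^bsub>T\<^esub> pure a' b' = pure (a \<otimes>\<^bsub>A\<^esub> a') (b \<otimes>\<^bsub>B\<^esub> b')"
  using assms by (simp add: pure_eq proj_mult basis_closed basis_mult)

lemma one_T: "\<one>\<^bsub>T\<^esub> = pure \<one>\<^bsub>A\<^esub> \<one>\<^bsub>B\<^esub>"
  by (simp add: T_eq quotient_algebra_simps pure_eq tensor_free_def monoid_algebra_simps)

end

section \<open>Polynomial algebras\<close>

abbreviation monomial_monoid :: "'v set \<Rightarrow> 'v multiset monoid"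
  where "monomial_monoid V \<equiv> \<lparr>carrier = {w. set_mset w \<subseteq> V}, monoid.mult = (+), one = {#}\<rparr>"

lemma comm_monoid_monomials: "comm_monoid (monomial_monoid V)"
  by (rule comm_monoidI) (auto simp: ac_simps)

context cring
begin

lemma algebra_poly_algebra: "algebra R (poly_algebra R V)"
  unfolding poly_algebra_def by (rule algebra_monoid_algebra[OF comm_monoid_monomials])

lemma poly_var_closed: "i \<in> V \<Longrightarrow> poly_var R i \<in> carrier (poly_algebra R V)"
  unfolding poly_var_def poly_algebra_def by (rule basis_elem_closed) simp

lemma poly_basis_closed: "set_mset w \<subseteq> V \<Longrightarrow> basis_elem R w \<in> carrier (poly_algebra R V)"
  unfolding poly_algebra_def by (rule basis_elem_closed) simp

lemma poly_var_mult_basis: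
  assumes "i \<in> V" "set_mset w \<subseteq> V"
  shows "poly_var R i \<otimes>\<^bsub>poly_algebra R V\<^esub> basis_elem R w = basis_elem R (add_mset i w)"
  unfolding poly_var_def poly_algebra_def
  using monoid_algebra_basis_mult[OF comm_monoid.axioms(1)[OF comm_monoid_monomials], of "{#i#}" V w] assms by simp

lemma poly_one: "\<one>\<^bsub>poly_algebra R V\<^esub> = basis_elem R {#}"
  by (simp add: poly_algebra_def monoid_algebra_simps)

lemma poly_hom_eqI:
  assumes "module R M" "h \<in> module_hom R (poly_algebra R V) M" "k \<in> module_hom R (poly_algebra R V) M"
    and "\<And>w. set_mset w \<subseteq> V \<Longrightarrow> h (basis_elem R w) = k (basis_elem R w)"
    and "p \<in> carrier (poly_algebra R V)"
  shows "h p = k p"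
  by (rule monoid_algebra_hom_eqI[where G = "monomial_monoid V"]) (use assms in \<open>simp_all add: poly_algebra_def\<close>)

definition monomial_value :: "('a, 'm, 'y) module_scheme \<Rightarrow> ('v \<Rightarrow> 'm) \<Rightarrow> 'v multiset \<Rightarrow> 'm"
  where "monomial_value A a w = (\<Otimes>\<^bsub>A\<^esub>i \<in> set_mset w. a i [^]\<^bsub>A\<^esub> count w i)"

context
  fixes A :: "('a, 'm, 'y) module_scheme" and V :: "'v set" and a :: "'v \<Rightarrow> 'm"
  assumes A: "algebra R A" and a: "\<And>i. i \<in> V \<Longrightarrow> a i \<in> carrier A"
begin

interpretation A: algebra R A by (rule A)

lemma monomial_value_superset:
  assumes "finite S" "set_mset w \<subseteq> S" "S \<subseteq> V"
  shows "monomial_value A a w = (\<Otimes>\<^bsub>A\<^esub>i \<in> S. a i [^]\<^bsub>A\<^esub> count w i)"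
  unfolding monomial_value_def
  by (rule A.finprod_mono_neutral_cong_left) (use assms a in \<open>auto simp: not_in_iff\<close>)

lemma monomial_value_closed: "set_mset w \<subseteq> V \<Longrightarrow> monomial_value A a w \<in> carrier A"
  unfolding monomial_value_def using a by (intro A.finprod_closed) auto

lemma monomial_value_add:
  assumes "set_mset v \<subseteq> V" "set_mset w \<subseteq> V"
  shows "monomial_value A a (v + w) = monomial_value A a v \<otimes>\<^bsub>A\<^esub> monomial_value A a w"
proof -
  let ?S = "set_mset v \<union> set_mset w"
  have "monomial_value A a (v + w) = (\<Otimes>\<^bsub>A\<^esub>i \<in> ?S. a i [^]\<^bsub>A\<^esub> count (v + w) i)"
    using assms by (intro monomial_value_superset) auto
  also have "\<dots> = (\<Otimes>\<^bsub>A\<^esub>i \<in> ?S. a i [^]\<^bsub>A\<^esub> count v i \<otimes>\<^bsub>A\<^esub> a i [^]\<^bsub>A\<^esub> count w i)"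
  proof (intro A.finprod_cong' refl)
    fix i assume "i \<in> ?S"
    then have "a i \<in> carrier A" using assms a by auto
    then show "a i [^]\<^bsub>A\<^esub> count (v + w) i = a i [^]\<^bsub>A\<^esub> count v i \<otimes>\<^bsub>A\<^esub> a i [^]\<^bsub>A\<^esub> count w i"
      by (simp add: A.nat_pow_mult)
  qed (use assms a in auto)
  also have "\<dots> = (\<Otimes>\<^bsub>A\<^esub>i \<in> ?S. a i [^]\<^bsub>A\<^esub> count v i) \<otimes>\<^bsub>A\<^esub> (\<Otimes>\<^bsub>A\<^esub>i \<in> ?S. a i [^]\<^bsub>A\<^esub> count w i)"
    using assms a by (intro A.finprod_multf) auto
  also have "\<dots> = monomial_value A a v \<otimes>\<^bsub>A\<^esub> monomial_value A a w"
    using assms by (simp add: monomial_value_superset[of ?S])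
  finally show ?thesis .
qed

lemma monomial_value_empty: "monomial_value A a {#} = \<one>\<^bsub>A\<^esub>"
  by (simp add: monomial_value_def)

lemma monomial_value_single: "i \<in> V \<Longrightarrow> monomial_value A a {#i#} = a i"
  using a[of i] by (simp add: monomial_value_def)

lemma poly_subst_eq: "poly_subst R A a = lin_map R A (monomial_value A a)"
  by (rule ext) (simp add: poly_subst_def lin_map_def monomial_value_def)

lemma poly_subst_algebra_hom: "poly_subst R A a \<in> algebra_hom R (poly_algebra R V) A"
  unfolding poly_subst_eq poly_algebra_def
  by (rule lin_map_algebra_hom[OF comm_monoid_monomials A])
    (auto simp: monomial_value_closed monomial_value_empty monomial_value_add)

lemma poly_subst_basis:
  assumes "set_mset w \<subseteq> V"
  shows "poly_subst R A a (basis_elem R w) = monomial_value A a w"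
  unfolding poly_subst_eq
  by (rule lin_map_basis[OF A.module_axioms, where G = "monomial_monoid V"])
    (use assms monomial_value_closed in auto)

lemma poly_subst_var: "i \<in> V \<Longrightarrow> poly_subst R A a (poly_var R i) = a i"
  by (simp add: poly_var_def poly_subst_basis monomial_value_single)

end

end

lemma algebra_hom_module_hom: "h \<in> algebra_hom R A B \<Longrightarrow> h \<in> module_hom R A B"
  by (rule module_homI) (auto dest: algebra_homD)

section \<open>Algebras with a nondegenerate trace form\<close>

text \<open>
  The families \<open>x\<close> and \<open>y\<close> are dual with respect to the bilinear form \<open>Tr (u v)\<close>, and
  \<open>\<Sum>\<^sub>i x\<^sub>i \<otimes> y\<^sub>i\<close> is a separability idempotent.
\<close>

locale trace_algebra = A: algebra R A
  for R :: "('r, 'x) ring_scheme" (structure) and A :: "('r, 'm, 'y) module_scheme" +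
  fixes Tr :: "'m \<Rightarrow> 'r" and k :: nat and x y :: "nat \<Rightarrow> 'm"
  assumes Tr_closed: "u \<in> carrier A \<Longrightarrow> Tr u \<in> carrier R"
    and Tr_add: "u \<in> carrier A \<Longrightarrow> v \<in> carrier A \<Longrightarrow> Tr (u \<oplus>\<^bsub>A\<^esub> v) = Tr u \<oplus> Tr v"
    and Tr_smult: "a \<in> carrier R \<Longrightarrow> u \<in> carrier A \<Longrightarrow> Tr (a \<odot>\<^bsub>A\<^esub> u) = a \<otimes> Tr u"
    and x_closed: "i < k \<Longrightarrow> x i \<in> carrier A"
    and y_closed: "i < k \<Longrightarrow> y i \<in> carrier A"
    and expand_x: "u \<in> carrier A \<Longrightarrow> (\<Oplus>\<^bsub>A\<^esub>i\<in>{..<k}. Tr (u \<otimes>\<^bsub>A\<^esub> y i) \<odot>\<^bsub>A\<^esub> x i) = u"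
    and expand_y: "u \<in> carrier A \<Longrightarrow> (\<Oplus>\<^bsub>A\<^esub>i\<in>{..<k}. Tr (u \<otimes>\<^bsub>A\<^esub> x i) \<odot>\<^bsub>A\<^esub> y i) = u"
    and sum_xy: "(\<Oplus>\<^bsub>A\<^esub>i\<in>{..<k}. x i \<otimes>\<^bsub>A\<^esub> y i) = \<one>\<^bsub>A\<^esub>"
begin

text \<open>The coordinates \<open>Tr (u y_i)\<close> are linear in \<open>u\<close>, so every
  choice of the \<open>m_i\<close> yields a linear map, whatever relations hold among the
  \<open>x_i\<close>. For \<open>m = x\<close> it is the identity. All maps out of \<open>A\<close>
  below are obtained in this way.\<close>

definition comb :: "('r, 'n, 'z) module_scheme \<Rightarrow> (nat \<Rightarrow> 'n) \<Rightarrow> 'm \<Rightarrow> 'n"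
  where "comb M m u = (\<Oplus>\<^bsub>M\<^esub>i\<in>{..<k}. Tr (u \<otimes>\<^bsub>A\<^esub> y i) \<odot>\<^bsub>M\<^esub> m i)"

lemma coeff_closed: "u \<in> carrier A \<Longrightarrow> i < k \<Longrightarrow> Tr (u \<otimes>\<^bsub>A\<^esub> y i) \<in> carrier R"
  by (intro Tr_closed A.m_closed y_closed)

lemma comb_hom:
  assumes "module R M" and m: "\<And>i. i < k \<Longrightarrow> m i \<in> carrier M"
  shows "comb M m \<in> module_hom R A M"
proof (rule module_homI)
  interpret M: module R M by fact
  fix u assume u: "u \<in> carrier A"
  show "comb M m u \<in> carrier M"
    unfolding comb_def using m coeff_closed[OF u] by (intro M.finsum_closed) auto
  { fix v assume v: "v \<in> carrier A"
    have "comb M m (u \<oplus>\<^bsub>A\<^esub> v)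
      = (\<Oplus>\<^bsub>M\<^esub>i\<in>{..<k}. Tr (u \<otimes>\<^bsub>A\<^esub> y i) \<odot>\<^bsub>M\<^esub> m i \<oplus>\<^bsub>M\<^esub> Tr (v \<otimes>\<^bsub>A\<^esub> y i) \<odot>\<^bsub>M\<^esub> m i)"
      unfolding comb_def using m coeff_closed[OF u] coeff_closed[OF v] u v y_closed
      by (intro M.finsum_cong') (auto simp: A.l_distr Tr_add M.smult_l_distr)
    also have "\<dots> = comb M m u \<oplus>\<^bsub>M\<^esub> comb M m v"
      unfolding comb_def using m coeff_closed[OF u] coeff_closed[OF v] by (intro M.finsum_addf) auto
    finally show "comb M m (u \<oplus>\<^bsub>A\<^esub> v) = comb M m u \<oplus>\<^bsub>M\<^esub> comb M m v" . }
  fix a assume a: "a \<in> carrier R"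
  have "comb M m (a \<odot>\<^bsub>A\<^esub> u) = (\<Oplus>\<^bsub>M\<^esub>i\<in>{..<k}. a \<odot>\<^bsub>M\<^esub> (Tr (u \<otimes>\<^bsub>A\<^esub> y i) \<odot>\<^bsub>M\<^esub> m i))"
    unfolding comb_def using m coeff_closed[OF u] u a y_closed
    by (intro M.finsum_cong') (auto simp: A.smult_assoc2 Tr_smult M.smult_assoc1)
  also have "\<dots> = a \<odot>\<^bsub>M\<^esub> comb M m u"
    unfolding comb_def using m coeff_closed[OF u] a by (intro M.finsum_smult_ldistr[symmetric]) auto
  finally show "comb M m (a \<odot>\<^bsub>A\<^esub> u) = a \<odot>\<^bsub>M\<^esub> comb M m u" .
qed

lemma hom_comb:
  assumes M: "module R M" and N: "module R N" and h: "h \<in> module_hom R M N"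
    and m: "\<And>i. i < k \<Longrightarrow> m i \<in> carrier M" and u: "u \<in> carrier A"
  shows "h (comb M m u) = comb N (\<lambda>i. h (m i)) u"
proof -
  interpret M: module R M by (rule M)
  interpret N: module R N by (rule N)
  note h' = module_homD[OF h]
  have "h (comb M m u) = (\<Oplus>\<^bsub>N\<^esub>i\<in>{..<k}. h (Tr (u \<otimes>\<^bsub>A\<^esub> y i) \<odot>\<^bsub>M\<^esub> m i))"
    unfolding comb_def
    by (rule additive_finsum[OF module_abelian_group[OF M] module_abelian_group[OF N]])
      (use h' m coeff_closed[OF u] in auto)
  also have "\<dots> = comb N (\<lambda>i. h (m i)) u"
    unfolding comb_def using h' m coeff_closed[OF u] by (intro N.finsum_cong') auto
  finally show ?thesis .
qed

lemma comb_cong: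
  assumes "module R M" "\<And>i. i < k \<Longrightarrow> m i \<in> carrier M" "\<And>i. i < k \<Longrightarrow> m i = m' i" "u \<in> carrier A"
  shows "comb M m u = comb M m' u"
proof -
  interpret M: module R M by fact
  show ?thesis unfolding comb_def using assms coeff_closed[OF assms(4)] by (intro M.finsum_cong') auto
qed

lemma comb_x: "u \<in> carrier A \<Longrightarrow> comb A x u = u"
  unfolding comb_def by (rule expand_x)

text \<open>The dual basis criterion: lift each \<open>f (x i)\<close> through \<open>g\<close> and
  take the combination of the lifts with the coordinates \<open>Tr (u y_i)\<close>.\<close>

lemma projective: "projective_module TYPE('c) R A"
  unfolding projective_module_def
proof (intro conjI allI impI A.module_axioms)
  fix M N :: "('r, 'c) module" and g f
  assume a: "module R M \<and> module R N \<and> g \<in> module_hom R M N \<and> g ` carrier M = carrier N \<and> f \<in> module_hom R A N"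
  then have M: "module R M" and N: "module R N" and g: "g \<in> module_hom R M N"
    and surj: "g ` carrier M = carrier N" and f: "f \<in> module_hom R A N" by auto
  have "\<exists>m. m \<in> carrier M \<and> g m = f (x i)" if i: "i < k" for i
  proof -
    have "f (x i) \<in> g ` carrier M" using module_homD(1)[OF f x_closed[OF i]] surj by simp
    then show ?thesis by auto
  qed
  then obtain m where m: "\<And>i. i < k \<Longrightarrow> m i \<in> carrier M" "\<And>i. i < k \<Longrightarrow> g (m i) = f (x i)" by metis
  have "g (comb M m u) = f u" if u: "u \<in> carrier A" for u
  proof -
    have "g (comb M m u) = comb N (\<lambda>i. g (m i)) u" by (rule hom_comb[OF M N g m(1) u])
    also have "\<dots> = comb N (\<lambda>i. f (x i)) u"
      by (intro comb_cong[OF N _ _ u] module_homD(1)[OF g] m)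
    also have "\<dots> = f (comb A x u)" by (rule hom_comb[OF A.module_axioms N f x_closed u, symmetric])
    finally show ?thesis using u by (simp add: comb_x)
  qed
  then have "\<forall>u\<in>carrier A. g (comb M m u) = f u" by (rule ballI)
  then show "\<exists>h\<in>module_hom R A M. \<forall>x\<in>carrier A. g (h x) = f x"
    using comb_hom[OF M m(1)] by (rule bexI)
qed

lemma finitely_generated: "submodule_generated R A (x ` {..<k}) = carrier A"
proof
  show "submodule_generated R A (x ` {..<k}) \<subseteq> carrier A"
    by (rule A.submodule_generated_least[OF A.carrier_is_submodule]) (use x_closed in auto)
  show "carrier A \<subseteq> submodule_generated R A (x ` {..<k})"
  proof
    fix u assume u: "u \<in> carrier A"
    have "u \<in> H" if H: "submodule H R A" "x ` {..<k} \<subseteq> H" for H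
    proof -
      note H' = A.submoduleE[OF H(1)]
      have "(\<Oplus>\<^bsub>A\<^esub>i\<in>S. Tr (u \<otimes>\<^bsub>A\<^esub> y i) \<odot>\<^bsub>A\<^esub> x i) \<in> H" if "finite S" "S \<subseteq> {..<k}" for S
        using that
      proof (induction S)
        case empty
        show ?case
          using additive_subgroup.zero_closed[OF additive_subgroup.intro[OF submodule.axioms(1)[OF H(1)]]] by simp
      next
        case (insert i S)
        have "(\<Oplus>\<^bsub>A\<^esub>i\<in>insert i S. Tr (u \<otimes>\<^bsub>A\<^esub> y i) \<odot>\<^bsub>A\<^esub> x i)
          = Tr (u \<otimes>\<^bsub>A\<^esub> y i) \<odot>\<^bsub>A\<^esub> x i \<oplus>\<^bsub>A\<^esub> (\<Oplus>\<^bsub>A\<^esub>i\<in>S. Tr (u \<otimes>\<^bsub>A\<^esub> y i) \<odot>\<^bsub>A\<^esub> x i)"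
          using insert coeff_closed[OF u] x_closed by (intro A.finsum_insert) auto
        then show ?case
          using insert H'(4,5) H(2) coeff_closed[OF u] by auto
      qed
      from this[of "{..<k}"] show ?thesis using expand_x[OF u] by simp
    qed
    then show "u \<in> submodule_generated R A (x ` {..<k})" by (auto simp: submodule_generated_def)
  qed
qed

text \<open>An element of \<open>N \<otimes> A\<close> is determined by coordinates in
  \<open>N\<close>, and these are natural in \<open>N\<close>. If two elements have the same image
  in \<open>N' \<otimes> A\<close>, then \<open>f\<close> identifies their coordinates, and
  injectivity of \<open>f\<close> finishes.\<close>

lemma flat: "flat_module TYPE('c) R A"
  unfolding flat_module_def
proof (intro conjI allI impI A.module_axioms)
  fix N N' :: "('r, 'c) module" and f
  assume a: "module R N \<and> module R N' \<and> f \<in> module_hom R N N' \<and> inj_on f (carrier N)"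
  then have f: "f \<in> module_hom R N N'" and inj: "inj_on f (carrier N)" by auto
  interpret N: module R N using a by blast
  interpret N': module R N' using a by blast
  interpret T: tensor R N A ..
  interpret T': tensor R N' A ..
  note f' = module_homD[OF f]
  \<comment> \<open>The coordinate maps: apply \<open>u \<mapsto> Tr (u y_i)\<close> to the second
    factor and identify \<open>M \<otimes> R\<close> with \<open>M\<close>.\<close>
  have proj: "\<exists>p\<in>module_hom R (tensor_product R M A) M. \<forall>n\<in>carrier M. \<forall>u\<in>carrier A.
      p (pure_tensor R M A n u) = Tr (u \<otimes>\<^bsub>A\<^esub> y i) \<odot>\<^bsub>M\<^esub> n" if M: "module R M" and i: "i < k" for i and M :: "('r, 'c) module"
  proof -
    interpret M: module R M by (rule M)
    interpret TM: tensor R M A ..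
    show ?thesis
      by (rule TM.tensor_lift[OF M])
        (use coeff_closed y_closed i in
          \<open>auto simp: A.l_distr Tr_add M.smult_l_distr M.smult_r_distr A.smult_assoc2 Tr_smult M.smult_assoc1[symmetric] A.R.m_comm\<close>)
  qed
  have "\<forall>i. \<exists>p. i < k \<longrightarrow> p \<in> module_hom R T.T N \<and> (\<forall>n\<in>carrier N. \<forall>u\<in>carrier A. p (T.pure n u) = Tr (u \<otimes>\<^bsub>A\<^esub> y i) \<odot>\<^bsub>N\<^esub> n)"
    using proj[OF N.module_axioms] by blast
  then obtain p where "\<forall>i. i < k \<longrightarrow> p i \<in> module_hom R T.T N \<and> (\<forall>n\<in>carrier N. \<forall>u\<in>carrier A. p i (T.pure n u) = Tr (u \<otimes>\<^bsub>A\<^esub> y i) \<odot>\<^bsub>N\<^esub> n)"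
    by (rule choice[THEN exE])
  then have p: "\<And>i. i < k \<Longrightarrow> p i \<in> module_hom R T.T N"
    "\<And>i n u. i < k \<Longrightarrow> n \<in> carrier N \<Longrightarrow> u \<in> carrier A \<Longrightarrow> p i (T.pure n u) = Tr (u \<otimes>\<^bsub>A\<^esub> y i) \<odot>\<^bsub>N\<^esub> n" by blast+
  have "\<forall>i. \<exists>p. i < k \<longrightarrow> p \<in> module_hom R T'.T N' \<and> (\<forall>n\<in>carrier N'. \<forall>u\<in>carrier A. p (T'.pure n u) = Tr (u \<otimes>\<^bsub>A\<^esub> y i) \<odot>\<^bsub>N'\<^esub> n)"
    using proj[OF N'.module_axioms] by blast
  then obtain p' where "\<forall>i. i < k \<longrightarrow> p' i \<in> module_hom R T'.T N' \<and> (\<forall>n\<in>carrier N'. \<forall>u\<in>carrier A. p' i (T'.pure n u) = Tr (u \<otimes>\<^bsub>A\<^esub> y i) \<odot>\<^bsub>N'\<^esub> n)"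
    by (rule choice[THEN exE])
  then have p': "\<And>i. i < k \<Longrightarrow> p' i \<in> module_hom R T'.T N'"
    "\<And>i n u. i < k \<Longrightarrow> n \<in> carrier N' \<Longrightarrow> u \<in> carrier A \<Longrightarrow> p' i (T'.pure n u) = Tr (u \<otimes>\<^bsub>A\<^esub> y i) \<odot>\<^bsub>N'\<^esub> n" by blast+
  obtain t where t: "t \<in> module_hom R T.T T'.T" "\<forall>n\<in>carrier N. \<forall>u\<in>carrier A. t (T.pure n u) = T'.pure (f n) u"
    using T.tensor_lift[OF T'.T.module_axioms, of "\<lambda>n u. T'.pure (f n) u"] f'
    by (force simp: T'.pure_closed T'.pure_add_left T'.pure_add_right T'.pure_smult_left T'.pure_smult_right)
  \<comment> \<open>Reconstruction from the coordinates: scalars cross the tensor sign, so on pure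
    tensors this is the expansion of \<open>u\<close> in the \<open>x_i\<close>.\<close>
  have recon: "u = (\<Oplus>\<^bsub>T.T\<^esub>i\<in>{..<k}. T.pure (p i u) (x i))" if "u \<in> carrier T.T" for u
    using that
  proof (induction rule: T.tensor_induct)
    case (pure n u)
    have "(\<Oplus>\<^bsub>T.T\<^esub>i\<in>{..<k}. T.pure (p i (T.pure n u)) (x i)) = (\<Oplus>\<^bsub>T.T\<^esub>i\<in>{..<k}. T.pure n (Tr (u \<otimes>\<^bsub>A\<^esub> y i) \<odot>\<^bsub>A\<^esub> x i))"
      using pure coeff_closed x_closed
      by (intro T.T.finsum_cong') (auto simp: p(2) T.pure_smult_left T.pure_smult_right T.pure_closed)
    also have "\<dots> = T.pure n (\<Oplus>\<^bsub>A\<^esub>i\<in>{..<k}. Tr (u \<otimes>\<^bsub>A\<^esub> y i) \<odot>\<^bsub>A\<^esub> x i)"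
      by (rule additive_finsum[symmetric, OF module_abelian_group[OF A.module_axioms] module_abelian_group[OF T.T.module_axioms]])
        (use pure coeff_closed x_closed in \<open>auto simp: T.pure_closed T.pure_add_right\<close>)
    finally show ?case using expand_x pure by simp
  next
    case (add u v)
    have "(\<Oplus>\<^bsub>T.T\<^esub>i\<in>{..<k}. T.pure (p i (u \<oplus>\<^bsub>T.T\<^esub> v)) (x i))
      = (\<Oplus>\<^bsub>T.T\<^esub>i\<in>{..<k}. T.pure (p i u) (x i) \<oplus>\<^bsub>T.T\<^esub> T.pure (p i v) (x i))"
      using add(1,2) x_closed module_homD[OF p(1)]
      by (intro T.T.finsum_cong') (auto simp: T.pure_add_left T.pure_closed)
    also have "\<dots> = (\<Oplus>\<^bsub>T.T\<^esub>i\<in>{..<k}. T.pure (p i u) (x i)) \<oplus>\<^bsub>T.T\<^esub> (\<Oplus>\<^bsub>T.T\<^esub>i\<in>{..<k}. T.pure (p i v) (x i))"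
      using add(1,2) x_closed module_homD[OF p(1)]
      by (intro T.T.finsum_addf) (auto simp: T.pure_closed)
    finally show ?case using add(3,4) by simp
  qed
  \<comment> \<open>Naturality: taking coordinates commutes with the map induced by
    \<open>f\<close>.\<close>
  have nat: "f (p i u) = p' i (t u)" if i: "i < k" and u: "u \<in> carrier T.T" for i u
    using u
  proof (induction rule: T.tensor_induct)
    case (pure n u)
    then show ?case using i t(2) f' coeff_closed by (simp add: p(2) p'(2))
  next
    case (add u v)
    then show ?case
      using module_homD[OF p(1)[OF i]] module_homD[OF p'(1)[OF i]] module_homD[OF t(1)] f' by simp
  qed
  have "inj_on t (carrier T.T)"
  proof (rule inj_onI)
    fix u v assume u: "u \<in> carrier T.T" and v: "v \<in> carrier T.T" and tuv: "t u = t v"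
    have puv: "p i u = p i v" if i: "i < k" for i
    proof (rule inj_onD[OF inj])
      show "f (p i u) = f (p i v)" using nat[OF i] u v tuv by simp
    qed (use module_homD(1)[OF p(1)[OF i]] u v in auto)
    have "u = (\<Oplus>\<^bsub>T.T\<^esub>i\<in>{..<k}. T.pure (p i u) (x i))" by (rule recon[OF u])
    also have "\<dots> = (\<Oplus>\<^bsub>T.T\<^esub>i\<in>{..<k}. T.pure (p i v) (x i))"
      using puv module_homD(1)[OF p(1)] v x_closed by (intro T.T.finsum_cong') (auto simp: T.pure_closed)
    also have "\<dots> = v" by (rule recon[OF v, symmetric])
    finally show "u = v" .
  qed
  then show "\<exists>t\<in>module_hom R T.T T'.T. (\<forall>n\<in>carrier N. \<forall>u\<in>carrier A. t (T.pure n u) = T'.pure (f n) u) \<and>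
      inj_on t (carrier T.T)"
    using t by blast
qed

text \<open>The element \<open>e = \<Sum> x_i \<otimes> y_i\<close> satisfies
  \<open>\<mu> e = 1\<close> and \<open>(b \<otimes> 1) e = (1 \<otimes> b) e\<close>. Therefore
  \<open>u \<mapsto> (u \<otimes> 1) e\<close> is a section of \<open>\<mu>\<close> which is linear
  over \<open>A \<otimes> A\<close>, and a module with such a section is projective.\<close>

lemma separable: "separable_algebra TYPE('c) R A"
proof -
  interpret T: algebra_tensor R A A ..
  obtain \<mu> where \<mu>: "\<mu> \<in> module_hom R T.T A"
    "\<forall>a\<in>carrier A. \<forall>b\<in>carrier A. \<mu> (T.pure a b) = a \<otimes>\<^bsub>A\<^esub> b"
  proof -
    have r: "a \<otimes>\<^bsub>A\<^esub> (c \<odot>\<^bsub>A\<^esub> b) = c \<odot>\<^bsub>A\<^esub> (a \<otimes>\<^bsub>A\<^esub> b)" if "c \<in> carrier R" "a \<in> carrier A" "b \<in> carrier A" for a b c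
      using that A.smult_assoc2[of c b a] by (simp add: A.m_comm)
    have "\<exists>t\<in>module_hom R T.T A. \<forall>a\<in>carrier A. \<forall>b\<in>carrier A. t (T.pure a b) = a \<otimes>\<^bsub>A\<^esub> b"
      by (rule T.tensor_lift[OF A.module_axioms]) (auto simp: A.l_distr A.r_distr A.smult_assoc2 r)
    then show thesis using that by blast
  qed
  note \<mu>' = module_homD[OF \<mu>(1)]
  have \<mu>_mult: "\<mu> (s \<otimes>\<^bsub>T.T\<^esub> t) = \<mu> s \<otimes>\<^bsub>A\<^esub> \<mu> t" if s: "s \<in> carrier T.T" and t: "t \<in> carrier T.T" for s t
    using s
  proof (induction rule: T.tensor_induct)
    case (pure a b)
    show ?case using t
    proof (induction rule: T.tensor_induct)
      case (pure a' b')
      then show ?case using \<open>a \<in> carrier A\<close> \<open>b \<in> carrier A\<close> \<mu>(2) by (simp add: T.pure_mult A.m_ac)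
    next
      case (add u v)
      then show ?case
        using T.pure_closed[OF \<open>a \<in> carrier A\<close> \<open>b \<in> carrier A\<close>] \<mu>' by (simp add: T.TA.r_distr A.r_distr)
    qed
  next
    case (add u v)
    then show ?case using t \<mu>' by (simp add: T.TA.l_distr A.l_distr)
  qed
  have \<mu>_one: "\<mu> \<one>\<^bsub>T.T\<^esub> = \<one>\<^bsub>A\<^esub>" using \<mu>(2) by (simp add: T.one_T)
  have \<mu>_hom: "\<mu> \<in> algebra_hom R T.T A"
    using \<mu>' \<mu>_mult \<mu>_one by (auto simp: algebra_hom_def Ring.ring_hom_def)
  define A' where "A' = ring.extend (ring.truncate A) \<lparr>module.smult = (\<lambda>t u. \<mu> t \<otimes>\<^bsub>A\<^esub> u)\<rparr>"
  have A'_simps: "carrier A' = carrier A" "u \<oplus>\<^bsub>A'\<^esub> v = u \<oplus>\<^bsub>A\<^esub> v" "\<zero>\<^bsub>A'\<^esub> = \<zero>\<^bsub>A\<^esub>"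
    "\<one>\<^bsub>A'\<^esub> = \<one>\<^bsub>A\<^esub>" "u \<otimes>\<^bsub>A'\<^esub> v = u \<otimes>\<^bsub>A\<^esub> v" "t \<odot>\<^bsub>A'\<^esub> u = \<mu> t \<otimes>\<^bsub>A\<^esub> u" for t u v
    by (simp_all add: A'_def ring.defs)
  have "abelian_group A'"
    by (rule ring.is_abelian_group, rule cring.axioms(1), rule cring_cong[OF A.M_cring]) (simp_all add: A'_simps)
  then have modA': "module T.T A'"
    using \<mu>' \<mu>_mult \<mu>_one T.TA.M_cring
    by (intro moduleI) (simp_all add: A'_simps A.l_distr A.r_distr A.m_assoc)
  define e where "e = (\<Oplus>\<^bsub>T.T\<^esub>i\<in>{..<k}. T.pure (x i) (y i))"
  have xy: "T.pure (x i) (y i) \<in> carrier T.T" if "i < k" for i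
    using that x_closed y_closed by (intro T.pure_closed)
  have e: "e \<in> carrier T.T" unfolding e_def using xy by (intro T.T.finsum_closed) auto
  have \<mu>_e: "\<mu> e = \<one>\<^bsub>A\<^esub>"
  proof -
    have "\<mu> e = (\<Oplus>\<^bsub>A\<^esub>i\<in>{..<k}. \<mu> (T.pure (x i) (y i)))"
      unfolding e_def
      by (rule additive_finsum[OF module_abelian_group[OF T.T.module_axioms] module_abelian_group[OF A.module_axioms]])
        (use \<mu>' xy in auto)
    also have "\<dots> = (\<Oplus>\<^bsub>A\<^esub>i\<in>{..<k}. x i \<otimes>\<^bsub>A\<^esub> y i)"
      using \<mu>(2) x_closed y_closed by (intro A.finsum_cong') auto
    finally show ?thesis using sum_xy by simp
  qed
  have left: "T.pure b \<one>\<^bsub>A\<^esub> \<otimes>\<^bsub>T.T\<^esub> e = (\<Oplus>\<^bsub>T.T\<^esub>i\<in>{..<k}. T.pure (b \<otimes>\<^bsub>A\<^esub> x i) (y i))" if b: "b \<in> carrier A" for b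
  proof -
    have "T.pure b \<one>\<^bsub>A\<^esub> \<otimes>\<^bsub>T.T\<^esub> e = (\<Oplus>\<^bsub>T.T\<^esub>i\<in>{..<k}. T.pure b \<one>\<^bsub>A\<^esub> \<otimes>\<^bsub>T.T\<^esub> T.pure (x i) (y i))"
      unfolding e_def using xy b by (intro T.TA.finsum_rdistr) (auto simp: T.pure_closed)
    also have "\<dots> = (\<Oplus>\<^bsub>T.T\<^esub>i\<in>{..<k}. T.pure (b \<otimes>\<^bsub>A\<^esub> x i) (y i))"
      using b x_closed y_closed by (intro T.T.finsum_cong') (auto simp: T.pure_mult T.pure_closed)
    finally show ?thesis .
  qed
  have right: "T.pure \<one>\<^bsub>A\<^esub> b \<otimes>\<^bsub>T.T\<^esub> e = (\<Oplus>\<^bsub>T.T\<^esub>i\<in>{..<k}. T.pure (x i) (b \<otimes>\<^bsub>A\<^esub> y i))" if b: "b \<in> carrier A" for b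
  proof -
    have "T.pure \<one>\<^bsub>A\<^esub> b \<otimes>\<^bsub>T.T\<^esub> e = (\<Oplus>\<^bsub>T.T\<^esub>i\<in>{..<k}. T.pure \<one>\<^bsub>A\<^esub> b \<otimes>\<^bsub>T.T\<^esub> T.pure (x i) (y i))"
      unfolding e_def using xy b by (intro T.TA.finsum_rdistr) (auto simp: T.pure_closed)
    also have "\<dots> = (\<Oplus>\<^bsub>T.T\<^esub>i\<in>{..<k}. T.pure (x i) (b \<otimes>\<^bsub>A\<^esub> y i))"
      using b x_closed y_closed by (intro T.T.finsum_cong') (auto simp: T.pure_mult T.pure_closed)
    finally show ?thesis .
  qed
  \<comment> \<open>Expand \<open>b x_i\<close> in the \<open>x_j\<close> on one side and
    \<open>b y_j\<close> in the \<open>y_i\<close> on the other: the coefficient is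
    \<open>Tr (b x_i y_j)\<close> both times.\<close>
  have e_comm: "T.pure b \<one>\<^bsub>A\<^esub> \<otimes>\<^bsub>T.T\<^esub> e = T.pure \<one>\<^bsub>A\<^esub> b \<otimes>\<^bsub>T.T\<^esub> e" if b: "b \<in> carrier A" for b
  proof -
    define c where "c i j = Tr (b \<otimes>\<^bsub>A\<^esub> x i \<otimes>\<^bsub>A\<^esub> y j)" for i j
    have c: "c i j \<in> carrier R" if "i < k" "j < k" for i j
      unfolding c_def using that b x_closed y_closed by (intro Tr_closed) auto
    have term_closed: "T.pure (x j) (c i j \<odot>\<^bsub>A\<^esub> y i) \<in> carrier T.T" if "i < k" "j < k" for i j
      using that c x_closed y_closed by (intro T.pure_closed) auto
    have "T.pure (b \<otimes>\<^bsub>A\<^esub> x i) (y i) = (\<Oplus>\<^bsub>T.T\<^esub>j\<in>{..<k}. T.pure (x j) (c i j \<odot>\<^bsub>A\<^esub> y i))" if i: "i < k" for i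
    proof -
      have bx: "b \<otimes>\<^bsub>A\<^esub> x i \<in> carrier A" using b x_closed i by auto
      have "T.pure (b \<otimes>\<^bsub>A\<^esub> x i) (y i) = T.pure (\<Oplus>\<^bsub>A\<^esub>j\<in>{..<k}. c i j \<odot>\<^bsub>A\<^esub> x j) (y i)"
        unfolding c_def expand_x[OF bx] ..
      also have "\<dots> = (\<Oplus>\<^bsub>T.T\<^esub>j\<in>{..<k}. T.pure (c i j \<odot>\<^bsub>A\<^esub> x j) (y i))"
        by (rule additive_finsum[where h = "\<lambda>u. T.pure u (y i)",
              OF module_abelian_group[OF A.module_axioms] module_abelian_group[OF T.T.module_axioms]])
          (use c i x_closed y_closed in \<open>auto simp: T.pure_closed T.pure_add_left\<close>)
      also have "\<dots> = (\<Oplus>\<^bsub>T.T\<^esub>j\<in>{..<k}. T.pure (x j) (c i j \<odot>\<^bsub>A\<^esub> y i))"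
        using c i x_closed y_closed term_closed
        by (intro T.T.finsum_cong') (auto simp: T.pure_smult_left T.pure_smult_right)
      finally show ?thesis .
    qed
    then have "T.pure b \<one>\<^bsub>A\<^esub> \<otimes>\<^bsub>T.T\<^esub> e = (\<Oplus>\<^bsub>T.T\<^esub>i\<in>{..<k}. \<Oplus>\<^bsub>T.T\<^esub>j\<in>{..<k}. T.pure (x j) (c i j \<odot>\<^bsub>A\<^esub> y i))"
      unfolding left[OF b] using term_closed
      by (intro T.T.finsum_cong') (auto intro!: T.T.finsum_closed)
    also have "\<dots> = (\<Oplus>\<^bsub>T.T\<^esub>j\<in>{..<k}. \<Oplus>\<^bsub>T.T\<^esub>i\<in>{..<k}. T.pure (x j) (c i j \<odot>\<^bsub>A\<^esub> y i))"
      using term_closed by (intro T.T.finsum_swap) auto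
    also have "\<dots> = (\<Oplus>\<^bsub>T.T\<^esub>j\<in>{..<k}. T.pure (x j) (b \<otimes>\<^bsub>A\<^esub> y j))"
    proof (intro T.T.finsum_cong' refl)
      fix j assume "j \<in> {..<k}"
      then have j: "j < k" by simp
      have byA: "b \<otimes>\<^bsub>A\<^esub> y j \<in> carrier A" using b y_closed j by auto
      have cc: "c i j = Tr (b \<otimes>\<^bsub>A\<^esub> y j \<otimes>\<^bsub>A\<^esub> x i)" if "i < k" for i
        unfolding c_def using b x_closed[OF that] y_closed[OF j] by (simp add: A.m_ac)
      have "(\<Oplus>\<^bsub>T.T\<^esub>i\<in>{..<k}. T.pure (x j) (c i j \<odot>\<^bsub>A\<^esub> y i)) = T.pure (x j) (\<Oplus>\<^bsub>A\<^esub>i\<in>{..<k}. c i j \<odot>\<^bsub>A\<^esub> y i)"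
        by (rule additive_finsum[symmetric, where h = "\<lambda>u. T.pure (x j) u",
              OF module_abelian_group[OF A.module_axioms] module_abelian_group[OF T.T.module_axioms]])
          (use c j x_closed y_closed in \<open>auto simp: T.pure_closed T.pure_add_right\<close>)
      also have "(\<Oplus>\<^bsub>A\<^esub>i\<in>{..<k}. c i j \<odot>\<^bsub>A\<^esub> y i) = (\<Oplus>\<^bsub>A\<^esub>i\<in>{..<k}. Tr (b \<otimes>\<^bsub>A\<^esub> y j \<otimes>\<^bsub>A\<^esub> x i) \<odot>\<^bsub>A\<^esub> y i)"
        using c j y_closed by (intro A.finsum_cong') (auto simp: cc[symmetric])
      also have "\<dots> = b \<otimes>\<^bsub>A\<^esub> y j" by (rule expand_y[OF byA])
      finally show "(\<Oplus>\<^bsub>T.T\<^esub>i\<in>{..<k}. T.pure (x j) (c i j \<odot>\<^bsub>A\<^esub> y i)) = T.pure (x j) (b \<otimes>\<^bsub>A\<^esub> y j)" .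
    qed (use b x_closed y_closed in \<open>auto intro!: T.pure_closed\<close>)
    also have "\<dots> = T.pure \<one>\<^bsub>A\<^esub> b \<otimes>\<^bsub>T.T\<^esub> e" by (rule right[OF b, symmetric])
    finally show ?thesis .
  qed
  \<comment> \<open>The section of \<open>\<mu>\<close>; \<open>s_mult\<close> below is its
    linearity over the tensor product.\<close>
  define s where "s u = T.pure u \<one>\<^bsub>A\<^esub> \<otimes>\<^bsub>T.T\<^esub> e" for u
  have s_closed: "s u \<in> carrier T.T" if "u \<in> carrier A" for u
    unfolding s_def using that e by (intro T.TA.m_closed T.pure_closed) auto
  have s_add: "s (u \<oplus>\<^bsub>A\<^esub> v) = s u \<oplus>\<^bsub>T.T\<^esub> s v" if "u \<in> carrier A" "v \<in> carrier A" for u v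
    unfolding s_def using that e by (simp add: T.pure_add_left T.TA.l_distr T.pure_closed)
  have s_mult: "s (\<mu> t \<otimes>\<^bsub>A\<^esub> u) = t \<otimes>\<^bsub>T.T\<^esub> s u" if t: "t \<in> carrier T.T" and u: "u \<in> carrier A" for t u
    using t
  proof (induction rule: T.tensor_induct)
    case (pure a b)
    have "s (\<mu> (T.pure a b) \<otimes>\<^bsub>A\<^esub> u) = T.pure (a \<otimes>\<^bsub>A\<^esub> u \<otimes>\<^bsub>A\<^esub> b) \<one>\<^bsub>A\<^esub> \<otimes>\<^bsub>T.T\<^esub> e"
      using pure u \<mu>(2) by (simp add: s_def A.m_ac)
    also have "\<dots> = T.pure (a \<otimes>\<^bsub>A\<^esub> u) \<one>\<^bsub>A\<^esub> \<otimes>\<^bsub>T.T\<^esub> T.pure b \<one>\<^bsub>A\<^esub> \<otimes>\<^bsub>T.T\<^esub> e"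
      using pure u by (simp add: T.pure_mult)
    also have "\<dots> = T.pure (a \<otimes>\<^bsub>A\<^esub> u) \<one>\<^bsub>A\<^esub> \<otimes>\<^bsub>T.T\<^esub> (T.pure \<one>\<^bsub>A\<^esub> b \<otimes>\<^bsub>T.T\<^esub> e)"
      using pure u e by (simp add: T.TA.m_assoc T.pure_closed e_comm)
    also have "\<dots> = T.pure (a \<otimes>\<^bsub>A\<^esub> u) b \<otimes>\<^bsub>T.T\<^esub> e"
      using pure u e by (simp add: T.TA.m_assoc[symmetric] T.pure_closed T.pure_mult)
    also have "\<dots> = T.pure a b \<otimes>\<^bsub>T.T\<^esub> s u"
      using pure u e by (simp add: s_def T.TA.m_assoc[symmetric] T.pure_closed T.pure_mult)
    finally show ?case .
  next
    case (add t t')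
    then show ?case
      using u \<mu>' s_closed by (simp add: A.l_distr s_add T.TA.l_distr)
  qed
  have "projective_module TYPE('c) T.T A'"
    unfolding projective_module_def
  proof (intro conjI allI impI modA')
    fix M N :: "(('m \<times> 'm \<Rightarrow> 'r) set, 'c) module" and g f
    assume a: "module T.T M \<and> module T.T N \<and> g \<in> module_hom T.T M N \<and> g ` carrier M = carrier N \<and>
      f \<in> module_hom T.T A' N"
    then have g: "g \<in> module_hom T.T M N" and surj: "g ` carrier M = carrier N" and f: "f \<in> module_hom T.T A' N"
      by auto
    interpret M: module T.T M using a by blast
    interpret N: module T.T N using a by blast
    note f' = module_homD[OF f, unfolded A'_simps] and g' = module_homD[OF g]
    \<comment> \<open>As a module over the tensor product \<open>A\<close> is cyclic, generated by
      its unit. One lift \<open>m\<close> of the image of the unit therefore suffices, and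
      \<open>u\<close> is sent to \<open>s u \<odot> m\<close>.\<close>
    have "f \<one>\<^bsub>A\<^esub> \<in> g ` carrier M" using f'(1) surj by simp
    then obtain m where m: "m \<in> carrier M" "g m = f \<one>\<^bsub>A\<^esub>" by force
    have "(\<lambda>u. s u \<odot>\<^bsub>M\<^esub> m) \<in> module_hom T.T A' M"
      by (rule module_homI)
        (use m s_closed in \<open>simp_all add: A'_simps s_add s_mult M.smult_l_distr M.smult_assoc1\<close>)
    moreover have "g (s u \<odot>\<^bsub>M\<^esub> m) = f u" if u: "u \<in> carrier A" for u
    proof -
      have "g (s u \<odot>\<^bsub>M\<^esub> m) = s u \<odot>\<^bsub>N\<^esub> f \<one>\<^bsub>A\<^esub>" using g'(3)[OF s_closed[OF u] m(1)] m(2) by simp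
      also have "\<dots> = f (\<mu> (s u) \<otimes>\<^bsub>A\<^esub> \<one>\<^bsub>A\<^esub>)" using f'(3)[OF s_closed[OF u], of "\<one>\<^bsub>A\<^esub>"] by simp
      also have "\<mu> (s u) = u"
        unfolding s_def using u e \<mu>(2) by (simp add: \<mu>_mult T.pure_closed \<mu>_e)
      finally show ?thesis using u by simp
    qed
    ultimately show "\<exists>h\<in>module_hom T.T A' M. \<forall>u\<in>carrier A'. g (h u) = f u"
      by (intro bexI[of _ "\<lambda>u. s u \<odot>\<^bsub>M\<^esub> m"]) (auto simp: A'_simps)
  qed
  then show ?thesis
    unfolding separable_algebra_def A'_def using A.algebra_axioms \<mu>_hom \<mu>(2) by blast
qed

text \<open>The map \<open>h\<close> that sends the variables to the \<open>x_i\<close> has a linear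
  section \<open>\<sigma>\<close> with values in the linear forms. Modulo the structure relations
  each polynomial \<open>p\<close> reduces to the linear form \<open>\<sigma> (h p)\<close>, which
  is zero when \<open>p\<close> lies in the kernel.\<close>

lemma finitely_presented: "finitely_presented_algebra R A"
proof -
  let ?P = "poly_algebra R {..<k}"
  interpret P: algebra R ?P by (rule A.R.algebra_poly_algebra)
  define h where "h = poly_subst R A x"
  define v where "v i = poly_var R i" for i :: nat
  define \<sigma> where "\<sigma> = comb ?P v"
  have v: "v i \<in> carrier ?P" if "i < k" for i unfolding v_def using that by (intro A.R.poly_var_closed) simp
  have xc: "x i \<in> carrier A" if "i \<in> {..<k}" for i using that x_closed by simp
  have h: "h \<in> algebra_hom R ?P A" unfolding h_def by (rule A.R.poly_subst_algebra_hom[OF A.algebra_axioms xc])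
  note h' = algebra_homD[OF h] and hm = algebra_hom_module_hom[OF h]
  have hv: "h (v i) = x i" if "i < k" for i
    unfolding h_def v_def using that by (intro A.R.poly_subst_var[where V = "{..<k}", OF A.algebra_axioms]) (auto simp: x_closed)
  have \<sigma>: "\<sigma> \<in> module_hom R A ?P" unfolding \<sigma>_def by (rule comb_hom[OF P.module_axioms v])
  note \<sigma>' = module_homD[OF \<sigma>]
  have h\<sigma>: "h (\<sigma> u) = u" if u: "u \<in> carrier A" for u
  proof -
    have "h (\<sigma> u) = comb A (\<lambda>i. h (v i)) u"
      unfolding \<sigma>_def by (rule hom_comb[OF P.module_axioms A.module_axioms hm v u])
    also have "\<dots> = comb A x u"
      by (rule comb_cong[OF A.module_axioms _ _ u]) (simp_all add: hv x_closed)
    finally show ?thesis using comb_x[OF u] by simp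
  qed
  have surj: "h ` carrier ?P = carrier A"
    using h'(1) \<sigma>'(1) h\<sigma> by (metis image_subsetI subsetI subset_antisym image_eqI)
  \<comment> \<open>The family \<open>x\<close> is not assumed to contain the unit, so besides the
    products of two variables the constant polynomial has to be rewritten as a linear form.\<close>
  define F where "F = insert (\<one>\<^bsub>?P\<^esub> \<ominus>\<^bsub>?P\<^esub> \<sigma> \<one>\<^bsub>A\<^esub>)
    ((\<lambda>(i, j). v i \<otimes>\<^bsub>?P\<^esub> v j \<ominus>\<^bsub>?P\<^esub> \<sigma> (x i \<otimes>\<^bsub>A\<^esub> x j)) ` ({..<k} \<times> {..<k}))"
  have F: "finite F" "F \<subseteq> carrier ?P"
    unfolding F_def using v \<sigma>'(1) x_closed by (auto intro!: P.minus_closed)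
  define J where "J = Idl\<^bsub>?P\<^esub> F"
  have J: "ideal J ?P" unfolding J_def by (rule P.genideal_ideal[OF F(2)])
  interpret J: ideal J ?P by (rule J)
  have FJ: "F \<subseteq> J" unfolding J_def by (rule P.genideal_self[OF F(2)])
  have subJ: "submodule J R ?P" by (rule P.ideal_submodule[OF J])
  interpret Q: quotient_module R ?P J
    by (intro quotient_module.intro quotient_module_axioms.intro P.module_axioms subJ)
  let ?\<pi> = "\<lambda>p. Q.proj p"
  note Qm = Q.module_quotient
  note \<pi> = module_homD[OF Q.proj_hom]
  have \<pi>_mult: "?\<pi> (p \<otimes>\<^bsub>?P\<^esub> q) = ?\<pi> (p \<otimes>\<^bsub>?P\<^esub> q')" if "p \<in> carrier ?P" "q \<in> carrier ?P" "q' \<in> carrier ?P" "?\<pi> q = ?\<pi> q'" for p q q'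
  proof (rule Q.proj_eqI)
    have "q \<ominus>\<^bsub>?P\<^esub> q' \<in> J" using Q.mem_proj_iff[OF that(3,2)] Q.proj_self[OF that(2)] that(4) by simp
    then have "p \<otimes>\<^bsub>?P\<^esub> (q \<ominus>\<^bsub>?P\<^esub> q') \<in> J" using that(1) by (rule J.I_l_closed)
    then show "p \<otimes>\<^bsub>?P\<^esub> q \<ominus>\<^bsub>?P\<^esub> p \<otimes>\<^bsub>?P\<^esub> q' \<in> J"
      using that by (simp add: P.minus_eq P.r_distr P.r_minus)
  qed (use that in auto)
  have lmult: "(\<lambda>p. q \<otimes>\<^bsub>?P\<^esub> p) \<in> module_hom R ?P ?P" if q: "q \<in> carrier ?P" for q
    using q unfolding poly_algebra_def
    by (rule A.R.monoid_algebra_mult_hom_right[OF comm_monoid.axioms(1)[OF comm_monoid_monomials]])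
  have lmultA: "(\<lambda>u. a \<otimes>\<^bsub>A\<^esub> u) \<in> module_hom R A A" if a: "a \<in> carrier A" for a
  proof (rule module_homI)
    fix c u assume "c \<in> carrier R" "u \<in> carrier A"
    then show "a \<otimes>\<^bsub>A\<^esub> (c \<odot>\<^bsub>A\<^esub> u) = c \<odot>\<^bsub>A\<^esub> (a \<otimes>\<^bsub>A\<^esub> u)"
      using a A.smult_assoc2[of c u a] by (simp add: A.m_comm)
  qed (use a in \<open>auto simp: A.r_distr\<close>)
  have comp: "(\<lambda>u. f (g u)) \<in> module_hom R M L" if "g \<in> module_hom R M N" "f \<in> module_hom R N L"
    for f :: "'b \<Rightarrow> 'c" and g :: "'a \<Rightarrow> 'b" and M :: "('r, 'a) module" and N :: "('r, 'b) module" and L :: "('r, 'c) module"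
    using module_homD[OF that(1)] module_homD[OF that(2)] by (intro module_homI) auto
  \<comment> \<open>The relations rewrite \<open>v_i v_l\<close>; by linearity of multiplication and
    of \<open>\<sigma>\<close> they rewrite \<open>v_i\<close> times any linear form in the image of
    \<open>\<sigma>\<close>.\<close>
  have step: "?\<pi> (v i \<otimes>\<^bsub>?P\<^esub> \<sigma> u) = ?\<pi> (\<sigma> (x i \<otimes>\<^bsub>A\<^esub> u))" if i: "i < k" and u: "u \<in> carrier A" for i u
  proof -
    have "?\<pi> (v i \<otimes>\<^bsub>?P\<^esub> \<sigma> u) = ?\<pi> (comb ?P (\<lambda>l. v i \<otimes>\<^bsub>?P\<^esub> v l) u)"
      unfolding \<sigma>_def using hom_comb[OF P.module_axioms P.module_axioms lmult[OF v[OF i]] v u] by simp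
    also have "\<dots> = comb Q.Q (\<lambda>l. ?\<pi> (v i \<otimes>\<^bsub>?P\<^esub> v l)) u"
      using v i by (intro hom_comb[OF P.module_axioms Qm Q.proj_hom _ u]) auto
    also have "\<dots> = comb Q.Q (\<lambda>l. ?\<pi> (\<sigma> (x i \<otimes>\<^bsub>A\<^esub> x l))) u"
    proof (rule comb_cong[OF Qm _ _ u])
      fix l assume l: "l < k"
      show "?\<pi> (v i \<otimes>\<^bsub>?P\<^esub> v l) \<in> carrier Q.Q" using v i l by (intro \<pi>) auto
      show "?\<pi> (v i \<otimes>\<^bsub>?P\<^esub> v l) = ?\<pi> (\<sigma> (x i \<otimes>\<^bsub>A\<^esub> x l))"
        using v i l \<sigma>'(1) x_closed FJ by (intro Q.proj_eqI) (auto simp: F_def)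
    qed
    also have "\<dots> = ?\<pi> (comb ?P (\<lambda>l. \<sigma> (x i \<otimes>\<^bsub>A\<^esub> x l)) u)"
      using \<sigma>'(1) x_closed i by (intro hom_comb[OF P.module_axioms Qm Q.proj_hom _ u, symmetric]) auto
    also have "comb ?P (\<lambda>l. \<sigma> (x i \<otimes>\<^bsub>A\<^esub> x l)) u = \<sigma> (comb A (\<lambda>l. x i \<otimes>\<^bsub>A\<^esub> x l) u)"
      using x_closed i by (intro hom_comb[OF A.module_axioms P.module_axioms \<sigma> _ u, symmetric]) auto
    also have "comb A (\<lambda>l. x i \<otimes>\<^bsub>A\<^esub> x l) u = x i \<otimes>\<^bsub>A\<^esub> comb A x u"
      using x_closed i by (intro hom_comb[OF A.module_axioms A.module_axioms lmultA _ u, symmetric]) auto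
    finally show ?thesis using comb_x[OF u] by simp
  qed
  \<comment> \<open>Both sides are linear in \<open>p\<close>, so it is enough to strip the
    variables off a monomial one after the other.\<close>
  have red: "?\<pi> p = ?\<pi> (\<sigma> (h p))" if p: "p \<in> carrier ?P" for p
  proof (rule A.R.poly_hom_eqI[OF Qm Q.proj_hom _ _ p])
    show "(\<lambda>p. ?\<pi> (\<sigma> (h p))) \<in> module_hom R ?P Q.Q"
      using module_homD[OF hm] \<sigma>' \<pi> by (intro module_homI) auto
    fix w :: "nat multiset" assume "set_mset w \<subseteq> {..<k}"
    then show "?\<pi> (basis_elem R w) = ?\<pi> (\<sigma> (h (basis_elem R w)))"
    proof (induction w)
      case empty
      have "?\<pi> \<one>\<^bsub>?P\<^esub> = ?\<pi> (\<sigma> \<one>\<^bsub>A\<^esub>)" using \<sigma>'(1) FJ by (intro Q.proj_eqI) (auto simp: F_def)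
      then show ?case using h'(4) by (simp add: A.R.poly_one)
    next
      case (add i w)
      then have i: "i < k" and w: "set_mset w \<subseteq> {..<k}" by auto
      note b = A.R.poly_basis_closed[OF w]
      have eq: "basis_elem R (add_mset i w) = v i \<otimes>\<^bsub>?P\<^esub> basis_elem R w"
        unfolding v_def using i w by (simp add: A.R.poly_var_mult_basis)
      have "?\<pi> (v i \<otimes>\<^bsub>?P\<^esub> basis_elem R w) = ?\<pi> (v i \<otimes>\<^bsub>?P\<^esub> \<sigma> (h (basis_elem R w)))"
        using add.IH[OF w] by (intro \<pi>_mult v i b \<sigma>'(1) h'(1))
      also have "\<dots> = ?\<pi> (\<sigma> (x i \<otimes>\<^bsub>A\<^esub> h (basis_elem R w)))" by (intro step i h'(1) b)
      also have "x i \<otimes>\<^bsub>A\<^esub> h (basis_elem R w) = h (v i \<otimes>\<^bsub>?P\<^esub> basis_elem R w)"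
        using h'(3)[OF v[OF i] b] hv[OF i] by simp
      finally show ?case unfolding eq .
    qed
  qed
  have ker: "a_kernel ?P A h = J"
  proof
    have hr: "ring_hom_ring ?P A h"
    proof (rule ring_hom_ringI2)
      show "ring ?P" "ring A" by (rule cring.axioms(1)[OF P.M_cring], rule cring.axioms(1)[OF A.M_cring])
      show "h \<in> Ring.ring_hom ?P A" using h unfolding algebra_hom_def by blast
    qed
    have mem: "p \<in> a_kernel ?P A h \<longleftrightarrow> p \<in> carrier ?P \<and> h p = \<zero>\<^bsub>A\<^esub>" for p
      by (simp add: a_kernel_def')
    show "J \<subseteq> a_kernel ?P A h"
      unfolding J_def
    proof (rule P.genideal_minimal[OF ring_hom_ring.kernel_is_ideal[OF hr]])
      have sub: "h (p \<ominus>\<^bsub>?P\<^esub> q) = h p \<ominus>\<^bsub>A\<^esub> h q" if "p \<in> carrier ?P" "q \<in> carrier ?P" for p q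
        by (rule additive_minus[OF module_abelian_group[OF P.module_axioms] module_abelian_group[OF A.module_axioms] _ _ that])
          (use h' in auto)
      show "F \<subseteq> a_kernel ?P A h"
      proof
        fix p assume p: "p \<in> F"
        then have "h p = \<zero>\<^bsub>A\<^esub>"
          unfolding F_def using v x_closed \<sigma>'(1) h'(3,4) by (auto simp: sub h\<sigma> hv A.minus_eq A.r_neg)
        then show "p \<in> a_kernel ?P A h" using p F(2) by (auto simp: mem)
      qed
    qed
    show "a_kernel ?P A h \<subseteq> J"
    proof
      fix p assume "p \<in> a_kernel ?P A h"
      then have p: "p \<in> carrier ?P" "h p = \<zero>\<^bsub>A\<^esub>" by (auto simp: mem)
      have "\<sigma> \<zero>\<^bsub>A\<^esub> = \<zero>\<^bsub>?P\<^esub>"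
        by (rule additive_zero[OF module_abelian_group[OF A.module_axioms] module_abelian_group[OF P.module_axioms]])
          (use \<sigma>' in auto)
      then have "p \<in> ?\<pi> \<zero>\<^bsub>?P\<^esub>" using red[OF p(1)] p(2) Q.proj_self[OF p(1)] by simp
      then have "p \<ominus>\<^bsub>?P\<^esub> \<zero>\<^bsub>?P\<^esub> \<in> J" using Q.mem_proj_iff[of "\<zero>\<^bsub>?P\<^esub>" p] p by simp
      then show "p \<in> J" using p by (simp add: P.minus_eq)
    qed
  qed
  show ?thesis
    unfolding finitely_presented_algebra_def Let_def
    using A.algebra_axioms F h surj ker unfolding J_def by blast
qed

lemma etale: "etale_algebra TYPE('c) R A"
  unfolding etale_algebra_def by (intro conjI A.algebra_axioms flat separable finitely_presented)

end

section \<open>Localization\<close>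

lemma (in abelian_group) add_eq_right_imp_zero:
  "a \<in> carrier G \<Longrightarrow> x \<in> carrier G \<Longrightarrow> a \<oplus> x = x \<Longrightarrow> a = \<zero>"
  using add.r_cancel_one by simp

lemma ring_as_algebra_simps:
  "carrier (ring_as_algebra S) = carrier S" "x \<oplus>\<^bsub>ring_as_algebra S\<^esub> y = x \<oplus>\<^bsub>S\<^esub> y"
  "\<zero>\<^bsub>ring_as_algebra S\<^esub> = \<zero>\<^bsub>S\<^esub>" "\<one>\<^bsub>ring_as_algebra S\<^esub> = \<one>\<^bsub>S\<^esub>"
  "x \<otimes>\<^bsub>ring_as_algebra S\<^esub> y = x \<otimes>\<^bsub>S\<^esub> y" "a \<odot>\<^bsub>ring_as_algebra S\<^esub> x = a \<otimes>\<^bsub>S\<^esub> x"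
  by (simp_all add: ring_as_algebra_def ring.defs)

lemma (in cring) algebra_ring_as_algebra: "algebra R (ring_as_algebra R)"
proof (rule algebraI)
  show "cring (ring_as_algebra R)"
    by (rule cring_cong[OF is_cring]) (simp_all add: ring_as_algebra_simps)
qed (simp_all add: ring_as_algebra_simps is_cring l_distr r_distr m_assoc)

locale mult_subset = R: cring R for R (structure) +
  fixes T
  assumes T_subset: "T \<subseteq> carrier R" and T_one: "\<one> \<in> T"
    and T_mult: "s \<in> T \<Longrightarrow> t \<in> T \<Longrightarrow> s \<otimes> t \<in> T"
begin

lemma T_carrier: "s \<in> T \<Longrightarrow> s \<in> carrier R"
  using T_subset by auto

abbreviation "RR \<equiv> ring_as_algebra R"
abbreviation "LR \<equiv> localization R T RR"

lemma module_RR: "module R RR"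
  using R.algebra_ring_as_algebra by (rule algebra.axioms)

context
  fixes M :: "('a, 'm, 'y) module_scheme"
  assumes M: "module R M"
begin

interpretation M: module R M by (rule M)

abbreviation (input) "LM \<equiv> localization R T M"
abbreviation (input) "fr m s \<equiv> fraction T M m s"

lemma fraction_rel_equiv: "equiv (carrier M \<times> T) (fraction_rel T M)"
proof (rule equivI)
  show "fraction_rel T M \<subseteq> (carrier M \<times> T) \<times> (carrier M \<times> T)" by (auto simp: fraction_rel_def)
  show "refl_on (carrier M \<times> T) (fraction_rel T M)"
    using T_one by (auto simp: refl_on_def fraction_rel_def)
  show "sym (fraction_rel T M)"
    unfolding sym_def fraction_rel_def by (auto intro: sym)
  show "trans (fraction_rel T M)"
  proof (rule transI)
    fix p q r assume pq: "(p, q) \<in> fraction_rel T M" and qr: "(q, r) \<in> fraction_rel T M"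
    obtain m1 s1 m2 s2 m3 s3 where e: "p = (m1, s1)" "q = (m2, s2)" "r = (m3, s3)"
      by (cases p; cases q; cases r) auto
    have c: "m1 \<in> carrier M" "s1 \<in> T" "m2 \<in> carrier M" "s2 \<in> T" "m3 \<in> carrier M" "s3 \<in> T"
      using pq qr e by (auto simp: fraction_rel_def)
    obtain u where u: "u \<in> T" "u \<odot>\<^bsub>M\<^esub> (s2 \<odot>\<^bsub>M\<^esub> m1) = u \<odot>\<^bsub>M\<^esub> (s1 \<odot>\<^bsub>M\<^esub> m2)"
      using pq e by (auto simp: fraction_rel_def)
    obtain v where v: "v \<in> T" "v \<odot>\<^bsub>M\<^esub> (s3 \<odot>\<^bsub>M\<^esub> m2) = v \<odot>\<^bsub>M\<^esub> (s2 \<odot>\<^bsub>M\<^esub> m3)"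
      using qr e by (auto simp: fraction_rel_def)
    note cR = T_carrier[OF c(2)] T_carrier[OF c(4)] T_carrier[OF c(6)] T_carrier[OF u(1)] T_carrier[OF v(1)]
    \<comment> \<open>The middle denominator \<open>s2\<close> goes into the multiplier along with
      \<open>u\<close> and \<open>v\<close>, since it cannot be cancelled in
      \<open>M\<close>.\<close>
    have "(u \<otimes> v \<otimes> s2) \<odot>\<^bsub>M\<^esub> (s3 \<odot>\<^bsub>M\<^esub> m1) = (v \<otimes> s3) \<odot>\<^bsub>M\<^esub> (u \<odot>\<^bsub>M\<^esub> (s2 \<odot>\<^bsub>M\<^esub> m1))"
      using c cR by (simp add: M.smult_assoc1[symmetric] R.m_ac)
    also have "\<dots> = (u \<otimes> s1) \<odot>\<^bsub>M\<^esub> (v \<odot>\<^bsub>M\<^esub> (s3 \<odot>\<^bsub>M\<^esub> m2))"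
      unfolding u(2) using c cR by (simp add: M.smult_assoc1[symmetric] R.m_ac)
    also have "\<dots> = (u \<otimes> v \<otimes> s2) \<odot>\<^bsub>M\<^esub> (s1 \<odot>\<^bsub>M\<^esub> m3)"
      unfolding v(2) using c cR by (simp add: M.smult_assoc1[symmetric] R.m_ac)
    finally have "(u \<otimes> v \<otimes> s2) \<odot>\<^bsub>M\<^esub> (s3 \<odot>\<^bsub>M\<^esub> m1) = (u \<otimes> v \<otimes> s2) \<odot>\<^bsub>M\<^esub> (s1 \<odot>\<^bsub>M\<^esub> m3)" .
    moreover have "u \<otimes> v \<otimes> s2 \<in> T" using u v c T_mult by blast
    ultimately show "(p, r) \<in> fraction_rel T M"
      unfolding fraction_rel_def e using c by blast
  qed
qed

lemma fraction_eq_iff: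
  assumes "m \<in> carrier M" "s \<in> T" "m' \<in> carrier M" "s' \<in> T"
  shows "fr m s = fr m' s' \<longleftrightarrow> (\<exists>u\<in>T. u \<odot>\<^bsub>M\<^esub> (s' \<odot>\<^bsub>M\<^esub> m) = u \<odot>\<^bsub>M\<^esub> (s \<odot>\<^bsub>M\<^esub> m'))"
proof -
  have "fr m s = fr m' s' \<longleftrightarrow> ((m, s), (m', s')) \<in> fraction_rel T M"
    unfolding fraction_def using assms by (intro eq_equiv_class_iff[OF fraction_rel_equiv]) auto
  then show ?thesis using assms by (simp add: fraction_rel_def)
qed

lemma mem_fraction:
  assumes "p \<in> fr m s" "m \<in> carrier M" "s \<in> T"
  obtains m' s' where "p = (m', s')" "m' \<in> carrier M" "s' \<in> T" "fr m' s' = fr m s"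
proof -
  obtain m' s' where p: "p = (m', s')" by (cases p)
  have "((m, s), (m', s')) \<in> fraction_rel T M" using assms(1) p by (simp add: fraction_def)
  moreover from this have "fr m s = fr m' s'"
    unfolding fraction_def by (rule equiv_class_eq[OF fraction_rel_equiv])
  ultimately show thesis using that p by (auto simp: fraction_rel_def)
qed

lemma fraction_self: "m \<in> carrier M \<Longrightarrow> s \<in> T \<Longrightarrow> (m, s) \<in> fr m s"
  unfolding fraction_def by (rule equiv_class_self[OF fraction_rel_equiv]) simp

lemma carrier_localization: "carrier LM = {fr m s | m s. m \<in> carrier M \<and> s \<in> T}"
  by (auto simp: localization_def fraction_def quotient_def)

lemma fraction_closed: "m \<in> carrier M \<Longrightarrow> s \<in> T \<Longrightarrow> fr m s \<in> carrier LM"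
  by (auto simp: carrier_localization)

lemma localization_elim:
  assumes "U \<in> carrier LM"
  obtains m s where "m \<in> carrier M" "s \<in> T" "U = fr m s"
  using assms by (auto simp: carrier_localization)

lemma fraction_cancel:
  assumes "m \<in> carrier M" "s \<in> T" "c \<in> T"
  shows "fr (c \<odot>\<^bsub>M\<^esub> m) (c \<otimes> s) = fr m s"
proof -
  note cR = T_carrier[OF assms(2)] T_carrier[OF assms(3)]
  have "\<one> \<odot>\<^bsub>M\<^esub> (s \<odot>\<^bsub>M\<^esub> (c \<odot>\<^bsub>M\<^esub> m)) = \<one> \<odot>\<^bsub>M\<^esub> ((c \<otimes> s) \<odot>\<^bsub>M\<^esub> m)"
    using assms cR by (simp add: M.smult_assoc1[symmetric] R.m_ac)
  then show ?thesis
    using assms cR T_one T_mult by (subst fraction_eq_iff) auto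
qed

text \<open>Addition is defined as a union over all representatives of the two classes. The class
  \<open>?g\<close> does not depend on them, so the union over the nonempty classes is a single
  class.\<close>

lemma fraction_add:
  assumes m: "m \<in> carrier M" "s \<in> T" and m': "m' \<in> carrier M" "s' \<in> T"
  shows "fr m s \<oplus>\<^bsub>LM\<^esub> fr m' s' = fr (s' \<odot>\<^bsub>M\<^esub> m \<oplus>\<^bsub>M\<^esub> s \<odot>\<^bsub>M\<^esub> m') (s \<otimes> s')"
proof -
  let ?g = "\<lambda>m s m' s'. fr (s' \<odot>\<^bsub>M\<^esub> m \<oplus>\<^bsub>M\<^esub> s \<odot>\<^bsub>M\<^esub> m') (s \<otimes> s')"
  have g: "?g m1 s1 m2 s2 = ?g m s m' s'"
    if c1: "m1 \<in> carrier M" "s1 \<in> T" "fr m1 s1 = fr m s" and c2: "m2 \<in> carrier M" "s2 \<in> T" "fr m2 s2 = fr m' s'"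
    for m1 s1 m2 s2
  proof -
    obtain u where u: "u \<in> T" "u \<odot>\<^bsub>M\<^esub> (s \<odot>\<^bsub>M\<^esub> m1) = u \<odot>\<^bsub>M\<^esub> (s1 \<odot>\<^bsub>M\<^esub> m)"
      using fraction_eq_iff[OF c1(1,2) m] c1(3) by blast
    obtain v where v: "v \<in> T" "v \<odot>\<^bsub>M\<^esub> (s' \<odot>\<^bsub>M\<^esub> m2) = v \<odot>\<^bsub>M\<^esub> (s2 \<odot>\<^bsub>M\<^esub> m')"
      using fraction_eq_iff[OF c2(1,2) m'] c2(3) by blast
    note cR = T_carrier[OF c1(2)] T_carrier[OF c2(2)] T_carrier[OF m(2)] T_carrier[OF m'(2)] T_carrier[OF u(1)] T_carrier[OF v(1)]
    have "(u \<otimes> v) \<odot>\<^bsub>M\<^esub> ((s \<otimes> s') \<odot>\<^bsub>M\<^esub> (s2 \<odot>\<^bsub>M\<^esub> m1 \<oplus>\<^bsub>M\<^esub> s1 \<odot>\<^bsub>M\<^esub> m2))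
      = (v \<otimes> s' \<otimes> s2) \<odot>\<^bsub>M\<^esub> (u \<odot>\<^bsub>M\<^esub> (s \<odot>\<^bsub>M\<^esub> m1)) \<oplus>\<^bsub>M\<^esub> (u \<otimes> s \<otimes> s1) \<odot>\<^bsub>M\<^esub> (v \<odot>\<^bsub>M\<^esub> (s' \<odot>\<^bsub>M\<^esub> m2))"
      using cR c1 c2 by (simp add: M.smult_r_distr M.smult_assoc1[symmetric] R.m_ac)
    also have "\<dots> = (u \<otimes> v) \<odot>\<^bsub>M\<^esub> ((s1 \<otimes> s2) \<odot>\<^bsub>M\<^esub> (s' \<odot>\<^bsub>M\<^esub> m \<oplus>\<^bsub>M\<^esub> s \<odot>\<^bsub>M\<^esub> m'))"
      unfolding u(2) v(2) using cR m m' by (simp add: M.smult_r_distr M.smult_assoc1[symmetric] R.m_ac)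
    finally show ?thesis
      using cR c1 c2 m m' u(1) v(1) T_mult by (subst fraction_eq_iff) auto
  qed
  have "fr m s \<oplus>\<^bsub>LM\<^esub> fr m' s' = (\<Union>p\<in>fr m s. \<Union>q\<in>fr m' s'. ?g (fst p) (snd p) (fst q) (snd q))"
    by (simp add: localization_def case_prod_unfold)
  also have "\<dots> = (\<Union>p\<in>fr m s. ?g m s m' s')"
  proof (intro SUP_cong refl)
    fix p assume "p \<in> fr m s"
    then obtain m1 s1 where p: "p = (m1, s1)" "m1 \<in> carrier M" "s1 \<in> T" "fr m1 s1 = fr m s"
      using m by (rule mem_fraction)
    have "?g (fst p) (snd p) (fst q) (snd q) = ?g m s m' s'" if q: "q \<in> fr m' s'" for q
    proof -
      obtain m2 s2 where "q = (m2, s2)" "m2 \<in> carrier M" "s2 \<in> T" "fr m2 s2 = fr m' s'"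
        using q m' by (rule mem_fraction)
      then show ?thesis using g[OF p(2-4)] p(1) by simp
    qed
    then show "(\<Union>q\<in>fr m' s'. ?g (fst p) (snd p) (fst q) (snd q)) = ?g m s m' s'"
      using fraction_self[OF m'] by (intro SUP_eq_const) auto
  qed
  also have "\<dots> = ?g m s m' s'" using fraction_self[OF m] by auto
  finally show ?thesis .
qed

text \<open>The module \<open>M\<close> is fixed in this context, whereas the scalars are fractions
  in \<open>RR\<close>. The facts about the latter enter as the hypotheses \<open>rel\<close> and
  \<open>self\<close>, which \<open>fraction_smult'\<close> discharges once the context has been
  left.\<close>

lemma fraction_smult:
  assumes a: "a \<in> carrier R" "t \<in> T" and m: "m \<in> carrier M" "s \<in> T"
    and rel: "\<And>p a t. p \<in> fraction T RR a t \<Longrightarrow> a \<in> carrier R \<Longrightarrow> t \<in> T \<Longrightarrow>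
      fst p \<in> carrier R \<and> snd p \<in> T \<and> (\<exists>u\<in>T. u \<otimes> (t \<otimes> fst p) = u \<otimes> (snd p \<otimes> a))"
    and self: "(a, t) \<in> fraction T RR a t"
  shows "fraction T RR a t \<odot>\<^bsub>LM\<^esub> fr m s = fr (a \<odot>\<^bsub>M\<^esub> m) (t \<otimes> s)"
proof -
  let ?g = "\<lambda>a t m s. fr (a \<odot>\<^bsub>M\<^esub> m) (t \<otimes> s)"
  have g: "?g a1 t1 m1 s1 = ?g a t m s"
    if c1: "a1 \<in> carrier R" "t1 \<in> T" "\<exists>u\<in>T. u \<otimes> (t \<otimes> a1) = u \<otimes> (t1 \<otimes> a)"
      and c2: "m1 \<in> carrier M" "s1 \<in> T" "fr m1 s1 = fr m s"
    for a1 t1 m1 s1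
  proof -
    obtain u where u: "u \<in> T" "u \<otimes> (t \<otimes> a1) = u \<otimes> (t1 \<otimes> a)" using c1(3) by blast
    obtain v where v: "v \<in> T" "v \<odot>\<^bsub>M\<^esub> (s \<odot>\<^bsub>M\<^esub> m1) = v \<odot>\<^bsub>M\<^esub> (s1 \<odot>\<^bsub>M\<^esub> m)"
      using fraction_eq_iff[OF c2(1,2) m] c2(3) by blast
    note cR = c1(1) a(1) T_carrier[OF c1(2)] T_carrier[OF c2(2)] T_carrier[OF a(2)] T_carrier[OF m(2)] T_carrier[OF u(1)] T_carrier[OF v(1)]
    have "(u \<otimes> v) \<odot>\<^bsub>M\<^esub> ((t \<otimes> s) \<odot>\<^bsub>M\<^esub> (a1 \<odot>\<^bsub>M\<^esub> m1)) = (u \<otimes> (t \<otimes> a1)) \<odot>\<^bsub>M\<^esub> (v \<odot>\<^bsub>M\<^esub> (s \<odot>\<^bsub>M\<^esub> m1))"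
      using cR c2 by (simp add: M.smult_assoc1[symmetric] R.m_ac)
    also have "\<dots> = (u \<otimes> v) \<odot>\<^bsub>M\<^esub> ((t1 \<otimes> s1) \<odot>\<^bsub>M\<^esub> (a \<odot>\<^bsub>M\<^esub> m))"
      unfolding u(2) v(2) using cR m by (simp add: M.smult_assoc1[symmetric] R.m_ac)
    finally show ?thesis
      using cR c1 c2 m a u(1) v(1) T_mult by (subst fraction_eq_iff) auto
  qed
  have "fraction T RR a t \<odot>\<^bsub>LM\<^esub> fr m s = (\<Union>p\<in>fraction T RR a t. \<Union>q\<in>fr m s. ?g (fst p) (snd p) (fst q) (snd q))"
    by (simp add: localization_def case_prod_unfold)
  also have "\<dots> = (\<Union>p\<in>fraction T RR a t. ?g a t m s)"
  proof (intro SUP_cong refl)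
    fix p assume "p \<in> fraction T RR a t"
    then have p: "fst p \<in> carrier R" "snd p \<in> T" "\<exists>u\<in>T. u \<otimes> (t \<otimes> fst p) = u \<otimes> (snd p \<otimes> a)"
      using rel a by blast+
    have "?g (fst p) (snd p) (fst q) (snd q) = ?g a t m s" if q: "q \<in> fr m s" for q
    proof -
      obtain m2 s2 where "q = (m2, s2)" "m2 \<in> carrier M" "s2 \<in> T" "fr m2 s2 = fr m s"
        using q m by (rule mem_fraction)
      then show ?thesis using g[OF p] by simp
    qed
    then show "(\<Union>q\<in>fr m s. ?g (fst p) (snd p) (fst q) (snd q)) = ?g a t m s"
      using fraction_self[OF m] by (intro SUP_eq_const) auto
  qed
  also have "\<dots> = ?g a t m s" using self by auto
  finally show ?thesis .
qed

lemma abelian_group_localization: "abelian_group LM"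
proof (rule abelian_groupI)
  have zero: "\<zero>\<^bsub>LM\<^esub> = fr \<zero>\<^bsub>M\<^esub> \<one>" by (simp add: localization_def)
  show "\<zero>\<^bsub>LM\<^esub> \<in> carrier LM" unfolding zero by (intro fraction_closed T_one) simp
  { fix U V assume "U \<in> carrier LM" "V \<in> carrier LM"
    then obtain m s m' s' where e: "U = fr m s" "V = fr m' s'" and c: "m \<in> carrier M" "s \<in> T" "m' \<in> carrier M" "s' \<in> T"
      by (metis localization_elim)
    note cR = T_carrier[OF c(2)] T_carrier[OF c(4)]
    show "U \<oplus>\<^bsub>LM\<^esub> V \<in> carrier LM"
      using c cR T_mult by (auto simp: e fraction_add intro!: fraction_closed)
    show "U \<oplus>\<^bsub>LM\<^esub> V = V \<oplus>\<^bsub>LM\<^esub> U"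
      using c cR by (simp add: e fraction_add R.m_comm M.a_comm)
    fix W assume "W \<in> carrier LM"
    then obtain m'' s'' where e': "W = fr m'' s''" and c': "m'' \<in> carrier M" "s'' \<in> T"
      by (metis localization_elim)
    note cR' = cR T_carrier[OF c'(2)]
    show "U \<oplus>\<^bsub>LM\<^esub> V \<oplus>\<^bsub>LM\<^esub> W = U \<oplus>\<^bsub>LM\<^esub> (V \<oplus>\<^bsub>LM\<^esub> W)"
      using c c' cR' T_mult
      by (simp add: e e' fraction_add M.smult_r_distr M.smult_assoc1[symmetric] R.m_ac M.a_ac) }
  fix U assume "U \<in> carrier LM"
  then obtain m s where e: "U = fr m s" and c: "m \<in> carrier M" "s \<in> T" by (metis localization_elim)
  note cR = T_carrier[OF c(2)]
  show "\<zero>\<^bsub>LM\<^esub> \<oplus>\<^bsub>LM\<^esub> U = U" using c cR T_one by (simp add: zero e fraction_add)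
  show "\<exists>V\<in>carrier LM. V \<oplus>\<^bsub>LM\<^esub> U = \<zero>\<^bsub>LM\<^esub>"
  proof
    show "fr (\<ominus>\<^bsub>M\<^esub> m) s \<in> carrier LM" using c by (intro fraction_closed) auto
    have "fr (\<ominus>\<^bsub>M\<^esub> m) s \<oplus>\<^bsub>LM\<^esub> U = fr (s \<odot>\<^bsub>M\<^esub> (\<ominus>\<^bsub>M\<^esub> m \<oplus>\<^bsub>M\<^esub> m)) (s \<otimes> s)"
      using c cR by (simp add: e fraction_add M.smult_r_distr del: M.l_neg)
    also have "\<dots> = \<zero>\<^bsub>LM\<^esub>"
      unfolding zero using c cR T_mult T_one by (subst fraction_eq_iff) (auto simp: M.l_neg intro!: bexI[of _ \<one>])
    finally show "fr (\<ominus>\<^bsub>M\<^esub> m) s \<oplus>\<^bsub>LM\<^esub> U = \<zero>\<^bsub>LM\<^esub>" .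
  qed
qed

lemma fraction_hom:
  assumes "s \<in> T"
  shows "m \<in> carrier M \<Longrightarrow> m' \<in> carrier M \<Longrightarrow> fr (m \<oplus>\<^bsub>M\<^esub> m') s = fr m s \<oplus>\<^bsub>LM\<^esub> fr m' s"
  using assms T_carrier[OF assms] fraction_cancel[of "m \<oplus>\<^bsub>M\<^esub> m'" s s]
  by (simp add: fraction_add M.smult_r_distr)

end

section \<open>The localized ring and its action on localized modules\<close>

lemma fraction_RR:
  assumes "p \<in> fraction T RR a t" "a \<in> carrier R" "t \<in> T"
  shows "fst p \<in> carrier R \<and> snd p \<in> T \<and> (\<exists>u\<in>T. u \<otimes> (t \<otimes> fst p) = u \<otimes> (snd p \<otimes> a))"
proof -
  obtain a' t' where p: "p = (a', t')" "a' \<in> carrier R" "t' \<in> T" "fraction T RR a' t' = fraction T RR a t"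
    using mem_fraction[OF module_RR assms(1)] assms by (auto simp: ring_as_algebra_simps)
  then show ?thesis
    using fraction_eq_iff[OF module_RR, of a' t' a t] assms by (auto simp: ring_as_algebra_simps)
qed

lemma fraction_smult':
  assumes M: "module R M" and "a \<in> carrier R" "t \<in> T" "m \<in> carrier M" "s \<in> T"
  shows "fraction T RR a t \<odot>\<^bsub>localization R T M\<^esub> fraction T M m s = fraction T M (a \<odot>\<^bsub>M\<^esub> m) (t \<otimes> s)"
  using assms by (intro fraction_smult[OF M] fraction_RR fraction_self[OF module_RR]) (auto simp: ring_as_algebra_simps)

lemma LR_elim:
  assumes "U \<in> carrier LR"
  obtains a t where "a \<in> carrier R" "t \<in> T" "U = fraction T RR a t"
  using localization_elim[OF module_RR assms] by (auto simp: ring_as_algebra_simps)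

lemma LR_add:
  "a \<in> carrier R \<Longrightarrow> t \<in> T \<Longrightarrow> b \<in> carrier R \<Longrightarrow> r \<in> T \<Longrightarrow>
    fraction T RR a t \<oplus>\<^bsub>LR\<^esub> fraction T RR b r = fraction T RR (r \<otimes> a \<oplus> t \<otimes> b) (t \<otimes> r)"
  using fraction_add[OF module_RR, of a t b r] by (simp add: ring_as_algebra_simps)

lemma LR_closed: "a \<in> carrier R \<Longrightarrow> t \<in> T \<Longrightarrow> fraction T RR a t \<in> carrier LR"
  by (rule fraction_closed[OF module_RR]) (simp_all add: ring_as_algebra_simps)

lemma localization_smult_closed:
  assumes M: "module R M" and "A \<in> carrier LR" "U \<in> carrier (localization R T M)"
  shows "A \<odot>\<^bsub>localization R T M\<^esub> U \<in> carrier (localization R T M)"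
proof -
  interpret M: module R M by (rule M)
  obtain a t where a: "a \<in> carrier R" "t \<in> T" "A = fraction T RR a t" using LR_elim assms(2) by blast
  obtain m s where m: "m \<in> carrier M" "s \<in> T" "U = fraction T M m s" using localization_elim[OF M assms(3)] by blast
  show ?thesis using a m T_mult by (simp add: fraction_smult'[OF M] fraction_closed[OF M])
qed

lemma localization_smult_l_distr:
  assumes M: "module R M" and "A \<in> carrier LR" "B \<in> carrier LR" "U \<in> carrier (localization R T M)"
  shows "(A \<oplus>\<^bsub>LR\<^esub> B) \<odot>\<^bsub>localization R T M\<^esub> U
    = A \<odot>\<^bsub>localization R T M\<^esub> U \<oplus>\<^bsub>localization R T M\<^esub> B \<odot>\<^bsub>localization R T M\<^esub> U"
proof -
  interpret M: module R M by (rule M)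
  obtain a t where a: "a \<in> carrier R" "t \<in> T" "A = fraction T RR a t" using LR_elim assms(2) by blast
  obtain b r where b: "b \<in> carrier R" "r \<in> T" "B = fraction T RR b r" using LR_elim assms(3) by blast
  obtain m s where m: "m \<in> carrier M" "s \<in> T" "U = fraction T M m s" using localization_elim[OF M assms(4)] by blast
  note cR = T_carrier[OF a(2)] T_carrier[OF b(2)] T_carrier[OF m(2)]
  have tr: "t \<otimes> r \<in> T" "t \<otimes> s \<in> T" "r \<otimes> s \<in> T" "t \<otimes> r \<otimes> s \<in> T" using a b m T_mult by auto
  have "(A \<oplus>\<^bsub>LR\<^esub> B) \<odot>\<^bsub>localization R T M\<^esub> U = fraction T M ((r \<otimes> a \<oplus> t \<otimes> b) \<odot>\<^bsub>M\<^esub> m) (t \<otimes> r \<otimes> s)"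
    using a b m cR tr by (simp add: LR_add fraction_smult'[OF M])
  also have "\<dots> = fraction T M (s \<odot>\<^bsub>M\<^esub> ((r \<otimes> a \<oplus> t \<otimes> b) \<odot>\<^bsub>M\<^esub> m)) (s \<otimes> (t \<otimes> r \<otimes> s))"
    using a b m cR tr by (intro fraction_cancel[OF M, symmetric]) auto
  also have "\<dots> = A \<odot>\<^bsub>localization R T M\<^esub> U \<oplus>\<^bsub>localization R T M\<^esub> B \<odot>\<^bsub>localization R T M\<^esub> U"
    using a b m cR tr
    by (simp add: fraction_smult'[OF M] fraction_add[OF M] M.smult_l_distr M.smult_r_distr M.smult_assoc1[symmetric] R.m_ac)
  finally show ?thesis .
qed

lemma localization_smult_r_distr:
  assumes M: "module R M" and "A \<in> carrier LR" "U \<in> carrier (localization R T M)" "V \<in> carrier (localization R T M)"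
  shows "A \<odot>\<^bsub>localization R T M\<^esub> (U \<oplus>\<^bsub>localization R T M\<^esub> V)
    = A \<odot>\<^bsub>localization R T M\<^esub> U \<oplus>\<^bsub>localization R T M\<^esub> A \<odot>\<^bsub>localization R T M\<^esub> V"
proof -
  interpret M: module R M by (rule M)
  obtain a t where a: "a \<in> carrier R" "t \<in> T" "A = fraction T RR a t" using LR_elim assms(2) by blast
  obtain m s where m: "m \<in> carrier M" "s \<in> T" "U = fraction T M m s" using localization_elim[OF M assms(3)] by blast
  obtain m' s' where m': "m' \<in> carrier M" "s' \<in> T" "V = fraction T M m' s'" using localization_elim[OF M assms(4)] by blast
  note cR = T_carrier[OF a(2)] T_carrier[OF m(2)] T_carrier[OF m'(2)]
  have ts: "t \<otimes> s \<in> T" "t \<otimes> s' \<in> T" "s \<otimes> s' \<in> T" "t \<otimes> (s \<otimes> s') \<in> T" using a m m' T_mult by auto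
  have "A \<odot>\<^bsub>localization R T M\<^esub> (U \<oplus>\<^bsub>localization R T M\<^esub> V)
    = fraction T M (a \<odot>\<^bsub>M\<^esub> (s' \<odot>\<^bsub>M\<^esub> m \<oplus>\<^bsub>M\<^esub> s \<odot>\<^bsub>M\<^esub> m')) (t \<otimes> (s \<otimes> s'))"
    using a m m' cR ts by (simp add: fraction_smult'[OF M] fraction_add[OF M])
  also have "\<dots> = fraction T M (t \<odot>\<^bsub>M\<^esub> (a \<odot>\<^bsub>M\<^esub> (s' \<odot>\<^bsub>M\<^esub> m \<oplus>\<^bsub>M\<^esub> s \<odot>\<^bsub>M\<^esub> m'))) (t \<otimes> (t \<otimes> (s \<otimes> s')))"
    using a m m' cR ts by (intro fraction_cancel[OF M, symmetric]) auto
  also have "\<dots> = A \<odot>\<^bsub>localization R T M\<^esub> U \<oplus>\<^bsub>localization R T M\<^esub> A \<odot>\<^bsub>localization R T M\<^esub> V"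
    using a m m' cR ts
    by (simp add: fraction_smult'[OF M] fraction_add[OF M] M.smult_r_distr M.smult_assoc1[symmetric] R.m_ac)
  finally show ?thesis .
qed

text \<open>The product of fractions in \<open>RR\<close> is given by the same formula as the scalar
  action of \<open>LR\<close> on itself, so distributivity in the ring is an instance of
  distributivity in the module.\<close>

lemma LR_mult: "A \<otimes>\<^bsub>LR\<^esub> B = A \<odot>\<^bsub>LR\<^esub> B"
  by (simp add: localization_def ring_as_algebra_simps)

lemma LR_mult_fraction:
  "a \<in> carrier R \<Longrightarrow> t \<in> T \<Longrightarrow> b \<in> carrier R \<Longrightarrow> r \<in> T \<Longrightarrow>
    fraction T RR a t \<otimes>\<^bsub>LR\<^esub> fraction T RR b r = fraction T RR (a \<otimes> b) (t \<otimes> r)"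
  using fraction_smult'[OF module_RR, of a t b r] by (simp add: LR_mult ring_as_algebra_simps)

lemma LR_one: "\<one>\<^bsub>LR\<^esub> = fraction T RR \<one> \<one>"
  by (simp add: localization_def ring_as_algebra_simps)

lemma LR_zero: "\<zero>\<^bsub>LR\<^esub> = fraction T RR \<zero> \<one>"
  by (simp add: localization_def ring_as_algebra_simps)

lemma cring_LR: "cring LR"
proof (rule cringI)
  show "abelian_group LR" by (rule abelian_group_localization[OF module_RR])
  show "comm_monoid LR"
  proof (rule comm_monoidI)
    show "\<one>\<^bsub>LR\<^esub> \<in> carrier LR" unfolding LR_one by (intro LR_closed T_one) simp
    fix U V assume UV: "U \<in> carrier LR" "V \<in> carrier LR"
    obtain a t where a: "a \<in> carrier R" "t \<in> T" "U = fraction T RR a t" using LR_elim UV(1) by blast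
    obtain b r where b: "b \<in> carrier R" "r \<in> T" "V = fraction T RR b r" using LR_elim UV(2) by blast
    note cR = T_carrier[OF a(2)] T_carrier[OF b(2)]
    show "U \<otimes>\<^bsub>LR\<^esub> V \<in> carrier LR" using a b T_mult by (simp add: LR_mult_fraction LR_closed)
    show "U \<otimes>\<^bsub>LR\<^esub> V = V \<otimes>\<^bsub>LR\<^esub> U" using a b cR by (simp add: LR_mult_fraction R.m_comm)
    show "\<one>\<^bsub>LR\<^esub> \<otimes>\<^bsub>LR\<^esub> U = U" using a cR T_one by (simp add: LR_one LR_mult_fraction)
    fix W assume "W \<in> carrier LR"
    then obtain c q where c: "c \<in> carrier R" "q \<in> T" "W = fraction T RR c q" using LR_elim by blast
    show "U \<otimes>\<^bsub>LR\<^esub> V \<otimes>\<^bsub>LR\<^esub> W = U \<otimes>\<^bsub>LR\<^esub> (V \<otimes>\<^bsub>LR\<^esub> W)"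
      using a b c cR T_carrier[OF c(2)] T_mult by (simp add: LR_mult_fraction R.m_assoc)
  qed
  show "(A \<oplus>\<^bsub>LR\<^esub> B) \<otimes>\<^bsub>LR\<^esub> C = A \<otimes>\<^bsub>LR\<^esub> C \<oplus>\<^bsub>LR\<^esub> B \<otimes>\<^bsub>LR\<^esub> C"
    if "A \<in> carrier LR" "B \<in> carrier LR" "C \<in> carrier LR" for A B C
    unfolding LR_mult by (rule localization_smult_l_distr[OF module_RR that])
qed

lemma module_localization:
  assumes M: "module R M"
  shows "module LR (localization R T M)"
proof (rule moduleI)
  interpret M: module R M by (rule M)
  show "cring LR" by (rule cring_LR)
  show "abelian_group (localization R T M)" by (rule abelian_group_localization[OF M])
  fix U assume U: "U \<in> carrier (localization R T M)"
  obtain m s where m: "m \<in> carrier M" "s \<in> T" "U = fraction T M m s" using localization_elim[OF M U] by blast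
  show "\<one>\<^bsub>LR\<^esub> \<odot>\<^bsub>localization R T M\<^esub> U = U"
    using m T_one T_carrier[OF m(2)] by (simp add: LR_one fraction_smult'[OF M])
  fix A B assume A: "A \<in> carrier LR" and B: "B \<in> carrier LR"
  obtain a t where a: "a \<in> carrier R" "t \<in> T" "A = fraction T RR a t" using LR_elim A by blast
  obtain b r where b: "b \<in> carrier R" "r \<in> T" "B = fraction T RR b r" using LR_elim B by blast
  show "(A \<otimes>\<^bsub>LR\<^esub> B) \<odot>\<^bsub>localization R T M\<^esub> U = A \<odot>\<^bsub>localization R T M\<^esub> (B \<odot>\<^bsub>localization R T M\<^esub> U)"
    using a b m T_mult T_carrier[OF a(2)] T_carrier[OF b(2)] T_carrier[OF m(2)]
    by (simp add: LR_mult_fraction fraction_smult'[OF M] M.smult_assoc1 R.m_assoc)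
qed (use localization_smult_closed[OF M] localization_smult_l_distr[OF M] localization_smult_r_distr[OF M] in auto)

text \<open>A linear relation with coefficients in the localized ring becomes one with coefficients
  in \<open>R\<close> once all denominators agree.\<close>

lemma common_denominator:
  assumes "\<And>i. i < (n :: nat) \<Longrightarrow> D i \<in> carrier LR"
  shows "\<exists>t\<in>T. \<exists>d. \<forall>i<n. d i \<in> carrier R \<and> D i = fraction T RR (d i) t"
  using assms
proof (induction n)
  case 0
  then show ?case using T_one by auto
next
  case (Suc n)
  then obtain t d where t: "t \<in> T" and d: "\<And>i. i < n \<Longrightarrow> d i \<in> carrier R \<and> D i = fraction T RR (d i) t"
    by (metis less_SucI)
  obtain a r where a: "a \<in> carrier R" "r \<in> T" "D n = fraction T RR a r" using LR_elim Suc.prems by blast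
  define d' where "d' i = (if i < n then r \<otimes> d i else t \<otimes> a)" for i
  have cancel: "fraction T RR (c \<otimes> b) (c \<otimes> s) = fraction T RR b s" if "b \<in> carrier R" "s \<in> T" "c \<in> T" for b c s
    using fraction_cancel[OF module_RR, of b s c] that by (simp add: ring_as_algebra_simps)
  have "d' i \<in> carrier R \<and> D i = fraction T RR (d' i) (r \<otimes> t)" if "i < Suc n" for i
  proof (cases "i < n")
    case True
    then show ?thesis using d[OF True] a t T_carrier cancel by (simp add: d'_def)
  next
    case False
    then have "i = n" using that by simp
    then show ?thesis using a t T_carrier[OF t] T_carrier[OF a(2)] cancel[of a r t]
      by (simp add: d'_def R.m_comm)
  qed
  then show ?case using a t T_mult by blast
qed

text \<open>Since \<open>s\<close> becomes invertible, the \<open>b i\<close> span after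
  localization. A relation with cleared denominators has coefficients that are killed by an element
  of \<open>T\<close>, so they vanish in the localized ring and the coordinates are unique.\<close>

lemma free_localization:
  fixes n :: nat
  assumes M: "module R M" and b: "\<And>i. i < n \<Longrightarrow> b i \<in> carrier M" and s: "s \<in> T"
    and c: "\<And>m i. m \<in> carrier M \<Longrightarrow> i < n \<Longrightarrow> c m i \<in> carrier R"
    and span: "\<And>m. m \<in> carrier M \<Longrightarrow> s \<odot>\<^bsub>M\<^esub> m = (\<Oplus>\<^bsub>M\<^esub>i\<in>{..<n}. c m i \<odot>\<^bsub>M\<^esub> b i)"
    and indep: "\<And>d. (\<And>i. i < n \<Longrightarrow> d i \<in> carrier R) \<Longrightarrow> (\<Oplus>\<^bsub>M\<^esub>i\<in>{..<n}. d i \<odot>\<^bsub>M\<^esub> b i) = \<zero>\<^bsub>M\<^esub> \<Longrightarrow>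
      \<exists>v\<in>T. \<forall>i<n. v \<otimes> d i = \<zero>"
  shows "free_module_of_rank n LR (localization R T M)"
proof -
  interpret M: module R M by (rule M)
  let ?L = "localization R T M"
  interpret L: module LR ?L by (rule module_localization[OF M])
  define \<beta> where "\<beta> i = fraction T M (b i) \<one>" for i
  have \<beta>: "\<beta> i \<in> carrier ?L" if "i < n" for i
    unfolding \<beta>_def using b[OF that] by (intro fraction_closed[OF M] T_one)
  have sum_frac: "(\<Oplus>\<^bsub>?L\<^esub>i\<in>{..<n}. fraction T RR (d i) t \<odot>\<^bsub>?L\<^esub> \<beta> i) = fraction T M (\<Oplus>\<^bsub>M\<^esub>i\<in>{..<n}. d i \<odot>\<^bsub>M\<^esub> b i) t"
    if d: "\<And>i. i < n \<Longrightarrow> d i \<in> carrier R" and t: "t \<in> T" for d t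
  proof -
    have "(\<Oplus>\<^bsub>?L\<^esub>i\<in>{..<n}. fraction T RR (d i) t \<odot>\<^bsub>?L\<^esub> \<beta> i) = (\<Oplus>\<^bsub>?L\<^esub>i\<in>{..<n}. fraction T M (d i \<odot>\<^bsub>M\<^esub> b i) t)"
      using d t b T_one T_carrier[OF t]
      by (intro L.finsum_cong') (auto simp: \<beta>_def fraction_smult'[OF M] intro!: fraction_closed[OF M])
    also have "\<dots> = fraction T M (\<Oplus>\<^bsub>M\<^esub>i\<in>{..<n}. d i \<odot>\<^bsub>M\<^esub> b i) t"
      by (rule additive_finsum[symmetric, where h = "\<lambda>m. fraction T M m t",
            OF module_abelian_group[OF M] abelian_group_localization[OF M]])
        (use d t b in \<open>auto simp: fraction_hom[OF M t] intro!: fraction_closed[OF M]\<close>)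
    finally show ?thesis .
  qed
  have ex: "\<exists>C. C \<in> {..<n} \<rightarrow>\<^sub>E carrier LR \<and> U = (\<Oplus>\<^bsub>?L\<^esub>i\<in>{..<n}. C i \<odot>\<^bsub>?L\<^esub> \<beta> i)" if U: "U \<in> carrier ?L" for U
  proof -
    obtain m r where m: "m \<in> carrier M" "r \<in> T" "U = fraction T M m r" using localization_elim[OF M U] by blast
    have sr: "s \<otimes> r \<in> T" using s m T_mult by blast
    define C where "C = (\<lambda>i\<in>{..<n}. fraction T RR (c m i) (s \<otimes> r))"
    have C: "C \<in> {..<n} \<rightarrow>\<^sub>E carrier LR" unfolding C_def using c[OF m(1)] sr LR_closed by auto
    have "(\<Oplus>\<^bsub>?L\<^esub>i\<in>{..<n}. C i \<odot>\<^bsub>?L\<^esub> \<beta> i) = (\<Oplus>\<^bsub>?L\<^esub>i\<in>{..<n}. fraction T RR (c m i) (s \<otimes> r) \<odot>\<^bsub>?L\<^esub> \<beta> i)"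
      using c[OF m(1)] sr LR_closed \<beta> by (intro L.finsum_cong') (auto simp: C_def)
    also have "\<dots> = fraction T M (s \<odot>\<^bsub>M\<^esub> m) (s \<otimes> r)"
      unfolding span[OF m(1)] using c[OF m(1)] sr by (rule sum_frac)
    also have "\<dots> = U" unfolding m(3) by (rule fraction_cancel[OF M m(1,2) s])
    finally show ?thesis using C by blast
  qed
  have uniq: "C = C'" if C: "C \<in> {..<n} \<rightarrow>\<^sub>E carrier LR" and C': "C' \<in> {..<n} \<rightarrow>\<^sub>E carrier LR"
    and eq: "(\<Oplus>\<^bsub>?L\<^esub>i\<in>{..<n}. C i \<odot>\<^bsub>?L\<^esub> \<beta> i) = (\<Oplus>\<^bsub>?L\<^esub>i\<in>{..<n}. C' i \<odot>\<^bsub>?L\<^esub> \<beta> i)" for C C'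
  proof -
    have Cc: "C i \<in> carrier LR" "C' i \<in> carrier LR" if "i < n" for i using C C' that by auto
    define E where "E i = C i \<ominus>\<^bsub>LR\<^esub> C' i" for i
    have E: "E i \<in> carrier LR" if "i < n" for i unfolding E_def using Cc[OF that] by (rule L.R.minus_closed)
    have CE: "C i = E i \<oplus>\<^bsub>LR\<^esub> C' i" if "i < n" for i
      unfolding E_def using Cc[OF that] by (simp add: L.R.minus_eq L.R.a_assoc L.R.l_neg)
    have "(\<Oplus>\<^bsub>?L\<^esub>i\<in>{..<n}. C i \<odot>\<^bsub>?L\<^esub> \<beta> i) = (\<Oplus>\<^bsub>?L\<^esub>i\<in>{..<n}. E i \<odot>\<^bsub>?L\<^esub> \<beta> i \<oplus>\<^bsub>?L\<^esub> C' i \<odot>\<^bsub>?L\<^esub> \<beta> i)"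
      using E Cc \<beta> by (intro L.finsum_cong') (auto simp: CE L.smult_l_distr)
    also have "\<dots> = (\<Oplus>\<^bsub>?L\<^esub>i\<in>{..<n}. E i \<odot>\<^bsub>?L\<^esub> \<beta> i) \<oplus>\<^bsub>?L\<^esub> (\<Oplus>\<^bsub>?L\<^esub>i\<in>{..<n}. C' i \<odot>\<^bsub>?L\<^esub> \<beta> i)"
      using E Cc \<beta> by (intro L.finsum_addf) auto
    finally have sum: "(\<Oplus>\<^bsub>?L\<^esub>i\<in>{..<n}. E i \<odot>\<^bsub>?L\<^esub> \<beta> i) \<oplus>\<^bsub>?L\<^esub> (\<Oplus>\<^bsub>?L\<^esub>i\<in>{..<n}. C' i \<odot>\<^bsub>?L\<^esub> \<beta> i)
      = (\<Oplus>\<^bsub>?L\<^esub>i\<in>{..<n}. C' i \<odot>\<^bsub>?L\<^esub> \<beta> i)" using eq by simp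
    have cl: "(\<Oplus>\<^bsub>?L\<^esub>i\<in>{..<n}. E i \<odot>\<^bsub>?L\<^esub> \<beta> i) \<in> carrier ?L" "(\<Oplus>\<^bsub>?L\<^esub>i\<in>{..<n}. C' i \<odot>\<^bsub>?L\<^esub> \<beta> i) \<in> carrier ?L"
      using E Cc \<beta> by (auto intro!: L.finsum_closed)
    have sumE: "(\<Oplus>\<^bsub>?L\<^esub>i\<in>{..<n}. E i \<odot>\<^bsub>?L\<^esub> \<beta> i) = \<zero>\<^bsub>?L\<^esub>"
      by (rule abelian_group.add_eq_right_imp_zero[OF abelian_group_localization[OF M] cl sum])
    obtain t d where t: "t \<in> T" and d: "\<forall>i<n. d i \<in> carrier R \<and> E i = fraction T RR (d i) t"
      using common_denominator[of n E] E by blast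
    let ?S = "\<Oplus>\<^bsub>M\<^esub>i\<in>{..<n}. d i \<odot>\<^bsub>M\<^esub> b i"
    have S: "?S \<in> carrier M" using d b by (intro M.finsum_closed) auto
    have "(\<Oplus>\<^bsub>?L\<^esub>i\<in>{..<n}. E i \<odot>\<^bsub>?L\<^esub> \<beta> i) = (\<Oplus>\<^bsub>?L\<^esub>i\<in>{..<n}. fraction T RR (d i) t \<odot>\<^bsub>?L\<^esub> \<beta> i)"
      using d E \<beta> by (intro L.finsum_cong') auto
    also have "\<dots> = fraction T M ?S t" by (rule sum_frac) (use d t in auto)
    finally have "fraction T M ?S t = fraction T M \<zero>\<^bsub>M\<^esub> \<one>" using sumE by (simp add: localization_def)
    \<comment> \<open>Vanishing in the localization means vanishing after multiplication by some
      \<open>u\<close> in \<open>T\<close>, so the relation over \<open>R\<close> to which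
      \<open>indep\<close> applies is the one with coefficients \<open>u d_i\<close>.\<close>
    then obtain u where u: "u \<in> T" "u \<odot>\<^bsub>M\<^esub> (\<one> \<odot>\<^bsub>M\<^esub> ?S) = u \<odot>\<^bsub>M\<^esub> (t \<odot>\<^bsub>M\<^esub> \<zero>\<^bsub>M\<^esub>)"
      using fraction_eq_iff[OF M S t M.zero_closed T_one] by blast
    then have "u \<odot>\<^bsub>M\<^esub> ?S = \<zero>\<^bsub>M\<^esub>" using S T_carrier[OF t] T_carrier[OF u(1)] by simp
    moreover have "u \<odot>\<^bsub>M\<^esub> ?S = (\<Oplus>\<^bsub>M\<^esub>i\<in>{..<n}. u \<odot>\<^bsub>M\<^esub> (d i \<odot>\<^bsub>M\<^esub> b i))"
      using d b T_carrier[OF u(1)] by (intro M.finsum_smult_ldistr) auto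
    moreover have "\<dots> = (\<Oplus>\<^bsub>M\<^esub>i\<in>{..<n}. (u \<otimes> d i) \<odot>\<^bsub>M\<^esub> b i)"
      using d b T_carrier[OF u(1)] by (intro M.finsum_cong') (auto simp: M.smult_assoc1)
    ultimately have "(\<Oplus>\<^bsub>M\<^esub>i\<in>{..<n}. (u \<otimes> d i) \<odot>\<^bsub>M\<^esub> b i) = \<zero>\<^bsub>M\<^esub>" by simp
    then obtain v where v: "v \<in> T" "\<forall>i<n. v \<otimes> (u \<otimes> d i) = \<zero>"
      using indep[of "\<lambda>i. u \<otimes> d i"] d T_carrier[OF u(1)] by auto
    have E0: "E i = \<zero>\<^bsub>LR\<^esub>" if i: "i < n" for i
    proof -
      have di: "d i \<in> carrier R" "E i = fraction T RR (d i) t" using d i by auto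
      have vu: "v \<otimes> u \<in> T" using T_mult v u by blast
      have "(v \<otimes> u) \<otimes> (\<one> \<otimes> d i) = (v \<otimes> u) \<otimes> (t \<otimes> \<zero>)"
        using v(2) i di T_carrier[OF v(1)] T_carrier[OF u(1)] T_carrier[OF t] by (simp add: R.m_assoc)
      then show ?thesis
        unfolding di(2) LR_zero using fraction_eq_iff[OF module_RR, of "d i" t \<zero> \<one>] di t T_one vu
        by (auto simp: ring_as_algebra_simps)
    qed
    show "C = C'"
    proof
      fix i show "C i = C' i"
      proof (cases "i < n")
        case True
        then show ?thesis using CE[OF True] E0[OF True] Cc[OF True] by simp
      next
        case False
        then show ?thesis using PiE_arb[OF C, of i] PiE_arb[OF C', of i] by simp
      qed
    qed
  qed
  have "\<exists>!C. C \<in> {..<n} \<rightarrow>\<^sub>E carrier LR \<and> U = (\<Oplus>\<^bsub>?L\<^esub>i\<in>{..<n}. C i \<odot>\<^bsub>?L\<^esub> \<beta> i)" if U: "U \<in> carrier ?L" for U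
  proof (rule ex_ex1I)
    show "\<exists>C. C \<in> {..<n} \<rightarrow>\<^sub>E carrier LR \<and> U = (\<Oplus>\<^bsub>?L\<^esub>i\<in>{..<n}. C i \<odot>\<^bsub>?L\<^esub> \<beta> i)" by (rule ex[OF U])
    fix C C'
    assume C: "C \<in> {..<n} \<rightarrow>\<^sub>E carrier LR \<and> U = (\<Oplus>\<^bsub>?L\<^esub>i\<in>{..<n}. C i \<odot>\<^bsub>?L\<^esub> \<beta> i)"
      and C': "C' \<in> {..<n} \<rightarrow>\<^sub>E carrier LR \<and> U = (\<Oplus>\<^bsub>?L\<^esub>i\<in>{..<n}. C' i \<odot>\<^bsub>?L\<^esub> \<beta> i)"
    show "C = C'" by (rule uniq[OF conjunct1[OF C] conjunct1[OF C'] trans[OF conjunct2[OF C, symmetric] conjunct2[OF C']]])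
  qed
  then have unique: "\<forall>U\<in>carrier ?L. \<exists>!C. C \<in> {..<n} \<rightarrow>\<^sub>E carrier LR \<and> U = (\<Oplus>\<^bsub>?L\<^esub>i\<in>{..<n}. C i \<odot>\<^bsub>?L\<^esub> \<beta> i)"
    by (rule ballI)
  have "\<beta> \<in> {..<n} \<rightarrow> carrier ?L" using \<beta> by auto
  then show ?thesis
    unfolding free_module_of_rank_def
    by (intro conjI bexI[of _ \<beta>] unique) (rule module_localization[OF M])
qed

end

section \<open>Products of algebras with trace forms\<close>

lemma product_algebra_simps:
  "carrier (product_algebra A B) = carrier A \<times> carrier B"
  "p \<oplus>\<^bsub>product_algebra A B\<^esub> q = (fst p \<oplus>\<^bsub>A\<^esub> fst q, snd p \<oplus>\<^bsub>B\<^esub> snd q)"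
  "p \<otimes>\<^bsub>product_algebra A B\<^esub> q = (fst p \<otimes>\<^bsub>A\<^esub> fst q, snd p \<otimes>\<^bsub>B\<^esub> snd q)"
  "\<zero>\<^bsub>product_algebra A B\<^esub> = (\<zero>\<^bsub>A\<^esub>, \<zero>\<^bsub>B\<^esub>)"
  "\<one>\<^bsub>product_algebra A B\<^esub> = (\<one>\<^bsub>A\<^esub>, \<one>\<^bsub>B\<^esub>)"
  "a \<odot>\<^bsub>product_algebra A B\<^esub> p = (a \<odot>\<^bsub>A\<^esub> fst p, a \<odot>\<^bsub>B\<^esub> snd p)"
  by (simp_all add: product_algebra_def RDirProd_def DirProd_def monoid.defs ring.defs case_prod_unfold)

lemma power_algebra_simps:
  "carrier (power_algebra A m) = {..<m} \<rightarrow>\<^sub>E carrier A"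
  "x \<oplus>\<^bsub>power_algebra A m\<^esub> y = (\<lambda>i\<in>{..<m}. x i \<oplus>\<^bsub>A\<^esub> y i)"
  "x \<otimes>\<^bsub>power_algebra A m\<^esub> y = (\<lambda>i\<in>{..<m}. x i \<otimes>\<^bsub>A\<^esub> y i)"
  "\<zero>\<^bsub>power_algebra A m\<^esub> = (\<lambda>i\<in>{..<m}. \<zero>\<^bsub>A\<^esub>)"
  "\<one>\<^bsub>power_algebra A m\<^esub> = (\<lambda>i\<in>{..<m}. \<one>\<^bsub>A\<^esub>)"
  "a \<odot>\<^bsub>power_algebra A m\<^esub> x = (\<lambda>i\<in>{..<m}. a \<odot>\<^bsub>A\<^esub> x i)"
  by (simp_all add: power_algebra_def)

lemma algebra_product_algebra:
  assumes "algebra R A" "algebra R B"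
  shows "algebra R (product_algebra A B)"
proof -
  interpret A: algebra R A by fact
  interpret B: algebra R B by fact
  let ?P = "product_algebra A B"
  have "abelian_group ?P"
  proof (rule abelian_groupI)
    fix p assume p: "p \<in> carrier ?P"
    show "\<exists>q\<in>carrier ?P. q \<oplus>\<^bsub>?P\<^esub> p = \<zero>\<^bsub>?P\<^esub>"
      by (rule bexI[of _ "(\<ominus>\<^bsub>A\<^esub> fst p, \<ominus>\<^bsub>B\<^esub> snd p)"])
        (use p in \<open>auto simp: product_algebra_simps A.l_neg B.l_neg\<close>)
  qed (auto simp: product_algebra_simps A.a_ac B.a_ac)
  moreover have "comm_monoid ?P"
    by (rule comm_monoidI) (auto simp: product_algebra_simps A.m_ac B.m_ac)
  ultimately have "cring ?P"
    by (rule cringI) (auto simp: product_algebra_simps A.l_distr B.l_distr)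
  then show ?thesis
    by (intro algebraI A.R.is_cring)
      (auto simp: product_algebra_simps A.smult_l_distr B.smult_l_distr A.smult_r_distr B.smult_r_distr
        A.smult_assoc1 B.smult_assoc1 A.smult_assoc2 B.smult_assoc2)
qed

lemma algebra_power_algebra:
  assumes "algebra R A"
  shows "algebra R (power_algebra A m)"
proof -
  interpret A: algebra R A by fact
  let ?P = "power_algebra A m"
  have cl: "x i \<in> carrier A" if "x \<in> carrier ?P" "i < m" for x i using that by (auto simp: power_algebra_simps)
  have ext: "x = y" if "x \<in> carrier ?P" "y \<in> carrier ?P" "\<And>i. i < m \<Longrightarrow> x i = y i" for x y
    using that by (intro PiE_ext[of x "{..<m}" "\<lambda>_. carrier A" y]) (auto simp: power_algebra_simps)
  have mem: "(\<lambda>i\<in>{..<m}. f i) \<in> carrier ?P" if "\<And>i. i < m \<Longrightarrow> f i \<in> carrier A" for f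
    using that by (simp add: power_algebra_simps)
  have closed: "x \<oplus>\<^bsub>?P\<^esub> y \<in> carrier ?P" "x \<otimes>\<^bsub>?P\<^esub> y \<in> carrier ?P" if "x \<in> carrier ?P" "y \<in> carrier ?P" for x y
    unfolding power_algebra_simps(2,3) by (rule mem; use that cl in auto)+
  have zo: "\<zero>\<^bsub>?P\<^esub> \<in> carrier ?P" "\<one>\<^bsub>?P\<^esub> \<in> carrier ?P"
    unfolding power_algebra_simps(4,5) by (rule mem; simp)+
  have sm: "a \<odot>\<^bsub>?P\<^esub> x \<in> carrier ?P" if "a \<in> carrier R" "x \<in> carrier ?P" for a x
    unfolding power_algebra_simps(6) by (rule mem) (use that cl in auto)
  have ev: "(x \<oplus>\<^bsub>?P\<^esub> y) i = x i \<oplus>\<^bsub>A\<^esub> y i" "(x \<otimes>\<^bsub>?P\<^esub> y) i = x i \<otimes>\<^bsub>A\<^esub> y i" "\<zero>\<^bsub>?P\<^esub> i = \<zero>\<^bsub>A\<^esub>"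
    "\<one>\<^bsub>?P\<^esub> i = \<one>\<^bsub>A\<^esub>" "(a \<odot>\<^bsub>?P\<^esub> x) i = a \<odot>\<^bsub>A\<^esub> x i" if "i < m" for x y i a
    using that by (simp_all add: power_algebra_simps)
  have "abelian_group ?P"
  proof (rule abelian_groupI)
    fix x assume x: "x \<in> carrier ?P"
    have n: "(\<lambda>i\<in>{..<m}. \<ominus>\<^bsub>A\<^esub> x i) \<in> carrier ?P" by (rule mem) (use x cl in auto)
    have "(\<lambda>i\<in>{..<m}. \<ominus>\<^bsub>A\<^esub> x i) \<oplus>\<^bsub>?P\<^esub> x = \<zero>\<^bsub>?P\<^esub>"
      by (rule ext) (use x n closed zo cl in \<open>auto simp: ev A.l_neg\<close>)
    then show "\<exists>y\<in>carrier ?P. y \<oplus>\<^bsub>?P\<^esub> x = \<zero>\<^bsub>?P\<^esub>" using n by blast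
  next
    fix x y z assume c: "x \<in> carrier ?P" "y \<in> carrier ?P" "z \<in> carrier ?P"
    show "x \<oplus>\<^bsub>?P\<^esub> y \<oplus>\<^bsub>?P\<^esub> z = x \<oplus>\<^bsub>?P\<^esub> (y \<oplus>\<^bsub>?P\<^esub> z)"
      by (rule ext) (use c closed cl in \<open>auto simp: ev A.a_assoc\<close>)
  next
    fix x y assume c: "x \<in> carrier ?P" "y \<in> carrier ?P"
    show "x \<oplus>\<^bsub>?P\<^esub> y = y \<oplus>\<^bsub>?P\<^esub> x"
      by (rule ext) (use c closed cl in \<open>auto simp: ev A.a_comm\<close>)
  next
    fix x assume c: "x \<in> carrier ?P"
    show "\<zero>\<^bsub>?P\<^esub> \<oplus>\<^bsub>?P\<^esub> x = x"
      by (rule ext) (use c closed zo cl in \<open>auto simp: ev\<close>)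
  qed (auto intro: closed zo)
  moreover have "comm_monoid ?P"
  proof (rule comm_monoidI)
    fix x y z assume c: "x \<in> carrier ?P" "y \<in> carrier ?P" "z \<in> carrier ?P"
    show "x \<otimes>\<^bsub>?P\<^esub> y \<otimes>\<^bsub>?P\<^esub> z = x \<otimes>\<^bsub>?P\<^esub> (y \<otimes>\<^bsub>?P\<^esub> z)"
      by (rule ext) (use c closed cl in \<open>auto simp: ev A.m_assoc\<close>)
  next
    fix x y assume c: "x \<in> carrier ?P" "y \<in> carrier ?P"
    show "x \<otimes>\<^bsub>?P\<^esub> y = y \<otimes>\<^bsub>?P\<^esub> x"
      by (rule ext) (use c closed cl in \<open>auto simp: ev A.m_comm\<close>)
  next
    fix x assume c: "x \<in> carrier ?P"
    show "\<one>\<^bsub>?P\<^esub> \<otimes>\<^bsub>?P\<^esub> x = x"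
      by (rule ext) (use c closed zo cl in \<open>auto simp: ev\<close>)
  qed (auto intro: closed zo)
  ultimately have cr: "cring ?P"
  proof (rule cringI)
    fix x y z assume c: "x \<in> carrier ?P" "y \<in> carrier ?P" "z \<in> carrier ?P"
    show "(x \<oplus>\<^bsub>?P\<^esub> y) \<otimes>\<^bsub>?P\<^esub> z = x \<otimes>\<^bsub>?P\<^esub> z \<oplus>\<^bsub>?P\<^esub> y \<otimes>\<^bsub>?P\<^esub> z"
      by (rule ext) (use c closed cl in \<open>auto simp: ev A.l_distr\<close>)
  qed
  show ?thesis
  proof (rule algebraI[OF A.R.is_cring cr])
    fix a x assume a: "a \<in> carrier R" and x: "x \<in> carrier ?P"
    { fix b assume b: "b \<in> carrier R"
      show "(a \<oplus>\<^bsub>R\<^esub> b) \<odot>\<^bsub>?P\<^esub> x = a \<odot>\<^bsub>?P\<^esub> x \<oplus>\<^bsub>?P\<^esub> b \<odot>\<^bsub>?P\<^esub> x"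
        by (rule ext) (use a b x closed sm cl in \<open>auto simp: ev A.smult_l_distr\<close>)
      show "(a \<otimes>\<^bsub>R\<^esub> b) \<odot>\<^bsub>?P\<^esub> x = a \<odot>\<^bsub>?P\<^esub> (b \<odot>\<^bsub>?P\<^esub> x)"
        by (rule ext) (use a b x closed sm cl in \<open>auto simp: ev A.smult_assoc1\<close>) }
    { fix y assume y: "y \<in> carrier ?P"
      show "a \<odot>\<^bsub>?P\<^esub> (x \<oplus>\<^bsub>?P\<^esub> y) = a \<odot>\<^bsub>?P\<^esub> x \<oplus>\<^bsub>?P\<^esub> a \<odot>\<^bsub>?P\<^esub> y"
        by (rule ext) (use a x y closed sm cl in \<open>auto simp: ev A.smult_r_distr\<close>)
      show "(a \<odot>\<^bsub>?P\<^esub> x) \<otimes>\<^bsub>?P\<^esub> y = a \<odot>\<^bsub>?P\<^esub> (x \<otimes>\<^bsub>?P\<^esub> y)"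
        by (rule ext) (use a x y closed sm cl in \<open>auto simp: ev A.smult_assoc2\<close>) }
  next
    fix x assume x: "x \<in> carrier ?P"
    show "\<one>\<^bsub>R\<^esub> \<odot>\<^bsub>?P\<^esub> x = x"
      by (rule ext) (use x sm cl in \<open>auto simp: ev\<close>)
  qed (auto intro: sm)
qed

lemma product_finsum:
  assumes A: "algebra R A" and B: "algebra R B" and "finite I" "f \<in> I \<rightarrow> carrier (product_algebra A B)"
  shows "(\<Oplus>\<^bsub>product_algebra A B\<^esub>i\<in>I. f i) = (\<Oplus>\<^bsub>A\<^esub>i\<in>I. fst (f i), \<Oplus>\<^bsub>B\<^esub>i\<in>I. snd (f i))"
proof -
  interpret A: algebra R A by (rule A)
  interpret B: algebra R B by (rule B)
  interpret P: algebra R "product_algebra A B" by (rule algebra_product_algebra[OF A B])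
  note ag = module_abelian_group[OF P.module_axioms]
  have "fst (\<Oplus>\<^bsub>product_algebra A B\<^esub>i\<in>I. f i) = (\<Oplus>\<^bsub>A\<^esub>i\<in>I. fst (f i))"
    by (rule additive_finsum[OF ag module_abelian_group[OF A.module_axioms] _ _ assms(3,4)])
      (auto simp: product_algebra_simps)
  moreover have "snd (\<Oplus>\<^bsub>product_algebra A B\<^esub>i\<in>I. f i) = (\<Oplus>\<^bsub>B\<^esub>i\<in>I. snd (f i))"
    by (rule additive_finsum[OF ag module_abelian_group[OF B.module_axioms] _ _ assms(3,4)])
      (auto simp: product_algebra_simps)
  ultimately show ?thesis by (metis prod.collapse)
qed

lemma power_finsum:
  assumes A: "algebra R A" and "finite I" "f \<in> I \<rightarrow> carrier (power_algebra A m)" "j < m"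
  shows "(\<Oplus>\<^bsub>power_algebra A m\<^esub>i\<in>I. f i) j = (\<Oplus>\<^bsub>A\<^esub>i\<in>I. f i j)"
proof -
  interpret A: algebra R A by (rule A)
  interpret P: algebra R "power_algebra A m" by (rule algebra_power_algebra[OF A])
  show ?thesis
    by (rule additive_finsum[OF module_abelian_group[OF P.module_axioms] module_abelian_group[OF A.module_axioms] _ _ assms(2,3)])
      (use assms(4) in \<open>auto simp: power_algebra_simps\<close>)
qed

lemma (in abelian_monoid) finsum_append:
  fixes k l :: nat
  assumes "f \<in> {..<k} \<rightarrow> carrier G" "g \<in> {..<l} \<rightarrow> carrier G"
  shows "(\<Oplus>i\<in>{..<k + l}. if i < k then f i else g (i - k)) = (\<Oplus>i\<in>{..<k}. f i) \<oplus> (\<Oplus>i\<in>{..<l}. g i)"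
proof -
  let ?h = "\<lambda>i. if i < k then f i else g (i - k)"
  have e: "{..<k + l} = {..<k} \<union> (+) k ` {..<l}"
  proof -
    have "(+) k ` {0..<l} = {k..<k + l}" by (simp only: image_add_atLeastLessThan) (simp add: add.commute)
    then show ?thesis by (auto simp: lessThan_atLeast0)
  qed
  have "(\<Oplus>i\<in>{..<k + l}. ?h i) = (\<Oplus>i\<in>{..<k}. ?h i) \<oplus> (\<Oplus>i\<in>(+) k ` {..<l}. ?h i)"
    unfolding e by (rule finsum_Un_disjoint) (use assms in auto)
  also have "(\<Oplus>i\<in>(+) k ` {..<l}. ?h i) = (\<Oplus>i\<in>{..<l}. ?h (k + i))"
    by (rule finsum_reindex) (use assms in auto)
  also have "\<dots> = (\<Oplus>i\<in>{..<l}. g i)" by (rule finsum_cong') (use assms in auto)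
  also have "(\<Oplus>i\<in>{..<k}. ?h i) = (\<Oplus>i\<in>{..<k}. f i)" by (rule finsum_cong') (use assms in auto)
  finally show ?thesis .
qed

text \<open>The trace form of a product is the orthogonal sum of those of the factors. The dual
  families are concatenated, each padded by zero in the other factor, and the mixed terms
  vanish.\<close>

lemma trace_algebra_product:
  assumes "trace_algebra R A Tr k x y" "trace_algebra R B Tr' l x' y'"
  shows "trace_algebra R (product_algebra A B) (\<lambda>p. Tr (fst p) \<oplus>\<^bsub>R\<^esub> Tr' (snd p)) (k + l)
    (\<lambda>i. if i < k then (x i, \<zero>\<^bsub>B\<^esub>) else (\<zero>\<^bsub>A\<^esub>, x' (i - k)))
    (\<lambda>i. if i < k then (y i, \<zero>\<^bsub>B\<^esub>) else (\<zero>\<^bsub>A\<^esub>, y' (i - k)))"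
proof -
  interpret A: trace_algebra R A Tr k x y by fact
  interpret B: trace_algebra R B Tr' l x' y' by fact
  let ?P = "product_algebra A B"
  let ?Tr = "\<lambda>p. Tr (fst p) \<oplus>\<^bsub>R\<^esub> Tr' (snd p)"
  note PA = algebra_product_algebra[OF A.A.algebra_axioms B.A.algebra_axioms]
  note fs = product_finsum[OF A.A.algebra_axioms B.A.algebra_axioms]
  have T0: "Tr \<zero>\<^bsub>A\<^esub> = \<zero>\<^bsub>R\<^esub>" "Tr' \<zero>\<^bsub>B\<^esub> = \<zero>\<^bsub>R\<^esub>"
    using A.Tr_smult[of "\<zero>\<^bsub>R\<^esub>" "\<zero>\<^bsub>A\<^esub>"] B.Tr_smult[of "\<zero>\<^bsub>R\<^esub>" "\<zero>\<^bsub>B\<^esub>"] A.Tr_closed B.Tr_closed by auto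
  \<comment> \<open>Arbitrary families \<open>u\<close> and \<open>v\<close> are allowed, so that
    exchanging \<open>x\<close> and \<open>y\<close> gives both expansions at once.\<close>
  have expand: "(\<Oplus>\<^bsub>?P\<^esub>i\<in>{..<k + l}. ?Tr (p \<otimes>\<^bsub>?P\<^esub> (if i < k then (v i, \<zero>\<^bsub>B\<^esub>) else (\<zero>\<^bsub>A\<^esub>, v' (i - k))))
      \<odot>\<^bsub>?P\<^esub> (if i < k then (u i, \<zero>\<^bsub>B\<^esub>) else (\<zero>\<^bsub>A\<^esub>, u' (i - k)))) = p"
    if p: "p \<in> carrier ?P" and u: "\<And>i. i < k \<Longrightarrow> u i \<in> carrier A" and v: "\<And>i. i < k \<Longrightarrow> v i \<in> carrier A"
      and u': "\<And>i. i < l \<Longrightarrow> u' i \<in> carrier B" and v': "\<And>i. i < l \<Longrightarrow> v' i \<in> carrier B"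
      and e: "(\<Oplus>\<^bsub>A\<^esub>i\<in>{..<k}. Tr (fst p \<otimes>\<^bsub>A\<^esub> v i) \<odot>\<^bsub>A\<^esub> u i) = fst p"
      and e': "(\<Oplus>\<^bsub>B\<^esub>i\<in>{..<l}. Tr' (snd p \<otimes>\<^bsub>B\<^esub> v' i) \<odot>\<^bsub>B\<^esub> u' i) = snd p" for p u v u' v'
  proof -
    have p': "fst p \<in> carrier A" "snd p \<in> carrier B" using p by (auto simp: product_algebra_simps)
    have c: "Tr (fst p \<otimes>\<^bsub>A\<^esub> v i) \<in> carrier R" if "i < k" for i using p' v[OF that] by (intro A.Tr_closed) auto
    have c': "Tr' (snd p \<otimes>\<^bsub>B\<^esub> v' i) \<in> carrier R" if "i < l" for i using p' v'[OF that] by (intro B.Tr_closed) auto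
    let ?f = "\<lambda>i. if i < k then (Tr (fst p \<otimes>\<^bsub>A\<^esub> v i) \<odot>\<^bsub>A\<^esub> u i, \<zero>\<^bsub>B\<^esub>)
      else (\<zero>\<^bsub>A\<^esub>, Tr' (snd p \<otimes>\<^bsub>B\<^esub> v' (i - k)) \<odot>\<^bsub>B\<^esub> u' (i - k))"
    have f: "?f \<in> {..<k + l} \<rightarrow> carrier ?P" using c c' u u' by (auto simp: product_algebra_simps)
    have eq: "?Tr (p \<otimes>\<^bsub>?P\<^esub> (if i < k then (v i, \<zero>\<^bsub>B\<^esub>) else (\<zero>\<^bsub>A\<^esub>, v' (i - k))))
      \<odot>\<^bsub>?P\<^esub> (if i < k then (u i, \<zero>\<^bsub>B\<^esub>) else (\<zero>\<^bsub>A\<^esub>, u' (i - k))) = ?f i" if i: "i < k + l" for i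
    proof (cases "i < k")
      case True
      then show ?thesis using p' c[OF True] by (simp add: product_algebra_simps T0)
    next
      case False
      then have "i - k < l" using i by simp
      then show ?thesis using p' c'[of "i - k"] False by (simp add: product_algebra_simps T0)
    qed
    interpret P: algebra R ?P by (rule PA)
    have "(\<Oplus>\<^bsub>?P\<^esub>i\<in>{..<k + l}. ?Tr (p \<otimes>\<^bsub>?P\<^esub> (if i < k then (v i, \<zero>\<^bsub>B\<^esub>) else (\<zero>\<^bsub>A\<^esub>, v' (i - k))))
      \<odot>\<^bsub>?P\<^esub> (if i < k then (u i, \<zero>\<^bsub>B\<^esub>) else (\<zero>\<^bsub>A\<^esub>, u' (i - k)))) = (\<Oplus>\<^bsub>?P\<^esub>i\<in>{..<k + l}. ?f i)"
      by (rule P.finsum_cong'[OF refl f]) (simp only: lessThan_iff eq)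
    also have "\<dots> = (\<Oplus>\<^bsub>A\<^esub>i\<in>{..<k + l}. fst (?f i), \<Oplus>\<^bsub>B\<^esub>i\<in>{..<k + l}. snd (?f i))"
      by (rule fs[OF _ f]) simp
    also have "(\<Oplus>\<^bsub>A\<^esub>i\<in>{..<k + l}. fst (?f i)) = (\<Oplus>\<^bsub>A\<^esub>i\<in>{..<k + l}. if i < k then Tr (fst p \<otimes>\<^bsub>A\<^esub> v i) \<odot>\<^bsub>A\<^esub> u i else (\<lambda>_. \<zero>\<^bsub>A\<^esub>) (i - k))"
      using c u by (intro A.A.finsum_cong') auto
    also have "\<dots> = (\<Oplus>\<^bsub>A\<^esub>i\<in>{..<k}. Tr (fst p \<otimes>\<^bsub>A\<^esub> v i) \<odot>\<^bsub>A\<^esub> u i) \<oplus>\<^bsub>A\<^esub> (\<Oplus>\<^bsub>A\<^esub>i\<in>{..<l}. \<zero>\<^bsub>A\<^esub>)"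
      using c u by (intro A.A.finsum_append) auto
    also have "\<dots> = fst p" using e p' by simp
    also have "(\<Oplus>\<^bsub>B\<^esub>i\<in>{..<k + l}. snd (?f i)) = (\<Oplus>\<^bsub>B\<^esub>i\<in>{..<k + l}. if i < k then (\<lambda>_. \<zero>\<^bsub>B\<^esub>) i else Tr' (snd p \<otimes>\<^bsub>B\<^esub> v' (i - k)) \<odot>\<^bsub>B\<^esub> u' (i - k))"
      using c' u' by (intro B.A.finsum_cong') auto
    also have "\<dots> = (\<Oplus>\<^bsub>B\<^esub>i\<in>{..<k}. \<zero>\<^bsub>B\<^esub>) \<oplus>\<^bsub>B\<^esub> (\<Oplus>\<^bsub>B\<^esub>i\<in>{..<l}. Tr' (snd p \<otimes>\<^bsub>B\<^esub> v' i) \<odot>\<^bsub>B\<^esub> u' i)"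
      using c' u' by (intro B.A.finsum_append[where g = "\<lambda>i. Tr' (snd p \<otimes>\<^bsub>B\<^esub> v' i) \<odot>\<^bsub>B\<^esub> u' i"]) auto
    also have "\<dots> = snd p" using e' p' by simp
    finally show ?thesis by simp
  qed
  show ?thesis
  proof (intro trace_algebra.intro trace_algebra_axioms.intro PA)
    fix p assume p: "p \<in> carrier ?P"
    have p': "fst p \<in> carrier A" "snd p \<in> carrier B" using p by (auto simp: product_algebra_simps)
    show "?Tr p \<in> carrier R" using p' A.Tr_closed B.Tr_closed by auto
    { fix q assume "q \<in> carrier ?P"
      then have "fst q \<in> carrier A" "snd q \<in> carrier B" by (auto simp: product_algebra_simps)
      then show "?Tr (p \<oplus>\<^bsub>?P\<^esub> q) = ?Tr p \<oplus>\<^bsub>R\<^esub> ?Tr q"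
        using p' A.Tr_closed B.Tr_closed by (simp add: product_algebra_simps A.Tr_add B.Tr_add A.A.R.a_ac) }
    { fix a assume "a \<in> carrier R"
      then show "?Tr (a \<odot>\<^bsub>?P\<^esub> p) = a \<otimes>\<^bsub>R\<^esub> ?Tr p"
        using p' A.Tr_closed B.Tr_closed by (simp add: product_algebra_simps A.Tr_smult B.Tr_smult A.A.R.r_distr) }
    show "(\<Oplus>\<^bsub>?P\<^esub>i\<in>{..<k + l}. ?Tr (p \<otimes>\<^bsub>?P\<^esub> (if i < k then (y i, \<zero>\<^bsub>B\<^esub>) else (\<zero>\<^bsub>A\<^esub>, y' (i - k))))
      \<odot>\<^bsub>?P\<^esub> (if i < k then (x i, \<zero>\<^bsub>B\<^esub>) else (\<zero>\<^bsub>A\<^esub>, x' (i - k)))) = p"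
      by (rule expand[OF p A.x_closed A.y_closed B.x_closed B.y_closed A.expand_x[OF p'(1)] B.expand_x[OF p'(2)]])
    show "(\<Oplus>\<^bsub>?P\<^esub>i\<in>{..<k + l}. ?Tr (p \<otimes>\<^bsub>?P\<^esub> (if i < k then (x i, \<zero>\<^bsub>B\<^esub>) else (\<zero>\<^bsub>A\<^esub>, x' (i - k))))
      \<odot>\<^bsub>?P\<^esub> (if i < k then (y i, \<zero>\<^bsub>B\<^esub>) else (\<zero>\<^bsub>A\<^esub>, y' (i - k)))) = p"
      by (rule expand[OF p A.y_closed A.x_closed B.y_closed B.x_closed A.expand_y[OF p'(1)] B.expand_y[OF p'(2)]])
  next
    fix i assume "i < k + l"
    then show "(if i < k then (x i, \<zero>\<^bsub>B\<^esub>) else (\<zero>\<^bsub>A\<^esub>, x' (i - k))) \<in> carrier ?P"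
      "(if i < k then (y i, \<zero>\<^bsub>B\<^esub>) else (\<zero>\<^bsub>A\<^esub>, y' (i - k))) \<in> carrier ?P"
      using A.x_closed A.y_closed B.x_closed[of "i - k"] B.y_closed[of "i - k"] by (auto simp: product_algebra_simps)
  next
    interpret P: algebra R ?P by (rule PA)
    let ?f = "\<lambda>i. if i < k then (x i \<otimes>\<^bsub>A\<^esub> y i, \<zero>\<^bsub>B\<^esub>) else (\<zero>\<^bsub>A\<^esub>, x' (i - k) \<otimes>\<^bsub>B\<^esub> y' (i - k))"
    have f: "?f \<in> {..<k + l} \<rightarrow> carrier ?P"
      using A.x_closed A.y_closed B.x_closed B.y_closed by (auto simp: product_algebra_simps)
    have "(\<Oplus>\<^bsub>?P\<^esub>i\<in>{..<k + l}. (if i < k then (x i, \<zero>\<^bsub>B\<^esub>) else (\<zero>\<^bsub>A\<^esub>, x' (i - k)))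
      \<otimes>\<^bsub>?P\<^esub> (if i < k then (y i, \<zero>\<^bsub>B\<^esub>) else (\<zero>\<^bsub>A\<^esub>, y' (i - k)))) = (\<Oplus>\<^bsub>?P\<^esub>i\<in>{..<k + l}. ?f i)"
      by (rule P.finsum_cong'[OF refl f]) (auto simp: product_algebra_simps)
    also have "\<dots> = (\<Oplus>\<^bsub>A\<^esub>i\<in>{..<k + l}. fst (?f i), \<Oplus>\<^bsub>B\<^esub>i\<in>{..<k + l}. snd (?f i))"
      by (rule fs[OF _ f]) simp
    also have "(\<Oplus>\<^bsub>A\<^esub>i\<in>{..<k + l}. fst (?f i)) = (\<Oplus>\<^bsub>A\<^esub>i\<in>{..<k + l}. if i < k then x i \<otimes>\<^bsub>A\<^esub> y i else (\<lambda>_. \<zero>\<^bsub>A\<^esub>) (i - k))"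
      using A.x_closed A.y_closed by (intro A.A.finsum_cong') auto
    also have "\<dots> = (\<Oplus>\<^bsub>A\<^esub>i\<in>{..<k}. x i \<otimes>\<^bsub>A\<^esub> y i) \<oplus>\<^bsub>A\<^esub> (\<Oplus>\<^bsub>A\<^esub>i\<in>{..<l}. \<zero>\<^bsub>A\<^esub>)"
      using A.x_closed A.y_closed by (intro A.A.finsum_append) auto
    also have "\<dots> = \<one>\<^bsub>A\<^esub>" using A.sum_xy by simp
    also have "(\<Oplus>\<^bsub>B\<^esub>i\<in>{..<k + l}. snd (?f i)) = (\<Oplus>\<^bsub>B\<^esub>i\<in>{..<k + l}. if i < k then (\<lambda>_. \<zero>\<^bsub>B\<^esub>) i else x' (i - k) \<otimes>\<^bsub>B\<^esub> y' (i - k))"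
      using B.x_closed B.y_closed by (intro B.A.finsum_cong') auto
    also have "\<dots> = (\<Oplus>\<^bsub>B\<^esub>i\<in>{..<k}. \<zero>\<^bsub>B\<^esub>) \<oplus>\<^bsub>B\<^esub> (\<Oplus>\<^bsub>B\<^esub>i\<in>{..<l}. x' i \<otimes>\<^bsub>B\<^esub> y' i)"
      using B.x_closed B.y_closed by (intro B.A.finsum_append[where g = "\<lambda>i. x' i \<otimes>\<^bsub>B\<^esub> y' i"]) auto
    also have "\<dots> = \<one>\<^bsub>B\<^esub>" using B.sum_xy by simp
    finally show "(\<Oplus>\<^bsub>?P\<^esub>i\<in>{..<k + l}. (if i < k then (x i, \<zero>\<^bsub>B\<^esub>) else (\<zero>\<^bsub>A\<^esub>, x' (i - k)))
      \<otimes>\<^bsub>?P\<^esub> (if i < k then (y i, \<zero>\<^bsub>B\<^esub>) else (\<zero>\<^bsub>A\<^esub>, y' (i - k)))) = \<one>\<^bsub>?P\<^esub>"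
      by (simp add: product_algebra_simps)
  qed
qed

section \<open>The algebra of m-tuples over a ring\<close>

context cring
begin

definition unit_vector :: "nat \<Rightarrow> nat \<Rightarrow> nat \<Rightarrow> 'a"
  where "unit_vector m i = (\<lambda>j\<in>{..<m}. if j = i then \<one> else \<zero>)"

abbreviation "Rpow m \<equiv> power_algebra (ring_as_algebra R) m"

lemma Rpow_algebra: "algebra R (Rpow m)"
  by (rule algebra_power_algebra[OF algebra_ring_as_algebra])

lemma Rpow_closed: "x \<in> carrier (Rpow m) \<longleftrightarrow> x \<in> {..<m} \<rightarrow>\<^sub>E carrier R"
  by (simp add: power_algebra_simps ring_as_algebra_simps)

lemma unit_vector_closed: "unit_vector m i \<in> carrier (Rpow m)"
  unfolding Rpow_closed unit_vector_def by auto

lemma Rpow_ext: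
  assumes "x \<in> carrier (Rpow m)" "y \<in> carrier (Rpow m)" "\<And>i. i < m \<Longrightarrow> x i = y i"
  shows "x = y"
  using assms unfolding Rpow_closed by (intro PiE_ext[of x "{..<m}" "\<lambda>_. carrier R" y]) auto

lemma finsum_RR: "finsum (ring_as_algebra R) f I = finsum R f I"
proof -
  have "add (ring_as_algebra R) = add R" by (simp add: ring_as_algebra_def ring.defs)
  then show ?thesis by (simp add: finsum_def finprod_def ring_as_algebra_simps)
qed

lemma Rpow_finsum:
  assumes "finite I" "f \<in> I \<rightarrow> carrier (Rpow m)" "j < m"
  shows "(\<Oplus>\<^bsub>Rpow m\<^esub>i\<in>I. f i) j = (\<Oplus>i\<in>I. f i j)"
  using power_finsum[OF algebra_ring_as_algebra assms] by (simp add: finsum_RR)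

lemma Rpow_unit_expansion:
  assumes w: "\<And>i. i < m \<Longrightarrow> w i \<in> carrier R" and j: "j < m"
  shows "(\<Oplus>\<^bsub>Rpow m\<^esub>i\<in>{..<m}. w i \<odot>\<^bsub>Rpow m\<^esub> unit_vector m i) j = w j"
proof -
  interpret P: algebra R "Rpow m" by (rule Rpow_algebra)
  have "(\<Oplus>\<^bsub>Rpow m\<^esub>i\<in>{..<m}. w i \<odot>\<^bsub>Rpow m\<^esub> unit_vector m i) j = (\<Oplus>i\<in>{..<m}. (w i \<odot>\<^bsub>Rpow m\<^esub> unit_vector m i) j)"
    using w unit_vector_closed j by (intro Rpow_finsum) auto
  also have "\<dots> = (\<Oplus>i\<in>{..<m}. if j = i then w i else \<zero>)"
    using w j by (intro finsum_cong') (auto simp: power_algebra_simps ring_as_algebra_simps unit_vector_def)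
  also have "\<dots> = w j" using w j by (intro finsum_singleton) auto
  finally show ?thesis .
qed

text \<open>The unit vectors are orthonormal for the sum of the coordinates of a product, so this
  family is its own dual.\<close>

lemma trace_algebra_power:
  "trace_algebra R (Rpow m) (\<lambda>w. \<Oplus>j\<in>{..<m}. w j) m (unit_vector m) (unit_vector m)"
proof -
  interpret P: algebra R "Rpow m" by (rule Rpow_algebra)
  have c: "u j \<in> carrier R" if "u \<in> carrier (Rpow m)" "j < m" for u j
    using that unfolding Rpow_closed by auto
  have Tr: "(\<Oplus>j\<in>{..<m}. (u \<otimes>\<^bsub>Rpow m\<^esub> unit_vector m i) j) = u i" if u: "u \<in> carrier (Rpow m)" and i: "i < m" for u i
  proof -
    have "(\<Oplus>j\<in>{..<m}. (u \<otimes>\<^bsub>Rpow m\<^esub> unit_vector m i) j) = (\<Oplus>j\<in>{..<m}. if i = j then u j else \<zero>)"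
      using c[OF u] by (intro finsum_cong') (auto simp: power_algebra_simps ring_as_algebra_simps unit_vector_def)
    also have "\<dots> = u i" using c[OF u] i by (intro finsum_singleton) auto
    finally show ?thesis .
  qed
  have expand: "(\<Oplus>\<^bsub>Rpow m\<^esub>i\<in>{..<m}. (\<Oplus>j\<in>{..<m}. (u \<otimes>\<^bsub>Rpow m\<^esub> unit_vector m i) j) \<odot>\<^bsub>Rpow m\<^esub> unit_vector m i) = u"
    if u: "u \<in> carrier (Rpow m)" for u
  proof -
    have "(\<Oplus>\<^bsub>Rpow m\<^esub>i\<in>{..<m}. (\<Oplus>j\<in>{..<m}. (u \<otimes>\<^bsub>Rpow m\<^esub> unit_vector m i) j) \<odot>\<^bsub>Rpow m\<^esub> unit_vector m i)
      = (\<Oplus>\<^bsub>Rpow m\<^esub>i\<in>{..<m}. u i \<odot>\<^bsub>Rpow m\<^esub> unit_vector m i)"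
      using c[OF u] unit_vector_closed by (intro P.finsum_cong') (auto simp: Tr[OF u])
    also have "\<dots> = u"
    proof (rule Rpow_ext[OF _ u])
      show "(\<Oplus>\<^bsub>Rpow m\<^esub>i\<in>{..<m}. u i \<odot>\<^bsub>Rpow m\<^esub> unit_vector m i) \<in> carrier (Rpow m)"
        using c[OF u] unit_vector_closed by (intro P.finsum_closed) auto
    qed (rule Rpow_unit_expansion[OF c[OF u]])
    finally show ?thesis .
  qed
  show ?thesis
  proof (intro trace_algebra.intro trace_algebra_axioms.intro Rpow_algebra unit_vector_closed expand)
    fix u assume u: "u \<in> carrier (Rpow m)"
    show "(\<Oplus>j\<in>{..<m}. u j) \<in> carrier R" using c[OF u] by (intro finsum_closed) auto
    { fix v assume v: "v \<in> carrier (Rpow m)"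
      have "(\<Oplus>j\<in>{..<m}. (u \<oplus>\<^bsub>Rpow m\<^esub> v) j) = (\<Oplus>j\<in>{..<m}. u j \<oplus> v j)"
        using c[OF u] c[OF v] by (intro finsum_cong') (auto simp: power_algebra_simps ring_as_algebra_simps)
      also have "\<dots> = (\<Oplus>j\<in>{..<m}. u j) \<oplus> (\<Oplus>j\<in>{..<m}. v j)"
        using c[OF u] c[OF v] by (intro finsum_addf) auto
      finally show "(\<Oplus>j\<in>{..<m}. (u \<oplus>\<^bsub>Rpow m\<^esub> v) j) = (\<Oplus>j\<in>{..<m}. u j) \<oplus> (\<Oplus>j\<in>{..<m}. v j)" . }
    { fix a assume a: "a \<in> carrier R"
      have "(\<Oplus>j\<in>{..<m}. (a \<odot>\<^bsub>Rpow m\<^esub> u) j) = (\<Oplus>j\<in>{..<m}. a \<otimes> u j)"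
        using c[OF u] a by (intro finsum_cong') (auto simp: power_algebra_simps ring_as_algebra_simps)
      also have "\<dots> = a \<otimes> (\<Oplus>j\<in>{..<m}. u j)"
        using c[OF u] a by (intro finsum_rdistr[symmetric]) auto
      finally show "(\<Oplus>j\<in>{..<m}. (a \<odot>\<^bsub>Rpow m\<^esub> u) j) = a \<otimes> (\<Oplus>j\<in>{..<m}. u j)" . }
  next
    show "(\<Oplus>\<^bsub>Rpow m\<^esub>i\<in>{..<m}. unit_vector m i \<otimes>\<^bsub>Rpow m\<^esub> unit_vector m i) = \<one>\<^bsub>Rpow m\<^esub>"
    proof (rule Rpow_ext)
      show "(\<Oplus>\<^bsub>Rpow m\<^esub>i\<in>{..<m}. unit_vector m i \<otimes>\<^bsub>Rpow m\<^esub> unit_vector m i) \<in> carrier (Rpow m)"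
        using unit_vector_closed by (intro P.finsum_closed) auto
      fix j assume j: "j < m"
      have "(\<Oplus>\<^bsub>Rpow m\<^esub>i\<in>{..<m}. unit_vector m i \<otimes>\<^bsub>Rpow m\<^esub> unit_vector m i) j
        = (\<Oplus>i\<in>{..<m}. (unit_vector m i \<otimes>\<^bsub>Rpow m\<^esub> unit_vector m i) j)"
        using unit_vector_closed j by (intro Rpow_finsum) auto
      also have "\<dots> = (\<Oplus>i\<in>{..<m}. if j = i then \<one> else \<zero>)"
        using j by (intro finsum_cong') (auto simp: power_algebra_simps ring_as_algebra_simps unit_vector_def)
      also have "\<dots> = \<one>" using j finsum_singleton[of j "{..<m}" "\<lambda>_. \<one>"] by simp
      finally show "(\<Oplus>\<^bsub>Rpow m\<^esub>i\<in>{..<m}. unit_vector m i \<otimes>\<^bsub>Rpow m\<^esub> unit_vector m i) j = \<one>\<^bsub>Rpow m\<^esub> j"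
        using j by (simp add: power_algebra_simps ring_as_algebra_simps)
    qed simp
  qed
qed

end

section \<open>The quotient of a ring by a free involution\<close>

lemma (in abelian_monoid) finsum_lessThan_Suc_shift:
  fixes n :: nat
  assumes "f \<in> {..<Suc n} \<rightarrow> carrier G"
  shows "(\<Oplus>i\<in>{..<Suc n}. f i) = f 0 \<oplus> (\<Oplus>i\<in>{..<n}. f (Suc i))"
proof -
  have "{..<Suc n} = insert 0 (Suc ` {..<n})" by (rule lessThan_Suc_eq_insert_0)
  then have "(\<Oplus>i\<in>{..<Suc n}. f i) = f 0 \<oplus> (\<Oplus>i\<in>Suc ` {..<n}. f i)"
    using assms by (simp only:) (rule finsum_insert, auto)
  also have "(\<Oplus>i\<in>Suc ` {..<n}. f i) = (\<Oplus>i\<in>{..<n}. f (Suc i))"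
    by (rule finsum_reindex) (use assms in auto)
  finally show ?thesis .
qed

text \<open>The etale statement uses the sphere only through these hypotheses: odd elements with sum
  of squares equal to one, and an element \<open>h\<close> playing the role of one half.\<close>

locale free_involution = S: cring S for S (structure) +
  fixes \<sigma> :: "'a \<Rightarrow> 'a" and r :: nat and z :: "nat \<Rightarrow> 'a" and h :: 'a
  assumes \<sigma>_closed: "u \<in> carrier S \<Longrightarrow> \<sigma> u \<in> carrier S"
    and \<sigma>_add: "u \<in> carrier S \<Longrightarrow> v \<in> carrier S \<Longrightarrow> \<sigma> (u \<oplus> v) = \<sigma> u \<oplus> \<sigma> v"
    and \<sigma>_mult: "u \<in> carrier S \<Longrightarrow> v \<in> carrier S \<Longrightarrow> \<sigma> (u \<otimes> v) = \<sigma> u \<otimes> \<sigma> v"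
    and \<sigma>_one: "\<sigma> \<one> = \<one>"
    and \<sigma>_invol: "u \<in> carrier S \<Longrightarrow> \<sigma> (\<sigma> u) = u"
    and z_closed: "i < r \<Longrightarrow> z i \<in> carrier S"
    and \<sigma>_z: "i < r \<Longrightarrow> \<sigma> (z i) = \<ominus> z i"
    and sum_z: "(\<Oplus>i\<in>{..<r}. z i \<otimes> z i) = \<one>"
    and h_closed: "h \<in> carrier S" and h_half: "h \<oplus> h = \<one>"
begin

abbreviation "R \<equiv> S\<lparr>carrier := {u \<in> carrier S. \<sigma> u = u}\<rparr>"
abbreviation "SS \<equiv> ring_as_algebra S"

lemma \<sigma>_zero: "\<sigma> \<zero> = \<zero>"
  by (rule additive_zero[OF S.is_abelian_group S.is_abelian_group]) (use \<sigma>_closed \<sigma>_add in auto)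

lemma \<sigma>_minus: "u \<in> carrier S \<Longrightarrow> \<sigma> (\<ominus> u) = \<ominus> \<sigma> u"
  using additive_minus[OF S.is_abelian_group S.is_abelian_group, of \<sigma> \<zero> u] \<sigma>_closed \<sigma>_add \<sigma>_zero
  by (simp add: S.minus_eq)

lemma half_double: "u \<in> carrier S \<Longrightarrow> h \<otimes> (u \<oplus> u) = u"
  using S.l_distr[OF h_closed h_closed, of u] by (simp add: S.r_distr h_closed h_half)

text \<open>Halves of the unit are unique, and \<open>\<sigma>\<close> sends a half of the unit to
  another one.\<close>

lemma \<sigma>_h: "\<sigma> h = h"
proof -
  have "\<sigma> h = h \<otimes> (\<sigma> h \<oplus> \<sigma> h)" by (rule half_double[symmetric, OF \<sigma>_closed[OF h_closed]])
  also have "\<sigma> h \<oplus> \<sigma> h = \<one>" using \<sigma>_add[OF h_closed h_closed] by (simp add: h_half \<sigma>_one)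
  finally show ?thesis using h_closed by simp
qed

lemma cring_R: "cring R"
proof -
  have "abelian_group R"
  proof (rule abelian_groupI)
    fix u assume "u \<in> carrier R"
    then show "\<exists>v\<in>carrier R. v \<oplus>\<^bsub>R\<^esub> u = \<zero>\<^bsub>R\<^esub>"
      by (intro bexI[of _ "\<ominus> u"]) (auto simp: S.l_neg \<sigma>_minus)
  qed (auto simp: \<sigma>_add \<sigma>_zero S.a_ac)
  moreover have "comm_monoid R"
    by (rule comm_monoidI) (auto simp: \<sigma>_mult \<sigma>_one S.m_ac)
  ultimately show ?thesis
    by (rule cringI) (auto simp: S.l_distr)
qed

lemma algebra_SS: "algebra R SS"
proof (rule algebraI[OF cring_R])
  show "cring SS" by (rule algebra.M_cring[OF S.algebra_ring_as_algebra])
qed (auto simp: ring_as_algebra_simps S.l_distr S.r_distr S.m_assoc)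

definition dual :: "nat \<Rightarrow> 'a" where "dual i = (case i of 0 \<Rightarrow> \<one> | Suc j \<Rightarrow> z j)"

lemma dual_closed: "i < Suc r \<Longrightarrow> dual i \<in> carrier S"
  by (auto simp: dual_def z_closed split: nat.splits)

abbreviation "Tr u \<equiv> u \<oplus> \<sigma> u"

lemma Tr_half: "u \<in> carrier S \<Longrightarrow> Tr (h \<otimes> u) = h \<otimes> Tr u"
  using h_closed \<sigma>_closed by (simp add: \<sigma>_mult \<sigma>_h S.r_distr)

text \<open>The unit contributes \<open>u + \<sigma> u\<close>. As \<open>z_i\<close> is odd,
  \<open>Tr (u z_i) = (u - \<sigma> u) z_i\<close>, so the remaining terms add up to
  \<open>(u - \<sigma> u)\<close> times the sum of the \<open>z_i^2\<close>, that is, to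
  \<open>u - \<sigma> u\<close>.\<close>

lemma trace_expansion:
  assumes u: "u \<in> carrier S"
  shows "(\<Oplus>i\<in>{..<Suc r}. Tr (u \<otimes> dual i) \<otimes> dual i) = u \<oplus> u"
proof -
  note \<sigma>u = \<sigma>_closed[OF u]
  have c: "(\<lambda>i. Tr (u \<otimes> dual i) \<otimes> dual i) \<in> {..<Suc r} \<rightarrow> carrier S"
    using u dual_closed \<sigma>_closed by auto
  have "(\<Oplus>i\<in>{..<Suc r}. Tr (u \<otimes> dual i) \<otimes> dual i)
    = Tr (u \<otimes> dual 0) \<otimes> dual 0 \<oplus> (\<Oplus>i\<in>{..<r}. Tr (u \<otimes> dual (Suc i)) \<otimes> dual (Suc i))"
    by (rule S.finsum_lessThan_Suc_shift[OF c])
  also have "(\<Oplus>i\<in>{..<r}. Tr (u \<otimes> dual (Suc i)) \<otimes> dual (Suc i)) = (\<Oplus>i\<in>{..<r}. (u \<ominus> \<sigma> u) \<otimes> (z i \<otimes> z i))"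
  proof (intro S.finsum_cong' refl)
    fix i assume "i \<in> {..<r}"
    then have i: "z i \<in> carrier S" "\<sigma> (z i) = \<ominus> z i" using z_closed \<sigma>_z by auto
    have "Tr (u \<otimes> z i) = (u \<ominus> \<sigma> u) \<otimes> z i"
      using u \<sigma>u i by (simp add: \<sigma>_mult S.minus_eq S.l_distr S.r_minus S.l_minus)
    then show "Tr (u \<otimes> dual (Suc i)) \<otimes> dual (Suc i) = (u \<ominus> \<sigma> u) \<otimes> (z i \<otimes> z i)"
      using u \<sigma>u i by (simp add: dual_def S.m_assoc)
  qed (use u \<sigma>u z_closed in auto)
  also have "\<dots> = (u \<ominus> \<sigma> u) \<otimes> (\<Oplus>i\<in>{..<r}. z i \<otimes> z i)"
    using u \<sigma>u z_closed by (intro S.finsum_rdistr[symmetric]) auto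
  also have "\<dots> = u \<ominus> \<sigma> u" using u \<sigma>u by (simp add: sum_z)
  also have "Tr (u \<otimes> dual 0) \<otimes> dual 0 \<oplus> (u \<ominus> \<sigma> u) = u \<oplus> u"
  proof -
    have "(u \<oplus> \<sigma> u) \<oplus> (u \<oplus> \<ominus> \<sigma> u) = (u \<oplus> u) \<oplus> (\<sigma> u \<oplus> \<ominus> \<sigma> u)"
      using u \<sigma>u by (simp only: S.a_ac S.add.m_closed S.a_inv_closed)
    also have "\<dots> = u \<oplus> u" using u \<sigma>u by (simp add: S.r_neg)
    finally show ?thesis using u \<sigma>u by (simp add: dual_def S.minus_eq)
  qed
  finally show ?thesis .
qed

lemma finsum_SS: "finsum SS f I = finsum S f I"
  by (rule S.finsum_RR)

text \<open>The expansion with the same family on both sides gives \<open>2 u\<close>; the factor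
  \<open>h\<close> in the second family divides by two, and since \<open>h\<close> is invariant it
  passes through \<open>Tr\<close>.\<close>

lemma trace_algebra_SS:
  "trace_algebra R SS (\<lambda>u. Tr u) (Suc r) dual (\<lambda>i. h \<otimes> dual i)"
proof (intro trace_algebra.intro trace_algebra_axioms.intro algebra_SS)
  have base: "(\<Oplus>i\<in>{..<Suc r}. h \<otimes> (Tr (u \<otimes> dual i) \<otimes> dual i)) = u" if u: "u \<in> carrier S" for u
  proof -
    have "(\<Oplus>i\<in>{..<Suc r}. h \<otimes> (Tr (u \<otimes> dual i) \<otimes> dual i)) = h \<otimes> (\<Oplus>i\<in>{..<Suc r}. Tr (u \<otimes> dual i) \<otimes> dual i)"
      using u dual_closed \<sigma>_closed h_closed by (intro S.finsum_rdistr[symmetric]) auto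
    then show ?thesis using trace_expansion[OF u] half_double[OF u] by simp
  qed
  fix u assume "u \<in> carrier SS"
  then have u: "u \<in> carrier S" by (simp add: ring_as_algebra_simps)
  show "Tr u \<in> carrier R" using u by (simp add: \<sigma>_closed \<sigma>_add \<sigma>_invol S.a_comm)
  { fix v assume "v \<in> carrier SS"
    then show "Tr (u \<oplus>\<^bsub>SS\<^esub> v) = Tr u \<oplus>\<^bsub>R\<^esub> Tr v"
      using u by (simp add: ring_as_algebra_simps \<sigma>_closed \<sigma>_add S.a_ac) }
  { fix a assume "a \<in> carrier R"
    then show "Tr (a \<odot>\<^bsub>SS\<^esub> u) = a \<otimes>\<^bsub>R\<^esub> Tr u"
      using u by (simp add: ring_as_algebra_simps \<sigma>_closed \<sigma>_mult S.r_distr) }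
  have t: "Tr (u \<otimes> (h \<otimes> dual i)) \<otimes> dual i = h \<otimes> (Tr (u \<otimes> dual i) \<otimes> dual i)"
    "Tr (u \<otimes> dual i) \<otimes> (h \<otimes> dual i) = h \<otimes> (Tr (u \<otimes> dual i) \<otimes> dual i)" if i: "i < Suc r" for i
  proof -
    have c: "u \<otimes> dual i \<in> carrier S" "Tr (u \<otimes> dual i) \<in> carrier S"
      using u dual_closed[OF i] \<sigma>_closed by auto
    have "u \<otimes> (h \<otimes> dual i) = h \<otimes> (u \<otimes> dual i)" using u dual_closed[OF i] h_closed by (simp add: S.m_ac)
    then show "Tr (u \<otimes> (h \<otimes> dual i)) \<otimes> dual i = h \<otimes> (Tr (u \<otimes> dual i) \<otimes> dual i)"
      using Tr_half[OF c(1)] c dual_closed[OF i] h_closed by (simp only: S.m_assoc)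
    show "Tr (u \<otimes> dual i) \<otimes> (h \<otimes> dual i) = h \<otimes> (Tr (u \<otimes> dual i) \<otimes> dual i)"
      using c(2) dual_closed[OF i] h_closed by (simp only: S.m_lcomm)
  qed
  have cl: "(\<lambda>i. h \<otimes> (Tr (u \<otimes> dual i) \<otimes> dual i)) \<in> {..<Suc r} \<rightarrow> carrier S"
    using u dual_closed \<sigma>_closed h_closed by auto
  show "(\<Oplus>\<^bsub>SS\<^esub>i\<in>{..<Suc r}. Tr (u \<otimes>\<^bsub>SS\<^esub> (h \<otimes> dual i)) \<odot>\<^bsub>SS\<^esub> dual i) = u"
    unfolding finsum_SS ring_as_algebra_simps
    by (rule trans[OF S.finsum_cong'[OF refl cl] base[OF u]]) (rule t(1), simp)
  show "(\<Oplus>\<^bsub>SS\<^esub>i\<in>{..<Suc r}. Tr (u \<otimes>\<^bsub>SS\<^esub> dual i) \<odot>\<^bsub>SS\<^esub> (h \<otimes> dual i)) = u"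
    unfolding finsum_SS ring_as_algebra_simps
    by (rule trans[OF S.finsum_cong'[OF refl cl] base[OF u]]) (rule t(2), simp)
next
  fix i assume "i < Suc r"
  then show "dual i \<in> carrier SS" "h \<otimes> dual i \<in> carrier SS"
    using dual_closed h_closed by (auto simp: ring_as_algebra_simps)
next
  have dd: "(\<Oplus>i\<in>{..<Suc r}. dual i \<otimes> dual i) = \<one> \<oplus> \<one>"
    by (subst S.finsum_lessThan_Suc_shift) (use dual_closed in \<open>auto simp: dual_def sum_z\<close>)
  have "(\<Oplus>\<^bsub>SS\<^esub>i\<in>{..<Suc r}. dual i \<otimes>\<^bsub>SS\<^esub> (h \<otimes> dual i)) = (\<Oplus>i\<in>{..<Suc r}. h \<otimes> (dual i \<otimes> dual i))"
    unfolding finsum_SS ring_as_algebra_simps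
    using dual_closed h_closed by (intro S.finsum_cong') (auto simp: S.m_lcomm)
  also have "\<dots> = h \<otimes> (\<Oplus>i\<in>{..<Suc r}. dual i \<otimes> dual i)"
    using dual_closed h_closed by (intro S.finsum_rdistr[symmetric]) auto
  also have "\<dots> = \<one>\<^bsub>SS\<^esub>" unfolding dd using half_double[of \<one>] by (simp add: ring_as_algebra_simps)
  finally show "(\<Oplus>\<^bsub>SS\<^esub>i\<in>{..<Suc r}. dual i \<otimes>\<^bsub>SS\<^esub> (h \<otimes> dual i)) = \<one>\<^bsub>SS\<^esub>" .
qed

section \<open>The product of the ring with a power of its fixed ring\<close>

context
  fixes m :: nat
begin

abbreviation "P \<equiv> power_algebra (ring_as_algebra R) m"
abbreviation "A \<equiv> product_algebra SS P"

interpretation R: cring R by (rule cring_R)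

lemma algebra_P: "algebra R P"
  by (rule R.Rpow_algebra)

lemma algebra_A: "algebra R A"
  by (rule algebra_product_algebra[OF algebra_SS algebra_P])

lemma trace_algebra_A: "\<exists>Tr k x y. trace_algebra R A Tr k x y"
  using trace_algebra_product[OF trace_algebra_SS R.trace_algebra_power[of m]] by blast

lemma etale_A: "etale_algebra TYPE('c) R A"
  using trace_algebra_A trace_algebra.etale by blast

lemma projective_A: "projective_module TYPE('c) R A"
  using trace_algebra_A trace_algebra.projective by blast

lemma finitely_generated_A: "\<exists>B. finite B \<and> B \<subseteq> carrier A \<and> submodule_generated R A B = carrier A"
proof -
  obtain Tr k x y where "trace_algebra R A Tr k x y" using trace_algebra_A by blast
  then interpret trace_algebra R A Tr k x y .
  show ?thesis
    by (intro exI[of _ "x ` {..<k}"] conjI finitely_generated) (use x_closed in auto)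
qed

text \<open>A basis once \<open>z_l^2\<close> has been inverted: indices 0 and 1 carry the basis
  \<open>1, z_l\<close> of the first factor, and index \<open>2 + j\<close> carries the unit vector
  \<open>j\<close> of the second.\<close>

definition local_basis :: "nat \<Rightarrow> nat \<Rightarrow> 'a \<times> (nat \<Rightarrow> 'a)"
  where "local_basis l i = (if i < 2 then (if i = 0 then \<one> else z l, \<zero>\<^bsub>P\<^esub>) else (\<zero>, R.unit_vector m (i - 2)))"

lemma local_basis_closed: "l < r \<Longrightarrow> local_basis l i \<in> carrier A"
  using z_closed[of l] R.unit_vector_closed[of m "i - 2"] cring.cring_simprules(2)[OF algebra.M_cring[OF algebra_P]]
  by (auto simp: local_basis_def product_algebra_simps ring_as_algebra_simps)

lemma local_basis_sum:
  assumes l: "l < r" and d: "\<And>i. i < 2 + m \<Longrightarrow> d i \<in> carrier R"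
  shows "fst (\<Oplus>\<^bsub>A\<^esub>i\<in>{..<2 + m}. d i \<odot>\<^bsub>A\<^esub> local_basis l i) = d 0 \<oplus> d 1 \<otimes> z l"
    and "j < m \<Longrightarrow> snd (\<Oplus>\<^bsub>A\<^esub>i\<in>{..<2 + m}. d i \<odot>\<^bsub>A\<^esub> local_basis l i) j = d (2 + j)"
proof -
  interpret AA: algebra R A by (rule algebra_A)
  interpret PP: algebra R P by (rule algebra_P)
  interpret SA: algebra R SS by (rule algebra_SS)
  have dS: "d i \<in> carrier S" if "i < 2 + m" for i using d[OF that] by simp
  have f: "(\<lambda>i. d i \<odot>\<^bsub>A\<^esub> local_basis l i) \<in> {..<2 + m} \<rightarrow> carrier A"
    using d local_basis_closed[OF l] by (intro Pi_I AA.smult_closed) auto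
  have split: "(\<Oplus>\<^bsub>A\<^esub>i\<in>{..<2 + m}. d i \<odot>\<^bsub>A\<^esub> local_basis l i)
    = (\<Oplus>\<^bsub>SS\<^esub>i\<in>{..<2 + m}. fst (d i \<odot>\<^bsub>A\<^esub> local_basis l i), \<Oplus>\<^bsub>P\<^esub>i\<in>{..<2 + m}. snd (d i \<odot>\<^bsub>A\<^esub> local_basis l i))"
    by (rule product_finsum[OF algebra_SS algebra_P _ f]) simp
  let ?f = "\<lambda>i. d i \<otimes> (if i = 0 then \<one> else z l)"
  have fc: "?f \<in> {..<2} \<rightarrow> carrier S" using dS z_closed[OF l] by auto
  have "fst (\<Oplus>\<^bsub>A\<^esub>i\<in>{..<2 + m}. d i \<odot>\<^bsub>A\<^esub> local_basis l i)
    = (\<Oplus>i\<in>{..<2 + m}. if i < 2 then ?f i else (\<lambda>_. \<zero>) (i - 2))"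
    unfolding split fst_conv finsum_SS
    using fc dS z_closed[OF l] by (intro S.finsum_cong') (auto simp: product_algebra_simps ring_as_algebra_simps local_basis_def)
  also have "\<dots> = (\<Oplus>i\<in>{..<2}. ?f i) \<oplus> (\<Oplus>i\<in>{..<m}. \<zero>)"
    by (rule S.finsum_append[OF fc]) simp
  also have "(\<Oplus>i\<in>{..<2}. ?f i) = ?f 0 \<oplus> (\<Oplus>i\<in>{..<1}. ?f (Suc i))"
    using S.finsum_lessThan_Suc_shift[of ?f 1] fc by (simp add: numeral_2_eq_2)
  also have "(\<Oplus>i\<in>{..<1}. ?f (Suc i)) = ?f 1"
    using S.finsum_lessThan_Suc_shift[of "\<lambda>i. ?f (Suc i)" 0] dS[of 1] z_closed[OF l] by simp
  finally show "fst (\<Oplus>\<^bsub>A\<^esub>i\<in>{..<2 + m}. d i \<odot>\<^bsub>A\<^esub> local_basis l i) = d 0 \<oplus> d 1 \<otimes> z l"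
    using dS[of 0] dS[of 1] z_closed[OF l] by simp
  assume j: "j < m"
  let ?g = "\<lambda>i. d (2 + i) \<odot>\<^bsub>P\<^esub> R.unit_vector m i"
  have gc: "?g \<in> {..<m} \<rightarrow> carrier P"
    using d R.unit_vector_closed by (intro Pi_I PP.smult_closed) auto
  have "snd (\<Oplus>\<^bsub>A\<^esub>i\<in>{..<2 + m}. d i \<odot>\<^bsub>A\<^esub> local_basis l i)
    = (\<Oplus>\<^bsub>P\<^esub>i\<in>{..<2 + m}. if i < 2 then (\<lambda>_. \<zero>\<^bsub>P\<^esub>) i else ?g (i - 2))"
    unfolding split snd_conv
  proof (rule PP.finsum_cong'[OF refl])
    show "(\<lambda>i. if i < 2 then (\<lambda>_. \<zero>\<^bsub>P\<^esub>) i else ?g (i - 2)) \<in> {..<2 + m} \<rightarrow> carrier P"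
    proof (rule Pi_I)
      fix i assume "i \<in> {..<2 + m}"
      then have "\<not> i < 2 \<Longrightarrow> ?g (i - 2) \<in> carrier P" by (intro funcset_mem[OF gc]) auto
      then show "(if i < 2 then (\<lambda>_. \<zero>\<^bsub>P\<^esub>) i else ?g (i - 2)) \<in> carrier P"
        by (simp only: PP.M.zero_closed split: if_splits) blast
    qed
    fix i assume "i \<in> {..<2 + m}"
    then have di: "d i \<in> carrier R" using d by simp
    show "snd (d i \<odot>\<^bsub>A\<^esub> local_basis l i) = (if i < 2 then (\<lambda>_. \<zero>\<^bsub>P\<^esub>) i else ?g (i - 2))"
    proof (cases "i < 2")
      case True
      then show ?thesis using PP.smult_r_null[OF di] by (simp add: local_basis_def product_algebra_simps(6))
    next
      case False
      then have "2 + (i - 2) = i" by simp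
      then show ?thesis using False by (simp only: local_basis_def product_algebra_simps(6) if_False snd_conv)
    qed
  qed
  also have "\<dots> = (\<Oplus>\<^bsub>P\<^esub>i\<in>{..<2 :: nat}. \<zero>\<^bsub>P\<^esub>) \<oplus>\<^bsub>P\<^esub> (\<Oplus>\<^bsub>P\<^esub>i\<in>{..<m}. ?g i)"
    by (rule PP.finsum_append[OF _ gc]) simp
  also have "\<dots> = (\<Oplus>\<^bsub>P\<^esub>i\<in>{..<m}. ?g i)"
    using PP.finsum_closed[OF gc] PP.finsum_zero[of "{..<2 :: nat}"] PP.M.l_zero by simp
  finally show "snd (\<Oplus>\<^bsub>A\<^esub>i\<in>{..<2 + m}. d i \<odot>\<^bsub>A\<^esub> local_basis l i) j = d (2 + j)"
    using R.Rpow_unit_expansion[of m "\<lambda>i. d (2 + i)" j] d j by simp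
qed

text \<open>Otherwise the prime would contain the sum of the \<open>z_l^2\<close>, which is the
  unit. Squares are used because \<open>z_l\<close> itself is odd and does not belong to the fixed
  ring in general.\<close>

lemma exists_z_not_in_prime:
  assumes "primeideal I R"
  shows "\<exists>l<r. z l \<otimes> z l \<in> carrier R - I"
proof (rule ccontr)
  assume none: "\<not> ?thesis"
  interpret I: primeideal I R by fact
  have zz: "z l \<otimes> z l \<in> carrier R" if "l < r" for l
    using that z_closed[OF that] by (simp add: \<sigma>_mult \<sigma>_z S.l_minus S.r_minus)
  then have all: "z l \<otimes> z l \<in> I" if "l < r" for l using none that by blast
  have "(\<Oplus>l\<in>J. z l \<otimes> z l) \<in> I" if "finite J" "J \<subseteq> {..<r}" for J
    using that
  proof (induction J)
    case empty
    then show ?case using I.zero_closed by simp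
  next
    case (insert l J)
    have "(\<Oplus>l\<in>insert l J. z l \<otimes> z l) = z l \<otimes> z l \<oplus> (\<Oplus>l\<in>J. z l \<otimes> z l)"
      using insert z_closed by (intro S.finsum_insert) auto
    then show ?case using I.a_closed[of "z l \<otimes> z l" "\<Oplus>l\<in>J. z l \<otimes> z l"] all[of l] insert by simp
  qed
  from this[of "{..<r}"] have "\<one>\<^bsub>R\<^esub> \<in> I" using sum_z by simp
  then show False using I.one_imp_carrier I.I_notcarr by simp
qed

text \<open>An element of the first factor is the sum of an even and an odd part, and the odd part
  becomes an invariant multiple of \<open>z_l\<close> after multiplication by \<open>z_l^2\<close>.
  For uniqueness the two parts of a relation are separated by applying
  \<open>\<sigma>\<close>.\<close>

lemma free_rank_A:
  assumes I: "primeideal I R"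
  shows "free_module_of_rank (2 + m) (localization R (carrier R - I) (ring_as_algebra R))
    (localization R (carrier R - I) A)"
proof -
  interpret I: primeideal I R by (rule I)
  have one: "\<one>\<^bsub>R\<^esub> \<in> carrier R - I"
  proof
    show "\<one>\<^bsub>R\<^esub> \<in> carrier R" by (simp add: \<sigma>_one)
    show "\<one>\<^bsub>R\<^esub> \<notin> I"
    proof
      assume "\<one>\<^bsub>R\<^esub> \<in> I"
      then have "I = carrier R" by (intro I.one_imp_carrier) simp
      then show False using I.I_notcarr by simp
    qed
  qed
  have mult: "s \<otimes>\<^bsub>R\<^esub> t \<in> carrier R - I" if "s \<in> carrier R - I" "t \<in> carrier R - I" for s t
  proof
    show "s \<otimes>\<^bsub>R\<^esub> t \<in> carrier R" using that by (simp add: \<sigma>_mult)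
    show "s \<otimes>\<^bsub>R\<^esub> t \<notin> I" using that I.I_prime[of s t] by auto
  qed
  interpret T: mult_subset R "carrier R - I"
    by (rule mult_subset.intro[OF cring_R mult_subset_axioms.intro[OF Diff_subset one mult]])
  obtain l where l: "l < r" and s: "z l \<otimes> z l \<in> carrier R - I" using exists_z_not_in_prime[OF I] by blast
  note zl = z_closed[OF l]
  let ?s = "z l \<otimes> z l"
  \<comment> \<open>With \<open>u = fst p\<close>: the even part \<open>h (u + \<sigma> u)\<close>,
    times \<open>s\<close>, is the coefficient of the unit. For the odd part
    \<open>v = h (u - \<sigma> u)\<close> one has \<open>s v = (z_l v) z_l\<close>, where
    \<open>z_l v\<close> is a product of two odd elements and hence invariant.\<close>
  define c where "c p i = (if i = 0 then ?s \<otimes> (h \<otimes> (fst p \<oplus> \<sigma> (fst p)))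
    else if i = 1 then z l \<otimes> (h \<otimes> (fst p \<ominus> \<sigma> (fst p))) else ?s \<otimes> snd p (i - 2))"
    for p :: "'a \<times> (nat \<Rightarrow> 'a)" and i :: nat
  have pc: "fst p \<in> carrier S" "\<And>j. j < m \<Longrightarrow> snd p j \<in> carrier R" if "p \<in> carrier A" for p
  proof -
    show "fst p \<in> carrier S" using that by (simp add: product_algebra_simps mem_Times_iff ring_as_algebra_simps)
    have "snd p \<in> carrier P" using that by (simp only: product_algebra_simps mem_Times_iff)
    then have w: "snd p \<in> {..<m} \<rightarrow>\<^sub>E carrier R" by (simp only: R.Rpow_closed)
    show "snd p j \<in> carrier R" if j: "j < m" for j
    proof (rule PiE_mem[OF w])
      show "j \<in> {..<m}" using j by simp
    qed
  qed
  have sR: "?s \<in> carrier R" using s by blast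
  have c_closed: "c p i \<in> carrier R" if p: "p \<in> carrier A" and i: "i < 2 + m" for p i
  proof -
    note u = pc(1)[OF p] and \<sigma>u = \<sigma>_closed[OF pc(1)[OF p]]
    consider "i = 0" | "i = 1" | "i \<noteq> 0" "i \<noteq> 1" "i - 2 < m" using i by linarith
    then show ?thesis
    proof cases
      case 1
      then show ?thesis
        using u \<sigma>u zl h_closed
        by (simp add: c_def \<sigma>_mult \<sigma>_add \<sigma>_h \<sigma>_z[OF l] \<sigma>_invol S.l_minus S.r_minus S.a_comm)
    next
      case 2
      have "\<sigma> (fst p \<ominus> \<sigma> (fst p)) = \<ominus> (fst p \<ominus> \<sigma> (fst p))"
        using u \<sigma>u by (simp add: S.minus_eq \<sigma>_add \<sigma>_minus \<sigma>_invol S.minus_add S.a_comm)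
      then show ?thesis
        using 2 u \<sigma>u zl h_closed by (simp add: c_def \<sigma>_mult \<sigma>_h \<sigma>_z[OF l] S.l_minus S.r_minus)
    next
      case 3
      then show ?thesis using sR pc(2)[OF p 3(3)] zl by (simp add: c_def \<sigma>_mult)
    qed
  qed
  show ?thesis
  proof (rule T.free_localization[where b = "local_basis l" and s = ?s and c = c])
    show "module R A" using algebra_A by (rule algebra.axioms)
    show "local_basis l i \<in> carrier A" for i by (rule local_basis_closed[OF l])
    show "?s \<in> carrier R - I" by (rule s)
    show "c p i \<in> carrier R" if "p \<in> carrier A" "i < 2 + m" for p i by (rule c_closed[OF that])
  next
    fix p assume p: "p \<in> carrier A"
    interpret AA: algebra R A by (rule algebra_A)
    note u = pc(1)[OF p] and \<sigma>u = \<sigma>_closed[OF pc(1)[OF p]]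
    let ?B = "\<Oplus>\<^bsub>A\<^esub>i\<in>{..<2 + m}. c p i \<odot>\<^bsub>A\<^esub> local_basis l i"
    have sum: "fst ?B = c p 0 \<oplus> c p 1 \<otimes> z l" "\<And>j. j < m \<Longrightarrow> snd ?B j = c p (2 + j)"
      using local_basis_sum[OF l, of "c p"] c_closed[OF p] by blast+
    have Bc: "?B \<in> carrier A"
      using c_closed[OF p] local_basis_closed[OF l] by (intro AA.finsum_closed Pi_I AA.smult_closed) auto
    have sp: "?s \<odot>\<^bsub>A\<^esub> p \<in> carrier A" using sR p by (rule AA.smult_closed)
    have "fst ?B = ?s \<otimes> (h \<otimes> (fst p \<oplus> \<sigma> (fst p))) \<oplus> z l \<otimes> (h \<otimes> (fst p \<ominus> \<sigma> (fst p))) \<otimes> z l"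
      using sum(1) by (simp add: c_def)
    also have "z l \<otimes> (h \<otimes> (fst p \<ominus> \<sigma> (fst p))) \<otimes> z l = ?s \<otimes> (h \<otimes> (fst p \<ominus> \<sigma> (fst p)))"
      using u \<sigma>u zl h_closed by (simp add: S.m_ac)
    also have "?s \<otimes> (h \<otimes> (fst p \<oplus> \<sigma> (fst p))) \<oplus> ?s \<otimes> (h \<otimes> (fst p \<ominus> \<sigma> (fst p)))
      = ?s \<otimes> (h \<otimes> ((fst p \<oplus> \<sigma> (fst p)) \<oplus> (fst p \<ominus> \<sigma> (fst p))))"
      using u \<sigma>u zl h_closed by (simp add: S.r_distr)
    also have "(fst p \<oplus> \<sigma> (fst p)) \<oplus> (fst p \<ominus> \<sigma> (fst p)) = fst p \<oplus> fst p"
    proof -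
      have "(fst p \<oplus> \<sigma> (fst p)) \<oplus> (fst p \<oplus> \<ominus> \<sigma> (fst p)) = (fst p \<oplus> fst p) \<oplus> (\<sigma> (fst p) \<oplus> \<ominus> \<sigma> (fst p))"
        using u \<sigma>u by (simp only: S.a_ac S.add.m_closed S.a_inv_closed)
      then show ?thesis using u \<sigma>u by (simp add: S.r_neg S.minus_eq)
    qed
    also have "h \<otimes> (fst p \<oplus> fst p) = fst p" by (rule half_double[OF u])
    finally have 1: "fst (?s \<odot>\<^bsub>A\<^esub> p) = fst ?B" by (simp add: product_algebra_simps ring_as_algebra_simps)
    have "snd (?s \<odot>\<^bsub>A\<^esub> p) = snd ?B"
    proof (rule R.Rpow_ext[where m = m])
      show "snd (?s \<odot>\<^bsub>A\<^esub> p) \<in> carrier P" "snd ?B \<in> carrier P"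
        using sp Bc by (auto simp: product_algebra_simps)
      fix j assume j: "j < m"
      show "snd (?s \<odot>\<^bsub>A\<^esub> p) j = snd ?B j"
        using j sum(2)[OF j] by (simp add: c_def product_algebra_simps power_algebra_simps ring_as_algebra_simps)
    qed
    with 1 show "?s \<odot>\<^bsub>A\<^esub> p = ?B" by (rule prod_eqI)
  next
    fix d assume d: "\<And>i. i < 2 + m \<Longrightarrow> d i \<in> carrier R"
      and zero: "(\<Oplus>\<^bsub>A\<^esub>i\<in>{..<2 + m}. d i \<odot>\<^bsub>A\<^esub> local_basis l i) = \<zero>\<^bsub>A\<^esub>"
    have d0: "d 0 \<in> carrier S" "\<sigma> (d 0) = d 0" and d1: "d 1 \<in> carrier S" "\<sigma> (d 1) = d 1"
      using d[of 0] d[of 1] by auto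
    have sum: "fst \<zero>\<^bsub>A\<^esub> = d 0 \<oplus> d 1 \<otimes> z l" "\<And>j. j < m \<Longrightarrow> snd \<zero>\<^bsub>A\<^esub> j = d (2 + j)"
      using local_basis_sum[OF l, of d, unfolded zero] d by blast+
    have e: "d 0 \<oplus> d 1 \<otimes> z l = \<zero>"
      using sum(1) by (simp add: product_algebra_simps ring_as_algebra_simps)
    \<comment> \<open>The coefficients are invariant and \<open>z_l\<close> is odd, so
      \<open>\<sigma>\<close> only changes the sign of the second summand. Adding the two equations
      gives \<open>2 d_0 = 0\<close>.\<close>
    have "d 0 \<oplus> \<ominus> (d 1 \<otimes> z l) = \<sigma> (d 0 \<oplus> d 1 \<otimes> z l)"
      using d0 d1 zl by (simp add: \<sigma>_add \<sigma>_mult \<sigma>_z[OF l] S.r_minus)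
    then have e': "d 0 \<oplus> \<ominus> (d 1 \<otimes> z l) = \<zero>" using e \<sigma>_zero by simp
    then have eq: "d 0 = d 1 \<otimes> z l"
      using d0 d1 zl S.minus_zero_iff[of "d 0" "d 1 \<otimes> z l"] by (simp add: S.minus_eq)
    then have dz: "d 0 = \<zero>" using e half_double[OF d0(1)] h_closed by simp
    then have d1z: "d 1 \<otimes> z l = \<zero>" using eq by simp
    have "?s \<otimes> d i = \<zero>" if i: "i < 2 + m" for i
    proof -
      consider "i = 0" | "i = 1" | j where "i = 2 + j" "j < m"
      proof -
        have "i = 0 \<or> i = 1 \<or> (i = 2 + (i - 2) \<and> i - 2 < m)" using i by linarith
        then show thesis using that by blast
      qed
      then show ?thesis
      proof cases
        case 1
        then show ?thesis using dz zl by simp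
      next
        case 2
        \<comment> \<open>Only \<open>d_1 z_l = 0\<close> is available, and one more factor
          \<open>z_l\<close> turns it into a statement about the invariant element
          \<open>s\<close>.\<close>
        have "?s \<otimes> d 1 = z l \<otimes> (d 1 \<otimes> z l)" using d1 zl by (simp add: S.m_ac)
        then show ?thesis using 2 d1z zl by simp
      next
        case 3
        have "d i = \<zero>"
          using sum(2)[OF 3(2)] 3
          by (simp add: product_algebra_simps power_algebra_simps ring_as_algebra_simps)
        then show ?thesis using zl by simp
      qed
    qed
    then show "\<exists>v\<in>carrier R - I. \<forall>i<2 + m. v \<otimes>\<^bsub>R\<^esub> d i = \<zero>\<^bsub>R\<^esub>"
      using s by (intro bexI[of _ ?s]) auto
  qed
qed

lemma etale_of_degree_A: "etale_algebra_of_degree TYPE('c) (2 + m) R A"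
  unfolding etale_algebra_of_degree_def projective_module_of_rank_def
  by (intro conjI allI impI etale_A projective_A finitely_generated_A) (rule free_rank_A)

end

end

section \<open>Linear algebra in odd dimension\<close>

lemma odd_degree_real_root:
  fixes p :: "real poly"
  assumes "odd (Polynomial.degree p)"
  shows "\<exists>x. poly p x = 0"
proof -
  have pos: "\<exists>n. \<forall>x\<ge>n. poly q x > 0" if "lead_coeff q > 0" for q :: "real poly"
    using poly_pinfty_gt_lc[OF that] that by (meson less_le_trans)
  have key: "\<exists>x. poly p x = 0" if odd: "odd (Polynomial.degree p)" and lc: "lead_coeff p > 0" for p :: "real poly"
  proof -
    \<comment> \<open>\<open>q(x) = - p(- x)\<close> has the leading coefficient of \<open>p\<close>
      because the degree is odd. Positivity of \<open>q\<close> far to the right means that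
      \<open>p\<close> is negative far to the left.\<close>
    define q where "q = - (p \<circ>\<^sub>p [:0, -1:])"
    have "lead_coeff (p \<circ>\<^sub>p [:0, -1:]) = - lead_coeff p"
      using odd by (subst lead_coeff_comp) auto
    then have "lead_coeff q = lead_coeff p"
      by (simp only: q_def lead_coeff_minus minus_minus)
    then obtain m where m: "\<forall>x\<ge>m. poly q x > 0" using pos lc by metis
    obtain n where n: "\<forall>x\<ge>n. poly p x > 0" using pos lc by metis
    have "poly p (- \<bar>m\<bar> - 1) < 0"
      using m[rule_format, of "\<bar>m\<bar> + 1"] by (simp add: q_def poly_pcompose)
    moreover have "poly p (\<bar>n\<bar>) > 0" using n by auto
    ultimately show ?thesis
      using poly_IVT_pos[of "- \<bar>m\<bar> - 1" "\<bar>n\<bar>" p] by fastforce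
  qed
  have "lead_coeff p \<noteq> 0" using assms by auto
  then have "lead_coeff p > 0 \<or> lead_coeff (- p) > 0"
    unfolding lead_coeff_minus by linarith
  then consider "lead_coeff p > 0" | "lead_coeff (- p) > 0" by blast
  then show ?thesis
    using key[of p] key[of "- p"] assms by cases auto
qed

text \<open>The polynomial is the characteristic polynomial of the matrix of \<open>T\<close> in an
  enumeration of \<open>B\<close>. The operator is confined to the span of a finite independent set
  because the ambient spaces of polynomials are infinite-dimensional.\<close>

lemma eigenvalue_poly_on_span:
  fixes T :: "'a::real_vector \<Rightarrow> 'a"
  assumes B: "finite B" "independent B" and T: "linear T" "T ` B \<subseteq> span B"
  shows "\<exists>q :: real poly. Polynomial.degree q = card B \<and> q \<noteq> 0 \<and>
    (\<forall>k. poly q k = 0 \<longleftrightarrow> (\<exists>v\<in>span B. v \<noteq> 0 \<and> T v = k *\<^sub>R v))"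
proof -
  obtain bs where bs: "distinct bs" "set bs = B" using B(1) finite_distinct_list by blast
  define N where "N = length bs"
  have bij: "bij_betw ((!) bs) {..<N} B"
    unfolding N_def using bs bij_betw_nth by blast
  define A where "A = mat N N (\<lambda>(i, j). representation B (T (bs ! j)) (bs ! i))"
  have A: "A \<in> carrier_mat N N" by (simp add: A_def)
  \<comment> \<open>The coordinate isomorphism from column vectors onto \<open>span B\<close>; the
    following facts show that it intertwines \<open>A\<close> and \<open>T\<close>, is injective and
    is surjective.\<close>
  define comb where "comb u = (\<Sum>j<N. (vec_index u j) *\<^sub>R bs ! j)" for u :: "real Matrix.vec"
  have T_comb: "T (comb u) = comb (A *\<^sub>v u)" if u: "u \<in> carrier_vec N" for u
  proof -
    have Tb: "T (bs ! j) = (\<Sum>i<N. (A $$ (i, j)) *\<^sub>R bs ! i)" if j: "j < N" for j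
    proof -
      have "bs ! j \<in> B" using bs j by (auto simp: N_def)
      then have "T (bs ! j) \<in> span B" using T by auto
      then have "T (bs ! j) = (\<Sum>b\<in>B. representation B (T (bs ! j)) b *\<^sub>R b)"
        using B by (simp add: real_vector.sum_representation_eq)
      also have "\<dots> = (\<Sum>i<N. representation B (T (bs ! j)) (bs ! i) *\<^sub>R bs ! i)"
        by (rule sum.reindex_bij_betw[OF bij, symmetric])
      also have "\<dots> = (\<Sum>i<N. (A $$ (i, j)) *\<^sub>R bs ! i)"
        using j by (intro sum.cong) (auto simp: A_def)
      finally show ?thesis .
    qed
    have "T (comb u) = (\<Sum>j<N. (vec_index u j) *\<^sub>R T (bs ! j))"
      unfolding comb_def by (simp add: linear_sum[OF T(1)] linear_scale[OF T(1)])
    also have "\<dots> = (\<Sum>j<N. \<Sum>i<N. (vec_index u j * A $$ (i, j)) *\<^sub>R bs ! i)"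
      by (simp add: Tb scaleR_sum_right)
    also have "\<dots> = (\<Sum>i<N. (\<Sum>j<N. vec_index u j * A $$ (i, j)) *\<^sub>R bs ! i)"
      by (subst sum.swap) (simp add: scaleR_sum_left)
    also have "\<dots> = comb (A *\<^sub>v u)"
      unfolding comb_def using A u
      by (intro sum.cong) (auto simp: scalar_prod_def mult.commute atLeast0LessThan intro!: sum.cong)
    finally show ?thesis .
  qed
  have comb_span: "comb u \<in> span B" for u
    unfolding comb_def using bij by (intro span_sum span_scale span_base) (auto simp: bij_betw_def)
  have comb_inj: "u = 0\<^sub>v N" if u: "u \<in> carrier_vec N" and 0: "comb u = 0" for u
  proof (rule eq_vecI)
    define c where "c b = vec_index u (the_inv_into {..<N} ((!) bs) b)" for b
    have c: "c (bs ! j) = vec_index u j" if "j < N" for j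
      using that bij by (simp add: c_def the_inv_into_f_f bij_betw_def)
    have "(\<Sum>b\<in>B. c b *\<^sub>R b) = (\<Sum>j<N. c (bs ! j) *\<^sub>R bs ! j)"
      by (rule sum.reindex_bij_betw[OF bij, symmetric])
    also have "\<dots> = comb u" unfolding comb_def using c by (intro sum.cong) auto
    finally have "(\<Sum>b\<in>B. c b *\<^sub>R b) = 0" using 0 by simp
    then have "\<forall>b\<in>B. c b = 0" using B real_vector.independentD by blast
    then show "vec_index u j = vec_index (0\<^sub>v N) j" if "j < dim_vec (0\<^sub>v N)" for j
      using that c[of j] bij by (auto simp: bij_betw_def)
  qed (use u in auto)
  have comb_surj: "\<exists>u\<in>carrier_vec N. v = comb u" if "v \<in> span B" for v
  proof
    have "v = (\<Sum>b\<in>B. representation B v b *\<^sub>R b)"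
      using B that by (simp add: real_vector.sum_representation_eq)
    also have "\<dots> = (\<Sum>j<N. representation B v (bs ! j) *\<^sub>R bs ! j)"
      by (rule sum.reindex_bij_betw[OF bij, symmetric])
    finally show "v = comb (vec N (\<lambda>j. representation B v (bs ! j)))"
      by (simp add: comb_def)
  qed auto
  have comb_smult: "comb (k \<cdot>\<^sub>v u) = k *\<^sub>R comb u" if "u \<in> carrier_vec N" for k u
    using that by (simp add: comb_def scaleR_sum_right)
  have comb_diff: "comb (u - w) = comb u - comb w" if "u \<in> carrier_vec N" "w \<in> carrier_vec N" for u w
    using that by (simp add: comb_def sum_subtractf[symmetric] scaleR_diff_left)
  have comb_eq: "u = w" if uw: "u \<in> carrier_vec N" "w \<in> carrier_vec N" "comb u = comb w" for u w
  proof -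
    have "u - w = 0\<^sub>v N" using uw comb_diff by (intro comb_inj) auto
    then have "\<forall>j<N. vec_index u j = vec_index w j" using uw
      by (metis carrier_vecD eq_iff_diff_eq_0 index_minus_vec(1) index_zero_vec(1))
    then show ?thesis using uw by (intro eq_vecI) auto
  qed
  have 0: "comb (0\<^sub>v N) = 0" by (simp add: comb_def)
  have eig: "eigenvalue A k \<longleftrightarrow> (\<exists>v\<in>span B. v \<noteq> 0 \<and> T v = k *\<^sub>R v)" for k
  proof
    assume "eigenvalue A k"
    then obtain u where u: "u \<in> carrier_vec N" "u \<noteq> 0\<^sub>v N" "A *\<^sub>v u = k \<cdot>\<^sub>v u"
      using A by (auto simp: eigenvalue_def eigenvector_def)
    then have "comb u \<noteq> 0" using comb_inj by blast
    moreover have "T (comb u) = k *\<^sub>R comb u" using u T_comb comb_smult by simp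
    ultimately show "\<exists>v\<in>span B. v \<noteq> 0 \<and> T v = k *\<^sub>R v" using comb_span by blast
  next
    assume "\<exists>v\<in>span B. v \<noteq> 0 \<and> T v = k *\<^sub>R v"
    then obtain v where v: "v \<in> span B" "v \<noteq> 0" "T v = k *\<^sub>R v" by blast
    obtain u where u: "u \<in> carrier_vec N" "v = comb u" using comb_surj v by blast
    have "A *\<^sub>v u = k \<cdot>\<^sub>v u"
      using u v A T_comb comb_smult by (intro comb_eq) auto
    moreover have "u \<noteq> 0\<^sub>v N" using v u 0 by auto
    ultimately show "eigenvalue A k" using A u by (auto simp: eigenvalue_def eigenvector_def)
  qed
  have "N = card B" using bij bij_betw_same_card by fastforce
  then have "Polynomial.degree (char_poly A) = card B" "char_poly A \<noteq> 0"
    using degree_monic_char_poly[OF A] by auto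
  then show ?thesis
    using eigenvalue_root_char_poly[OF A] eig by blast
qed

text \<open>A basis \<open>K\<close> of the kernel is extended to a basis \<open>E\<close> of
  \<open>span B\<close>. On the span of \<open>E - K\<close> the map is injective, so the image of
  \<open>E - K\<close> is a basis of the image.\<close>

lemma rank_nullity_on_span:
  fixes T :: "'a::real_vector \<Rightarrow> 'b::real_vector"
  assumes B: "finite B" "independent B" and T: "linear T"
  obtains K C where "finite K" "independent K" "span K = {v \<in> span B. T v = 0}"
    "finite C" "independent C" "span C = T ` span B" "card K + card C = card B"
proof -
  define U where "U = {v \<in> span B. T v = 0}"
  have sub: "subspace U"
    unfolding U_def subspace_def using linear_0[OF T] linear_add[OF T] linear_scale[OF T]
    by (auto intro: span_add span_scale span_zero)
  obtain K where K: "K \<subseteq> U" "independent K" "U \<subseteq> span K"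
    using real_vector.maximal_independent_subset by blast
  have spanK: "span K = U" using K sub by (meson span_minimal subset_antisym)
  have "K \<subseteq> span B" using K U_def by auto
  then obtain E where E: "K \<subseteq> E" "E \<subseteq> span B" "independent E" "span B \<subseteq> span E"
    using real_vector.maximal_independent_subset_extend[OF _ K(2)] by blast
  have finE: "finite E" "card E \<le> card B"
    using real_vector.independent_span_bound[OF B(1) E(3,2)] by auto
  have "card B \<le> card E"
    using real_vector.independent_span_bound[OF finE(1) B(2)] E(4) span_superset by blast
  then have cardE: "card E = card B" using finE by simp
  have spanE: "span E = span B" using E by (meson span_minimal subset_antisym subspace_span)
  have inj: "inj_on T (span (E - K))"
  proof (rule inj_onI)
    fix x y assume xy: "x \<in> span (E - K)" "y \<in> span (E - K)" "T x = T y"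
    define w where "w = x - y"
    have w1: "w \<in> span (E - K)" using xy by (simp add: w_def span_diff)
    then have wE: "w \<in> span E" using span_mono[of "E - K" E] by auto
    have "T w = 0" using xy by (simp add: w_def linear_diff[OF T])
    then have "w \<in> span K" using wE spanE spanK by (simp add: U_def)
    then have r1: "representation E w = representation K w"
      using E by (intro real_vector.representation_extend) auto
    \<comment> \<open>The coordinates of \<open>w\<close> in \<open>E\<close> are supported in
      \<open>K\<close> and also in \<open>E - K\<close>, hence they all vanish.\<close>
    have r2: "representation E w = representation (E - K) w"
      using E w1 by (intro real_vector.representation_extend) auto
    have "representation E w b = 0" for b
      using r1 r2 real_vector.representation_ne_zero[of K w b] real_vector.representation_ne_zero[of "E - K" w b]
      by fastforce
    then have "(\<Sum>b\<in>E. representation E w b *\<^sub>R b) = 0" by simp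
    then have "w = 0" using real_vector.sum_representation_eq[OF E(3) wE finE(1)] by simp
    then show "x = y" by (simp add: w_def)
  qed
  define C where "C = T ` (E - K)"
  have "independent (E - K)" using E(3) real_vector.independent_mono by blast
  then have indC: "independent C"
    unfolding C_def using inj T by (intro linear_independent_injective_image) auto
  have cardC: "card C = card (E - K)"
    unfolding C_def using inj by (meson card_image inj_on_subset span_superset)
  have "T ` span B = span (T ` E)" using linear_span_image[OF T] spanE by simp
  also have "T ` E = T ` K \<union> C" using E(1) by (auto simp: C_def)
  also have "span (T ` K \<union> C) = span C"
  proof -
    have "T ` K \<subseteq> span C" using K(1) by (auto simp: U_def span_zero)
    then have "T ` K \<union> C \<subseteq> span C" using span_superset by auto
    then show ?thesis by (meson span_minimal span_mono subset_antisym subspace_span sup_ge2)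
  qed
  finally have "span C = T ` span B" by simp
  moreover have "card K + card C = card B"
    using E(1) finE(1) cardC cardE card_mono[OF finE(1) E(1)]
    by (simp add: card_Diff_subset finite_subset)
  ultimately show thesis
    using that[of K C] finE E(1) K(2) spanK indC by (auto simp: U_def C_def intro: finite_subset)
qed

text \<open>This finiteness is what keeps the set of exceptional parameters of the perturbed system
  countable.\<close>

lemma finite_eigenvalues_on_span:
  fixes T :: "'a::real_vector \<Rightarrow> 'a"
  assumes "finite B" "independent B" "linear T" "T ` B \<subseteq> span B"
  shows "finite {k. \<exists>v\<in>span B. v \<noteq> 0 \<and> T v = k *\<^sub>R v}"
proof -
  obtain q :: "real poly" where q: "q \<noteq> 0"
    "\<And>k. poly q k = 0 \<longleftrightarrow> (\<exists>v\<in>span B. v \<noteq> 0 \<and> T v = k *\<^sub>R v)"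
    using eigenvalue_poly_on_span[OF assms] by blast
  show ?thesis using poly_roots_finite[OF q(1)] unfolding q(2) .
qed

lemma injective_imp_surjective_on_span:
  fixes T :: "'a::real_vector \<Rightarrow> 'a"
  assumes B: "finite B" "independent B" and T: "linear T" "T ` span B \<subseteq> span B"
    and inj: "\<And>v. v \<in> span B \<Longrightarrow> T v = 0 \<Longrightarrow> v = 0"
  shows "T ` span B = span B"
proof -
  obtain K C where K: "independent K" "span K = {v \<in> span B. T v = 0}"
    and C: "finite C" "independent C" "span C = T ` span B" "card K + card C = card B"
    using rank_nullity_on_span[OF B T(1)] by metis
  have "span K \<subseteq> {0}" using K inj by auto
  then have "K \<subseteq> {0}" using span_superset by blast
  then have "K = {}" using K(1) real_vector.dependent_zero by blast
  then have card: "card C = card B" using C by simp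
  have "C \<subseteq> span B" using C(3) T(2) span_superset by blast
  then obtain E where E: "C \<subseteq> E" "E \<subseteq> span B" "independent E" "span B \<subseteq> span E"
    using real_vector.maximal_independent_subset_extend[OF _ C(2)] by blast
  have "finite E" "card E \<le> card C"
    using real_vector.independent_span_bound[OF B(1) E(3,2)] card by auto
  then have "E = C" using E(1) card_seteq by metis
  then show ?thesis using E(4) C(3) T(2) by auto
qed

text \<open>Induction on the dimension. If some \<open>T\<close> is not scalar, odd degree provides
  a real eigenvalue \<open>k\<close>. The kernel and the image of \<open>T - k\<close> are invariant
  under the whole commuting family, and their dimensions add up to an odd number, so one of the two
  spaces again has odd dimension.\<close>

lemma commuting_common_eigenvector:
  fixes \<T> :: "('a::real_vector \<Rightarrow> 'a) set"
  assumes "finite B" "independent B" "odd (card B)"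
    and "\<And>T. T \<in> \<T> \<Longrightarrow> linear T" "\<And>T. T \<in> \<T> \<Longrightarrow> T ` span B \<subseteq> span B"
    and "\<And>S T v. S \<in> \<T> \<Longrightarrow> T \<in> \<T> \<Longrightarrow> v \<in> span B \<Longrightarrow> S (T v) = T (S v)"
  shows "\<exists>v\<in>span B. v \<noteq> 0 \<and> (\<forall>T\<in>\<T>. \<exists>k. T v = k *\<^sub>R v)"
  using assms(1-3,5,6)
proof (induction "card B" arbitrary: B rule: less_induct)
  case less
  show ?case
  proof (cases "\<forall>T\<in>\<T>. \<exists>k. \<forall>v\<in>span B. T v = k *\<^sub>R v")
    case True
    obtain b where "b \<in> B" using less.prems(3) by fastforce
    then have "b \<in> span B" "b \<noteq> 0"
      using less.prems(2) real_vector.dependent_zero span_base by blast+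
    then show ?thesis using True by blast
  next
    case False
    then obtain T where T: "T \<in> \<T>" "\<And>k. \<exists>v\<in>span B. T v \<noteq> k *\<^sub>R v" by blast
    have "T ` B \<subseteq> span B" using less.prems(4)[OF T(1)] span_superset by blast
    then obtain q :: "real poly" where q: "Polynomial.degree q = card B"
      "\<And>k. poly q k = 0 \<longleftrightarrow> (\<exists>v\<in>span B. v \<noteq> 0 \<and> T v = k *\<^sub>R v)"
      using eigenvalue_poly_on_span[OF less.prems(1,2) assms(4)[OF T(1)]] by blast
    obtain k where "poly q k = 0" using odd_degree_real_root less.prems(3) q(1) by metis
    then obtain v where v: "v \<in> span B" "v \<noteq> 0" "T v = k *\<^sub>R v" using q by blast
    define T' where "T' x = T x - k *\<^sub>R x" for x
    have linT': "linear T'"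
      unfolding T'_def using assms(4)[OF T(1)] by (intro linear_compose_sub linear_scale_self)
    have T'span: "T' x \<in> span B" if "x \<in> span B" for x
      using less.prems(4)[OF T(1)] that by (auto simp: T'_def intro!: span_diff span_scale)
    have comm: "S (T' x) = T' (S x)" if S: "S \<in> \<T>" and x: "x \<in> span B" for S x
      using less.prems(5)[OF S T(1) x] assms(4)[OF S]
      by (simp add: T'_def linear_diff linear_scale)
    obtain K C where K: "finite K" "independent K" "span K = {v \<in> span B. T' v = 0}"
      and C: "finite C" "independent C" "span C = T' ` span B" "card K + card C = card B"
      using rank_nullity_on_span[OF less.prems(1,2) linT'] by metis
    \<comment> \<open>The eigenvector makes the kernel nonzero, and \<open>T\<close> not being
      \<open>k\<close> times the identity makes the image nonzero. As the two dimensions add up to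
      \<open>card B\<close>, both are smaller.\<close>
    have "v \<in> span K" using K v by (simp add: T'_def)
    then have "K \<noteq> {}" using v by auto
    then have K0: "card K > 0" using K by (simp add: card_gt_0_iff)
    obtain w where "w \<in> span B" "T w \<noteq> k *\<^sub>R w" using T(2) by blast
    then have "T' w \<in> span C" "T' w \<noteq> 0" using C by (auto simp: T'_def)
    then have "C \<noteq> {}" by auto
    then have C0: "card C > 0" using C by (simp add: card_gt_0_iff)
    have sub: "span K \<subseteq> span B" "span C \<subseteq> span B" using K C T'span by auto
    consider "odd (card K)" | "odd (card C)" using C(4) less.prems(3) by (metis even_add)
    then show ?thesis
    proof cases
      case 1
      have "S ` span K \<subseteq> span K" if "S \<in> \<T>" for S
        using less.prems(4)[OF that] comm[OF that] linear_0[OF assms(4)[OF that]] K(3)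
        by fastforce
      moreover have "S (T v) = T (S v)" if "S \<in> \<T>" "T \<in> \<T>" "v \<in> span K" for S T v
        using less.prems(5)[OF that(1,2)] that(3) sub by blast
      moreover have "card K < card B" using C0 C(4) by linarith
      ultimately have "\<exists>v\<in>span K. v \<noteq> 0 \<and> (\<forall>T\<in>\<T>. \<exists>k. T v = k *\<^sub>R v)"
        using less.hyps[OF _ K(1,2) 1] by blast
      then show ?thesis using sub by blast
    next
      case 2
      have "S ` span C \<subseteq> span C" if "S \<in> \<T>" for S
        using less.prems(4)[OF that] comm[OF that] C(3) by fastforce
      moreover have "S (T v) = T (S v)" if "S \<in> \<T>" "T \<in> \<T>" "v \<in> span C" for S T v
        using less.prems(5)[OF that(1,2)] that(3) sub by blast
      moreover have "card C < card B" using K0 C(4) by linarith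
      ultimately have "\<exists>v\<in>span C. v \<noteq> 0 \<and> (\<forall>T\<in>\<T>. \<exists>k. T v = k *\<^sub>R v)"
        using less.hyps[OF _ C(1,2) 2] by blast
      then show ?thesis using sub by blast
    qed
  qed
qed

section \<open>Real polynomials\<close>

text \<open>For Borsuk-Ulam polynomials are elements of a type and not of a carrier: products are
  then type class operations, and with this instance \<open>span\<close>, \<open>independent\<close>
  and \<open>linear\<close> apply to them. \<open>eval_at_eq_eval_poly\<close> connects them with
  \<open>real_poly\<close>.\<close>

instantiation poly_mapping :: (type, real_vector) real_vector
begin

lift_definition scaleR_poly_mapping :: "real \<Rightarrow> ('a \<Rightarrow>\<^sub>0 'b) \<Rightarrow> 'a \<Rightarrow>\<^sub>0 'b"
  is "\<lambda>c f k. c *\<^sub>R f k"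
proof -
  fix c :: real and f :: "'a \<Rightarrow> 'b"
  assume "finite {k. f k \<noteq> 0}"
  then show "finite {k. c *\<^sub>R f k \<noteq> 0}" by (rule rev_finite_subset) auto
qed

instance
  by standard (transfer; simp add: scaleR_add_right scaleR_add_left)+

end

lemma lookup_scaleR: "Poly_Mapping.lookup (c *\<^sub>R p) k = c *\<^sub>R Poly_Mapping.lookup p k"
  by transfer simp

lemma keys_scaleR: "Poly_Mapping.keys (c *\<^sub>R p) \<subseteq> Poly_Mapping.keys p"
  by (auto simp: in_keys_iff lookup_scaleR)

lemma scaleR_mult_poly_mapping:
  fixes p q :: "'a::comm_monoid_add \<Rightarrow>\<^sub>0 real"
  shows "(c *\<^sub>R p) * q = c *\<^sub>R (p * q)" "p * (c *\<^sub>R q) = c *\<^sub>R (p * q)"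
proof -
  \<comment> \<open>Scaling is multiplication by a constant polynomial, so both rules reduce to
    associativity and commutativity.\<close>
  have s: "c *\<^sub>R r = Poly_Mapping.single 0 c * r" for r :: "'a \<Rightarrow>\<^sub>0 real"
    by (rule poly_mapping_eqI) (simp add: lookup_scaleR mult_map_scale_conv_mult[symmetric] map.rep_eq when_def)
  show "(c *\<^sub>R p) * q = c *\<^sub>R (p * q)" "p * (c *\<^sub>R q) = c *\<^sub>R (p * q)"
    by (simp_all add: s mult_ac)
qed

section \<open>Linear extension from monomials\<close>

abbreviation mon :: "'a \<Rightarrow> 'a \<Rightarrow>\<^sub>0 real" where "mon w \<equiv> Poly_Mapping.single w 1"

definition lin_ext :: "('a \<Rightarrow> 'b::real_vector) \<Rightarrow> ('a \<Rightarrow>\<^sub>0 real) \<Rightarrow> 'b"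
  where "lin_ext h p = (\<Sum>w\<in>Poly_Mapping.keys p. Poly_Mapping.lookup p w *\<^sub>R h w)"

lemma lin_ext_superset:
  assumes "finite A" "Poly_Mapping.keys p \<subseteq> A"
  shows "lin_ext h p = (\<Sum>w\<in>A. Poly_Mapping.lookup p w *\<^sub>R h w)"
  unfolding lin_ext_def using assms by (intro sum.mono_neutral_left) (auto simp: in_keys_iff)

lemma linear_lin_ext: "linear (lin_ext h)"
proof (rule linearI)
  fix p q :: "'a \<Rightarrow>\<^sub>0 real"
  have *: "lin_ext h r = (\<Sum>w\<in>Poly_Mapping.keys p \<union> Poly_Mapping.keys q. Poly_Mapping.lookup r w *\<^sub>R h w)" if "Poly_Mapping.keys r \<subseteq> Poly_Mapping.keys p \<union> Poly_Mapping.keys q" for r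
    using that by (intro lin_ext_superset) auto
  have "Poly_Mapping.keys (p + q) \<subseteq> Poly_Mapping.keys p \<union> Poly_Mapping.keys q" by (simp add: keys_add)
  then show "lin_ext h (p + q) = lin_ext h p + lin_ext h q"
    by (simp add: * lookup_add scaleR_add_left sum.distrib)
next
  fix c :: real and p :: "'a \<Rightarrow>\<^sub>0 real"
  have "lin_ext h (c *\<^sub>R p) = (\<Sum>w\<in>Poly_Mapping.keys p. Poly_Mapping.lookup (c *\<^sub>R p) w *\<^sub>R h w)"
    by (intro lin_ext_superset keys_scaleR) simp
  then show "lin_ext h (c *\<^sub>R p) = c *\<^sub>R lin_ext h p"
    by (simp add: lin_ext_def lookup_scaleR scaleR_sum_right)
qed

lemma lin_ext_mon [simp]: "lin_ext h (mon w) = h w"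
  by (simp add: lin_ext_def)

lemma sum_mon: "(\<Sum>w\<in>Poly_Mapping.keys p. Poly_Mapping.lookup p w *\<^sub>R mon w) = p"
  by (rule poly_mapping_eqI)
    (auto simp: lookup_sum lookup_scaleR lookup_single when_def sum.If_cases in_keys_iff
      if_distrib[of "(*) _"] cong: if_cong)

lemma linear_eq_on_mon:
  assumes "linear f" "linear g" "\<And>w. w \<in> Poly_Mapping.keys p \<Longrightarrow> f (mon w) = g (mon w)"
  shows "f p = g p"
proof -
  have "f (\<Sum>w\<in>Poly_Mapping.keys p. Poly_Mapping.lookup p w *\<^sub>R mon w) = g (\<Sum>w\<in>Poly_Mapping.keys p. Poly_Mapping.lookup p w *\<^sub>R mon w)"
    using assms by (simp add: linear_sum linear_scale)
  then show ?thesis by (simp add: sum_mon)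
qed

lemma subspace_linear_on_mon:
  assumes "linear f" "subspace S" "\<And>w. w \<in> Poly_Mapping.keys p \<Longrightarrow> f (mon w) \<in> S"
  shows "f p \<in> S"
proof -
  have "f (\<Sum>w\<in>Poly_Mapping.keys p. Poly_Mapping.lookup p w *\<^sub>R mon w) \<in> S"
    using assms by (simp add: linear_sum linear_scale subspace_sum subspace_scale)
  then show ?thesis by (simp add: sum_mon)
qed

lemma inj_mon: "inj_on (mon :: 'a \<Rightarrow> 'a \<Rightarrow>\<^sub>0 real) W"
proof (rule inj_onI)
  fix v w :: 'a assume "mon v = mon w"
  then have "Poly_Mapping.keys (mon v) = Poly_Mapping.keys (mon w)" by (rule arg_cong)
  then show "v = w" by simp
qed

text \<open>The coefficient at \<open>w\<close> of a linear relation isolates the scalar in front of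
  \<open>mon w\<close>.\<close>

lemma independent_mon: "independent (mon ` W)"
proof
  assume "dependent (mon ` W)"
  then obtain t u v where t: "finite t" "t \<subseteq> mon ` W" "v \<in> t" "u v \<noteq> 0" "(\<Sum>v\<in>t. u v *\<^sub>R v) = 0"
    unfolding real_vector.dependent_explicit by blast
  then obtain w where w: "v = mon w" by blast
  have "Poly_Mapping.lookup x w = (if x = v then 1 else 0)" if x: "x \<in> t" for x
  proof -
    obtain w' where w': "x = mon w'" using x t(2) by blast
    show ?thesis unfolding w w' using inj_mon[of UNIV] by (auto simp: lookup_single when_def dest: injD)
  qed
  then have "(\<Sum>x\<in>t. u x * Poly_Mapping.lookup x w) = (\<Sum>x\<in>t. if x = v then u v else 0)"
    by (intro sum.cong) auto
  also have "\<dots> = u v" using t by simp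
  finally have "Poly_Mapping.lookup (\<Sum>v\<in>t. u v *\<^sub>R v) w = u v"
    by (simp add: lookup_sum lookup_scaleR)
  then show False using t by simp
qed

lemma subspace_keys: "subspace {p :: 'a \<Rightarrow>\<^sub>0 real. Poly_Mapping.keys p \<subseteq> W}"
  unfolding subspace_def
proof (intro conjI ballI allI)
  fix p q :: "'a \<Rightarrow>\<^sub>0 real" and c :: real
  assume p: "p \<in> {p. Poly_Mapping.keys p \<subseteq> W}"
  then show "c *\<^sub>R p \<in> {p. Poly_Mapping.keys p \<subseteq> W}"
    using keys_scaleR[of c p] by auto
  assume "q \<in> {p. Poly_Mapping.keys p \<subseteq> W}"
  then show "p + q \<in> {p. Poly_Mapping.keys p \<subseteq> W}"
    using p keys_add[of p q] by auto
qed simp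

lemma span_mon: "span (mon ` W) = {p. Poly_Mapping.keys p \<subseteq> W}"
proof
  show "span (mon ` W) \<subseteq> {p. Poly_Mapping.keys p \<subseteq> W}"
    by (rule span_minimal) (auto simp: subspace_keys)
  show "{p. Poly_Mapping.keys p \<subseteq> W} \<subseteq> span (mon ` W)"
  proof
    fix p assume "p \<in> {p :: 'a \<Rightarrow>\<^sub>0 real. Poly_Mapping.keys p \<subseteq> W}"
    then have "(\<Sum>w\<in>Poly_Mapping.keys p. Poly_Mapping.lookup p w *\<^sub>R mon w) \<in> span (mon ` W)"
      by (intro span_sum span_scale span_base) auto
    then show "p \<in> span (mon ` W)" by (simp add: sum_mon)
  qed
qed

lemma finite_multisets_of_bounded_size:
  assumes "finite A"
  shows "finite {w. set_mset w \<subseteq> A \<and> size w \<le> E}"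
proof (induction E)
  case 0
  have "{w. set_mset w \<subseteq> A \<and> size w \<le> 0} \<subseteq> {{#}}" by auto
  then show ?case using finite_subset by blast
next
  case (Suc E)
  have "{w. set_mset w \<subseteq> A \<and> size w \<le> Suc E}
    \<subseteq> {w. set_mset w \<subseteq> A \<and> size w \<le> E} \<union> (\<lambda>(x, w). add_mset x w) ` (A \<times> {w. set_mset w \<subseteq> A \<and> size w \<le> E})"
  proof
    fix w assume w: "w \<in> {w. set_mset w \<subseteq> A \<and> size w \<le> Suc E}"
    show "w \<in> {w. set_mset w \<subseteq> A \<and> size w \<le> E} \<union> (\<lambda>(x, w). add_mset x w) ` (A \<times> {w. set_mset w \<subseteq> A \<and> size w \<le> E})"
    proof (cases w)
      case (add x v)
      then have "(x, v) \<in> A \<times> {w. set_mset w \<subseteq> A \<and> size w \<le> E}" using w by auto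
      then show ?thesis using add by force
    qed (use w in auto)
  qed
  then show ?case using Suc assms by (meson finite_SigmaI finite_UnI finite_imageI finite_subset)
qed

section \<open>Evaluation at real points\<close>

definition eval_poly :: "('v \<Rightarrow> real) \<Rightarrow> ('v multiset \<Rightarrow>\<^sub>0 real) \<Rightarrow> real"
  where "eval_poly y = lin_ext (\<lambda>w. \<Prod>i\<in>#w. y i)"

lemma linear_eval_poly: "linear (eval_poly y)"
  unfolding eval_poly_def by (rule linear_lin_ext)

lemma eval_poly_mon [simp]: "eval_poly y (mon w) = (\<Prod>i\<in>#w. y i)"
  by (simp add: eval_poly_def)

lemma linear_mult_left: "linear (\<lambda>q. p * q)" for p :: "'a::comm_monoid_add \<Rightarrow>\<^sub>0 real"
  by (rule linearI) (simp_all add: distrib_left scaleR_mult_poly_mapping)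

lemma linear_mult_right: "linear (\<lambda>q. q * p)" for p :: "'a::comm_monoid_add \<Rightarrow>\<^sub>0 real"
  by (rule linearI) (simp_all add: distrib_right scaleR_mult_poly_mapping)

lemma keys_multE:
  assumes "w \<in> Poly_Mapping.keys (p * q)"
  obtains a b where "a \<in> Poly_Mapping.keys p" "b \<in> Poly_Mapping.keys q" "w = a + b"
  using keys_mult[of p q] assms by blast

lemma mon_mult: "mon v * mon w = mon (v + w)"
  by (simp add: mult_single)

lemma eval_poly_mult [simp]: "eval_poly y (p * q) = eval_poly y p * eval_poly y q"
proof -
  have 1: "eval_poly y (mon v * q) = eval_poly y (mon v) * eval_poly y q" for v
  proof (rule linear_eq_on_mon)
    show "linear (\<lambda>q. eval_poly y (mon v * q))"
      using linear_compose[OF linear_mult_left linear_eval_poly] by (simp add: o_def)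
    show "linear (\<lambda>q. eval_poly y (mon v) * eval_poly y q)"
      by (rule linearI) (simp_all add: linear_add[OF linear_eval_poly] linear_scale[OF linear_eval_poly] distrib_left)
  qed (simp add: mon_mult)
  show ?thesis
  proof (rule linear_eq_on_mon[where p = p])
    show "linear (\<lambda>p. eval_poly y (p * q))"
      using linear_compose[OF linear_mult_right linear_eval_poly] by (simp add: o_def)
    show "linear (\<lambda>p. eval_poly y p * eval_poly y q)"
      by (rule linearI) (simp_all add: linear_add[OF linear_eval_poly] linear_scale[OF linear_eval_poly] distrib_right)
  qed (rule 1)
qed

lemma eval_poly_one [simp]: "eval_poly y 1 = 1"
  using eval_poly_mon[of y "{#}"] by (simp flip: single_one)

lemma eval_poly_power [simp]: "eval_poly y (p ^ k) = eval_poly y p ^ k"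
  by (induction k) simp_all

section \<open>Perturbed systems of odd degree\<close>

text \<open>
  \<open>L i s\<close> replaces a factor \<open>y\<^sub>j\<^sup>D\<close>, with the least possible \<open>j \<le> i\<close>, by \<open>F s j\<close>. It respects the degree
  filtration and is a perturbation of the identity, hence bijective unless \<open>- 1 / s\<close> is one of countably
  many eigenvalues.
\<close>

locale odd_system =
  fixes n D :: nat and g :: "nat \<Rightarrow> nat multiset \<Rightarrow>\<^sub>0 real"
  assumes odd_D: "odd D"
    and keys_g: "\<And>j w. j \<in> {1..n} \<Longrightarrow> w \<in> Poly_Mapping.keys (g j) \<Longrightarrow> set_mset w \<subseteq> {1..n} \<and> size w \<le> D"
begin

definition monomials :: "nat multiset set" where "monomials = {w. set_mset w \<subseteq> {1..n}}"

definition monos_le :: "nat \<Rightarrow> nat multiset set"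
  where "monos_le E = {w. set_mset w \<subseteq> {1..n} \<and> size w \<le> E}"

definition polys :: "(nat multiset \<Rightarrow>\<^sub>0 real) set" where "polys = {p. Poly_Mapping.keys p \<subseteq> monomials}"

text \<open>Divisibility by one of the leading monomials \<open>y_1^D, ..., y_i^D\<close> of the
  first \<open>i\<close> equations.\<close>

definition divisible :: "nat \<Rightarrow> nat multiset \<Rightarrow> bool"
  where "divisible i w \<longleftrightarrow> (\<exists>j\<in>{1..i}. D \<le> count w j)"

text \<open>Taking the least index makes the choice independent of the stage \<open>i\<close>: a
  monomial that is divisible at stage \<open>i\<close> is rewritten in the same way at all later
  stages.\<close>

definition divisor :: "nat multiset \<Rightarrow> nat"
  where "divisor w = (LEAST j. 1 \<le> j \<and> D \<le> count w j)"

definition cofactor :: "nat multiset \<Rightarrow> nat multiset"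
  where "cofactor w = w - replicate_mset D (divisor w)"

definition pert :: "nat \<Rightarrow> nat multiset \<Rightarrow> nat multiset \<Rightarrow>\<^sub>0 real"
  where "pert i w = (if divisible i w then g (divisor w) * mon (cofactor w) else 0)"

definition L :: "nat \<Rightarrow> real \<Rightarrow> (nat multiset \<Rightarrow>\<^sub>0 real) \<Rightarrow> nat multiset \<Rightarrow>\<^sub>0 real"
  where "L i s = lin_ext (\<lambda>w. mon w + s *\<^sub>R pert i w)"

definition F :: "real \<Rightarrow> nat \<Rightarrow> nat multiset \<Rightarrow>\<^sub>0 real"
  where "F s j = mon (replicate_mset D j) + s *\<^sub>R g j"

definition red :: "nat \<Rightarrow> (nat multiset \<Rightarrow>\<^sub>0 real) set"
  where "red i = {p. Poly_Mapping.keys p \<subseteq> {w \<in> monomials. \<not> divisible i w}}"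

definition unred :: "nat \<Rightarrow> (nat multiset \<Rightarrow>\<^sub>0 real) set"
  where "unred i = {p. Poly_Mapping.keys p \<subseteq> {w \<in> monomials. divisible i w}}"

text \<open>The ideal generated by the first \<open>i\<close> equations in the polynomials in
  \<open>y_1, ..., y_n\<close>.\<close>

definition I :: "real \<Rightarrow> nat \<Rightarrow> (nat multiset \<Rightarrow>\<^sub>0 real) set"
  where "I s i = {p. \<exists>h. (\<forall>j\<in>{1..i}. h j \<in> polys) \<and> p = (\<Sum>j\<in>{1..i}. F s j * h j)}"

text \<open>Injectivity is required at every stage, since the analysis of the ideal adds the
  equations one at a time.\<close>

definition good :: "real \<Rightarrow> bool"
  where "good s \<longleftrightarrow> (\<forall>i\<le>n. \<forall>p\<in>polys. L i s p = 0 \<longrightarrow> p = 0)"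

lemma divisor_in:
  assumes "divisible i w"
  shows "divisor w \<in> {1..i}" "w = replicate_mset D (divisor w) + cofactor w"
proof -
  obtain j where j: "1 \<le> j" "j \<le> i" "D \<le> count w j" using assms by (auto simp: divisible_def)
  have 1: "1 \<le> divisor w \<and> D \<le> count w (divisor w)"
    unfolding divisor_def using j LeastI[of "\<lambda>j. 1 \<le> j \<and> D \<le> count w j" j] by blast
  moreover have "divisor w \<le> j" unfolding divisor_def by (rule Least_le) (use j in auto)
  ultimately show "divisor w \<in> {1..i}" using j by auto
  have "replicate_mset D (divisor w) \<subseteq># w"
    using 1 by (simp add: count_le_replicate_mset_subset_eq)
  then show "w = replicate_mset D (divisor w) + cofactor w"
    unfolding cofactor_def by (rule subset_mset.add_diff_inverse[symmetric])
qed

lemma cofactor_monos: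
  assumes "divisible i w" "w \<in> monomials"
  shows "cofactor w \<in> monomials" "size w = D + size (cofactor w)"
proof -
  note w = divisor_in(2)[OF assms(1)]
  have "set_mset (cofactor w) \<subseteq> set_mset w" by (subst (2) w) auto
  then show "cofactor w \<in> monomials" using assms by (auto simp: monomials_def)
  show "size w = D + size (cofactor w)" by (subst w) simp
qed

lemma subspace_polys: "subspace polys"
  unfolding polys_def by (rule subspace_keys)

lemma polys_mult:
  assumes "p \<in> polys" "q \<in> polys"
  shows "p * q \<in> polys"
  unfolding polys_def
proof (intro CollectI subsetI)
  fix w assume "w \<in> Poly_Mapping.keys (p * q)"
  then obtain a b where ab: "a \<in> Poly_Mapping.keys p" "b \<in> Poly_Mapping.keys q" "w = a + b"
    by (rule keys_multE)
  then have "a \<in> monomials" "b \<in> monomials" using assms by (auto simp: polys_def)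
  then show "w \<in> monomials" using ab by (auto simp: monomials_def)
qed

lemma g_polys: "j \<in> {1..n} \<Longrightarrow> g j \<in> polys"
  using keys_g by (auto simp: polys_def monomials_def)

lemma mon_polys: "w \<in> monomials \<Longrightarrow> mon w \<in> polys"
  by (simp add: polys_def)

lemma F_polys: "j \<in> {1..n} \<Longrightarrow> F s j \<in> polys"
  unfolding F_def
  by (intro subspace_add[OF subspace_polys] subspace_scale[OF subspace_polys] g_polys mon_polys)
    (auto simp: monomials_def)

lemma linear_L: "linear (L i s)"
  unfolding L_def by (rule linear_lin_ext)

text \<open>As \<open>w\<close> is \<open>y_j^D\<close> times its cofactor, adding the perturbation
  completes the leading monomial to the whole equation. This is how \<open>L\<close> maps unreduced
  polynomials into the ideal.\<close>

lemma L_mon_divisible: "divisible i w \<Longrightarrow> L i s (mon w) = F s (divisor w) * mon (cofactor w)"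
  using divisor_in(2)[of i w]
  by (simp add: L_def pert_def F_def distrib_right scaleR_mult_poly_mapping mon_mult)

lemma L_mon_not_divisible: "\<not> divisible i w \<Longrightarrow> L i s (mon w) = mon w"
  by (simp add: L_def pert_def)

lemma L_red: "p \<in> red i \<Longrightarrow> L i s p = p"
  by (rule linear_eq_on_mon[where f = "L i s" and g = "\<lambda>p. p"])
    (auto simp: linear_L linear_ident red_def L_mon_not_divisible)

lemma L_decomp: "L i s p = p + s *\<^sub>R lin_ext (pert i) p"
proof (rule linear_eq_on_mon[where f = "L i s" and p = p])
  show "linear (\<lambda>p. p + s *\<^sub>R lin_ext (pert i) p)"
    by (rule linearI) (simp_all add: linear_add[OF linear_lin_ext] linear_scale[OF linear_lin_ext] algebra_simps)
qed (simp_all add: linear_L L_def linear_lin_ext)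

section \<open>The degree filtration and the exceptional parameters\<close>

lemma finite_monos_le: "finite (monos_le E)"
  unfolding monos_le_def by (rule finite_multisets_of_bounded_size) simp

lemma polys_bounded: "p \<in> polys \<Longrightarrow> \<exists>E. Poly_Mapping.keys p \<subseteq> monos_le E"
  by (intro exI[of _ "Max (size ` Poly_Mapping.keys p)"]) (auto simp: polys_def monos_le_def monomials_def)

text \<open>The degree of \<open>g_j\<close> is at most \<open>D\<close>, so trading
  \<open>y_j^D\<close> for \<open>g_j\<close> does not raise the degree. The finite-dimensional
  spaces of bounded degree are therefore invariant.\<close>

lemma pert_keys:
  assumes "i \<le> n" "Poly_Mapping.keys p \<subseteq> monos_le E"
  shows "Poly_Mapping.keys (lin_ext (pert i) p) \<subseteq> monos_le E"
proof -
  have "lin_ext (pert i) p \<in> {p. Poly_Mapping.keys p \<subseteq> monos_le E}"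
  proof (rule subspace_linear_on_mon[OF linear_lin_ext subspace_keys])
    fix w assume "w \<in> Poly_Mapping.keys p"
    then have w: "w \<in> monomials" "size w \<le> E" using assms by (auto simp: monomials_def monos_le_def)
    have "Poly_Mapping.keys (pert i w) \<subseteq> monos_le E"
    proof (cases "divisible i w")
      case True
      have "divisor w \<in> {1..n}" using divisor_in(1)[OF True] assms(1) by auto
      note d = this
      show ?thesis
      proof
        fix u assume "u \<in> Poly_Mapping.keys (pert i w)"
        then obtain a where a: "a \<in> Poly_Mapping.keys (g (divisor w))" "u = a + cofactor w"
          using True by (auto simp: pert_def elim!: keys_multE)
        then show "u \<in> monos_le E"
          using keys_g[OF d a(1)] cofactor_monos[OF True w(1)] w(2)
          by (auto simp: monos_le_def monomials_def)
      qed
    qed (simp add: pert_def)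
    then show "lin_ext (pert i) (mon w) \<in> {p. Poly_Mapping.keys p \<subseteq> monos_le E}" by simp
  qed
  then show ?thesis by simp
qed

text \<open>For each of the countably many pairs of a stage \<open>i\<close> and a degree bound
  \<open>E\<close>, the perturbation acts on a finite-dimensional space and has finitely many
  eigenvalues there. Every polynomial lies in one of these spaces.\<close>

lemma countable_bad: "countable {s. s \<noteq> 0 \<and> \<not> good s}"
proof -
  define Ev where "Ev i E = {k. \<exists>v\<in>span (mon ` monos_le E). v \<noteq> 0 \<and> lin_ext (pert i) v = k *\<^sub>R v}" for i E
  have fin: "finite (Ev i E)" if i: "i \<le> n" for i E
  proof -
    have "Poly_Mapping.keys (lin_ext (pert i) (mon w)) \<subseteq> monos_le E" if w: "w \<in> monos_le E" for w
    proof (rule pert_keys[OF i])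
      show "Poly_Mapping.keys (mon w) \<subseteq> monos_le E" using w by simp
    qed
    then have "lin_ext (pert i) ` mon ` monos_le E \<subseteq> span (mon ` monos_le E)"
      unfolding span_mon by blast
    then show ?thesis
      unfolding Ev_def
      by (rule finite_eigenvalues_on_span[OF finite_imageI[OF finite_monos_le] independent_mon linear_lin_ext])
  qed
  have "{s. s \<noteq> 0 \<and> \<not> good s} \<subseteq> (\<Union>i\<in>{..n}. \<Union>E. (\<lambda>k. - 1 / k) ` Ev i E)"
  proof
    fix s assume "s \<in> {s. s \<noteq> 0 \<and> \<not> good s}"
    then obtain i p where s: "s \<noteq> 0" and i: "i \<le> n" and p: "p \<in> polys" "L i s p = 0" "p \<noteq> 0"
      by (auto simp: good_def)
    obtain E where E: "Poly_Mapping.keys p \<subseteq> monos_le E" using polys_bounded p by blast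
    have "s *\<^sub>R lin_ext (pert i) p = - p" using p(2) L_decomp[of i s p] by (simp add: add_eq_0_iff)
    then have "(1 / s) *\<^sub>R s *\<^sub>R lin_ext (pert i) p = (1 / s) *\<^sub>R (- p)" by (rule arg_cong)
    then have "lin_ext (pert i) p = (- 1 / s) *\<^sub>R p" using s by simp
    then have "- 1 / s \<in> Ev i E" using p E by (auto simp: Ev_def span_mon)
    moreover have "s = - 1 / (- 1 / s)" using s by simp
    ultimately show "s \<in> (\<Union>i\<in>{..n}. \<Union>E. (\<lambda>k. - 1 / k) ` Ev i E)" using i by blast
  qed
  moreover have "countable (\<Union>i\<in>{..n}. \<Union>E. (\<lambda>k. - 1 / k) ` Ev i E)"
    using fin by (intro countable_UN countable_image) (auto intro: countable_finite)
  ultimately show ?thesis using countable_subset by blast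
qed

text \<open>Injectivity gives surjectivity on each of the finite-dimensional spaces of bounded
  degree, which \<open>L i s\<close> preserves.\<close>

lemma L_surj:
  assumes "good s" "i \<le> n" "p \<in> polys"
  shows "\<exists>q\<in>polys. L i s q = p"
proof -
  obtain E where E: "Poly_Mapping.keys p \<subseteq> monos_le E" using polys_bounded assms by blast
  have sub: "{p. Poly_Mapping.keys p \<subseteq> monos_le E} \<subseteq> polys" by (auto simp: polys_def monomials_def monos_le_def)
  have "L i s ` span (mon ` monos_le E) = span (mon ` monos_le E)"
  proof (rule injective_imp_surjective_on_span)
    show "L i s ` span (mon ` monos_le E) \<subseteq> span (mon ` monos_le E)"
    proof (rule image_subsetI)
      fix q assume "q \<in> span (mon ` monos_le E)"
      then have q: "Poly_Mapping.keys q \<subseteq> monos_le E" by (simp add: span_mon)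
      then have "lin_ext (pert i) q \<in> span (mon ` monos_le E)"
        unfolding span_mon using pert_keys[OF assms(2)] by blast
      then show "L i s q \<in> span (mon ` monos_le E)"
        unfolding L_decomp using q by (intro span_add span_scale) (auto simp: span_mon)
    qed
    show "v = 0" if "v \<in> span (mon ` monos_le E)" "L i s v = 0" for v
      using that assms sub by (auto simp: good_def span_mon)
  qed (simp_all add: finite_monos_le independent_mon linear_L)
  then have "p \<in> L i s ` span (mon ` monos_le E)" using E by (simp add: span_mon)
  then show ?thesis using sub unfolding span_mon by blast
qed

section \<open>Reduced polynomials and the ideal of the equations\<close>

lemma subspace_I: "subspace (I s i)"
  unfolding subspace_def
proof (intro conjI ballI allI)
  show "0 \<in> I s i"
    unfolding I_def using subspace_0[OF subspace_polys] by (auto intro!: exI[of _ "\<lambda>_. 0"])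
next
  fix p q assume "p \<in> I s i" "q \<in> I s i"
  then obtain h k where hk: "\<forall>j\<in>{1..i}. h j \<in> polys" "p = (\<Sum>j\<in>{1..i}. F s j * h j)"
    "\<forall>j\<in>{1..i}. k j \<in> polys" "q = (\<Sum>j\<in>{1..i}. F s j * k j)" by (auto simp: I_def)
  then show "p + q \<in> I s i"
    unfolding I_def using subspace_add[OF subspace_polys]
    by (auto intro!: exI[of _ "\<lambda>j. h j + k j"] simp: distrib_left sum.distrib)
next
  fix c p assume "p \<in> I s i"
  then obtain h where h: "\<forall>j\<in>{1..i}. h j \<in> polys" "p = (\<Sum>j\<in>{1..i}. F s j * h j)" by (auto simp: I_def)
  then show "c *\<^sub>R p \<in> I s i"
    unfolding I_def using subspace_scale[OF subspace_polys]
    by (auto intro!: exI[of _ "\<lambda>j. c *\<^sub>R h j"] simp: scaleR_mult_poly_mapping scaleR_sum_right)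
qed

lemma I_mult:
  assumes "p \<in> I s i" "q \<in> polys"
  shows "q * p \<in> I s i"
proof -
  obtain h where h: "\<forall>j\<in>{1..i}. h j \<in> polys" "p = (\<Sum>j\<in>{1..i}. F s j * h j)"
    using assms by (auto simp: I_def)
  then have "q * p = (\<Sum>j\<in>{1..i}. F s j * (q * h j))" by (simp add: sum_distrib_left mult_ac)
  then show ?thesis unfolding I_def using polys_mult assms h by (intro CollectI exI[of _ "\<lambda>j. q * h j"]) auto
qed

lemma F_mult_in_I:
  assumes "j \<in> {1..i}" "q \<in> polys"
  shows "F s j * q \<in> I s i"
proof -
  have "(\<Sum>k\<in>{1..i}. F s k * (if k = j then q else 0)) = (\<Sum>k\<in>{1..i}. if k = j then F s j * q else 0)"
    by (intro sum.cong) auto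
  also have "\<dots> = F s j * q" using assms by simp
  finally show ?thesis
    unfolding I_def using assms subspace_0[OF subspace_polys]
    by (intro CollectI exI[of _ "\<lambda>k. if k = j then q else 0"]) auto
qed

lemma L_unred_in_I:
  assumes "p \<in> unred i"
  shows "L i s p \<in> I s i"
proof (rule subspace_linear_on_mon[OF linear_L subspace_I])
  fix w assume "w \<in> Poly_Mapping.keys p"
  then have w: "w \<in> monomials" "divisible i w" using assms by (auto simp: unred_def)
  then show "L i s (mon w) \<in> I s i"
    unfolding L_mon_divisible[OF w(2)]
    by (intro F_mult_in_I divisor_in(1) mon_polys cofactor_monos)
qed

lemma split_red:
  assumes "p \<in> polys"
  shows "\<exists>a\<in>red i. \<exists>b\<in>unred i. p = a + b"
proof -
  define a where "a = (\<Sum>w\<in>{w\<in>Poly_Mapping.keys p. \<not> divisible i w}. Poly_Mapping.lookup p w *\<^sub>R mon w)"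
  define b where "b = (\<Sum>w\<in>{w\<in>Poly_Mapping.keys p. divisible i w}. Poly_Mapping.lookup p w *\<^sub>R mon w)"
  have "a \<in> red i" unfolding a_def red_def using assms
    by (intro subspace_sum subspace_keys subspace_scale) (auto simp: polys_def)
  moreover have "b \<in> unred i" unfolding b_def unred_def using assms
    by (intro subspace_sum subspace_keys subspace_scale) (auto simp: polys_def)
  moreover have "p = a + b"
  proof -
    have "{w\<in>Poly_Mapping.keys p. \<not> divisible i w} \<union> {w\<in>Poly_Mapping.keys p. divisible i w} = Poly_Mapping.keys p" by auto
    then have "a + b = (\<Sum>w\<in>Poly_Mapping.keys p. Poly_Mapping.lookup p w *\<^sub>R mon w)"
      unfolding a_def b_def by (subst sum.union_disjoint[symmetric]) auto
    then show ?thesis by (simp add: sum_mon)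
  qed
  ultimately show ?thesis by blast
qed

text \<open>Write \<open>p\<close> as the image under \<open>L\<close> of a reduced plus an
  unreduced polynomial: \<open>L\<close> fixes the first and sends the second into the
  ideal.\<close>

lemma polys_eq_red_plus_I:
  assumes "good s" "i \<le> n" "p \<in> polys"
  shows "\<exists>a\<in>red i. p - a \<in> I s i"
proof -
  obtain q where q: "q \<in> polys" "L i s q = p" using L_surj assms by blast
  obtain a b where ab: "a \<in> red i" "b \<in> unred i" "q = a + b" using split_red q by blast
  have "p = a + L i s b" using q ab L_red[OF ab(1)] by (simp add: linear_add[OF linear_L])
  then show ?thesis using ab L_unred_in_I by (intro bexI[of _ a]) auto
qed

text \<open>
  The products of \<open>F s (i + 1)\<close> with elements of \<open>I s i\<close> lie in \<open>I s i\<close> already, so only the products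
  with reduced polynomials are new.
\<close>

lemma I_subset_L_unred:
  assumes "good s" "i \<le> n" "p \<in> I s i"
  shows "\<exists>a\<in>unred i. p = L i s a"
  using assms(2,3)
proof (induction i arbitrary: p)
  case 0
  then have "p = L 0 s 0" by (simp add: I_def linear_0[OF linear_L])
  moreover have "0 \<in> unred 0" by (simp add: unred_def)
  ultimately show ?case by blast
next
  case (Suc i)
  define r where "r = replicate_mset D (Suc i)"
  obtain h where h: "\<forall>j\<in>{1..Suc i}. h j \<in> polys" "p = (\<Sum>j\<in>{1..Suc i}. F s j * h j)"
    using Suc.prems by (auto simp: I_def)
  \<comment> \<open>The cofactor of the new equation is replaced by its reduced remainder
    \<open>m\<close> modulo the previous equations; the difference is covered by the induction
    hypothesis.\<close>
  obtain m where m: "m \<in> red i" "h (Suc i) - m \<in> I s i"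
    using polys_eq_red_plus_I[OF assms(1), of i "h (Suc i)"] Suc.prems h by auto
  have "(\<Sum>j\<in>{1..i}. F s j * h j) \<in> I s i"
    unfolding I_def using h by (intro CollectI exI[of _ h]) auto
  moreover have "F s (Suc i) * (h (Suc i) - m) \<in> I s i"
    using m(2) Suc.prems by (intro I_mult F_polys) auto
  ultimately have "(\<Sum>j\<in>{1..i}. F s j * h j) + F s (Suc i) * (h (Suc i) - m) \<in> I s i"
    by (rule subspace_add[OF subspace_I])
  then obtain a where a: "a \<in> unred i" "(\<Sum>j\<in>{1..i}. F s j * h j) + F s (Suc i) * (h (Suc i) - m) = L i s a"
    using Suc.IH Suc.prems by (meson Suc_leD)
  have "p = L i s a + F s (Suc i) * m" by (simp add: h(2) a(2)[symmetric] algebra_simps)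
  \<comment> \<open>All monomials of \<open>a\<close> are divisible at stage \<open>i\<close>, where
    the least divisor is the same as at the next stage.\<close>
  also have "L i s a = L (Suc i) s a"
  proof (rule linear_eq_on_mon[OF linear_L linear_L])
    fix w assume "w \<in> Poly_Mapping.keys a"
    then have "divisible i w" using a by (auto simp: unred_def)
    moreover from this have "divisible (Suc i) w" by (auto simp: divisible_def)
    ultimately show "L i s (mon w) = L (Suc i) s (mon w)" by (simp add: L_mon_divisible)
  qed
  \<comment> \<open>A monomial \<open>w\<close> of \<open>m\<close> is divisible by none of the
    first \<open>i\<close> leading monomials, so the least divisor of \<open>r + w\<close> is
    \<open>Suc i\<close> and its cofactor is \<open>w\<close>.\<close>
  also have "F s (Suc i) * m = L (Suc i) s (mon r * m)"
  proof (rule linear_eq_on_mon[where p = m and f = "\<lambda>m. F s (Suc i) * m" and g = "\<lambda>m. L (Suc i) s (mon r * m)"])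
    show "linear (\<lambda>m. L (Suc i) s (mon r * m))"
      using linear_compose[OF linear_mult_left linear_L] by (simp add: o_def)
    fix w assume "w \<in> Poly_Mapping.keys m"
    then have w: "\<not> divisible i w" using m by (auto simp: red_def)
    have "divisible (Suc i) (r + w)" by (auto simp: divisible_def r_def)
    moreover have "divisor (r + w) = Suc i"
      unfolding divisor_def
    proof (rule Least_equality)
      show "Suc i \<le> j" if "1 \<le> j \<and> D \<le> count (r + w) j" for j
        using that w by (cases "j \<le> i") (auto simp: divisible_def r_def)
    qed (simp add: r_def)
    moreover from this have "cofactor (r + w) = w" by (simp add: cofactor_def r_def)
    ultimately show "F s (Suc i) * mon w = L (Suc i) s (mon r * mon w)"
      by (simp add: mon_mult L_mon_divisible)
  qed (rule linear_mult_left)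
  finally have "p = L (Suc i) s (a + mon r * m)" by (simp add: linear_add[OF linear_L])
  moreover have "a + mon r * m \<in> unred (Suc i)"
  proof -
    have "divisible (Suc i) w" if "divisible i w" for w
      using that unfolding divisible_def by (meson atLeastAtMost_iff le_SucI)
    then have "a \<in> unred (Suc i)" using a(1) unfolding unred_def by blast
    moreover have "mon r * m \<in> unred (Suc i)"
      unfolding unred_def
    proof (rule CollectI, rule subsetI)
      fix u assume "u \<in> Poly_Mapping.keys (mon r * m)"
      then obtain b where b: "b \<in> Poly_Mapping.keys m" "u = r + b" by (auto elim!: keys_multE)
      have "b \<in> monomials" using b(1) m by (auto simp: red_def)
      moreover have "r \<in> monomials" using Suc.prems by (auto simp: monomials_def r_def)
      moreover have "D \<le> count u (Suc i)" by (simp add: b(2) r_def)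
      ultimately show "u \<in> {w \<in> monomials. divisible (Suc i) w}"
        using b(2) by (auto simp: monomials_def divisible_def)
    qed
    ultimately show ?thesis
      unfolding unred_def by (rule subspace_add[OF subspace_keys])
  qed
  ultimately show ?case by blast
qed

text \<open>A reduced \<open>p\<close> in the ideal is \<open>L a\<close> for an unreduced
  \<open>a\<close>, and it is also \<open>L p\<close>. Injectivity gives \<open>a = p\<close>, which
  leaves no monomial for \<open>p\<close>.\<close>

lemma I_inter_red:
  assumes "good s" "p \<in> I s n" "p \<in> red n"
  shows "p = 0"
proof -
  obtain a where a: "a \<in> unred n" "p = L n s a" using I_subset_L_unred assms by blast
  have "L n s (a - p) = 0" using a L_red[OF assms(3)] by (simp add: linear_diff[OF linear_L])
  moreover have "a - p \<in> polys"
    using a assms by (intro subspace_diff[OF subspace_polys]) (auto simp: polys_def red_def unred_def)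
  ultimately have "a - p = 0" using assms(1) unfolding good_def by blast
  then have "a = p" by simp
  then have "Poly_Mapping.keys p \<subseteq> {w. divisible n w}" "Poly_Mapping.keys p \<subseteq> {w. \<not> divisible n w}"
    using a(1) assms(3) unfolding red_def unred_def by blast+
  then have "Poly_Mapping.keys p = {}" by blast
  then show ?thesis by simp
qed

definition std_monos :: "nat multiset set" where "std_monos = {w \<in> monomials. \<not> divisible n w}"

text \<open>A standard monomial is a free choice of \<open>n\<close> exponents below
  \<open>D\<close>.\<close>

lemma card_std_monos: "finite std_monos" "card std_monos = D ^ n"
proof -
  have "bij_betw (\<lambda>w. restrict (count w) {1..n}) std_monos ({1..n} \<rightarrow>\<^sub>E {..<D})"
    unfolding bij_betw_def
  proof
    show "inj_on (\<lambda>w. restrict (count w) {1..n}) std_monos"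
    proof (rule inj_onI)
      fix v w assume vw: "v \<in> std_monos" "w \<in> std_monos"
        and eq: "restrict (count v) {1..n} = restrict (count w) {1..n}"
      show "v = w"
      proof (rule multiset_eqI)
        fix j
        show "count v j = count w j"
        proof (cases "j \<in> {1..n}")
          case True then show ?thesis using fun_cong[OF eq, of j] by simp
        next
          case False
          then have "j \<notin># v" "j \<notin># w" using vw by (auto simp: std_monos_def monomials_def)
          then show ?thesis by (simp add: not_in_iff)
        qed
      qed
    qed
    show "(\<lambda>w. restrict (count w) {1..n}) ` std_monos = ({1..n} \<rightarrow>\<^sub>E {..<D})" (is "?f ` _ = ?A")
    proof
      show "?f ` std_monos \<subseteq> ?A"
      proof (intro image_subsetI PiE_I)
        fix w j assume "w \<in> std_monos" "j \<in> {1..n}"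
        then have "\<not> D \<le> count w j" unfolding std_monos_def divisible_def by blast
        then show "?f w j \<in> {..<D}" using \<open>j \<in> {1..n}\<close> by simp
      next
        fix w j assume "j \<notin> {1..n}"
        then show "?f w j = undefined" by (simp only: restrict_def if_False)
      qed
      show "?A \<subseteq> ?f ` std_monos"
      proof
        fix f assume f: "f \<in> ?A"
        define w where "w = (\<Sum>j\<in>{1..n}. replicate_mset (f j) j)"
        have count: "count w j = (if j \<in> {1..n} then f j else 0)" for j
          by (simp add: w_def count_sum)
        have "w \<in> std_monos"
          unfolding std_monos_def monomials_def divisible_def
        proof (intro CollectI conjI subsetI notI)
          fix j assume "j \<in># w"
          then have "count w j \<noteq> 0" by simp
          then show "j \<in> {1..n}" unfolding count by argo
        next
          assume "\<exists>j\<in>{1..n}. D \<le> count w j"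
          then obtain j where j: "j \<in> {1..n}" "D \<le> count w j" by blast
          then have "f j < D" using f by (meson PiE_mem lessThan_iff)
          then show False using j count[of j] by simp
        qed
        moreover have "?f w = f"
        proof
          fix j show "?f w j = f j"
            using f count[of j] PiE_arb[OF f, of j] by (simp add: restrict_def)
        qed
        ultimately show "f \<in> ?f ` std_monos" by blast
      qed
    qed
  qed
  moreover have "finite ({1..n} \<rightarrow>\<^sub>E {..<D})" "card ({1..n} \<rightarrow>\<^sub>E {..<D}) = D ^ n"
    by (auto simp: finite_PiE card_PiE)
  ultimately show "finite std_monos" "card std_monos = D ^ n"
    using bij_betw_finite bij_betw_same_card by metis+
qed

lemma red_eq_span: "red n = span (mon ` std_monos)"
  by (auto simp: red_def span_mon std_monos_def)

lemma red_subset_polys: "red i \<subseteq> polys"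
  by (auto simp: red_def polys_def)

text \<open>The quotient by the ideal is modelled on its normal forms: \<open>\<pi>\<close> chooses
  a reduced remainder, and since a reduced element of the ideal is zero, congruences between reduced
  polynomials are equalities. \<open>T k\<close> is multiplication by \<open>y_k\<close> in this
  model.\<close>

lemma system_has_solution:
  assumes good: "good s"
  shows "\<exists>y. \<forall>j\<in>{1..n}. y j ^ D + s * eval_poly y (g j) = 0"
proof -
  have "\<forall>w\<in>monomials. \<exists>a. a \<in> red n \<and> mon w - a \<in> I s n"
    using polys_eq_red_plus_I[OF good] mon_polys by blast
  then obtain \<rho> where \<rho>: "\<And>w. w \<in> monomials \<Longrightarrow> \<rho> w \<in> red n \<and> mon w - \<rho> w \<in> I s n" by metis
  define \<pi> where "\<pi> = lin_ext \<rho>"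
  have lin\<pi>: "linear \<pi>" unfolding \<pi>_def by (rule linear_lin_ext)
  have sub_red: "subspace (red n)" unfolding red_def by (rule subspace_keys)
  have \<pi>_red: "\<pi> p \<in> red n" if "p \<in> polys" for p
  proof (rule subspace_linear_on_mon[OF lin\<pi> sub_red])
    fix w assume "w \<in> Poly_Mapping.keys p"
    then have "w \<in> monomials" using that by (auto simp: polys_def)
    then show "\<pi> (mon w) \<in> red n" using \<rho> by (simp add: \<pi>_def)
  qed
  have lin_diff: "linear (\<lambda>p. p - \<pi> p)" by (intro linear_compose_sub lin\<pi> linear_ident)
  have \<pi>_I: "p - \<pi> p \<in> I s n" if "p \<in> polys" for p
  proof (rule subspace_linear_on_mon[OF lin_diff subspace_I])
    fix w assume "w \<in> Poly_Mapping.keys p"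
    then have "w \<in> monomials" using that by (auto simp: polys_def)
    then show "mon w - \<pi> (mon w) \<in> I s n" using \<rho> by (simp add: \<pi>_def)
  qed
  define T where "T k p = \<pi> (mon {#k#} * p)" for k p
  have linT: "linear (T k)" for k
    using linear_compose[OF linear_mult_left lin\<pi>] by (simp add: o_def T_def[abs_def])
  have X: "mon {#k#} \<in> polys" if "k \<in> {1..n}" for k using that by (intro mon_polys) (simp add: monomials_def)
  have T_red: "T k p \<in> red n" if "k \<in> {1..n}" "p \<in> polys" for k p
    unfolding T_def using that by (intro \<pi>_red polys_mult X)
  have T_I: "mon {#k#} * p - T k p \<in> I s n" if "k \<in> {1..n}" "p \<in> polys" for k p
    unfolding T_def using that by (intro \<pi>_I polys_mult X)
  have TT: "mon {#k#} * (mon {#l#} * p) - T k (T l p) \<in> I s n"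
    if "k \<in> {1..n}" "l \<in> {1..n}" "p \<in> polys" for k l p
  proof -
    have "mon {#k#} * (mon {#l#} * p - T l p) + (mon {#k#} * T l p - T k (T l p)) \<in> I s n"
      using that red_subset_polys T_red by (intro subspace_add[OF subspace_I] I_mult T_I X) auto
    then show ?thesis by (simp add: algebra_simps)
  qed
  \<comment> \<open>Both composites are congruent to multiplication by \<open>y_k y_l\<close>, and
    both are reduced.\<close>
  have comm: "T k (T l p) = T l (T k p)" if kl: "k \<in> {1..n}" "l \<in> {1..n}" "p \<in> polys" for k l p
  proof -
    have "(mon {#l#} * (mon {#k#} * p) - T l (T k p)) - (mon {#k#} * (mon {#l#} * p) - T k (T l p)) \<in> I s n"
      using kl by (intro subspace_diff[OF subspace_I] TT)
    then have "T k (T l p) - T l (T k p) \<in> I s n" by (simp add: algebra_simps)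
    moreover have "T k (T l p) - T l (T k p) \<in> red n"
      using kl T_red red_subset_polys by (intro subspace_diff[OF sub_red] T_red) auto
    ultimately show ?thesis using I_inter_red[OF good] by fastforce
  qed
  have "\<exists>v\<in>span (mon ` std_monos). v \<noteq> 0 \<and> (\<forall>S\<in>T ` {1..n}. \<exists>k. S v = k *\<^sub>R v)"
  proof (rule commuting_common_eigenvector)
    show "odd (card (mon ` std_monos :: (nat multiset \<Rightarrow>\<^sub>0 real) set))"
      by (simp add: card_image inj_mon card_std_monos odd_D)
    show "S ` span (mon ` std_monos) \<subseteq> span (mon ` std_monos)" if "S \<in> T ` {1..n}" for S
      using that T_red red_subset_polys unfolding red_eq_span[symmetric] by blast
    show "S1 (S2 v) = S2 (S1 v)"
      if "S1 \<in> T ` {1..n}" "S2 \<in> T ` {1..n}" "v \<in> span (mon ` std_monos)" for S1 S2 v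
      using that comm red_subset_polys unfolding red_eq_span[symmetric] by blast
  qed (auto simp: card_std_monos independent_mon linT)
  then obtain v where v: "v \<in> red n" "v \<noteq> 0" "\<forall>k\<in>{1..n}. \<exists>c. T k v = c *\<^sub>R v"
    unfolding red_eq_span[symmetric] by blast
  then obtain y where y: "\<And>k. k \<in> {1..n} \<Longrightarrow> T k v = y k *\<^sub>R v" by metis
  have vp: "v \<in> polys" using v red_subset_polys by auto
  \<comment> \<open>Modulo the ideal, multiplication by a monomial scales \<open>v\<close> by the
    value of the monomial at the point of eigenvalues.\<close>
  have mon_v: "mon w * v - (\<Prod>i\<in>#w. y i) *\<^sub>R v \<in> I s n" if "w \<in> monomials" for w
    using that
  proof (induction w)
    case empty
    then show ?case using subspace_0[OF subspace_I] by simp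
  next
    case (add k w)
    then have k: "k \<in> {1..n}" "w \<in> monomials" by (auto simp: monomials_def)
    have "mon {#k#} * (mon w * v - (\<Prod>i\<in>#w. y i) *\<^sub>R v) + (\<Prod>i\<in>#w. y i) *\<^sub>R (mon {#k#} * v - T k v) \<in> I s n"
      using k vp add.IH by (intro subspace_add[OF subspace_I] subspace_scale[OF subspace_I] I_mult T_I X) auto
    moreover have "mon {#k#} * (mon w * v) = mon (add_mset k w) * v"
      by (simp add: mon_mult flip: mult.assoc)
    ultimately show ?case by (simp add: y[OF k(1)] algebra_simps scaleR_mult_poly_mapping)
  qed
  have lin_v: "linear (\<lambda>p. p * v - eval_poly y p *\<^sub>R v)"
    by (rule linearI)
      (simp_all add: linear_add[OF linear_eval_poly] linear_scale[OF linear_eval_poly] algebra_simps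
        scaleR_mult_poly_mapping)
  have poly_v: "p * v - eval_poly y p *\<^sub>R v \<in> I s n" if "p \<in> polys" for p
  proof (rule subspace_linear_on_mon[OF lin_v subspace_I])
    fix w assume "w \<in> Poly_Mapping.keys p"
    then have "w \<in> monomials" using that by (auto simp: polys_def)
    then show "mon w * v - eval_poly y (mon w) *\<^sub>R v \<in> I s n" using mon_v by simp
  qed
  \<comment> \<open>\<open>F_j v\<close> lies in the ideal and is congruent to
    \<open>F_j(y) v\<close>. The latter is reduced, hence zero, and \<open>v\<close> is not
    zero.\<close>
  have "eval_poly y (F s j) = 0" if j: "j \<in> {1..n}" for j
  proof -
    have "F s j * v - (F s j * v - eval_poly y (F s j) *\<^sub>R v) \<in> I s n"
      using j vp by (intro subspace_diff[OF subspace_I] poly_v F_mult_in_I F_polys)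
    moreover have "eval_poly y (F s j) *\<^sub>R v \<in> red n" using v by (intro subspace_scale[OF sub_red])
    ultimately have "eval_poly y (F s j) *\<^sub>R v = 0" by (intro I_inter_red[OF good]) simp_all
    then show ?thesis using v by simp
  qed
  moreover have "eval_poly y (F s j) = y j ^ D + s * eval_poly y (g j)" for j
    by (simp add: F_def linear_add[OF linear_eval_poly] linear_scale[OF linear_eval_poly])
  ultimately show ?thesis by (intro exI[of _ y]) simp
qed

end

section \<open>The Borsuk-Ulam theorem for polynomial maps\<close>

text \<open>Bolzano-Weierstrass for finitely many coordinates: each further coordinate costs one
  passage to a monotone, hence convergent, subsequence, which preserves the limits already
  found.\<close>

lemma finite_coordinates_convergent_subsequence:
  fixes u :: "nat \<Rightarrow> 'a \<Rightarrow> real"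
  assumes "finite J" "\<And>m j. j \<in> J \<Longrightarrow> \<bar>u m j\<bar> \<le> 1"
  shows "\<exists>\<phi> l. strict_mono (\<phi> :: nat \<Rightarrow> nat) \<and> (\<forall>j\<in>J. (\<lambda>m. u (\<phi> m) j) \<longlonglongrightarrow> l j)"
  using assms
proof (induction J)
  case empty
  then show ?case by (intro exI[of _ id]) (simp add: strict_mono_def)
next
  case (insert k J)
  then obtain \<phi> l where \<phi>: "strict_mono (\<phi> :: nat \<Rightarrow> nat)" "\<forall>j\<in>J. (\<lambda>m. u (\<phi> m) j) \<longlonglongrightarrow> l j"
    by blast
  obtain \<psi> where \<psi>: "strict_mono \<psi>" "monoseq (\<lambda>m. u (\<phi> (\<psi> m)) k)"
    using seq_monosub[of "\<lambda>m. u (\<phi> m) k"] by blast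
  have "Bseq (\<lambda>m. u (\<phi> (\<psi> m)) k)"
    using insert.prems by (intro BseqI'[of _ 1]) simp
  then obtain c where c: "(\<lambda>m. u (\<phi> (\<psi> m)) k) \<longlonglongrightarrow> c"
    using Bseq_monoseq_convergent[OF _ \<psi>(2)] convergent_def by blast
  have "(\<lambda>m. u (\<phi> (\<psi> m)) j) \<longlonglongrightarrow> (l(k := c)) j" if "j \<in> insert k J" for j
  proof (cases "j = k")
    case False
    then have "(\<lambda>m. u (\<phi> m) j) \<longlonglongrightarrow> l j" using \<phi>(2) that by blast
    then have "((\<lambda>m. u (\<phi> m) j) \<circ> \<psi>) \<longlonglongrightarrow> l j" by (rule LIMSEQ_subseq_LIMSEQ[OF _ \<psi>(1)])
    then show ?thesis using False by (simp add: o_def)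
  qed (use c in simp)
  moreover have "strict_mono (\<phi> \<circ> \<psi>)" using \<phi>(1) \<psi>(1) by (rule strict_mono_o)
  ultimately show ?case by (intro exI[of _ "\<phi> \<circ> \<psi>"] exI[of _ "l(k := c)"]) (simp only: o_def, blast)
qed

lemma tendsto_eval_poly:
  assumes "\<And>w j. w \<in> Poly_Mapping.keys p \<Longrightarrow> j \<in># w \<Longrightarrow> (\<lambda>m. u m j) \<longlonglongrightarrow> l j"
  shows "(\<lambda>m. eval_poly (u m) p) \<longlonglongrightarrow> eval_poly l p"
proof -
  have "(\<lambda>m. \<Prod>j\<in>#w. u m j) \<longlonglongrightarrow> (\<Prod>j\<in>#w. l j)" if "\<And>j. j \<in># w \<Longrightarrow> (\<lambda>m. u m j) \<longlonglongrightarrow> l j" for w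
    using that by (induction w) (auto intro!: tendsto_mult)
  then show ?thesis
    unfolding eval_poly_def lin_ext_def real_scaleR_def using assms
    by (intro tendsto_sum tendsto_mult tendsto_const) blast
qed

definition degree_le :: "nat \<Rightarrow> nat \<Rightarrow> (nat multiset \<Rightarrow>\<^sub>0 real) set"
  where "degree_le n E = {p. Poly_Mapping.keys p \<subseteq> {w. set_mset w \<subseteq> {1..n} \<and> size w \<le> E}}"

lemma subspace_degree_le: "subspace (degree_le n E)"
  unfolding degree_le_def by (rule subspace_keys)

lemma mon_degree_le: "set_mset w \<subseteq> {1..n} \<Longrightarrow> size w \<le> E \<Longrightarrow> mon w \<in> degree_le n E"
  by (simp add: degree_le_def)

lemma degree_le_mult:
  assumes "p \<in> degree_le n E" "q \<in> degree_le n E'"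
  shows "p * q \<in> degree_le n (E + E')"
  unfolding degree_le_def
proof (rule CollectI, rule subsetI)
  fix w assume "w \<in> Poly_Mapping.keys (p * q)"
  then obtain a b where ab: "a \<in> Poly_Mapping.keys p" "b \<in> Poly_Mapping.keys q" "w = a + b"
    by (rule keys_multE)
  then have "set_mset a \<subseteq> {1..n} \<and> size a \<le> E" "set_mset b \<subseteq> {1..n} \<and> size b \<le> E'"
    using assms unfolding degree_le_def by blast+
  then show "w \<in> {w. set_mset w \<subseteq> {1..n} \<and> size w \<le> E + E'}" using ab(3) by auto
qed

lemma degree_le_power:
  assumes "p \<in> degree_le n E"
  shows "p ^ k \<in> degree_le n (k * E)"
proof (induction k)
  case 0
  then show ?case using mon_degree_le[of "{#}" n 0] by (simp flip: single_one)
next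
  case (Suc k)
  then show ?case using degree_le_mult[OF assms Suc] by simp
qed

text \<open>
  On the sphere the odd parts of the polynomials become forms of odd degree \<open>D\<close> after multiplying
  their monomials by powers of \<open>\<Sum>\<^sub>j x\<^sub>j\<^sup>2\<close>. Setting the last variable to \<open>1\<close> gives
  a system \<open>g\<close> to which \<open>odd_system.system_has_solution\<close> applies; projecting the solutions to the sphere
  makes the odd parts as small as \<open>1 / s\<close>.
\<close>

theorem polynomial_borsuk_ulam:
  fixes p :: "nat \<Rightarrow> nat multiset \<Rightarrow>\<^sub>0 real"
  assumes r: "r \<ge> 1"
    and p: "\<And>i w. i \<in> {1..<r} \<Longrightarrow> w \<in> Poly_Mapping.keys (p i) \<Longrightarrow> set_mset w \<subseteq> {1..r}"
  shows "\<exists>x. (\<Sum>j\<in>{1..r}. (x j)\<^sup>2) = 1 \<and>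
    (\<forall>i\<in>{1..<r}. eval_poly x (p i) = eval_poly (\<lambda>j. - x j) (p i))"
proof -
  define n where "n = r - 1"
  have idx: "{1..<r} = {1..n}" using r by (auto simp: n_def)
  define W where "W = (\<Union>i\<in>{1..n}. Poly_Mapping.keys (p i))"
  \<comment> \<open>Twice a bound of all degrees plus one is odd and still a bound. Inserting 0
    covers the case that no monomial occurs.\<close>
  define D where "D = 2 * Max (insert 0 (size ` W)) + 1"
  have finW: "finite W" by (simp add: W_def)
  have D: "odd D" "size w \<le> D" if "w \<in> W" for w
  proof -
    have "size w \<le> Max (insert 0 (size ` W))" using finW that by (intro Max_ge) auto
    then show "size w \<le> D" by (simp add: D_def)
  qed (simp add: D_def)
  have oddD: "odd D" by (simp add: D_def)
  \<comment> \<open>The form \<open>x_1^2 + ... + x_r^2\<close> with its last variable set to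
    1.\<close>
  define sq :: "nat multiset \<Rightarrow>\<^sub>0 real" where "sq = 1 + (\<Sum>j\<in>{1..n}. mon {#j, j#})"
  \<comment> \<open>The monomial \<open>w\<close> with its last variable set to 1, padded by powers
    of \<open>sq\<close> up to degree \<open>D\<close>. The exponent is exact for odd
    \<open>size w\<close>, because \<open>D\<close> is odd too.\<close>
  define h where "h w = mon (filter_mset (\<lambda>j. j \<noteq> r) w) * sq ^ ((D - size w) div 2)" for w
  define odd_part where "odd_part = lin_ext (\<lambda>w. if odd (size w) then mon w else (0 :: nat multiset \<Rightarrow>\<^sub>0 real))"
  define g where "g i = lin_ext (\<lambda>w. if odd (size w) then h w else 0) (p i)" for i
  have sq: "sq \<in> degree_le n 2"
    unfolding sq_def using mon_degree_le[of "{#}" n 2]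
    by (intro subspace_add[OF subspace_degree_le] subspace_sum[OF subspace_degree_le] mon_degree_le)
      (simp_all flip: single_one)
  have h: "h w \<in> degree_le n D" if w: "w \<in> W" "odd (size w)" for w
  proof -
    have "set_mset (filter_mset (\<lambda>j. j \<noteq> r) w) \<subseteq> {1..n}"
    proof
      fix j assume "j \<in># filter_mset (\<lambda>j. j \<noteq> r) w"
      then have "j \<in># w" "j \<noteq> r" by auto
      moreover have "set_mset w \<subseteq> {1..r}"
      proof -
        obtain i where "i \<in> {1..n}" "w \<in> Poly_Mapping.keys (p i)" using w(1) unfolding W_def by blast
        then show ?thesis using p idx by blast
      qed
      ultimately have "j \<in> {1..r}" "j \<noteq> r" by blast+
      then show "j \<in> {1..n}" by (auto simp: n_def)
    qed
    then have "mon (filter_mset (\<lambda>j. j \<noteq> r) w) \<in> degree_le n (size w)"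
      by (intro mon_degree_le) (simp_all add: size_filter_mset_lesseq)
    then have "h w \<in> degree_le n (size w + (D - size w) div 2 * 2)"
      unfolding h_def by (rule degree_le_mult[OF _ degree_le_power[OF sq]])
    moreover have "size w + (D - size w) div 2 * 2 = D" using D[OF w(1)] w(2) oddD by presburger
    ultimately show ?thesis by simp
  qed
  have gle: "g i \<in> degree_le n D" if i: "i \<in> {1..n}" for i
    unfolding g_def
  proof (rule subspace_linear_on_mon[OF linear_lin_ext subspace_degree_le])
    fix w assume "w \<in> Poly_Mapping.keys (p i)"
    then have "w \<in> W" using i by (auto simp: W_def)
    then show "lin_ext (\<lambda>w. if odd (size w) then h w else 0) (mon w) \<in> degree_le n D"
      using h subspace_0[OF subspace_degree_le] by simp
  qed
  interpret odd_system n D g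
  proof
    show "odd D" by (rule oddD)
    fix j w assume "j \<in> {1..n}" "w \<in> Poly_Mapping.keys (g j)"
    then show "set_mset w \<subseteq> {1..n} \<and> size w \<le> D"
      using gle[of j] unfolding degree_le_def by blast
  qed
  \<comment> \<open>An interval of positive parameters is uncountable, so it cannot consist of
    exceptional ones.\<close>
  have ex_good: "\<exists>s>a. good s" if "a \<ge> 0" for a
  proof (rule ccontr)
    assume "\<not> (\<exists>s>a. good s)"
    then have "{a<..<a + 1} \<subseteq> {s. s \<noteq> 0 \<and> \<not> good s}" using that by auto
    then have "countable {a<..<a + 1}" using countable_bad countable_subset by blast
    then show False using uncountable_open_interval[of a "a + 1"] by simp
  qed
  have approx: "\<exists>x. (\<Sum>j\<in>{1..r}. (x j)\<^sup>2) = 1 \<and> (\<forall>i\<in>{1..n}. \<bar>eval_poly x (odd_part (p i))\<bar> \<le> 1 / real (Suc m))" for m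
  proof -
    obtain s where s: "s > real (Suc m)" "good s" using ex_good[of "real (Suc m)"] by auto
    obtain y where y: "\<And>j. j \<in> {1..n} \<Longrightarrow> y j ^ D + s * eval_poly y (g j) = 0"
      using system_has_solution[OF s(2)] by blast
    \<comment> \<open>\<open>N\<close> is the norm of the vector \<open>(y_1, ..., y_n, 1)\<close>,
      and \<open>x\<close> is its projection to the unit sphere.\<close>
    define N where "N = sqrt (1 + (\<Sum>j\<in>{1..n}. (y j)\<^sup>2))"
    have S0: "(\<Sum>j\<in>{1..n}. (y j)\<^sup>2) \<ge> 0" by (intro sum_nonneg) simp
    then have N: "N > 0" "N\<^sup>2 = 1 + (\<Sum>j\<in>{1..n}. (y j)\<^sup>2)"
      by (auto simp: N_def add_pos_nonneg)
    define x where "x j = (if j = r then 1 else y j) / N" for j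
    have "{1..r} = insert r {1..n}" "r \<notin> {1..n}" using r by (auto simp: n_def)
    then have "(\<Sum>j\<in>{1..r}. (x j)\<^sup>2) = (x r)\<^sup>2 + (\<Sum>j\<in>{1..n}. (x j)\<^sup>2)" by simp
    also have "(\<Sum>j\<in>{1..n}. (x j)\<^sup>2) = (\<Sum>j\<in>{1..n}. (y j)\<^sup>2 / N\<^sup>2)"
      using r by (intro sum.cong) (auto simp: x_def n_def power_divide)
    also have "(x r)\<^sup>2 + \<dots> = (1 + (\<Sum>j\<in>{1..n}. (y j)\<^sup>2)) / N\<^sup>2"
      by (simp add: x_def power_divide sum_divide_distrib[symmetric] add_divide_distrib)
    also have "\<dots> = 1" unfolding N(2)[symmetric] using N(1) by simp
    finally have sphere: "(\<Sum>j\<in>{1..r}. (x j)\<^sup>2) = 1" .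
    have ev_sq: "eval_poly y sq = N\<^sup>2"
      unfolding N(2)
      by (simp add: sq_def linear_add[OF linear_eval_poly] linear_sum[OF linear_eval_poly] power2_eq_square)
    have prod_x: "(\<Prod>j\<in>#w. x j) = (\<Prod>j\<in>#filter_mset (\<lambda>j. j \<noteq> r) w. y j) / N ^ size w" for w
      by (induction w) (auto simp: x_def)
    \<comment> \<open>Padding raised every odd monomial to the same degree \<open>D\<close>, so one
      and the same power of \<open>N\<close> relates values at \<open>x\<close> to values at
      \<open>y\<close>.\<close>
    have ev_h: "(\<Prod>j\<in>#w. x j) = eval_poly y (h w) / N ^ D" if w: "w \<in> W" "odd (size w)" for w
    proof -
      obtain k where k: "D = size w + 2 * k" using D[OF w(1)] w(2) oddD
        by (metis add_diff_inverse_nat even_add even_diff_nat evenE linorder_not_less)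
      have "eval_poly y (h w) = (\<Prod>j\<in>#filter_mset (\<lambda>j. j \<noteq> r) w. y j) * N ^ (2 * k)"
        using k by (simp add: h_def ev_sq power_mult)
      then show ?thesis using N(1) by (simp add: prod_x k power_add)
    qed
    have "\<bar>eval_poly x (odd_part (p i))\<bar> \<le> 1 / real (Suc m)" if i: "i \<in> {1..n}" for i
    proof -
      have "eval_poly x (odd_part (p i)) = (1 / N ^ D) *\<^sub>R eval_poly y (g i)"
        unfolding g_def odd_part_def
      proof (rule linear_eq_on_mon[where p = "p i" and
            f = "\<lambda>q. eval_poly x (lin_ext (\<lambda>w. if odd (size w) then mon w else 0) q)" and
            g = "\<lambda>q. (1 / N ^ D) *\<^sub>R eval_poly y (lin_ext (\<lambda>w. if odd (size w) then h w else 0) q)"])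
        show "linear (\<lambda>q. eval_poly x (lin_ext (\<lambda>w. if odd (size w) then mon w else 0) q))"
          using linear_compose[OF linear_lin_ext linear_eval_poly] by (simp add: o_def)
        show "linear (\<lambda>q. (1 / N ^ D) *\<^sub>R eval_poly y (lin_ext (\<lambda>w. if odd (size w) then h w else 0) q))"
          using linear_compose[OF linear_compose[OF linear_lin_ext linear_eval_poly] linear_scaleR[of "1 / N ^ D"]]
          by (simp only: o_def)
        fix w assume "w \<in> Poly_Mapping.keys (p i)"
        then have "w \<in> W" using i by (auto simp: W_def)
        then show "eval_poly x (lin_ext (\<lambda>w. if odd (size w) then mon w else 0) (mon w)) =
            (1 / N ^ D) *\<^sub>R eval_poly y (lin_ext (\<lambda>w. if odd (size w) then h w else 0) (mon w))"
          using ev_h by (simp add: linear_0[OF linear_eval_poly])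
      qed
      \<comment> \<open>This is the equation solved by \<open>y\<close>. Division by
        \<open>N^D\<close> then turns \<open>y_i^D\<close> into \<open>x_i^D\<close>, which is
        bounded by 1 on the sphere.\<close>
      also have "eval_poly y (g i) = - (y i ^ D) / s"
        using y[OF i] s(1) by (simp add: field_simps add_eq_0_iff)
      also have "(1 / N ^ D) *\<^sub>R (- (y i ^ D) / s) = - (x i ^ D) / s"
        using i r by (auto simp: x_def n_def power_divide)
      finally have "\<bar>eval_poly x (odd_part (p i))\<bar> = \<bar>x i\<bar> ^ D / s"
        using s(1) by (simp add: power_abs)
      moreover have "(x i)\<^sup>2 \<le> 1"
        unfolding sphere[symmetric] using i by (intro member_le_sum) (auto simp: n_def)
      then have "\<bar>x i\<bar> ^ D \<le> 1" by (intro power_le_one) (auto simp: abs_square_le_1)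
      ultimately show ?thesis using s(1) by (simp add: frac_le)
    qed
    then show ?thesis using sphere by blast
  qed
  then obtain u where u: "\<And>m. (\<Sum>j\<in>{1..r}. (u m j)\<^sup>2) = 1"
    "\<And>m i. i \<in> {1..n} \<Longrightarrow> \<bar>eval_poly (u m) (odd_part (p i))\<bar> \<le> 1 / real (Suc m)"
    by metis
  have "\<bar>u m j\<bar> \<le> 1" if "j \<in> {1..r}" for m j
  proof -
    have "(u m j)\<^sup>2 \<le> 1"
      unfolding u(1)[of m, symmetric] using that by (intro member_le_sum) auto
    then show ?thesis by (simp add: abs_square_le_1)
  qed
  \<comment> \<open>The coordinates of points of the sphere are bounded by 1, so the approximate
    zeros have a limit point.\<close>
  then have "\<exists>\<phi> l. strict_mono (\<phi> :: nat \<Rightarrow> nat) \<and> (\<forall>j\<in>{1..r}. (\<lambda>m. u (\<phi> m) j) \<longlonglongrightarrow> l j)"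
    by (intro finite_coordinates_convergent_subsequence) auto
  then obtain \<phi> x where \<phi>0: "strict_mono (\<phi> :: nat \<Rightarrow> nat)" "\<forall>j\<in>{1..r}. (\<lambda>m. u (\<phi> m) j) \<longlonglongrightarrow> x j"
    by blast
  note \<phi> = \<phi>0(1) bspec[OF \<phi>0(2)]
  have "(\<lambda>m. \<Sum>j\<in>{1..r}. (u (\<phi> m) j)\<^sup>2) \<longlonglongrightarrow> (\<Sum>j\<in>{1..r}. (x j)\<^sup>2)"
    using \<phi>(2) by (intro tendsto_sum tendsto_power) auto
  then have "(\<Sum>j\<in>{1..r}. (x j)\<^sup>2) = 1"
    unfolding u(1) by (simp add: LIMSEQ_const_iff)
  moreover have "eval_poly x (p i) = eval_poly (\<lambda>j. - x j) (p i)" if i: "i \<in> {1..<r}" for i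
  proof -
    have keys: "Poly_Mapping.keys (odd_part (p i)) \<subseteq> Poly_Mapping.keys (p i)"
    proof -
      have "odd_part (p i) \<in> {q. Poly_Mapping.keys q \<subseteq> Poly_Mapping.keys (p i)}"
        unfolding odd_part_def
        by (rule subspace_linear_on_mon[OF linear_lin_ext subspace_keys]) simp
      then show ?thesis by simp
    qed
    have "(\<lambda>m. eval_poly (u (\<phi> m)) (odd_part (p i))) \<longlonglongrightarrow> eval_poly x (odd_part (p i))"
    proof (rule tendsto_eval_poly)
      fix w j assume "w \<in> Poly_Mapping.keys (odd_part (p i))" "j \<in># w"
      then show "(\<lambda>m. u (\<phi> m) j) \<longlonglongrightarrow> x j" using keys p[OF i] by (intro \<phi>(2)) blast
    qed
    moreover have "(\<lambda>m. eval_poly (u (\<phi> m)) (odd_part (p i))) \<longlonglongrightarrow> 0"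
    proof (rule tendsto_rabs_zero_cancel,
        rule tendsto_sandwich[where f = "\<lambda>_. 0" and h = "\<lambda>m. inverse (real (Suc m))"])
      have "\<bar>eval_poly (u (\<phi> m)) (odd_part (p i))\<bar> \<le> 1 / real (Suc m)" for m
      proof -
        have "\<bar>eval_poly (u (\<phi> m)) (odd_part (p i))\<bar> \<le> 1 / real (Suc (\<phi> m))" using u(2) i idx by blast
        also have "\<dots> \<le> 1 / real (Suc m)"
          using seq_suble[OF \<phi>(1), of m] by (intro divide_left_mono) auto
        finally show ?thesis .
      qed
      then show "\<forall>\<^sub>F m in sequentially. \<bar>eval_poly (u (\<phi> m)) (odd_part (p i))\<bar> \<le> inverse (real (Suc m))"
        by (simp add: inverse_eq_divide)
      show "(\<lambda>m. inverse (real (Suc m))) \<longlonglongrightarrow> 0" by (rule LIMSEQ_inverse_real_of_nat)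
    qed simp_all
    ultimately have 0: "eval_poly x (odd_part (p i)) = 0" using LIMSEQ_unique by blast
    have prod_neg: "(\<Prod>j\<in>#w. - x j) = (- 1) ^ size w * (\<Prod>j\<in>#w. x j)" for w
      by (induction w) auto
    \<comment> \<open>The even monomials cancel in the difference and the odd ones double.\<close>
    have "eval_poly x (p i) - eval_poly (\<lambda>j. - x j) (p i) = 2 * eval_poly x (odd_part (p i))"
    proof (rule linear_eq_on_mon[where p = "p i" and f = "\<lambda>q. eval_poly x q - eval_poly (\<lambda>j. - x j) q" and
          g = "\<lambda>q. 2 * eval_poly x (odd_part q)"])
      show "linear (\<lambda>q. eval_poly x q - eval_poly (\<lambda>j. - x j) q)"
        by (intro linear_compose_sub linear_eval_poly)
      show "linear (\<lambda>q. 2 * eval_poly x (odd_part q))"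
        unfolding odd_part_def
        using linear_compose[OF linear_compose[OF linear_lin_ext linear_eval_poly] linear_scaleR[of 2]]
        by (simp add: o_def)
    qed (simp add: odd_part_def prod_neg linear_0[OF linear_eval_poly])
    then show ?thesis using 0 by simp
  qed
  ultimately show ?thesis by blast
qed

section \<open>The coordinate ring of the sphere\<close>

lemma (in cring) poly_algebra_hom_eqI:
  fixes V :: "'v set"
  assumes A: "algebra R A" and h: "h \<in> algebra_hom R (poly_algebra R V) A" and k: "k \<in> algebra_hom R (poly_algebra R V) A"
    and eq: "\<And>i. i \<in> V \<Longrightarrow> h (poly_var R i) = k (poly_var R i)"
    and p: "p \<in> carrier (poly_algebra R V)"
  shows "h p = k p"
proof (rule poly_hom_eqI[OF algebra.axioms(1)[OF A] algebra_hom_module_hom[OF h] algebra_hom_module_hom[OF k] _ p])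
  fix w :: "'v multiset" assume "set_mset w \<subseteq> V"
  then show "h (basis_elem R w) = k (basis_elem R w)"
  proof (induction w)
    case empty
    show ?case using algebra_homD(4)[OF h] algebra_homD(4)[OF k] by (simp add: poly_one)
  next
    case (add i w)
    then have i: "i \<in> V" "set_mset w \<subseteq> V" by auto
    note c = poly_var_closed[OF i(1)] poly_basis_closed[OF i(2)]
    show ?case
      unfolding poly_var_mult_basis[OF i, symmetric] algebra_homD(3)[OF h c] algebra_homD(3)[OF k c]
      using add.IH[OF i(2)] eq[OF i(1)] by simp
  qed
qed

lemma real_ring_simps:
  "carrier real_ring = UNIV" "x \<otimes>\<^bsub>real_ring\<^esub> y = x * y" "\<one>\<^bsub>real_ring\<^esub> = 1"
  "\<zero>\<^bsub>real_ring\<^esub> = 0" "x \<oplus>\<^bsub>real_ring\<^esub> y = x + y"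
  by (simp_all add: ring_of_type_algebra_def)

lemma cring_real: "cring real_ring"
  by (rule cring_from_type_algebra)

abbreviation "real_alg \<equiv> ring_as_algebra real_ring"

lemma algebra_real: "algebra real_ring real_alg"
  by (rule cring.algebra_ring_as_algebra[OF cring_real])

lemma finsum_real: "finite I \<Longrightarrow> finsum real_alg f I = sum f I"
proof (induction I rule: finite_induct)
  interpret A: algebra real_ring real_alg by (rule algebra_real)
  case empty
  then show ?case by (simp add: ring_as_algebra_simps real_ring_simps)
next
  interpret A: algebra real_ring real_alg by (rule algebra_real)
  case (insert i I)
  have "finsum real_alg f (insert i I) = f i \<oplus>\<^bsub>real_alg\<^esub> finsum real_alg f I"
    using insert by (intro A.finsum_insert) (auto simp: ring_as_algebra_simps real_ring_simps)
  then show ?case using insert by (simp add: ring_as_algebra_simps real_ring_simps)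
qed

lemma finprod_real: "finite I \<Longrightarrow> finprod real_alg f I = prod f I"
proof (induction I rule: finite_induct)
  interpret A: algebra real_ring real_alg by (rule algebra_real)
  case empty
  then show ?case by (simp add: ring_as_algebra_simps real_ring_simps)
next
  interpret A: algebra real_ring real_alg by (rule algebra_real)
  case (insert i I)
  have "finprod real_alg f (insert i I) = f i \<otimes>\<^bsub>real_alg\<^esub> finprod real_alg f I"
    using insert by (intro A.finprod_insert) (auto simp: ring_as_algebra_simps real_ring_simps)
  then show ?case using insert by (simp add: ring_as_algebra_simps real_ring_simps)
qed

lemma pow_real: "x [^]\<^bsub>real_alg\<^esub> (k :: nat) = x ^ k"
proof -
  interpret A: algebra real_ring real_alg by (rule algebra_real)
  show ?thesis
    by (induction k) (simp_all add: A.nat_pow_0 A.nat_pow_Suc ring_as_algebra_simps real_ring_simps)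
qed

definition eval_at :: "(nat \<Rightarrow> real) \<Rightarrow> (nat multiset \<Rightarrow> real) \<Rightarrow> real"
  where "eval_at x = poly_subst real_ring real_alg x"

lemma eval_at_hom: "eval_at x \<in> algebra_hom real_ring (real_poly r) real_alg"
  unfolding eval_at_def real_poly_def
  by (rule cring.poly_subst_algebra_hom[OF cring_real algebra_real]) (simp add: ring_as_algebra_simps real_ring_simps)

lemma eval_at_simps:
  assumes "p \<in> carrier (real_poly r)" "q \<in> carrier (real_poly r)"
  shows "eval_at x (p \<oplus>\<^bsub>real_poly r\<^esub> q) = eval_at x p + eval_at x q"
    "eval_at x (p \<otimes>\<^bsub>real_poly r\<^esub> q) = eval_at x p * eval_at x q"
  using algebra_homD(2,3)[OF eval_at_hom assms, of x] by (simp_all add: ring_as_algebra_simps real_ring_simps)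

lemma eval_at_one: "eval_at x \<one>\<^bsub>real_poly r\<^esub> = 1"
  using algebra_homD(4)[OF eval_at_hom, of x r] by (simp add: ring_as_algebra_simps real_ring_simps)

lemma eval_at_var: "eval_at x (poly_var real_ring i) = x i"
  unfolding eval_at_def
  by (rule cring.poly_subst_var[OF cring_real algebra_real, where V = UNIV])
    (simp_all add: ring_as_algebra_simps real_ring_simps)

text \<open>The bridge between \<open>real_poly\<close>, in which the sphere ring is defined, and
  the polynomials of the Borsuk-Ulam part.\<close>

lemma eval_at_eq_eval_poly:
  assumes "p \<in> carrier (real_poly r)"
  shows "eval_at x p = eval_poly x (Abs_poly_mapping p)"
    and "Poly_Mapping.keys (Abs_poly_mapping p) \<subseteq> {w. set_mset w \<subseteq> {1..r}}"
proof -
  have fin: "finite (support real_ring p)" and sub: "support real_ring p \<subseteq> {w. set_mset w \<subseteq> {1..r}}"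
    using assms by (auto simp: real_poly_def poly_algebra_def monoid_algebra_simps)
  have supp: "support real_ring p = {w. p w \<noteq> 0}" by (simp add: support_def real_ring_simps)
  then have l: "Poly_Mapping.lookup (Abs_poly_mapping p) = p"
    using fin by (intro lookup_Abs_poly_mapping) simp
  have keys: "Poly_Mapping.keys (Abs_poly_mapping p) = support real_ring p"
    unfolding supp by (auto simp: in_keys_iff l)
  then show "Poly_Mapping.keys (Abs_poly_mapping p) \<subseteq> {w. set_mset w \<subseteq> {1..r}}" using sub by simp
  have "eval_at x p = (\<Sum>w\<in>support real_ring p. p w * (\<Prod>i\<in>set_mset w. x i ^ count w i))"
    unfolding eval_at_def poly_subst_def using fin
    by (simp add: finsum_real finprod_real pow_real ring_as_algebra_simps(6) real_ring_simps)
  also have "\<dots> = eval_poly x (Abs_poly_mapping p)"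
    by (simp add: eval_poly_def lin_ext_def keys l image_prod_mset_multiplicity)
  finally show "eval_at x p = eval_poly x (Abs_poly_mapping p)" .
qed

section \<open>The antipode, the sphere ring and its evaluations\<close>

context
  fixes r :: nat
begin

abbreviation "Pr \<equiv> real_poly r"
abbreviation "z i \<equiv> poly_var real_ring (i :: nat)"

interpretation RR: cring real_ring by (rule cring_real)

lemma algebra_Pr: "algebra real_ring Pr"
  unfolding real_poly_def by (rule RR.algebra_poly_algebra)

interpretation Pr: algebra real_ring Pr by (rule algebra_Pr)

lemma var_closed: "i \<in> {1..r} \<Longrightarrow> z i \<in> carrier Pr"
  unfolding real_poly_def by (rule RR.poly_var_closed)

lemma var_square: "i \<in> {1..r} \<Longrightarrow> z i [^]\<^bsub>Pr\<^esub> (2 :: nat) = z i \<otimes>\<^bsub>Pr\<^esub> z i"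
  using var_closed[of i] by (simp add: numeral_2_eq_2 Pr.nat_pow_Suc Pr.nat_pow_0)

lemma sphere_equation_eq:
  "sphere_equation r = (\<Oplus>\<^bsub>Pr\<^esub>i \<in> {1..r}. z i \<otimes>\<^bsub>Pr\<^esub> z i) \<ominus>\<^bsub>Pr\<^esub> \<one>\<^bsub>Pr\<^esub>"
proof -
  have "(\<Oplus>\<^bsub>Pr\<^esub>i \<in> {1..r}. z i [^]\<^bsub>Pr\<^esub> (2 :: nat)) = (\<Oplus>\<^bsub>Pr\<^esub>i \<in> {1..r}. z i \<otimes>\<^bsub>Pr\<^esub> z i)"
    using var_closed by (intro Pr.finsum_cong') (auto simp: var_square)
  then show ?thesis by (simp add: sphere_equation_def)
qed

lemma sphere_equation_closed: "sphere_equation r \<in> carrier Pr"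
  unfolding sphere_equation_eq using var_closed by (intro Pr.minus_closed Pr.finsum_closed) auto

abbreviation "Ir \<equiv> Idl\<^bsub>Pr\<^esub> {sphere_equation r}"

lemma ideal_Ir: "ideal Ir Pr"
  using sphere_equation_closed by (intro Pr.genideal_ideal) simp

text \<open>With one generator, membership is an explicit multiple, so stability under the antipode
  and vanishing at points of the sphere are read off from the generator.\<close>

lemma Ir_eq: "Ir = {p \<otimes>\<^bsub>Pr\<^esub> sphere_equation r | p. p \<in> carrier Pr}"
  using Pr.cgenideal_eq_genideal[OF sphere_equation_closed] by (auto simp: cgenideal_def)

interpretation Q: quotient_module real_ring Pr Ir
  by (rule quotient_module.intro[OF Pr.module_axioms quotient_module_axioms.intro[OF Pr.ideal_submodule[OF ideal_Ir]]])

lemma sphere_ring_simps: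
  "carrier (sphere_ring r) = (\<lambda>p. Q.proj p) ` carrier Pr"
  "U \<oplus>\<^bsub>sphere_ring r\<^esub> V = U \<oplus>\<^bsub>Q.Q\<^esub> V"
  "U \<otimes>\<^bsub>sphere_ring r\<^esub> V = rcoset_mult Pr Ir U V"
  "\<one>\<^bsub>sphere_ring r\<^esub> = Q.proj \<one>\<^bsub>Pr\<^esub>"
  using Q.carrier_quotient by (simp_all add: sphere_ring_def FactRing_def quotient_algebra_simps)

lemma cring_sphere: "cring (sphere_ring r)"
  unfolding sphere_ring_def by (rule ideal.quotient_is_cring[OF ideal_Ir Pr.M_cring])

interpretation S: cring "sphere_ring r" by (rule cring_sphere)

lemma proj_S:
  assumes "p \<in> carrier Pr" "q \<in> carrier Pr"
  shows "Q.proj p \<in> carrier (sphere_ring r)"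
    "Q.proj (p \<oplus>\<^bsub>Pr\<^esub> q) = Q.proj p \<oplus>\<^bsub>sphere_ring r\<^esub> Q.proj q"
    "Q.proj (p \<otimes>\<^bsub>Pr\<^esub> q) = Q.proj p \<otimes>\<^bsub>sphere_ring r\<^esub> Q.proj q"
  using assms Q.proj_add ideal.rcoset_mult_add[OF ideal_Ir assms] by (auto simp: sphere_ring_simps)

lemma proj_minus: "p \<in> carrier Pr \<Longrightarrow> Q.proj (\<ominus>\<^bsub>Pr\<^esub> p) = \<ominus>\<^bsub>sphere_ring r\<^esub> Q.proj p"
  by (rule additive_uminus[where h = "\<lambda>p. Q.proj p", OF module_abelian_group[OF Pr.module_axioms] S.is_abelian_group])
    (use proj_S in auto)

lemma antipode_hom: "antipode r \<in> algebra_hom real_ring Pr Pr"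
  unfolding antipode_def
  by (subst (2) real_poly_def, rule RR.poly_subst_algebra_hom[OF algebra_Pr]) (use var_closed in auto)

lemmas antipode = algebra_homD[OF antipode_hom]

lemma antipode_var: "i \<in> {1..r} \<Longrightarrow> antipode r (z i) = \<ominus>\<^bsub>Pr\<^esub> z i"
  unfolding antipode_def
  by (rule RR.poly_subst_var[OF algebra_Pr, where V = "{1..r}"]) (use var_closed in auto)

lemma antipode_minus: "p \<in> carrier Pr \<Longrightarrow> antipode r (\<ominus>\<^bsub>Pr\<^esub> p) = \<ominus>\<^bsub>Pr\<^esub> antipode r p"
  by (rule additive_uminus[where h = "antipode r"]) (use antipode module_abelian_group[OF Pr.module_axioms] in auto)

lemma real_poly_hom_eqI:
  assumes "algebra real_ring A" "h \<in> algebra_hom real_ring Pr A" "k \<in> algebra_hom real_ring Pr A"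
    and "\<And>i. i \<in> {1..r} \<Longrightarrow> h (z i) = k (z i)" and "p \<in> carrier Pr"
  shows "h p = k p"
  by (rule RR.poly_algebra_hom_eqI[where V = "{1..r}", folded real_poly_def, OF assms])

lemma antipode_antipode: "p \<in> carrier Pr \<Longrightarrow> antipode r (antipode r p) = p"
proof -
  assume p: "p \<in> carrier Pr"
  have c: "(\<lambda>p. antipode r (antipode r p)) \<in> algebra_hom real_ring Pr Pr"
    using antipode by (auto simp: algebra_hom_def Ring.ring_hom_def)
  have i: "(\<lambda>p. p) \<in> algebra_hom real_ring Pr Pr" by (auto simp: algebra_hom_def Ring.ring_hom_def)
  show ?thesis
    by (rule real_poly_hom_eqI[OF algebra_Pr c i _ p]) (use var_closed in \<open>simp add: antipode_var antipode_minus\<close>)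
qed

lemma eval_at_antipode:
  assumes p: "p \<in> carrier Pr"
  shows "eval_at x (antipode r p) = eval_at (\<lambda>i. - x i) p"
proof -
  note ev = algebra_homD[OF eval_at_hom[of _ r]]
  have c: "(\<lambda>p. eval_at x (antipode r p)) \<in> algebra_hom real_ring Pr real_alg"
    using antipode ev by (auto simp: algebra_hom_def Ring.ring_hom_def)
  have m: "eval_at x (\<ominus>\<^bsub>Pr\<^esub> z i) = - x i" if i: "i \<in> {1..r}" for i
  proof -
    have "eval_at x (\<ominus>\<^bsub>Pr\<^esub> z i \<oplus>\<^bsub>Pr\<^esub> z i) = eval_at x (\<ominus>\<^bsub>Pr\<^esub> z i) + x i"
      using var_closed[OF i] by (simp add: eval_at_simps eval_at_var del: Pr.M.l_neg)
    moreover have "eval_at x \<zero>\<^bsub>Pr\<^esub> = 0"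
      using eval_at_simps(1)[of "\<zero>\<^bsub>Pr\<^esub>" r "\<zero>\<^bsub>Pr\<^esub>" x] by simp
    ultimately show ?thesis using Pr.M.l_neg[OF var_closed[OF i]] by simp
  qed
  show ?thesis
    by (rule real_poly_hom_eqI[OF algebra_real c eval_at_hom _ p]) (simp add: antipode_var m eval_at_var)
qed

lemma antipode_equation: "antipode r (sphere_equation r) = sphere_equation r"
proof -
  have ag: "abelian_group Pr" by (rule module_abelian_group[OF Pr.module_axioms])
  have "antipode r (sphere_equation r)
    = antipode r (\<Oplus>\<^bsub>Pr\<^esub>i \<in> {1..r}. z i \<otimes>\<^bsub>Pr\<^esub> z i) \<ominus>\<^bsub>Pr\<^esub> antipode r \<one>\<^bsub>Pr\<^esub>"
    unfolding sphere_equation_eq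
    by (rule additive_minus[OF ag ag]) (use antipode var_closed in \<open>auto intro!: Pr.finsum_closed\<close>)
  also have "antipode r (\<Oplus>\<^bsub>Pr\<^esub>i \<in> {1..r}. z i \<otimes>\<^bsub>Pr\<^esub> z i) = (\<Oplus>\<^bsub>Pr\<^esub>i \<in> {1..r}. antipode r (z i \<otimes>\<^bsub>Pr\<^esub> z i))"
    by (rule additive_finsum[OF ag ag]) (use antipode var_closed in auto)
  also have "\<dots> = (\<Oplus>\<^bsub>Pr\<^esub>i \<in> {1..r}. z i \<otimes>\<^bsub>Pr\<^esub> z i)"
    using antipode var_closed by (intro Pr.finsum_cong') (auto simp: antipode_var Pr.l_minus Pr.r_minus)
  finally show ?thesis by (simp add: antipode(4) sphere_equation_eq)
qed

lemma antipode_Ir: "p \<in> Ir \<Longrightarrow> antipode r p \<in> Ir"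
  unfolding Ir_eq using antipode sphere_equation_closed antipode_equation by auto

text \<open>The action is the image of a coset as a set of polynomials. The antipode preserves the
  ideal and is its own inverse, so this image is a full coset again.\<close>

lemma antipode_proj:
  assumes p: "p \<in> carrier Pr"
  shows "antipode r ` Q.proj p = Q.proj (antipode r p)"
proof
  have I: "q \<in> Ir \<Longrightarrow> q \<in> carrier Pr" for q by (rule Q.K_closed)
  show "antipode r ` Q.proj p \<subseteq> Q.proj (antipode r p)"
    using p I antipode(2) antipode_Ir by (fastforce simp: a_r_coset_def')
  show "Q.proj (antipode r p) \<subseteq> antipode r ` Q.proj p"
  proof
    fix q assume "q \<in> Q.proj (antipode r p)"
    then obtain a where a: "a \<in> Ir" "q = a \<oplus>\<^bsub>Pr\<^esub> antipode r p" by (auto simp: a_r_coset_def')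
    \<comment> \<open>The preimage of \<open>q\<close> is found by applying the involution to
      \<open>q\<close>.\<close>
    have "q = antipode r (antipode r a \<oplus>\<^bsub>Pr\<^esub> p)"
      using a p I antipode(1,2) by (simp add: antipode_antipode)
    moreover have "antipode r a \<oplus>\<^bsub>Pr\<^esub> p \<in> Q.proj p"
      using antipode_Ir[OF a(1)] by (auto simp: a_r_coset_def')
    ultimately show "q \<in> antipode r ` Q.proj p" by blast
  qed
qed

lemma invariant_ring_eq:
  "invariant_ring r = (sphere_ring r)\<lparr>carrier := {U \<in> carrier (sphere_ring r). antipode r ` U = U}\<rparr>"
proof -
  have "carrier (integer_mod_group 2) = {0, 1}"
    by (auto simp: carrier_integer_mod_group)
  moreover have "invariants (carrier (sphere_ring r)) (antipodal_action r) 0 = carrier (sphere_ring r)"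
    by (auto simp: invariants_def antipodal_action_def)
  moreover have "invariants (carrier (sphere_ring r)) (antipodal_action r) 1 = {U \<in> carrier (sphere_ring r). antipode r ` U = U}"
    by (auto simp: invariants_def antipodal_action_def)
  ultimately have "(\<Inter>g\<in>carrier (integer_mod_group 2). invariants (carrier (sphere_ring r)) (antipodal_action r) g)
    = {U \<in> carrier (sphere_ring r). antipode r ` U = U}" by auto
  then show ?thesis by (simp add: invariant_ring_def)
qed

lemma S_elim:
  assumes "U \<in> carrier (sphere_ring r)"
  obtains p where "p \<in> carrier Pr" "U = Q.proj p"
  using assms by (auto simp: sphere_ring_simps)

text \<open>The variables are numbered from 1 and the family of the locale from 0, hence
  \<open>Suc i\<close>. The half is the class of the constant \<open>1 / 2\<close>.\<close>

lemma free_involution_sphere: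
  "free_involution (sphere_ring r) (\<lambda>U. antipode r ` U) r (\<lambda>i. Q.proj (z (Suc i)))
    (Q.proj ((1 / 2) \<odot>\<^bsub>Pr\<^esub> \<one>\<^bsub>Pr\<^esub>))"
proof (intro free_involution.intro free_involution_axioms.intro cring_sphere)
  have v: "z (Suc i) \<in> carrier Pr" if "i < r" for i using that by (intro var_closed) auto
  fix U assume "U \<in> carrier (sphere_ring r)"
  then obtain p where p: "p \<in> carrier Pr" "U = Q.proj p" by (rule S_elim)
  show "antipode r ` U \<in> carrier (sphere_ring r)" using p antipode(1) proj_S(1) by (simp add: antipode_proj)
  show "antipode r ` antipode r ` U = U" using p antipode(1) by (simp add: antipode_proj antipode_antipode)
  fix V assume "V \<in> carrier (sphere_ring r)"
  then obtain q where q: "q \<in> carrier Pr" "V = Q.proj q" by (rule S_elim)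
  show "antipode r ` (U \<oplus>\<^bsub>sphere_ring r\<^esub> V) = antipode r ` U \<oplus>\<^bsub>sphere_ring r\<^esub> antipode r ` V"
    using p q antipode(1,2) by (simp add: proj_S(2)[symmetric] antipode_proj)
  show "antipode r ` (U \<otimes>\<^bsub>sphere_ring r\<^esub> V) = antipode r ` U \<otimes>\<^bsub>sphere_ring r\<^esub> antipode r ` V"
    using p q antipode(1,3) by (simp add: proj_S(3)[symmetric] antipode_proj)
next
  show "antipode r ` \<one>\<^bsub>sphere_ring r\<^esub> = \<one>\<^bsub>sphere_ring r\<^esub>"
    using antipode(4) by (simp add: sphere_ring_simps antipode_proj)
next
  fix i assume "i < r"
  then have v: "z (Suc i) \<in> carrier Pr" and i: "Suc i \<in> {1..r}" by (auto intro!: var_closed)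
  show "Q.proj (z (Suc i)) \<in> carrier (sphere_ring r)" by (rule proj_S(1)[OF v v])
  show "antipode r ` Q.proj (z (Suc i)) = \<ominus>\<^bsub>sphere_ring r\<^esub> Q.proj (z (Suc i))"
    unfolding antipode_proj[OF v] antipode_var[OF i] by (rule proj_minus[OF v])
next
  have v: "z (Suc i) \<in> carrier Pr" if "i < r" for i using that by (intro var_closed) auto
  have "(\<Oplus>\<^bsub>sphere_ring r\<^esub>i\<in>{..<r}. Q.proj (z (Suc i)) \<otimes>\<^bsub>sphere_ring r\<^esub> Q.proj (z (Suc i)))
    = (\<Oplus>\<^bsub>sphere_ring r\<^esub>i\<in>{..<r}. Q.proj (z (Suc i) \<otimes>\<^bsub>Pr\<^esub> z (Suc i)))"
    by (intro S.finsum_cong') (use v proj_S(1)[OF v v] proj_S(3)[OF v v] in \<open>auto intro!: S.m_closed\<close>)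
  also have "\<dots> = Q.proj (\<Oplus>\<^bsub>Pr\<^esub>i\<in>{..<r}. z (Suc i) \<otimes>\<^bsub>Pr\<^esub> z (Suc i))"
    by (rule additive_finsum[where h = "\<lambda>p. Q.proj p", symmetric, OF module_abelian_group[OF Pr.module_axioms] S.is_abelian_group])
      (use v proj_S in \<open>auto intro!: Pr.m_closed\<close>)
  also have "(\<Oplus>\<^bsub>Pr\<^esub>i\<in>{..<r}. z (Suc i) \<otimes>\<^bsub>Pr\<^esub> z (Suc i)) = (\<Oplus>\<^bsub>Pr\<^esub>i\<in>Suc ` {..<r}. z i \<otimes>\<^bsub>Pr\<^esub> z i)"
    by (rule Pr.finsum_reindex[symmetric]) (use v in auto)
  also have "Suc ` {..<r} = {1..r}" by (auto simp: image_Suc_lessThan)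
  also have "Q.proj (\<Oplus>\<^bsub>Pr\<^esub>i\<in>{1..r}. z i \<otimes>\<^bsub>Pr\<^esub> z i) = Q.proj \<one>\<^bsub>Pr\<^esub>"
  proof (rule Q.proj_eqI)
    show "(\<Oplus>\<^bsub>Pr\<^esub>i\<in>{1..r}. z i \<otimes>\<^bsub>Pr\<^esub> z i) \<in> carrier Pr" using var_closed by (intro Pr.finsum_closed) auto
    show "(\<Oplus>\<^bsub>Pr\<^esub>i\<in>{1..r}. z i \<otimes>\<^bsub>Pr\<^esub> z i) \<ominus>\<^bsub>Pr\<^esub> \<one>\<^bsub>Pr\<^esub> \<in> Ir"
      unfolding sphere_equation_eq[symmetric] using Pr.genideal_self[of "{sphere_equation r}"] sphere_equation_closed by simp
  qed simp
  also have "\<dots> = \<one>\<^bsub>sphere_ring r\<^esub>" by (simp add: sphere_ring_simps)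
  finally show "(\<Oplus>\<^bsub>sphere_ring r\<^esub>i\<in>{..<r}. Q.proj (z (Suc i)) \<otimes>\<^bsub>sphere_ring r\<^esub> Q.proj (z (Suc i))) = \<one>\<^bsub>sphere_ring r\<^esub>" .
next
  have c: "(1 / 2 :: real) \<odot>\<^bsub>Pr\<^esub> \<one>\<^bsub>Pr\<^esub> \<in> carrier Pr" by (intro Pr.smult_closed) (auto simp: real_ring_simps)
  show "Q.proj ((1 / 2) \<odot>\<^bsub>Pr\<^esub> \<one>\<^bsub>Pr\<^esub>) \<in> carrier (sphere_ring r)" by (rule proj_S(1)[OF c c])
  have "(1 / 2 :: real) \<odot>\<^bsub>Pr\<^esub> \<one>\<^bsub>Pr\<^esub> \<oplus>\<^bsub>Pr\<^esub> (1 / 2 :: real) \<odot>\<^bsub>Pr\<^esub> \<one>\<^bsub>Pr\<^esub> = \<one>\<^bsub>Pr\<^esub>"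
    using Pr.smult_l_distr[of "1 / 2" "1 / 2" "\<one>\<^bsub>Pr\<^esub>"] Pr.smult_one[of "\<one>\<^bsub>Pr\<^esub>"] by (simp add: real_ring_simps)
  then show "Q.proj ((1 / 2) \<odot>\<^bsub>Pr\<^esub> \<one>\<^bsub>Pr\<^esub>) \<oplus>\<^bsub>sphere_ring r\<^esub> Q.proj ((1 / 2) \<odot>\<^bsub>Pr\<^esub> \<one>\<^bsub>Pr\<^esub>) = \<one>\<^bsub>sphere_ring r\<^esub>"
    unfolding proj_S(2)[OF c c, symmetric] sphere_ring_simps(4) by (rule arg_cong)
qed

text \<open>The sphere equation vanishes at a unit vector, so evaluation there does not depend on
  the representative of a class.\<close>

lemma eval_at_well_defined:
  assumes x: "(\<Sum>j\<in>{1..r}. (x j)\<^sup>2) = 1" and p: "p \<in> carrier Pr" and q: "q \<in> carrier Pr" and eq: "Q.proj p = Q.proj q"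
  shows "eval_at x p = eval_at x q"
proof -
  note ev = algebra_homD[OF eval_at_hom[of x r]]
  have ag: "abelian_group Pr" "abelian_group real_alg"
    by (rule module_abelian_group[OF Pr.module_axioms], rule module_abelian_group[OF algebra.axioms(1)[OF algebra_real]])
  have minus: "eval_at x (a \<ominus>\<^bsub>Pr\<^esub> b) = eval_at x a - eval_at x b" if a: "a \<in> carrier Pr" and b: "b \<in> carrier Pr" for a b
  proof -
    have ab: "a \<ominus>\<^bsub>Pr\<^esub> b \<in> carrier Pr" using a b by (rule Pr.minus_closed)
    have "(a \<ominus>\<^bsub>Pr\<^esub> b) \<oplus>\<^bsub>Pr\<^esub> b = a" using a b by (simp add: Pr.M.minus_eq Pr.M.a_assoc Pr.M.l_neg)
    then show ?thesis using eval_at_simps(1)[OF ab b, of x] by simp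
  qed
  have "eval_at x (\<Oplus>\<^bsub>Pr\<^esub>i\<in>{1..r}. z i \<otimes>\<^bsub>Pr\<^esub> z i) = (\<Oplus>\<^bsub>real_alg\<^esub>i\<in>{1..r}. eval_at x (z i \<otimes>\<^bsub>Pr\<^esub> z i))"
    by (rule additive_finsum[OF ag]) (use ev var_closed in auto)
  also have "\<dots> = (\<Sum>i\<in>{1..r}. eval_at x (z i \<otimes>\<^bsub>Pr\<^esub> z i))" by (simp add: finsum_real)
  also have "\<dots> = (\<Sum>i\<in>{1..r}. (x i)\<^sup>2)"
    using var_closed by (intro sum.cong) (auto simp: eval_at_simps(2) eval_at_var power2_eq_square)
  finally have "eval_at x (sphere_equation r) = 0"
    unfolding sphere_equation_eq using var_closed x by (subst minus) (auto simp: eval_at_one intro!: Pr.finsum_closed)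
  then have zero: "eval_at x a = 0" if "a \<in> Ir" for a
    using that sphere_equation_closed by (auto simp: Ir_eq eval_at_simps(2))
  have "p \<ominus>\<^bsub>Pr\<^esub> q \<in> Ir" using Q.mem_proj_iff[OF q p] Q.proj_self[OF p] eq by simp
  then show ?thesis using zero minus[OF p q] by fastforce
qed

section \<open>The number of generators\<close>

text \<open>Evaluations at \<open>x\<close> and at \<open>- x\<close> are multiplicative and
  additive, and they agree on invariant classes because the antipode exchanges them. Hence their
  equality is preserved by the operations and by scalars. It is phrased through a representative
  because \<open>eval_at\<close> is defined on polynomials and not on cosets.\<close>

lemma subalgebra_of_unseparated:
  fixes x m
  assumes x: "(\<Sum>j\<in>{1..r}. (x j)\<^sup>2) = 1"
  defines "A \<equiv> product_algebra (ring_as_algebra (sphere_ring r)) (power_algebra (ring_as_algebra (invariant_ring r)) m)"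
    and "H \<equiv> {a \<in> carrier (product_algebra (ring_as_algebra (sphere_ring r)) (power_algebra (ring_as_algebra (invariant_ring r)) m)).
      \<exists>p\<in>carrier Pr. fst a = Q.proj p \<and> eval_at x p = eval_at (\<lambda>i. - x i) p}"
  shows "subring H A" "\<And>c a. c \<in> carrier (invariant_ring r) \<Longrightarrow> a \<in> H \<Longrightarrow> c \<odot>\<^bsub>A\<^esub> a \<in> H"
proof -
  interpret I: free_involution "sphere_ring r" "\<lambda>U. antipode r ` U" r "\<lambda>i. Q.proj (z (Suc i))"
    "Q.proj ((1 / 2) \<odot>\<^bsub>Pr\<^esub> \<one>\<^bsub>Pr\<^esub>)" by (rule free_involution_sphere)
  have algA: "algebra (invariant_ring r) A"
    unfolding A_def invariant_ring_eq by (rule I.algebra_A)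
  interpret A: algebra "invariant_ring r" A by (rule algA)
  define C where "C U \<longleftrightarrow> (\<exists>p\<in>carrier Pr. U = Q.proj p \<and> eval_at x p = eval_at (\<lambda>i. - x i) p)" for U
  have H: "a \<in> H \<longleftrightarrow> a \<in> carrier A \<and> C (fst a)" for a by (simp add: H_def A_def C_def)
  have C_add: "C (U \<oplus>\<^bsub>sphere_ring r\<^esub> V)" and C_mult: "C (U \<otimes>\<^bsub>sphere_ring r\<^esub> V)" if UV: "C U" "C V" for U V
  proof -
    obtain p q where p: "p \<in> carrier Pr" "U = Q.proj p" "eval_at x p = eval_at (\<lambda>i. - x i) p"
      and q: "q \<in> carrier Pr" "V = Q.proj q" "eval_at x q = eval_at (\<lambda>i. - x i) q"
      using UV unfolding C_def by blast
    show "C (U \<oplus>\<^bsub>sphere_ring r\<^esub> V)"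
      unfolding C_def using p q
      by (intro bexI[of _ "p \<oplus>\<^bsub>Pr\<^esub> q"]) (auto simp: proj_S eval_at_simps)
    show "C (U \<otimes>\<^bsub>sphere_ring r\<^esub> V)"
      unfolding C_def using p q
      by (intro bexI[of _ "p \<otimes>\<^bsub>Pr\<^esub> q"]) (auto simp: proj_S eval_at_simps)
  qed
  \<comment> \<open>The antipode of \<open>p\<close> represents the same class as \<open>p\<close>,
    and its value at \<open>x\<close> is the value of \<open>p\<close> at
    \<open>- x\<close>.\<close>
  have C_inv: "C U" if U: "U \<in> carrier (invariant_ring r)" for U
  proof -
    have U': "U \<in> carrier (sphere_ring r)" "antipode r ` U = U" using U by (auto simp: invariant_ring_eq)
    then obtain p where p: "p \<in> carrier Pr" "U = Q.proj p" using S_elim by blast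
    have "eval_at x p = eval_at x (antipode r p)"
      using U'(2) p antipode(1)[OF p(1)] by (intro eval_at_well_defined[OF x]) (auto simp: antipode_proj)
    then show ?thesis unfolding C_def using p eval_at_antipode by auto
  qed
  have one_inv: "\<one>\<^bsub>sphere_ring r\<^esub> \<in> carrier (invariant_ring r)"
    and minus_one_inv: "\<ominus>\<^bsub>sphere_ring r\<^esub> \<one>\<^bsub>sphere_ring r\<^esub> \<in> carrier (invariant_ring r)"
    by (simp_all add: invariant_ring_eq I.\<sigma>_one I.\<sigma>_minus)
  have fst_closed: "fst a \<in> carrier (sphere_ring r)" if "a \<in> carrier A" for a
    using that by (auto simp: A_def product_algebra_simps ring_as_algebra_simps)
  show "subring H A"
  proof (rule ring.subringI)
    show "ring A" by (rule cring.axioms(1)[OF A.M_cring])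
    show "H \<subseteq> carrier A" using H by auto
    show "\<one>\<^bsub>A\<^esub> \<in> H"
      using C_inv[OF one_inv] by (simp add: H) (simp add: A_def product_algebra_simps ring_as_algebra_simps)
    fix a assume a: "a \<in> H"
    have fa: "fst a \<in> carrier (sphere_ring r)" using a H fst_closed by blast
    \<comment> \<open>Negation is multiplication by \<open>-1\<close>, which is invariant, so
      closure under products covers negatives.\<close>
    have "fst (\<ominus>\<^bsub>A\<^esub> a) \<oplus>\<^bsub>sphere_ring r\<^esub> fst a = fst (\<ominus>\<^bsub>A\<^esub> a \<oplus>\<^bsub>A\<^esub> a)"
      by (simp add: A_def product_algebra_simps ring_as_algebra_simps)
    also have "\<ominus>\<^bsub>A\<^esub> a \<oplus>\<^bsub>A\<^esub> a = \<zero>\<^bsub>A\<^esub>" using a H by (intro A.M.l_neg) auto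
    also have "fst \<zero>\<^bsub>A\<^esub> = \<zero>\<^bsub>sphere_ring r\<^esub>"
      by (simp add: A_def product_algebra_simps ring_as_algebra_simps)
    finally have "\<ominus>\<^bsub>sphere_ring r\<^esub> fst a = fst (\<ominus>\<^bsub>A\<^esub> a)"
      using fa a H by (intro S.minus_equality) (auto intro!: fst_closed)
    moreover have "\<ominus>\<^bsub>sphere_ring r\<^esub> fst a = \<ominus>\<^bsub>sphere_ring r\<^esub> \<one>\<^bsub>sphere_ring r\<^esub> \<otimes>\<^bsub>sphere_ring r\<^esub> fst a"
      using fa by (simp add: S.l_minus)
    moreover have "C (\<ominus>\<^bsub>sphere_ring r\<^esub> \<one>\<^bsub>sphere_ring r\<^esub> \<otimes>\<^bsub>sphere_ring r\<^esub> fst a)"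
      using C_mult[OF C_inv[OF minus_one_inv]] a H by blast
    ultimately have "C (fst (\<ominus>\<^bsub>A\<^esub> a))" by (simp only:)
    then show "\<ominus>\<^bsub>A\<^esub> a \<in> H" using a H by simp
    fix b assume b: "b \<in> H"
    show "a \<oplus>\<^bsub>A\<^esub> b \<in> H"
      using a b C_add by (simp add: H) (simp add: A_def product_algebra_simps ring_as_algebra_simps)
    show "a \<otimes>\<^bsub>A\<^esub> b \<in> H"
      using a b C_mult by (simp add: H) (simp add: A_def product_algebra_simps ring_as_algebra_simps)
  qed
  fix c a assume c: "c \<in> carrier (invariant_ring r)" and a: "a \<in> H"
  have "C (fst (c \<odot>\<^bsub>A\<^esub> a))"
    using C_mult[OF C_inv[OF c]] a H by (simp add: A_def product_algebra_simps ring_as_algebra_simps)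
  then show "c \<odot>\<^bsub>A\<^esub> a \<in> H" using c a H by simp
qed

theorem sphere_etale: "2 \<le> n \<Longrightarrow> etale_algebra_of_degree TYPE('c) n (invariant_ring r) (sphere_etale_algebra r n)"
  using free_involution.etale_of_degree_A[OF free_involution_sphere, of "n - 2", where ?'c = 'c]
  by (simp add: sphere_etale_algebra_def invariant_ring_eq le_add_diff_inverse del: add_2_eq_Suc)

theorem sphere_generators:
  assumes "r \<ge> 1" and G: "finite G" "G \<subseteq> carrier (sphere_etale_algebra r n)" "card G < r"
  shows "subalgebra_generated (invariant_ring r) (sphere_etale_algebra r n) G \<noteq> carrier (sphere_etale_algebra r n)"
proof
  let ?A = "sphere_etale_algebra r n"
  assume gen: "subalgebra_generated (invariant_ring r) ?A G = carrier ?A"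
  obtain g where g: "bij_betw g {1..card G} G" using ex_bij_betw_nat_finite_1[OF G(1)] by blast
  have "\<exists>p. p \<in> carrier Pr \<and> fst a = Q.proj p" if "a \<in> carrier ?A" for a
  proof -
    have "fst a \<in> carrier (sphere_ring r)"
      using that by (auto simp: sphere_etale_algebra_def product_algebra_simps ring_as_algebra_simps)
    then show ?thesis by (metis S_elim)
  qed
  then obtain rep where rep: "\<And>a. a \<in> carrier ?A \<Longrightarrow> rep a \<in> carrier Pr \<and> fst a = Q.proj (rep a)" by metis
  have gA: "g i \<in> carrier ?A" if "i \<in> {1..card G}" for i using g that G(2) by (auto simp: bij_betw_def)
  \<comment> \<open>Representatives of the first components, padded by zero polynomials:
    \<open>polynomial_borsuk_ulam\<close> takes polynomials for all indices below \<open>r\<close>,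
    while \<open>G\<close> may have fewer elements.\<close>
  define p where "p i = (if i \<in> {1..card G} then Abs_poly_mapping (rep (g i)) else 0)" for i
  have "set_mset w \<subseteq> {1..r}" if "w \<in> Poly_Mapping.keys (p i)" for i w
  proof (cases "i \<in> {1..card G}")
    case True
    have "Poly_Mapping.keys (p i) \<subseteq> {w. set_mset w \<subseteq> {1..r}}"
      using eval_at_eq_eval_poly(2) rep[OF gA[OF True]] True by (simp only: p_def if_True)
    then show ?thesis using that by blast
  next
    case False
    then have "p i = 0" unfolding p_def by (rule if_not_P)
    then show ?thesis using that by simp
  qed
  then obtain x where x: "(\<Sum>j\<in>{1..r}. (x j)\<^sup>2) = 1"
    "\<And>i. i \<in> {1..<r} \<Longrightarrow> eval_poly x (p i) = eval_poly (\<lambda>j. - x j) (p i)"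
    using polynomial_borsuk_ulam[OF assms(1), of p] by blast
  let ?B = "product_algebra (ring_as_algebra (sphere_ring r)) (power_algebra (ring_as_algebra (invariant_ring r)) (n - 2))"
  define H where "H = {a \<in> carrier ?B. \<exists>p\<in>carrier Pr. fst a = Q.proj p \<and> eval_at x p = eval_at (\<lambda>i. - x i) p}"
  have AB: "?A = ?B" by (simp add: sphere_etale_algebra_def)
  have "G \<subseteq> H"
  proof
    fix a assume a: "a \<in> G"
    then obtain i where i: "i \<in> {1..card G}" "a = g i" using g unfolding bij_betw_def by blast
    have r: "rep a \<in> carrier Pr" "fst a = Q.proj (rep a)" using rep[OF subsetD[OF G(2) a]] by blast+
    have "i \<in> {1..<r}" using i G(3) by auto
    then have "eval_poly x (p i) = eval_poly (\<lambda>j. - x j) (p i)" by (rule x(2))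
    then have "eval_at x (rep a) = eval_at (\<lambda>j. - x j) (rep a)"
      using i eval_at_eq_eval_poly(1)[OF r(1)] by (simp add: p_def)
    then show "a \<in> H" unfolding H_def using r a G(2) AB by auto
  qed
  moreover have "subring H ?A" "\<forall>c\<in>carrier (invariant_ring r). \<forall>a\<in>H. c \<odot>\<^bsub>?A\<^esub> a \<in> H"
    unfolding AB H_def using subalgebra_of_unseparated[OF x(1), where m = "n - 2"] by blast+
  ultimately have "subalgebra_generated (invariant_ring r) ?A G \<subseteq> H"
    unfolding subalgebra_generated_def by blast
  then have AH: "carrier ?A \<subseteq> H" using gen by simp
  interpret I: free_involution "sphere_ring r" "\<lambda>U. antipode r ` U" r "\<lambda>i. Q.proj (z (Suc i))"
    "Q.proj ((1 / 2) \<odot>\<^bsub>Pr\<^esub> \<one>\<^bsub>Pr\<^esub>)" by (rule free_involution_sphere)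
  \<comment> \<open>The class of \<open>z_j\<close> takes the values \<open>x_j\<close> and
    \<open>- x_j\<close> at the two points, so its membership in the subalgebra forces
    \<open>x_j = 0\<close>. For all \<open>j\<close> together this contradicts that \<open>x\<close>
    is a unit vector.\<close>
  have "x j = 0" if j: "j \<in> {1..r}" for j
  proof -
    note v = var_closed[OF j]
    let ?a = "(Q.proj (z j), \<zero>\<^bsub>power_algebra (ring_as_algebra (invariant_ring r)) (n - 2)\<^esub>)"
    have "\<zero>\<^bsub>power_algebra (ring_as_algebra (invariant_ring r)) (n - 2)\<^esub>
      \<in> carrier (power_algebra (ring_as_algebra (invariant_ring r)) (n - 2))"
      using cring.cring_simprules(2)[OF algebra.M_cring[OF I.algebra_P[of "n - 2"]]] by (simp add: invariant_ring_eq)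
    then have "?a \<in> carrier ?A"
      using proj_S(1)[OF v v] by (simp add: AB product_algebra_simps ring_as_algebra_simps)
    then obtain q where q: "q \<in> carrier Pr" "Q.proj (z j) = Q.proj q" "eval_at x q = eval_at (\<lambda>i. - x i) q"
      using AH by (auto simp: H_def)
    have x': "(\<Sum>j\<in>{1..r}. (- x j)\<^sup>2) = 1" using x(1) by simp
    have "x j = - x j"
      using eval_at_well_defined[OF x(1) v q(1,2)] eval_at_well_defined[OF x' v q(1,2)] q(3)
      by (simp add: eval_at_var)
    then show ?thesis by simp
  qed
  then have "(\<Sum>j\<in>{1..r}. (x j)\<^sup>2) = 0" by simp
  then show False using x(1) by simp
qed

end

theorem mainTheorem5:
  fixes r n :: nat
  assumes "r \<ge> 1" and "n \<ge> 2"
  shows "etale_algebra_of_degree TYPE('c) n (invariant_ring r) (sphere_etale_algebra r n) \<and>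
    \<not> (\<exists>G. finite G \<and> G \<subseteq> carrier (sphere_etale_algebra r n) \<and> card G < r \<and>
         subalgebra_generated (invariant_ring r) (sphere_etale_algebra r n) G
           = carrier (sphere_etale_algebra r n))"
  using sphere_etale[OF assms(2)] sphere_generators[OF assms(1)] by blast

end
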